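(* Let $n\geq 1$. The three complexes of invariant differential operators dual to the BGG resolutions $\mathrm K_0^\bullet\to\mathbb C[x]_{\bar0}$, $\mathrm K_1^\bullet\to\mathbb C[x]_{\bar1}$, $\mathrm{SK}^\bullet\to\mathbb C[x]$, $$0\to\underline{\mathrm{Ker}}(\Delta)\to\mathcal L_{(\frac12)^n}\xrightarrow{\Delta}\mathcal L_{(2,2)+(\frac12)^n}\to\cdots\to\bigoplus_{\alpha=(b_1,\dots,b_s|b_1,\dots,b_s),\ \sum b_i=m,\ |\alpha|\equiv0\,(2)}\mathcal L_{\alpha+(\frac12)^n}\to\cdots,$$ $$0\to\underline{\mathrm{Ker}}({\not D})\to\mathcal L_{(1)+(\frac12)^n}\xrightarrow{{\not D}}\mathcal L_{(2,1)+(\frac12)^n}\to\cdots\to\bigoplus_{\alpha=(b_1,\dots,b_s|b_1,\dots,b_s),\ \sum b_i=m,\ |\alpha|\equiv1\,(2)}\mathcal L_{\alpha+(\frac12)^n}\to\cdots,$$ on $\mathfrak H_n$, and $$0\to\underline{\mathrm{Ker}}({}^L\mathbb D)\to S\mathcal L_{(\frac12)^n}\xrightarrow{{}^L\mathbb D}S\mathcal L_{(1,1)+(\frac12)^n}\to\cdots\to\bigoplus_{\alpha\in Q_1(2m)}S\mathcal L_{\alpha+(\frac12)^n}\to\cdots$$ on $S\mathfrak H_n$ (the displayed general term being in degree $m$), are exact everywhere on $\mathfrak H_n$, resp. $S\mathfrak H_n$, as complexes of sheaves. Thus they give right resolutions of the sheaf kernels of $\Delta,{\not D},{}^L\mathbb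 D$ by equivariant vector bundles.
   Context: Lie algebras and modules. $E=\mathbb C^{2n}$ has basis $p_i,q_i$ with $\omega(p_i,q_j)=\delta_{ij}$, other pairings zero; $\mathrm{Heis}_n$ is generated by $E$ with $yz-zy=\frac12\omega(y,z)$. $\mathfrak g=\mathfrak{osp}(1|2n)$ is realized in $\mathrm{Heis}_n$ with odd part $\mathfrak g_{\bar1}=E$ and even part $\mathfrak g_{\bar0}=\mathrm{span}\{yz+zy\}\cong\mathfrak{sp}(2n)$, bracket = supercommutator. It acts on $\mathbb C[x]=\mathbb C[x_1,\dots,x_n]$ via $p_\nu\mapsto\frac1{\sqrt{-4\pi i}}\partial_{x_\nu}$, $q_\nu\mapsto\sqrt{-\pi i}\,x_\nu$ (with $\sqrt{-4\pi i}=2\sqrt{-\pi i}$); $\mathbb C[x]_{\bar0},\mathbb C[x]_{\bar1}$ (even, odd polynomials) are $\mathfrak g_{\bar0}$-submodules. With $L_p=\oplus\mathbb Cp_i$, $L_q=\oplus\mathbb Cq_i$ and $A\cdot B=\mathrm{span}\{ab+ba\}$: $\mathfrak p=L_p\oplus L_p\cdot E$, $\mathfrak p_{\bar0}=L_p\cdot E$, common Levi $\mathfrak m=L_p\cdot L_q\cong\mathfrak{gl}(L_p)=\mathfrak{gl}_n$. For $\beta\in(\frac12\mathbb Z)^n$ with $\beta_i-\beta_{i+1}\in\mathbb Z_{\ge0}$, $\Sigma^\beta$ is the irreducible $\mathfrak{gl}_n$-module of highest weight $\beta$ (nilradicals acting by $0$), $\mathrm V_\beta=U(\mathfrak g_{\bar0})\otimes_{U(\mathfrak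 p_{\bar0})}\Sigma^\beta$, $\mathrm{SV}_\beta=U(\mathfrak g)\otimes_{U(\mathfrak p)}\Sigma^\beta$. For a partition $\alpha$ with at most $n$ rows (padded by zeros), $\alpha^\vee=(-\alpha_n,\dots,-\alpha_1)$; $(\frac12)^n=(\frac12,\dots,\frac12)$; partitions with more than $n$ rows contribute zero. Frobenius notation: $\alpha=(a_1,\dots,a_s|b_1,\dots,b_s)$, where $s$ is the number of diagonal cells and $a_i$, $b_i$ are the numbers of cells strictly to the right of, resp. strictly below, the $i$-th diagonal cell. $Q_1(2m)$ is the set of partitions of $2m$ with $b_j=a_j+1$ for all $j$. The BGG resolutions are resolutions (which exist) $\mathrm K_r^\bullet\to\mathbb C[x]_{\bar r}$ by $\mathfrak g_{\bar0}$-modules ($r=0,1$) and $\mathrm{SK}^\bullet\to\mathbb C[x]$ by $\mathfrak g$-modules with $$\mathrm K_r^{-m}=\bigoplus_{\alpha=(b_1,\dots,b_s|b_1,\dots,b_s),\ \sum b_i=m,\ |\alpha|\equiv r\,(2)}\mathrm V_{\alpha^\vee-(\frac12)^n},\qquad \mathrm{SK}^{-m}=\bigoplus_{\alpha\in Q_1(2m)}\mathrm{SV}_{\alpha^\vee-(\frac12)^n}.$$ Geometry. $\mathrm{LG}$ is the Grassmannian of Lagrangian subspaces of $E$, $\mathrm{SLG}$ is the supermanifold of isotropic subspaces of dimension $n|0$ in $\mathbb C^{0|1}\oplus E$ (with form the orthogonal sum of the standard symmetric form on the odd line and $\omega$); their tautological bundles are $\Lambda$, $S\Lambda$. $\mathcal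 L_\beta=\Sigma^\beta(\Lambda)$, $S\mathcal L_\beta=\Sigma^\beta(S\Lambda)$; for half-integral $\beta$ they are defined using a local square root of $\det$ (as twisted bundles), and $\mathfrak g_{\bar0}$, resp. $\mathfrak g$, acts on their local sections. $\mathfrak H_n\subset\mathrm{LG}$ is the Siegel upper half plane of symmetric $T$ with $\mathrm{Im}\,T>0$, embedded as graphs of $T:L_q\to L_p$, and $S\mathfrak H_n\subset\mathrm{SLG}$ is the induced open sub-supermanifold; over $\mathfrak H_n$, resp. $S\mathfrak H_n$, the (twisted) bundles $\mathcal L_\beta$, resp. $S\mathcal L_\beta$, are actual bundles equivariant under the metaplectic group $\mathrm{Mp}(2n)$, resp. its super-analog $\mathrm{OMp}(1|2n)$. Duality. At the point $o=[L_p]$ the space of $\infty$-jets of sections of $\mathcal L_{\beta^\vee}$ (resp. $S\mathcal L_{\beta^\vee}$) is canonically the full dual $\mathrm V_\beta^*$ (resp. $\mathrm{SV}_\beta^*$). A homomorphism $\mathrm V_\gamma\to\mathrm V_\beta$ (resp. $\mathrm{SV}_\gamma\to\mathrm{SV}_\beta$) transposes to a map of jets at $o$ which is induced by a unique invariant differential operator $\mathcal L_{\beta^\vee}\to\mathcal L_{\gamma^\vee}$ (resp. $S\mathcal L_{\beta^\vee}\to S\mathcal L_{\gamma^\vee}$). The complexes in the claim are obtained by applying this to all differentials of the BGG resolutions (in the form: apply $\underline{\mathrm{Hom}}_{\mathcal D}(-,\mathcal O)$ to the associated complexes of equivariant $\mathcal D$-modules) and restricting to $\mathfrak H_n$, $S\mathfrak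 H_n$; $\Delta$, ${\not D}$, ${}^L\mathbb D$ denote the operators dual to the last differentials (degree $-1\to0$). *)

theory Defs
  imports "HOL-Analysis.Analysis" "HOL-Library.Poly_Mapping"
begin

text \<open>
  The number \<open>n\<close> is the cardinality of an index type of class \<open>finite\<close>; its linear order is the
  order of the rows of partitions and of the entries of weights.
\<close>

section \<open>The Lie superalgebra and its parabolic subalgebra\<close>

text \<open>The symplectic space \<open>E\<close>: \<open>Inl i\<close> is the \<open>p\<close>-coordinate and \<open>Inr i\<close> the \<open>q\<close>-coordinate.\<close>

type_synonym 'n symp = "complex ^ ('n + 'n)"
type_synonym 'n symp_mat = "complex ^ ('n + 'n) ^ ('n + 'n)"
type_synonym 'n mat = "complex ^ 'n ^ 'n"

definition pE :: "'n::finite \<Rightarrow> 'n symp" where "pE i = axis (Inl i) 1"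
definition qE :: "'n::finite \<Rightarrow> 'n symp" where "qE i = axis (Inr i) 1"

definition omega :: "'n::finite symp \<Rightarrow> 'n symp \<Rightarrow> complex" where
  "omega y z = (\<Sum>i\<in>UNIV. y $ Inl i * z $ Inr i - y $ Inr i * z $ Inl i)"

definition mscale :: "complex \<Rightarrow> complex ^ 'a ^ 'b \<Rightarrow> complex ^ 'a ^ 'b" where
  "mscale c M = (\<chi> i j. c * M $ i $ j)"

lemma vector_space_mscale: "vector_space mscale"
  by unfold_locales (simp_all add: mscale_def vec_eq_iff algebra_simps)

text \<open>
  The element \<open>yz + zy\<close> of the Heisenberg algebra (relations \<open>yz - zy = omega y z / 2\<close>) is
  recorded by its adjoint action on \<open>E\<close>: the relations give
  \<open>[yz + zy, w] = omega z w y + omega y w z\<close>. The span of these matrices is \<open>sp(E)\<close>.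
\<close>

definition quad :: "'n::finite symp \<Rightarrow> 'n symp \<Rightarrow> 'n symp_mat" where
  "quad y z = (\<chi> a b. omega z (axis b 1) * y $ a + omega y (axis b 1) * z $ a)"

definition sdot :: "'n::finite symp set \<Rightarrow> 'n symp set \<Rightarrow> 'n symp_mat set" where
  "sdot A B = module.span mscale {quad a b | a b. a \<in> A \<and> b \<in> B}"

definition Lp :: "'n::finite symp set" where
  "Lp = vec.span (range pE)"

text \<open>Homogeneous elements: even (a matrix in \<open>sp(E)\<close>) and odd (a vector of \<open>E\<close>).\<close>

datatype ('n::finite) osp = Ev "'n symp_mat" | Od "'n symp"

fun is_odd :: "'n::finite osp \<Rightarrow> bool" where
  "is_odd (Ev M) = False"
| "is_odd (Od y) = True"

text \<open>The supercommutator of the Heisenberg algebra.\<close>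

fun bracket :: "'n::finite osp \<Rightarrow> 'n osp \<Rightarrow> 'n osp" where
  "bracket (Ev M) (Ev N) = Ev (M ** N - N ** M)"
| "bracket (Ev M) (Od y) = Od (M *v y)"
| "bracket (Od y) (Ev M) = Od (- (M *v y))"
| "bracket (Od y) (Od z) = Ev (quad y z)"

definition sp_alg :: "'n::finite osp set" where
  "sp_alg = Ev ` sdot UNIV UNIV"

definition osp_alg :: "'n::finite osp set" where
  "osp_alg = sp_alg \<union> range Od"

definition sp_par :: "'n::finite osp set" where
  "sp_par = Ev ` sdot Lp UNIV"

definition osp_par :: "'n::finite osp set" where
  "osp_par = sp_par \<union> Od ` Lp"


section \<open>The action on polynomials\<close>

type_synonym 'n cpoly = "('n \<Rightarrow>\<^sub>0 nat) \<Rightarrow>\<^sub>0 complex"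

definition fscale :: "complex \<Rightarrow> ('a \<Rightarrow>\<^sub>0 complex) \<Rightarrow> ('a \<Rightarrow>\<^sub>0 complex)" where
  "fscale c x = Poly_Mapping.map ((*) c) x"

lemma lookup_fscale: "Poly_Mapping.lookup (fscale c x) k = c * Poly_Mapping.lookup x k"
  by (simp add: fscale_def Poly_Mapping.map.rep_eq when_def)

lemma vector_space_fscale: "vector_space fscale"
  by unfold_locales
    (simp_all add: poly_mapping_eq_iff fun_eq_iff lookup_fscale lookup_add algebra_simps)

definition xmul :: "'n \<Rightarrow> 'n cpoly \<Rightarrow> 'n cpoly" where
  "xmul v f = Poly_Mapping.single (Poly_Mapping.single v 1) 1 * f"

definition xderiv :: "'n \<Rightarrow> 'n cpoly \<Rightarrow> 'n cpoly" where
  "xderiv v f = (\<Sum>k\<in>Poly_Mapping.keys f.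
     Poly_Mapping.single (k - Poly_Mapping.single v 1)
       (of_nat (Poly_Mapping.lookup k v) * Poly_Mapping.lookup f k))"

lemma lookup_xderiv:
  "Poly_Mapping.lookup (xderiv v f) k =
     of_nat (Poly_Mapping.lookup k v + 1) * Poly_Mapping.lookup f (k + Poly_Mapping.single v 1)"
proof -
  let ?e = "Poly_Mapping.single v (1::nat)"
  let ?t = "\<lambda>k'. of_nat (Poly_Mapping.lookup k' v) * Poly_Mapping.lookup f k'"
  have 1: "k' = k + ?e" if "k' - ?e = k" "?t k' \<noteq> 0" for k'
  proof (rule poly_mapping_eqI)
    fix u
    from that(2) have "Poly_Mapping.lookup k' v > 0" by auto
    then show "Poly_Mapping.lookup k' u = Poly_Mapping.lookup (k + ?e) u"
      using that(1) by (auto simp: lookup_add lookup_minus lookup_single when_def)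
  qed
  have 2: "(k + ?e) - ?e = k" by simp
  have "Poly_Mapping.lookup (xderiv v f) k = (\<Sum>k'\<in>Poly_Mapping.keys f. (?t k' when k' - ?e = k))"
    unfolding xderiv_def by (simp add: lookup_sum lookup_single)
  also have "\<dots> = (\<Sum>k'\<in>Poly_Mapping.keys f. if k' = k + ?e then ?t (k + ?e) else 0)"
  proof (rule sum.cong)
    fix k'
    show "(?t k' when k' - ?e = k) = (if k' = k + ?e then ?t (k + ?e) else 0)"
    proof (cases "k' = k + ?e")
      case True
      then show ?thesis using 2 by (simp add: when_def)
    next
      case False
      then have "k' - ?e \<noteq> k \<or> ?t k' = 0" using 1 by blast
      then show ?thesis using False by (auto simp only: when_def if_False split: if_splits)
    qed
  qed simp
  also have "\<dots> = ?t (k + ?e)"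
    by (simp add: sum.delta in_keys_iff)
  finally show ?thesis by (simp add: lookup_add)
qed

lemma xderiv_add: "xderiv v (f + g) = xderiv v f + xderiv v g"
  by (rule poly_mapping_eqI) (simp add: lookup_xderiv lookup_add algebra_simps)

lemma xderiv_fscale: "xderiv v (fscale c f) = fscale c (xderiv v f)"
  by (rule poly_mapping_eqI) (simp add: lookup_xderiv lookup_fscale)


lemma fscale_mult: "fscale c (g * f) = g * fscale c (f :: 'n cpoly)"
proof -
  have "fscale c h = Poly_Mapping.single 0 c * h" for h :: "'n cpoly"
    unfolding fscale_def using mult_map_scale_conv_mult[of c h] by simp
  then show ?thesis by (simp add: mult.left_commute)
qed

lemma xderiv_single:
  "xderiv v (Poly_Mapping.single k c) =
     Poly_Mapping.single (k - Poly_Mapping.single v 1) (of_nat (Poly_Mapping.lookup k v) * c)"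
  by (cases "c = 0") (simp_all add: xderiv_def)

lemma xmul_add: "xmul v (f + g) = xmul v f + xmul v g"
  by (simp add: xmul_def distrib_left)

lemma xmul_fscale: "xmul v (fscale c f) = fscale c (xmul v f)"
  by (simp add: xmul_def fscale_mult)

lemma xderiv_xmul:
  "xderiv v (xmul u f) = xmul u (xderiv v f) + (if u = v then f else 0)"
proof (induction f rule: update_induct)
  case const
  show ?case by (simp add: xmul_def xderiv_def)
next
  case (update f k c)
  have *: "Poly_Mapping.update k c f = f + Poly_Mapping.single k c"
    using update by (intro poly_mapping_eqI)
      (auto simp: lookup_update lookup_add lookup_single when_def in_keys_iff)
  have "xderiv v (xmul u (Poly_Mapping.single k c))
      = xmul u (xderiv v (Poly_Mapping.single k c)) + (if u = v then Poly_Mapping.single k c else 0)"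
  proof (cases "u = v")
    case True
    have "Poly_Mapping.single v 1 + (k - Poly_Mapping.single v 1) = k" if "Poly_Mapping.lookup k v \<noteq> 0"
      using that by (intro poly_mapping_eqI) (auto simp: lookup_add lookup_minus lookup_single when_def)
    then show ?thesis using True
      by (cases "Poly_Mapping.lookup k v = 0")
        (simp_all add: xmul_def mult_single xderiv_single lookup_add flip: single_add,
         simp_all add: algebra_simps)
  next
    case False
    have "Poly_Mapping.single u 1 + k - Poly_Mapping.single v 1
        = Poly_Mapping.single u 1 + (k - Poly_Mapping.single v 1)"
      using False by (intro poly_mapping_eqI) (auto simp: lookup_add lookup_minus lookup_single when_def)
    then show ?thesis using False
      by (simp add: xmul_def mult_single xderiv_single lookup_add lookup_single)
  qed
  then show ?case
    using update by (simp add: * xmul_add xderiv_add algebra_simps split: if_splits)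
qed

lemma xderiv_commute: "xderiv v (xderiv u f) = xderiv u (xderiv v f)"
proof (rule poly_mapping_eqI)
  fix k
  show "Poly_Mapping.lookup (xderiv v (xderiv u f)) k = Poly_Mapping.lookup (xderiv u (xderiv v f)) k"
    by (cases "u = v") (simp_all add: lookup_xderiv lookup_add lookup_single ac_simps)
qed

lemma xmul_commute: "xmul v (xmul u f) = xmul u (xmul v f)"
  by (simp add: xmul_def mult.left_commute)

definition odd_poly :: "'n::finite symp \<Rightarrow> 'n cpoly \<Rightarrow> 'n cpoly" where
  "odd_poly y f = (\<Sum>v\<in>UNIV. fscale (y $ Inl v * (1 / csqrt (- 4 * pi * \<i>))) (xderiv v f)
                          + fscale (y $ Inr v * csqrt (- pi * \<i>)) (xmul v f))"

definition anticomm :: "('a \<Rightarrow> 'a::plus) \<Rightarrow> ('a \<Rightarrow> 'a) \<Rightarrow> 'a \<Rightarrow> 'a" where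
  "anticomm S T f = S (T f) + T (S f)"

text \<open>
  With the basis \<open>(p, q)\<close> of \<open>E\<close> and its \<open>omega\<close>-dual basis \<open>(-q, p)\<close>, a matrix \<open>M\<close> in \<open>sp(E)\<close> is
  the adjoint action of \<open>1/2\<close> times the sum over \<open>i\<close> of
  \<open>(M q_i) p_i + p_i (M q_i) - (M p_i) q_i - q_i (M p_i)\<close>; the lemmas below confirm the Heisenberg relation, the
  action of \<open>yz + zy\<close> and its adjoint action.
\<close>

fun osp_poly :: "'n::finite osp \<Rightarrow> 'n cpoly \<Rightarrow> 'n cpoly" where
  "osp_poly (Ev M) f = fscale (1/2) (\<Sum>i\<in>UNIV.
      anticomm (odd_poly (M *v qE i)) (odd_poly (pE i)) f
    - anticomm (odd_poly (M *v pE i)) (odd_poly (qE i)) f)"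
| "osp_poly (Od y) f = odd_poly y f"

interpretation fs: vector_space "fscale :: complex \<Rightarrow> ('a \<Rightarrow>\<^sub>0 complex) \<Rightarrow> _"
  by (rule vector_space_fscale)

lemma odd_poly_add: "odd_poly y (f + g) = odd_poly y f + odd_poly y g"
  by (simp add: odd_poly_def xderiv_add xmul_add fs.scale_right_distrib sum.distrib)

lemma odd_poly_fscale: "odd_poly y (fscale c f) = fscale c (odd_poly y f)"
  by (simp add: odd_poly_def xderiv_fscale xmul_fscale fs.scale_sum_right fs.scale_right_distrib
      mult.commute mult.left_commute)

lemma odd_poly_plus: "odd_poly (y + z) f = odd_poly y f + odd_poly z f"
  by (simp add: odd_poly_def sum.distrib fs.scale_left_distrib distrib_right add_divide_distrib)

lemma odd_poly_smult: "odd_poly (c *s y) f = fscale c (odd_poly y f)"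
  by (simp add: odd_poly_def fs.scale_sum_right fs.scale_right_distrib mult.assoc)

lemma odd_poly_0: "odd_poly 0 f = 0"
  by (simp add: odd_poly_def)

lemma odd_poly_zero: "odd_poly y 0 = 0"
  using odd_poly_fscale[of y 0 0] by simp

lemma odd_poly_sum: "odd_poly (sum y A) f = (\<Sum>i\<in>A. odd_poly (y i) f)"
  by (induction A rule: infinite_finite_induct) (simp_all add: odd_poly_0 odd_poly_plus)

lemma odd_poly_sum': "odd_poly y (sum f A) = (\<Sum>i\<in>A. odd_poly y (f i))"
  by (induction A rule: infinite_finite_induct) (simp_all add: odd_poly_zero odd_poly_add)

lemma symp_expand: "(y :: 'n::finite symp) = (\<Sum>i\<in>UNIV. y $ Inl i *s pE i + y $ Inr i *s qE i)"
proof (rule vec_eq_iff[THEN iffD2], rule allI)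
  fix a :: "'n + 'n"
  show "y $ a = (\<Sum>i\<in>UNIV. y $ Inl i *s pE i + y $ Inr i *s qE i) $ a"
  proof (cases a)
    case (Inl j)
    have "(\<Sum>i\<in>UNIV. y $ Inl i *s pE i + y $ Inr i *s qE i) $ a = (\<Sum>i\<in>UNIV. if i = j then y $ a else 0)"
      unfolding sum_component by (rule sum.cong) (auto simp: Inl pE_def qE_def axis_def)
    then show ?thesis by simp
  next
    case (Inr j)
    have "(\<Sum>i\<in>UNIV. y $ Inl i *s pE i + y $ Inr i *s qE i) $ a = (\<Sum>i\<in>UNIV. if i = j then y $ a else 0)"
      unfolding sum_component by (rule sum.cong) (auto simp: Inr pE_def qE_def axis_def)
    then show ?thesis by simp
  qed
qed

lemma omega_qE: "omega z (axis (Inr i) 1) = z $ Inl i"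
proof -
  have "omega z (axis (Inr i) 1) = (\<Sum>j\<in>UNIV. if j = i then z $ Inl i else 0)"
    unfolding omega_def by (rule sum.cong) (auto simp: axis_def)
  then show ?thesis by simp
qed

lemma omega_pE: "omega z (axis (Inl i) 1) = - z $ Inr i"
proof -
  have "omega z (axis (Inl i) 1) = (\<Sum>j\<in>UNIV. if j = i then - z $ Inr i else 0)"
    unfolding omega_def by (rule sum.cong) (auto simp: axis_def)
  then show ?thesis by simp
qed

lemma matrix_vector_axis: "(A *v axis k (1::complex)) $ a = A $ a $ k"
proof -
  have "(A *v axis k (1::complex)) $ a = (\<Sum>j\<in>UNIV. if j = k then A $ a $ k else 0)"
    unfolding matrix_vector_mult_def vec_lambda_beta by (rule sum.cong) (auto simp: axis_def)
  then show ?thesis by simp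
qed

lemma quad_qE: "quad y z *v qE i = z $ Inl i *s y + y $ Inl i *s z"
  unfolding qE_def by (simp add: vec_eq_iff matrix_vector_axis, simp add: quad_def omega_qE)

lemma quad_pE: "quad y z *v pE i = - (z $ Inr i *s y + y $ Inr i *s z)"
  unfolding pE_def by (simp add: vec_eq_iff matrix_vector_axis, simp add: quad_def omega_pE)

lemma osp_poly_quad:
  fixes y z :: "'n::finite symp"
  shows "osp_poly (Ev (quad y z)) f = anticomm (odd_poly y) (odd_poly z) f"
proof -
  have neg: "odd_poly (- u) g = - odd_poly u g" for u :: "'n symp" and g
    using odd_poly_smult[of "-1" u g] by (simp add: vector_sneg_minus1[symmetric])
  define A where "A u v = anticomm (odd_poly u) (odd_poly v) f" for u v :: "'n symp"
  have Asym: "A u v = A v u" for u v by (simp add: A_def anticomm_def add.commute)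
  have Aadd: "A (u + u') v = A u v + A u' v" for u u' v
    by (simp add: A_def anticomm_def odd_poly_plus odd_poly_add algebra_simps)
  have Asc: "A (c *s u) v = fscale c (A u v)" for c u v
    by (simp add: A_def anticomm_def odd_poly_smult odd_poly_fscale fs.scale_right_distrib)
  have A0: "A 0 v = 0" for v
    by (simp add: A_def anticomm_def odd_poly_0 odd_poly_zero)
  have Asum: "A (sum u I) v = (\<Sum>i\<in>I. A (u i) v)" for u v and I :: "'n set"
    by (induction I rule: infinite_finite_induct) (simp_all add: Aadd A0)
  have Aneg: "A (- u) v = - A u v" for u v
    using Asc[of "-1" u v] by (simp add: vector_sneg_minus1[symmetric])
  have Adiff: "A (u - u') v = A u v - A u' v" for u u' v
    using Aadd[of u "- u'" v] by (simp add: Aneg)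
  have Aexp: "A u v = (\<Sum>i\<in>UNIV. fscale (u $ Inl i) (A v (pE i)) + fscale (u $ Inr i) (A v (qE i)))"
    for u v
  proof -
    have "A u v = A (\<Sum>i\<in>UNIV. u $ Inl i *s pE i + u $ Inr i *s qE i) v"
      by (rule arg_cong[OF symp_expand])
    then show ?thesis by (simp add: Asum Aadd Asc Asym[of v])
  qed
  have "osp_poly (Ev (quad y z)) f =
      fscale (1/2) (\<Sum>i\<in>UNIV. A (quad y z *v qE i) (pE i) - A (quad y z *v pE i) (qE i))"
    by (simp add: A_def)
  also have "\<dots> = fscale (1/2) (A z y + A y z)"
    unfolding Aexp[of z y] Aexp[of y z]
    by (simp add: quad_qE quad_pE Aadd Asc Aneg Adiff sum.distrib sum_subtractf sum_negf algebra_simps)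
  also have "\<dots> = A y z"
    unfolding Asym[of z y] fs.scale_right_distrib by (simp flip: fs.scale_left_distrib)
  finally show ?thesis by (simp add: A_def)
qed

lemma odd_poly_heisenberg:
  fixes y z :: "'n::finite symp"
  shows "odd_poly y (odd_poly z f) - odd_poly z (odd_poly y f) = fscale (omega y z / 2) f"
proof -
  define a where "a = 1 / csqrt (- 4 * pi * \<i>)"
  define b where "b = csqrt (- pi * \<i>)"
  have "csqrt (- 4 * pi * \<i>) = 2 * b"
    unfolding b_def using csqrt_principal[of "- pi * \<i>"]
    by (intro csqrt_unique) (auto simp: power_mult_distrib)
  moreover have "b \<noteq> 0" by (simp add: b_def)
  ultimately have ab: "a * b = 1 / 2" by (simp add: a_def)
  define P where "P v g = fscale a (xderiv v g)" for v :: 'n and g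
  define Q where "Q v g = fscale b (xmul v g)" for v :: 'n and g
  have O: "odd_poly w g = (\<Sum>v\<in>UNIV. fscale (w $ Inl v) (P v g) + fscale (w $ Inr v) (Q v g))"
    for w :: "'n symp" and g
    by (simp add: odd_poly_def P_def Q_def a_def b_def)
  have PP: "P v (P u g) = P u (P v g)" and QQ: "Q v (Q u g) = Q u (Q v g)" for u v g
    by (simp_all add: P_def Q_def xderiv_fscale xmul_fscale xderiv_commute[of v u] xmul_commute[of v u])
  have PQ: "P v (Q u g) = Q u (P v g) + (if u = v then fscale (1/2) g else 0)" for u v g
    by (simp add: P_def Q_def xderiv_fscale xmul_fscale xderiv_xmul fs.scale_right_distrib
        mult.commute[of b a] ab)
  have Pl: "P v (g + h) = P v g + P v h" "P v (fscale c g) = fscale c (P v g)" for v g h c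
    by (simp_all add: P_def xderiv_add xderiv_fscale fs.scale_right_distrib mult.commute)
  have Ql: "Q v (g + h) = Q v g + Q v h" "Q v (fscale c g) = fscale c (Q v g)" for v g h c
    by (simp_all add: Q_def xmul_add xmul_fscale fs.scale_right_distrib mult.commute)
  have P0: "P v 0 = 0" "Q v 0 = 0" for v using Pl(2)[of v 0 0] Ql(2)[of v 0 0] by simp_all
  have Ps: "P v (sum g I) = (\<Sum>i\<in>I. P v (g i))" "Q v (sum g I) = (\<Sum>i\<in>I. Q v (g i))"
    for v g and I :: "'n set"
    by (induction I rule: infinite_finite_induct; simp add: Pl Ql P0)+
  let ?T = "\<lambda>v u. fscale (y $ Inl v * z $ Inl u) (P u (P v f)) + fscale (y $ Inr v * z $ Inr u) (Q u (Q v f))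
    + fscale (y $ Inl v * z $ Inr u) (Q u (P v f)) + fscale (y $ Inr v * z $ Inl u) (Q v (P u f))"
  have 1: "odd_poly y (odd_poly z f) = (\<Sum>v\<in>UNIV. \<Sum>u\<in>UNIV. ?T v u
      + (if u = v then fscale (y $ Inl v * z $ Inr v / 2) f else 0))"
    unfolding O
    apply (simp add: Ps Pl Ql fs.scale_sum_right fs.scale_right_distrib flip: sum.distrib)
    apply (intro sum.cong refl)
    subgoal for v u
      by (cases "u = v") (simp_all add: PQ PP[of v u] QQ[of v u] fs.scale_right_distrib algebra_simps)
    done
  have 2: "odd_poly z (odd_poly y f) = (\<Sum>v\<in>UNIV. \<Sum>u\<in>UNIV. ?T v u
      + (if u = v then fscale (y $ Inr v * z $ Inl v / 2) f else 0))"
    unfolding O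
    apply (simp add: Ps Pl Ql fs.scale_sum_right fs.scale_right_distrib flip: sum.distrib)
    apply (subst sum.swap)
    apply (intro sum.cong refl)
    subgoal for v u
      by (cases "u = v") (simp_all add: PQ fs.scale_right_distrib algebra_simps)
    done
  have "odd_poly y (odd_poly z f) - odd_poly z (odd_poly y f)
      = (\<Sum>v\<in>UNIV. fscale (y $ Inl v * z $ Inr v / 2) f) - (\<Sum>v\<in>UNIV. fscale (y $ Inr v * z $ Inl v / 2) f)"
    unfolding 1 2 by (simp add: sum.distrib)
  also have "\<dots> = fscale (omega y z / 2) f"
    by (simp add: omega_def sum_divide_distrib diff_divide_distrib fs.scale_sum_left sum_subtractf
        fs.scale_left_diff_distrib)
  finally show ?thesis .
qed

lemma quad_vec:
  fixes y z w :: "'n::finite symp"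
  shows "quad y z *v w = omega z w *s y + omega y w *s z"
proof -
  have *: "M *v w = (\<Sum>i\<in>UNIV. w $ Inl i *s (M *v pE i) + w $ Inr i *s (M *v qE i))"
    for M :: "'n symp_mat"
    by (subst symp_expand[of w])
      (simp add: vec.linear_sum[OF matrix_vector_mul_linear_gen] vec.linear_scale[OF matrix_vector_mul_linear_gen]
        matrix_vector_right_distrib)
  show ?thesis
    unfolding *[of "quad y z"]
    by (simp add: quad_pE quad_qE omega_def vec_eq_iff sum_subtractf sum.distrib sum_distrib_left
        sum_distrib_right sum_negf algebra_simps)
qed

lemma quad_commutator:
  fixes y z w :: "'n::finite symp"
  shows "osp_poly (Ev (quad y z)) (odd_poly w f) - odd_poly w (osp_poly (Ev (quad y z)) f)
     = odd_poly (quad y z *v w) f"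
proof -
  have yzw: "odd_poly u (odd_poly v g) = odd_poly v (odd_poly u g) + fscale (omega u v / 2) g"
    for u v :: "'n symp" and g
    using odd_poly_heisenberg[of u v g] by (simp add: algebra_simps)
  have half: "fscale (c / 2) g + fscale (c / 2) g = fscale c g" for c and g :: "'n cpoly"
    by (simp flip: fs.scale_left_distrib)
  have 1: "odd_poly u (odd_poly v (odd_poly w f)) = odd_poly w (odd_poly u (odd_poly v f))
      + fscale (omega u w / 2) (odd_poly v f) + fscale (omega v w / 2) (odd_poly u f)" for u v
    by (simp add: yzw[of v w] yzw[of u w] odd_poly_add odd_poly_fscale)
  show ?thesis
    unfolding osp_poly_quad quad_vec anticomm_def 1 odd_poly_plus odd_poly_smult odd_poly_add
    by (simp add: half[of "omega z w", symmetric] half[of "omega y w", symmetric])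
qed

definition mono_degree :: "('n::finite \<Rightarrow>\<^sub>0 nat) \<Rightarrow> nat" where
  "mono_degree k = (\<Sum>v\<in>UNIV. Poly_Mapping.lookup k v)"

definition poly_parity :: "nat \<Rightarrow> 'n::finite cpoly set" where
  "poly_parity r = {f. \<forall>k\<in>Poly_Mapping.keys f. mono_degree k mod 2 = r}"


section \<open>Irreducible modules over the Levi algebra\<close>

record ('n::finite, 'w) glmod =
  gspace :: "'w set"
  gscale :: "complex \<Rightarrow> 'w \<Rightarrow> 'w"
  gact :: "'n mat \<Rightarrow> 'w \<Rightarrow> 'w"

definition gl_module :: "('n::finite, 'w::ab_group_add) glmod \<Rightarrow> bool" where
  "gl_module R \<longleftrightarrow>
     vector_space (gscale R) \<and> module.subspace (gscale R) (gspace R) \<and>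
     (\<forall>A. \<forall>w\<in>gspace R. gact R A w \<in> gspace R) \<and>
     (\<forall>A. \<forall>w\<in>gspace R. \<forall>w'\<in>gspace R. gact R A (w + w') = gact R A w + gact R A w') \<and>
     (\<forall>A c. \<forall>w\<in>gspace R. gact R A (gscale R c w) = gscale R c (gact R A w)) \<and>
     (\<forall>A B. \<forall>w\<in>gspace R. gact R (A + B) w = gact R A w + gact R B w) \<and>
     (\<forall>A c. \<forall>w\<in>gspace R. gact R (mscale c A) w = gscale R c (gact R A w)) \<and>
     (\<forall>A B. \<forall>w\<in>gspace R.
        gact R (A ** B - B ** A) w = gact R A (gact R B w) - gact R B (gact R A w))"

definition mat_unit :: "'n \<Rightarrow> 'n \<Rightarrow> 'n::finite mat" where
  "mat_unit i j = (\<chi> a b. if a = i \<and> b = j then 1 else 0)"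

definition irreducible_hw ::
    "('n::{finite,linorder}, 'w::ab_group_add) glmod \<Rightarrow> ('n \<Rightarrow> real) \<Rightarrow> bool" where
  "irreducible_hw R \<beta> \<longleftrightarrow>
     gl_module R \<and>
     (\<exists>B. finite B \<and> gspace R = module.span (gscale R) B) \<and>
     (\<exists>v\<in>gspace R. v \<noteq> 0 \<and>
        (\<forall>i j. i < j \<longrightarrow> gact R (mat_unit i j) v = 0) \<and>
        (\<forall>i. gact R (mat_unit i i) v = gscale R (of_real (\<beta> i)) v)) \<and>
     (\<forall>U. module.subspace (gscale R) U \<and> U \<subseteq> gspace R \<and> (\<forall>A. \<forall>w\<in>U. gact R A w \<in> U)
        \<longrightarrow> U = {0} \<or> U = gspace R)"

definition half_integral_dominant :: "('n::{finite,linorder} \<Rightarrow> real) \<Rightarrow> bool" where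
  "half_integral_dominant \<beta> \<longleftrightarrow>
     (\<forall>i. 2 * \<beta> i \<in> \<int>) \<and> (\<forall>i j. i \<le> j \<longrightarrow> \<beta> i - \<beta> j \<in> \<nat>)"

definition pp_block :: "'n::finite symp_mat \<Rightarrow> 'n mat" where
  "pp_block M = (\<chi> i j. M $ Inl i $ Inl j)"
definition pq_block :: "'n::finite symp_mat \<Rightarrow> 'n mat" where
  "pq_block M = (\<chi> i j. M $ Inl i $ Inr j)"
definition qp_block :: "'n::finite symp_mat \<Rightarrow> 'n mat" where
  "qp_block M = (\<chi> i j. M $ Inr i $ Inl j)"
definition qq_block :: "'n::finite symp_mat \<Rightarrow> 'n mat" where
  "qq_block M = (\<chi> i j. M $ Inr i $ Inr j)"

text \<open>
  Inflation to the parabolic subalgebra. Its matrices are block upper triangular; the Levi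
  component is the action on \<open>Lp\<close>, the nilradical consists of the \<open>pq\<close>-blocks and of the odd
  elements.
\<close>

fun par_act :: "('n::finite, 'w::ab_group_add) glmod \<Rightarrow> 'n osp \<Rightarrow> 'w \<Rightarrow> 'w" where
  "par_act R (Ev M) w = gact R (pp_block M) w"
| "par_act R (Od y) w = 0"


section \<open>Generalized Verma modules\<close>

text \<open>
  For a (super)algebra \<open>G\<close> with parabolic \<open>P\<close> (sets of homogeneous elements) and a module \<open>R\<close>,
  the induced module \<open>U(G) \<otimes> R\<close> over \<open>U(P)\<close> is the quotient of \<open>ind_space\<close>, the free vector
  space on symbols \<open>X1 \<dots> Xk \<otimes> w\<close>, by \<open>ind_null\<close>. Linear maps between such quotients are given
  by linear lifts.
\<close>

type_synonym ('n, 'w) tens = "('n osp list \<times> 'w) \<Rightarrow>\<^sub>0 complex"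

definition word :: "'n::finite osp list \<Rightarrow> 'w \<Rightarrow> ('n, 'w) tens" where
  "word u w = Poly_Mapping.single (u, w) 1"

definition ind_space :: "'n::finite osp set \<Rightarrow> ('n, 'w) glmod \<Rightarrow> ('n, 'w) tens set" where
  "ind_space G R = {x. Poly_Mapping.keys x \<subseteq> lists G \<times> gspace R}"

definition ksign :: "'n::finite osp \<Rightarrow> 'n osp \<Rightarrow> complex" where
  "ksign X Y = (if is_odd X \<and> is_odd Y then - 1 else 1)"

definition relators ::
    "'n::finite osp set \<Rightarrow> 'n osp set \<Rightarrow> ('n, 'w::ab_group_add) glmod \<Rightarrow> ('n, 'w) tens set" where
  "relators G P R =
     {word u (w + w') - word u w - word u w' | u w w'.
        u \<in> lists G \<and> w \<in> gspace R \<and> w' \<in> gspace R}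
   \<union> {word u (gscale R c w) - fscale c (word u w) | u c w. u \<in> lists G \<and> w \<in> gspace R}
   \<union> {word (u @ [Ev (mscale a M + mscale b N)] @ v) w
        - fscale a (word (u @ [Ev M] @ v) w) - fscale b (word (u @ [Ev N] @ v) w) | u v a b M N w.
        u \<in> lists G \<and> v \<in> lists G \<and> Ev M \<in> G \<and> Ev N \<in> G \<and> w \<in> gspace R}
   \<union> {word (u @ [Od (a *s y + b *s z)] @ v) w
        - fscale a (word (u @ [Od y] @ v) w) - fscale b (word (u @ [Od z] @ v) w) | u v a b y z w.
        u \<in> lists G \<and> v \<in> lists G \<and> Od y \<in> G \<and> Od z \<in> G \<and> w \<in> gspace R}
   \<union> {word (u @ [X, Y] @ v) w - fscale (ksign X Y) (word (u @ [Y, X] @ v) w)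
        - word (u @ [bracket X Y] @ v) w | u v X Y w.
        u \<in> lists G \<and> v \<in> lists G \<and> X \<in> G \<and> Y \<in> G \<and> w \<in> gspace R}
   \<union> {word (u @ [X]) w - word u (par_act R X w) | u X w.
        u \<in> lists G \<and> X \<in> P \<and> w \<in> gspace R}"

definition ind_null ::
    "'n::finite osp set \<Rightarrow> 'n osp set \<Rightarrow> ('n, 'w::ab_group_add) glmod \<Rightarrow> ('n, 'w) tens set" where
  "ind_null G P R = module.span fscale (relators G P R)"

definition ind_act :: "'n::finite osp \<Rightarrow> ('n, 'w) tens \<Rightarrow> ('n, 'w) tens" where
  "ind_act X x = (\<Sum>k\<in>Poly_Mapping.keys x.
     Poly_Mapping.single (X # fst k, snd k) (Poly_Mapping.lookup x k))"

definition linear_on_fs ::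
    "('a \<Rightarrow>\<^sub>0 complex) set \<Rightarrow> (('a \<Rightarrow>\<^sub>0 complex) \<Rightarrow> ('b \<Rightarrow>\<^sub>0 complex)) \<Rightarrow> bool" where
  "linear_on_fs A f \<longleftrightarrow>
     (\<forall>x\<in>A. \<forall>y\<in>A. f (x + y) = f x + f y) \<and> (\<forall>c. \<forall>x\<in>A. f (fscale c x) = fscale c (f x))"

definition ind_hom ::
    "'n::finite osp set \<Rightarrow> 'n osp set \<Rightarrow> ('n, 'w::ab_group_add) glmod \<Rightarrow> ('n, 'w) glmod
      \<Rightarrow> (('n, 'w) tens \<Rightarrow> ('n, 'w) tens) \<Rightarrow> bool" where
  "ind_hom G P R R' \<phi> \<longleftrightarrow>
     \<phi> ` ind_space G R \<subseteq> ind_space G R' \<and> linear_on_fs (ind_space G R) \<phi> \<and>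
     \<phi> ` ind_null G P R \<subseteq> ind_null G P R' \<and>
     (\<forall>X\<in>G. \<forall>x\<in>ind_space G R. \<phi> (ind_act X x) - ind_act X (\<phi> x) \<in> ind_null G P R')"

definition ind_aug ::
    "'n::finite osp set \<Rightarrow> 'n osp set \<Rightarrow> ('n, 'w::ab_group_add) glmod \<Rightarrow> 'n cpoly set
      \<Rightarrow> (('n, 'w) tens \<Rightarrow> 'n cpoly) \<Rightarrow> bool" where
  "ind_aug G P R T \<epsilon> \<longleftrightarrow>
     \<epsilon> ` ind_space G R \<subseteq> T \<and> linear_on_fs (ind_space G R) \<epsilon> \<and>
     \<epsilon> ` ind_null G P R \<subseteq> {0} \<and>
     (\<forall>X\<in>G. \<forall>x\<in>ind_space G R. \<epsilon> (ind_act X x) = osp_poly X (\<epsilon> x))"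


section \<open>Partitions and resolutions of BGG type\<close>

text \<open>Partitions with at most \<open>n\<close> rows; rows and columns are numbered from \<open>0\<close>.\<close>

definition partitions_rows :: "nat \<Rightarrow> (nat \<Rightarrow> nat) set" where
  "partitions_rows n = {\<alpha>. antimono \<alpha> \<and> (\<forall>i\<ge>n. \<alpha> i = 0)}"

definition psize :: "(nat \<Rightarrow> nat) \<Rightarrow> nat" where
  "psize \<alpha> = (\<Sum>i | \<alpha> i \<noteq> 0. \<alpha> i)"

definition diag_cells :: "(nat \<Rightarrow> nat) \<Rightarrow> nat" where
  "diag_cells \<alpha> = card {i. i < \<alpha> i}"

definition frob_a :: "(nat \<Rightarrow> nat) \<Rightarrow> nat \<Rightarrow> nat" where
  "frob_a \<alpha> i = \<alpha> i - Suc i"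

definition frob_b :: "(nat \<Rightarrow> nat) \<Rightarrow> nat \<Rightarrow> nat" where
  "frob_b \<alpha> i = card {k. i < \<alpha> k} - Suc i"

definition K_index :: "nat \<Rightarrow> nat \<Rightarrow> nat \<Rightarrow> (nat \<Rightarrow> nat) set" where
  "K_index n r m = {\<alpha> \<in> partitions_rows n.
     (\<forall>i<diag_cells \<alpha>. frob_a \<alpha> i = frob_b \<alpha> i) \<and>
     (\<Sum>i<diag_cells \<alpha>. frob_b \<alpha> i) = m \<and> psize \<alpha> mod 2 = r}"

definition SK_index :: "nat \<Rightarrow> nat \<Rightarrow> (nat \<Rightarrow> nat) set" where
  "SK_index n m = {\<alpha> \<in> partitions_rows n.
     psize \<alpha> = 2 * m \<and> (\<forall>i<diag_cells \<alpha>. frob_b \<alpha> i = frob_a \<alpha> i + 1)}"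

text \<open>The weight \<open>\<alpha>\<^sup>\<or> - (1/2)^n\<close>, where \<open>\<alpha>\<^sup>\<or> = (- \<alpha>_n, \<dots>, - \<alpha>_1)\<close>.\<close>

definition bgg_weight :: "(nat \<Rightarrow> nat) \<Rightarrow> 'n::{finite,linorder} \<Rightarrow> real" where
  "bgg_weight \<alpha> i = - real (\<alpha> (CARD('n) - Suc (card {j. j < i}))) - 1/2"

text \<open>
  \<open>bgg_resolution G P I R T d \<epsilon>\<close>: the term of degree \<open>-m\<close> is the direct sum of the induced modules
  of \<open>R \<alpha>\<close> for \<open>\<alpha> \<in> I m\<close>; \<open>d m \<alpha> \<alpha>'\<close> are the matrix entries of the differential from degree
  \<open>-(m+1)\<close> to degree \<open>-m\<close>, and \<open>\<epsilon>\<close> is the augmentation from degree \<open>0\<close> onto \<open>T\<close>.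
\<close>

definition chains ::
    "'n::finite osp set \<Rightarrow> 'a set \<Rightarrow> ('a \<Rightarrow> ('n, 'w) glmod) \<Rightarrow> ('a \<Rightarrow> ('n, 'w) tens) set" where
  "chains G J R = {c. \<forall>\<alpha>\<in>J. c \<alpha> \<in> ind_space G (R \<alpha>)}"

definition chain_diff ::
    "(nat \<Rightarrow> 'a set) \<Rightarrow> (nat \<Rightarrow> 'a \<Rightarrow> 'a \<Rightarrow> ('n, 'w) tens \<Rightarrow> ('n, 'w) tens) \<Rightarrow> nat
      \<Rightarrow> ('a \<Rightarrow> ('n::finite, 'w) tens) \<Rightarrow> 'a \<Rightarrow> ('n, 'w) tens" where
  "chain_diff I d m c = (\<lambda>\<alpha>'. \<Sum>\<alpha>\<in>I (Suc m). d m \<alpha> \<alpha>' (c \<alpha>))"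

definition chain_aug ::
    "'a set \<Rightarrow> ('a \<Rightarrow> ('n, 'w) tens \<Rightarrow> 'n cpoly) \<Rightarrow> ('a \<Rightarrow> ('n::finite, 'w) tens) \<Rightarrow> 'n cpoly" where
  "chain_aug J \<epsilon> c = (\<Sum>\<alpha>\<in>J. \<epsilon> \<alpha> (c \<alpha>))"

definition bgg_resolution ::
    "'n::finite osp set \<Rightarrow> 'n osp set \<Rightarrow> (nat \<Rightarrow> 'a set) \<Rightarrow> ('a \<Rightarrow> ('n, 'w::ab_group_add) glmod)
      \<Rightarrow> 'n cpoly set \<Rightarrow> (nat \<Rightarrow> 'a \<Rightarrow> 'a \<Rightarrow> ('n, 'w) tens \<Rightarrow> ('n, 'w) tens)
      \<Rightarrow> ('a \<Rightarrow> ('n, 'w) tens \<Rightarrow> 'n cpoly) \<Rightarrow> bool" where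
  "bgg_resolution G P I R T d \<epsilon> \<longleftrightarrow>
     (\<forall>m. \<forall>\<alpha>\<in>I (Suc m). \<forall>\<alpha>'\<in>I m. ind_hom G P (R \<alpha>) (R \<alpha>') (d m \<alpha> \<alpha>')) \<and>
     (\<forall>\<alpha>\<in>I 0. ind_aug G P (R \<alpha>) T (\<epsilon> \<alpha>)) \<and>
     chain_aug (I 0) \<epsilon> ` chains G (I 0) R = T \<and>
     (\<forall>c\<in>chains G (I 0) R. chain_aug (I 0) \<epsilon> c = 0 \<longleftrightarrow>
        (\<exists>e\<in>chains G (I 1) R. \<forall>\<alpha>\<in>I 0. c \<alpha> - chain_diff I d 0 e \<alpha> \<in> ind_null G P (R \<alpha>))) \<and>
     (\<forall>m. \<forall>c\<in>chains G (I (Suc m)) R.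
        (\<forall>\<alpha>\<in>I m. chain_diff I d m c \<alpha> \<in> ind_null G P (R \<alpha>)) \<longleftrightarrow>
        (\<exists>e\<in>chains G (I (Suc (Suc m))) R.
           \<forall>\<alpha>\<in>I (Suc m). c \<alpha> - chain_diff I d (Suc m) e \<alpha> \<in> ind_null G P (R \<alpha>)))"


section \<open>Charts of the Lagrangian Grassmannians\<close>

text \<open>
  The big cell around \<open>o = [Lp]\<close> consists of the graphs of symmetric \<open>S: Lp \<rightarrow> Lq\<close>, with \<open>o\<close> at
  \<open>S = 0\<close>. It contains the Siegel upper half plane (graphs of \<open>T: Lq \<rightarrow> Lp\<close> with \<open>Im T > 0\<close>,
  which are invertible, so \<open>S = T\<^sup>-\<^sup>1\<close>).
\<close>

definition symm :: "'n::finite mat set" where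
  "symm = {S. transpose S = S}"

definition graph_p :: "'n::finite mat \<Rightarrow> 'n symp set" where
  "graph_p S = {e. \<forall>i. e $ Inr i = (\<Sum>k\<in>UNIV. S $ i $ k * e $ Inl k)}"

definition graph_q :: "'n::finite mat \<Rightarrow> 'n symp set" where
  "graph_q T = {e. \<forall>i. e $ Inl i = (\<Sum>k\<in>UNIV. T $ i $ k * e $ Inr k)}"

definition siegel :: "'n::finite mat set" where
  "siegel = {T \<in> symm. \<forall>x::real^'n. x \<noteq> 0 \<longrightarrow>
     (\<Sum>i\<in>UNIV. \<Sum>j\<in>UNIV. x $ i * Im (T $ i $ j) * x $ j) > 0}"

definition siegel_cell :: "'n::finite mat set" where
  "siegel_cell = {S \<in> symm. \<exists>T\<in>siegel. graph_p S = graph_q T}"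

definition opens :: "'n::finite mat set \<Rightarrow> 'n mat set set" where
  "opens X = {U. openin (top_of_set symm) U \<and> U \<subseteq> X}"

text \<open>
  Over the cell the tautological bundle has the frame given by \<open>p_k \<mapsto> p_k + S p_k\<close>. Hence for
  \<open>R = \<Sigma>^\<beta>\<close> a section of \<open>\<Sigma>^{\<beta>\<^sup>\<or>}(\<Lambda>)\<close> is a holomorphic function with values in the dual of \<open>R\<close>;
  half-integral \<open>\<beta>\<close> amounts to choosing the square root of \<open>det\<close> that is constant in this frame.

  On the super Lagrangian Grassmannian the frame is \<open>p_k + \<Sum>j. q_j S_jk + \<epsilon> \<theta>_k\<close> with odd
  \<open>\<theta>_k\<close>; isotropy (with \<open>(\<epsilon>, \<epsilon>) = 1\<close>) means \<open>S_ik - S_ki = \<theta>_i \<theta>_k\<close>, so \<open>S_ik = s_ik + \<theta>_i \<theta>_k / 2\<close>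
  with symmetric \<open>s\<close>, and superfunctions are \<open>\<Sum>I. \<theta>_I f_I(s)\<close>, where \<open>\<theta>_I\<close> is the product in
  increasing order.

  In both cases a section over \<open>U\<close> is a family of functions \<open>f I s w\<close>, indexed by the unit type
  in the classical case and by the sets \<open>I\<close> in the super case, extended by zero to \<open>s \<notin> U\<close> and to
  \<open>w \<notin> gspace R\<close>.
\<close>

type_synonym ('i, 'n, 'w) sect = "'i \<Rightarrow> 'n mat \<Rightarrow> 'w \<Rightarrow> complex"

definition holo_on :: "'n::finite mat set \<Rightarrow> ('n mat \<Rightarrow> complex) \<Rightarrow> bool" where
  "holo_on U g \<longleftrightarrow> (\<forall>S\<in>U. \<exists>L. (g has_derivative L) (at S within symm) \<and>
     (\<forall>c B. L (mscale c B) = c * L B))"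

definition sections ::
    "('n::finite, 'w::ab_group_add) glmod \<Rightarrow> 'n mat set \<Rightarrow> ('i, 'n, 'w) sect set" where
  "sections R U = {f.
     (\<forall>i S w. S \<notin> U \<or> w \<notin> gspace R \<longrightarrow> f i S w = 0) \<and>
     (\<forall>i. \<forall>S\<in>U. \<forall>w\<in>gspace R. \<forall>w'\<in>gspace R. f i S (w + w') = f i S w + f i S w') \<and>
     (\<forall>i c. \<forall>S\<in>U. \<forall>w\<in>gspace R. f i S (gscale R c w) = c * f i S w) \<and>
     (\<forall>i. \<forall>w\<in>gspace R. holo_on U (\<lambda>S. f i S w))}"

definition restr ::
    "('n::finite, 'w) glmod \<Rightarrow> 'n mat set \<Rightarrow> ('i, 'n, 'w) sect \<Rightarrow> ('i, 'n, 'w) sect" where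
  "restr R U f = (\<lambda>i S w. if S \<in> U \<and> w \<in> gspace R then f i S w else 0)"

definition ddir :: "'n::finite mat \<Rightarrow> ('n mat \<Rightarrow> complex) \<Rightarrow> 'n mat \<Rightarrow> complex" where
  "ddir B g S = deriv (\<lambda>t. g (S + mscale t B)) 0"


section \<open>Lie (super)algebra action on sections\<close>

text \<open>
  An element \<open>X\<close> takes the frame matrix \<open>F = (1, S)\<close> to \<open>X F = F h + \<delta>F\<close>, where \<open>h\<close> is the
  \<open>p\<close>-block of \<open>X F\<close> and \<open>\<delta>F\<close> has no \<open>p\<close>-block; the action on sections with values in the dual
  of \<open>R\<close> is \<open>(X f) w = - \<partial>_\<delta> f w - f (h w)\<close>.
\<close>

definition frame_h :: "'n::finite symp_mat \<Rightarrow> 'n mat \<Rightarrow> 'n mat" where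
  "frame_h M S = pp_block M + pq_block M ** S"

definition frame_delta :: "'n::finite symp_mat \<Rightarrow> 'n mat \<Rightarrow> 'n mat" where
  "frame_delta M S = qp_block M + qq_block M ** S - S ** frame_h M S"

text \<open>Only even elements are used in the classical case.\<close>

fun act_classical ::
    "('n::finite, 'w) glmod \<Rightarrow> 'n osp \<Rightarrow> (unit, 'n, 'w) sect \<Rightarrow> (unit, 'n, 'w) sect" where
  "act_classical R (Ev M) f = (\<lambda>i S w.
     - ddir (frame_delta M S) (\<lambda>S. f i S w) S - f i S (gact R (frame_h M S) w))"
| "act_classical R (Od y) f = (\<lambda>i S w. 0)"

text \<open>Left multiplication by \<open>\<theta>_k\<close> and the left derivative \<open>\<partial>/\<partial>\<theta>_k\<close>.\<close>

definition theta_sign :: "'n::{finite,linorder} \<Rightarrow> 'n set \<Rightarrow> complex" where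
  "theta_sign k I = (- 1) ^ card {i\<in>I. i < k}"

definition theta :: "'n::{finite,linorder} \<Rightarrow> ('n set, 'n, 'w) sect \<Rightarrow> ('n set, 'n, 'w) sect" where
  "theta k f = (\<lambda>I S w. if k \<in> I then theta_sign k I * f (I - {k}) S w else 0)"

definition dtheta :: "'n::{finite,linorder} \<Rightarrow> ('n set, 'n, 'w) sect \<Rightarrow> ('n set, 'n, 'w) sect" where
  "dtheta k f = (\<lambda>I S w. if k \<in> I then 0 else theta_sign k I * f (insert k I) S w)"

definition p_part :: "'n::finite symp \<Rightarrow> complex ^ 'n" where "p_part y = (\<chi> i. y $ Inl i)"
definition q_part :: "'n::finite symp \<Rightarrow> complex ^ 'n" where "q_part y = (\<chi> i. y $ Inr i)"

definition sym_outer :: "complex ^ 'n \<Rightarrow> 'n \<Rightarrow> 'n::finite mat" where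
  "sym_outer c k = (\<chi> i j. ((if j = k then c $ i else 0) + (if i = k then c $ j else 0)) / 2)"

text \<open>
  The same recipe with the frame \<open>F = (1, S, \<theta>)\<close>, where \<open>sp(E)\<close> acts by zero on \<open>\<epsilon>\<close>, and an odd
  \<open>y\<close> acts on \<open>\<epsilon>\<close> and \<open>E\<close> by \<open>y \<epsilon> = y\<close>, \<open>y z = omega y z \<epsilon>\<close>. Write \<open>s\<close> for the symmetric
  coordinate and, for even \<open>M\<close>, \<open>h = frame_h M s\<close>. Then
  \<open>\<delta>s = frame_delta M s\<close>, \<open>\<delta>\<theta> = - \<theta> h\<close> and \<open>M\<close> acts on the fibre by \<open>h + B \<theta> \<theta>^t / 2\<close>, \<open>B\<close> being the
  \<open>pq\<close>-block. For odd \<open>y = (a, b)\<close> put \<open>c = b - s a\<close>; then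
  \<open>\<delta>\<theta>_k = c_k + (a\<cdot>\<theta>) \<theta>_k / 2\<close>, \<open>\<delta>s = (c \<theta>^t + \<theta> c^t) / 2\<close>, and \<open>y\<close> acts on the fibre by \<open>a \<theta>^t\<close>.
\<close>

definition odd_shift :: "'n::finite symp \<Rightarrow> 'n mat \<Rightarrow> complex ^ 'n" where
  "odd_shift y S = q_part y - S *v p_part y"

fun act_super ::
    "('n::{finite,linorder}, 'w) glmod \<Rightarrow> 'n osp \<Rightarrow> ('n set, 'n, 'w) sect
      \<Rightarrow> ('n set, 'n, 'w) sect" where
  "act_super R (Ev M) f = (\<lambda>I S w.
     - ddir (frame_delta M S) (\<lambda>S. f I S w) S
     + (\<Sum>i\<in>UNIV. \<Sum>k\<in>UNIV. frame_h M S $ i $ k * theta i (dtheta k f) I S w)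
     - f I S (gact R (frame_h M S) w)
     - (1/2) * (\<Sum>i\<in>UNIV. \<Sum>j\<in>UNIV. \<Sum>k\<in>UNIV.
          pq_block M $ i $ j * theta j (theta k f) I S (gact R (mat_unit i k) w)))"
| "act_super R (Od y) f = (\<lambda>I S w.
     - (\<Sum>k\<in>UNIV. odd_shift y S $ k * dtheta k f I S w)
     - (1/2) * (\<Sum>j\<in>UNIV. \<Sum>k\<in>UNIV. p_part y $ j * theta j (theta k (dtheta k f)) I S w)
     - (\<Sum>k\<in>UNIV. theta k
          (\<lambda>I' S' w'. ddir (sym_outer (odd_shift y S') k) (\<lambda>S''. f I' S'' w') S') I S w)
     - (\<Sum>i\<in>UNIV. \<Sum>k\<in>UNIV. p_part y $ i * theta k f I S (gact R (mat_unit i k) w)))"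

text \<open>The two situations; \<open>body\<close> is the index of the component that is not multiplied by \<open>\<theta>\<close>s.\<close>

record ('i, 'n::finite, 'w) setting =
  alg :: "'n osp set"
  par :: "'n osp set"
  sact :: "('n, 'w) glmod \<Rightarrow> 'n osp \<Rightarrow> ('i, 'n, 'w) sect \<Rightarrow> ('i, 'n, 'w) sect"
  body :: 'i

definition classical :: "(unit, 'n::finite, 'w) setting" where
  "classical = \<lparr>alg = sp_alg, par = sp_par, sact = act_classical, body = ()\<rparr>"

definition super :: "('n set, 'n::{finite,linorder}, 'w) setting" where
  "super = \<lparr>alg = osp_alg, par = osp_par, sact = act_super, body = {}\<rparr>"


section \<open>Invariant differential operators dual to homomorphisms\<close>

text \<open>
  The pairing of the induced module with jets at \<open>o\<close>:
  \<open>\<langle>w, f\<rangle> = f(o)(w)\<close> and \<open>\<langle>X v, f\<rangle> = - (-1)^{|X||v|} \<langle>v, X f\<rangle>\<close>.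
\<close>

primrec jet_word ::
    "('i, 'n::finite, 'w) setting \<Rightarrow> ('n, 'w) glmod \<Rightarrow> 'n osp list
      \<Rightarrow> ('i, 'n, 'w) sect \<Rightarrow> 'w \<Rightarrow> complex" where
  "jet_word st R [] f w = f (body st) 0 w"
| "jet_word st R (X # u) f w =
     - (if is_odd X \<and> odd (length (filter is_odd u)) then - 1 else 1)
       * jet_word st R u (sact st R X f) w"

definition jet_pair ::
    "('i, 'n::finite, 'w) setting \<Rightarrow> ('n, 'w) glmod \<Rightarrow> ('n, 'w) tens
      \<Rightarrow> ('i, 'n, 'w) sect \<Rightarrow> complex" where
  "jet_pair st R x f = (\<Sum>k\<in>Poly_Mapping.keys x.
     Poly_Mapping.lookup x k * jet_word st R (fst k) f (snd k))"

definition jet_vanishes ::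
    "nat \<Rightarrow> 'n::finite mat \<Rightarrow> ('i, 'n, 'w) sect \<Rightarrow> bool" where
  "jet_vanishes r S f \<longleftrightarrow>
     (\<forall>j\<le>r. \<forall>B\<in>symm. \<forall>i w. (deriv ^^ j) (\<lambda>t. f i (S + mscale t B) w) 0 = 0)"

text \<open>
  A differential operator from sections of \<open>R\<close>-type to sections of \<open>R'\<close>-type on the big cell: a
  morphism of sheaves of vector spaces whose value at a point only depends on a jet of
  bounded order.
\<close>

definition diff_operator ::
    "('n::finite, 'w::ab_group_add) glmod \<Rightarrow> ('n, 'w) glmod
      \<Rightarrow> ('n mat set \<Rightarrow> ('i, 'n, 'w) sect \<Rightarrow> ('i, 'n, 'w) sect) \<Rightarrow> bool" where
  "diff_operator R R' D \<longleftrightarrow>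
     (\<forall>U\<in>opens symm. \<forall>f\<in>sections R U. D U f \<in> sections R' U) \<and>
     (\<forall>U\<in>opens symm. \<forall>f\<in>sections R U. \<forall>g\<in>sections R U.
        D U (\<lambda>i S w. f i S w + g i S w) = (\<lambda>i S w. D U f i S w + D U g i S w)) \<and>
     (\<forall>U\<in>opens symm. \<forall>f\<in>sections R U. \<forall>c. D U (\<lambda>i S w. c * f i S w) = (\<lambda>i S w. c * D U f i S w)) \<and>
     (\<forall>U\<in>opens symm. \<forall>V\<in>opens symm. \<forall>f\<in>sections R U. V \<subseteq> U \<longrightarrow>
        D V (restr R V f) = restr R' V (D U f)) \<and>
     (\<exists>r. \<forall>U\<in>opens symm. \<forall>f\<in>sections R U. \<forall>S\<in>U.
        jet_vanishes r S f \<longrightarrow> (\<forall>i w. D U f i S w = 0))"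

text \<open>
  \<open>D\<close> is the invariant differential operator whose action on jets at \<open>o\<close> is the transpose of
  the homomorphism \<open>\<phi>\<close> from the module induced from \<open>R'\<close> to the one induced from \<open>R\<close>.
\<close>

definition dual_operator ::
    "('i, 'n::finite, 'w::ab_group_add) setting \<Rightarrow> ('n, 'w) glmod \<Rightarrow> ('n, 'w) glmod
      \<Rightarrow> (('n, 'w) tens \<Rightarrow> ('n, 'w) tens)
      \<Rightarrow> ('n mat set \<Rightarrow> ('i, 'n, 'w) sect \<Rightarrow> ('i, 'n, 'w) sect) \<Rightarrow> bool" where
  "dual_operator st R R' \<phi> D \<longleftrightarrow>
     diff_operator R R' D \<and>
     (\<forall>X\<in>alg st. \<forall>U\<in>opens symm. \<forall>f\<in>sections R U.
        D U (restr R U (sact st R X f)) = restr R' U (sact st R' X (D U f))) \<and>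
     (\<forall>U\<in>opens symm. \<forall>f\<in>sections R U. 0 \<in> U \<longrightarrow>
        (\<forall>x\<in>ind_space (alg st) R'. jet_pair st R' x (D U f) = jet_pair st R (\<phi> x) f))"


section \<open>The dual complexes of sheaves\<close>

definition sheaf_term ::
    "'a set \<Rightarrow> ('a \<Rightarrow> ('n::finite, 'w::ab_group_add) glmod) \<Rightarrow> 'n mat set
      \<Rightarrow> ('a \<Rightarrow> ('i, 'n, 'w) sect) set" where
  "sheaf_term J R U = {g. (\<forall>\<alpha>\<in>J. g \<alpha> \<in> sections (R \<alpha>) U) \<and> (\<forall>\<alpha>. \<alpha> \<notin> J \<longrightarrow> g \<alpha> = (\<lambda>i S w. 0))}"

definition sheaf_restr ::
    "('a \<Rightarrow> ('n::finite, 'w) glmod) \<Rightarrow> 'n mat set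
      \<Rightarrow> ('a \<Rightarrow> ('i, 'n, 'w) sect) \<Rightarrow> 'a \<Rightarrow> ('i, 'n, 'w) sect" where
  "sheaf_restr R U g = (\<lambda>\<alpha>. restr (R \<alpha>) U (g \<alpha>))"

text \<open>\<open>D m \<alpha>' \<alpha>\<close> is the matrix entry of the differential from the summand \<open>\<alpha>'\<close> in degree \<open>m\<close> to the
  summand \<open>\<alpha>\<close> in degree \<open>m + 1\<close>.\<close>

definition sheaf_diff ::
    "(nat \<Rightarrow> 'a set) \<Rightarrow> (nat \<Rightarrow> 'a \<Rightarrow> 'a \<Rightarrow> 'n::finite mat set \<Rightarrow> ('i, 'n, 'w) sect \<Rightarrow> ('i, 'n, 'w) sect)
      \<Rightarrow> nat \<Rightarrow> 'n mat set \<Rightarrow> ('a \<Rightarrow> ('i, 'n, 'w) sect) \<Rightarrow> 'a \<Rightarrow> ('i, 'n, 'w) sect" where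
  "sheaf_diff I D m U g = (\<lambda>\<alpha> i S w.
     if \<alpha> \<in> I (Suc m) then \<Sum>\<alpha>'\<in>I m. D m \<alpha>' \<alpha> U (g \<alpha>') i S w else 0)"

definition dual_differentials ::
    "('i, 'n::finite, 'w::ab_group_add) setting \<Rightarrow> (nat \<Rightarrow> 'a set) \<Rightarrow> ('a \<Rightarrow> ('n, 'w) glmod)
      \<Rightarrow> (nat \<Rightarrow> 'a \<Rightarrow> 'a \<Rightarrow> ('n, 'w) tens \<Rightarrow> ('n, 'w) tens)
      \<Rightarrow> (nat \<Rightarrow> 'a \<Rightarrow> 'a \<Rightarrow> 'n mat set \<Rightarrow> ('i, 'n, 'w) sect \<Rightarrow> ('i, 'n, 'w) sect) \<Rightarrow> bool" where
  "dual_differentials st I R d D \<longleftrightarrow>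
     (\<forall>m. \<forall>\<alpha>\<in>I (Suc m). \<forall>\<alpha>'\<in>I m. dual_operator st (R \<alpha>') (R \<alpha>) (d m \<alpha> \<alpha>') (D m \<alpha>' \<alpha>))"

text \<open>Exactness of a sequence of sheaves \<open>\<F> \<rightarrow> \<G> \<rightarrow> \<H>\<close> at \<open>\<G>\<close>.\<close>

definition exact_sheaves ::
    "'x set set \<Rightarrow> ('x set \<Rightarrow> 's \<Rightarrow> 's) \<Rightarrow> 's \<Rightarrow> ('x set \<Rightarrow> 's set) \<Rightarrow> ('x set \<Rightarrow> 's \<Rightarrow> 's)
      \<Rightarrow> ('x set \<Rightarrow> 's set) \<Rightarrow> ('x set \<Rightarrow> 's \<Rightarrow> 's) \<Rightarrow> bool" where
  "exact_sheaves Ops res zero F a G b \<longleftrightarrow>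
     (\<forall>U\<in>Ops. \<forall>f\<in>F U. a U f \<in> G U \<and> b U (a U f) = zero) \<and>
     (\<forall>U\<in>Ops. \<forall>g\<in>G U. b U g = zero \<longrightarrow>
        (\<forall>x\<in>U. \<exists>V\<in>Ops. x \<in> V \<and> V \<subseteq> U \<and> (\<exists>f\<in>F V. a V f = res V g)))"

text \<open>The complex \<open>0 \<rightarrow> Ker \<rightarrow> L 0 \<rightarrow> L 1 \<rightarrow> \<dots>\<close> is exact, \<open>Ker\<close> being the sheaf kernel of the
  first differential.\<close>

definition right_resolution_of_kernel ::
    "'x set set \<Rightarrow> ('x set \<Rightarrow> 's \<Rightarrow> 's) \<Rightarrow> 's \<Rightarrow> (nat \<Rightarrow> 'x set \<Rightarrow> 's set)
      \<Rightarrow> (nat \<Rightarrow> 'x set \<Rightarrow> 's \<Rightarrow> 's) \<Rightarrow> bool" where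
  "right_resolution_of_kernel Ops res zero L D \<longleftrightarrow>
     (let Ker = (\<lambda>U. {f \<in> L 0 U. D 0 U f = zero}); incl = (\<lambda>U f. f) in
        exact_sheaves Ops res zero (\<lambda>U. {zero}) incl Ker incl \<and>
        exact_sheaves Ops res zero Ker incl (L 0) (D 0) \<and>
        (\<forall>m. exact_sheaves Ops res zero (L m) (D m) (L (Suc m)) (D (Suc m))))"

definition dual_complex_exact ::
    "'n::finite mat set \<Rightarrow> (nat \<Rightarrow> 'a set) \<Rightarrow> ('a \<Rightarrow> ('n, 'w::ab_group_add) glmod)
      \<Rightarrow> (nat \<Rightarrow> 'a \<Rightarrow> 'a \<Rightarrow> 'n mat set \<Rightarrow> ('i, 'n, 'w) sect \<Rightarrow> ('i, 'n, 'w) sect) \<Rightarrow> bool" where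
  "dual_complex_exact X I R D \<longleftrightarrow>
     right_resolution_of_kernel (opens X) (sheaf_restr R) (\<lambda>\<alpha> i S w. 0)
       (\<lambda>m. sheaf_term (I m) R) (sheaf_diff I D)"

end

theory Submission
 imports Defs "HOL-Computational_Algebra.Primes" "HOL-Library.Multiset" "HOL-Complex_Analysis.Complex_Analysis"
begin

text \<open>
 On the big cell the opposite nilradical acts by constant-coefficient vector fields. So the jet pairing
 kills the relations of the induced modules, invariant operators commute with translations, and it
 suffices to work at the origin. There a closed section gives a functional on the image of the
 differential of free modules over the enveloping algebra of the nilradical. Division by a Groebner
 basis extends it to the whole module with factorial growth, and a functional of factorial growth is
 the jet of a convergent power series.
\<close>

text \<open>Jets at \<open>o\<close> alone give only formal solutions. Convergence is the obstacle:
  an arbitrary linear extension from the boundaries would lose all control, so every functional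
  carries a bound \<open>C * R ^ n * n!\<close> on words of length \<open>n\<close>, the Cauchy
  bound for derivatives of order \<open>n\<close>.

  The action on sections is given by explicit formulas, and checking them on all brackets would be
  long. Only brackets with one factor in the opposite nilradical are computed. The defect of any
  other bracket relation vanishes at \<open>o\<close>; by the Jacobi identity so do its derivatives
  along the nilradical, and by the identity theorem it vanishes near \<open>o\<close>.

  No group acts on sections over the cell. Translations are exponentials of constant vector fields
  on Taylor polynomials, where the exponential is a finite sum; an operator of finite order sees no
  more than that.

  In the super case the odd generators act, up to sign, by
  \<open>D_l = d/d\<theta>_l + SUM_j \<theta>_j d_jl\<close>. A product of several of them reads off
  a component of a section only up to derivatives of smaller components; the elements
  \<open>tau I\<close> carry the corrections.\<close>

no_notation fps_nth (infixl "$" 75)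

declare split_paired_All [simp del] split_paired_Ex [simp del]

abbreviation "keys \<equiv> Poly_Mapping.keys"
abbreviation "lookup \<equiv> Poly_Mapping.lookup"
abbreviation "single \<equiv> Poly_Mapping.single"
abbreviation sum_UNIV (binder "SU " 10) where "sum_UNIV f \<equiv> sum f UNIV"

section \<open>Linear extension from a basis\<close>

text \<open>Functionals and maps on a free vector space are written through their values on basis
  elements, so that linearity and composition hold by construction.\<close>

definition lin_ext :: "('k => complex) => ('k \<Rightarrow>\<^sub>0 complex) => complex" where
 "lin_ext G x = (\<Sum>k\<in>keys x. lookup x k * G k)"

definition push :: "('k => ('l \<Rightarrow>\<^sub>0 complex)) => ('k \<Rightarrow>\<^sub>0 complex) => ('l \<Rightarrow>\<^sub>0 complex)" where
 "push h x = (\<Sum>k\<in>keys x. fscale (lookup x k) (h k))"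

lemma lin_ext_superset:
 assumes "finite K" "keys x <= K"
 shows "lin_ext G x = (\<Sum>k\<in>K. lookup x k * G k)"
 unfolding lin_ext_def using assms
 by(intro sum.mono_neutral_left) (auto simp: in_keys_iff)

lemma push_superset:
 assumes "finite K" "keys x <= K"
 shows "push h x = (\<Sum>k\<in>K. fscale (lookup x k) (h k))"
 unfolding push_def using assms
 by(intro sum.mono_neutral_left) (auto simp: in_keys_iff)

lemma lin_ext_add: "lin_ext G (x + y) = lin_ext G x + lin_ext G y"
proof -
 let ?K = "keys x \<union> keys y"
 have "keys (x + y) <= ?K" by(rule Poly_Mapping.keys_add)
 then show ?thesis
  by(simp add: lin_ext_superset[of ?K] lookup_add algebra_simps sum.distrib)
qed

lemma push_add: "push h (x + y) = push h x + push h y"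
proof -
 let ?K = "keys x \<union> keys y"
 have "keys (x + y) <= ?K" by(rule Poly_Mapping.keys_add)
 then show ?thesis
  by(simp add: push_superset[of ?K] lookup_add fs.scale_left_distrib sum.distrib)
qed

lemma keys_fscale: "keys (fscale c x) <= keys x"
 by(auto simp: in_keys_iff lookup_fscale)

lemma lin_ext_fscale: "lin_ext G (fscale c x) = c * lin_ext G x"
 using lin_ext_superset[OF finite_keys keys_fscale, of G c x]
 by(simp add: lookup_fscale lin_ext_def sum_distrib_left mult.assoc)

lemma push_fscale: "push h (fscale c x) = fscale c (push h x)"
 using push_superset[OF finite_keys keys_fscale, of h c x]
 by(simp add: lookup_fscale push_def fs.scale_sum_right)

lemma lin_ext_0 [simp]: "lin_ext G 0 = 0" by(simp add: lin_ext_def)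
lemma push_0 [simp]: "push h 0 = 0" by(simp add: push_def)

lemma lin_ext_diff: "lin_ext G (x - y) = lin_ext G x - lin_ext G y"
 using lin_ext_add[of G "x - y" y] by simp

lemma push_diff: "push h (x - y) = push h x - push h y"
 using push_add[of h "x - y" y] by simp

lemma lin_ext_sum: "lin_ext G (sum f A) = (\<Sum>a\<in>A. lin_ext G (f a))"
 by(induction A rule: infinite_finite_induct) (simp_all add: lin_ext_add)

lemma push_sum: "push h (sum f A) = (\<Sum>a\<in>A. push h (f a))"
 by(induction A rule: infinite_finite_induct) (simp_all add: push_add)

lemma lin_ext_single [simp]: "lin_ext G (single k c) = c * G k"
 by(cases "c = 0") (simp_all add: lin_ext_def)

lemma push_single [simp]: "push h (single k c) = fscale c (h k)"
 by(cases "c = 0") (simp_all add: push_def)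

lemma lin_ext_push: "lin_ext G (push h x) = lin_ext (\<lambda>k. lin_ext G (h k)) x"
 by(simp add: push_def lin_ext_sum lin_ext_fscale) (simp add: lin_ext_def)

lemma push_push: "push g (push h x) = push (\<lambda>k. push g (h k)) x"
 by(simp add: push_def[of h] push_sum push_fscale) (simp add: push_def)

lemma lin_ext_cong: "(!!k. k \<in> keys x ==> G k = G' k) ==> lin_ext G x = lin_ext G' x"
 by(simp add: lin_ext_def)

lemma push_cong: "(!!k. k \<in> keys x ==> h k = h' k) ==> push h x = push h' x"
 by(simp add: push_def)

lemma fscale_single: "fscale c (single k d) = single k (c * d)"
 by(rule poly_mapping_eqI) (simp add: lookup_fscale lookup_single when_def)

lemma push_single_id: "push (\<lambda>k. single k 1) x = x"
 by(rule poly_mapping_eqI)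
  (simp add: push_def fscale_single lookup_sum lookup_single when_def in_keys_iff)

lemma keys_push:
 assumes "!!k. k \<in> keys x ==> keys (h k) <= K"
 shows "keys (push h x) <= K"
proof -
 have "keys (push h x) <= (\<Union>k\<in>keys x. keys (fscale (lookup x k) (h k)))"
  unfolding push_def by(rule Poly_Mapping.keys_sum)
 also have "... <= K" using assms keys_fscale by fastforce
 finally show ?thesis .
qed

lemma push_in_subspace:
 assumes "fs.subspace V" "!!k. k \<in> keys x ==> h k \<in> V"
 shows "push h x \<in> V"
 unfolding push_def using assms by(intro fs.subspace_sum fs.subspace_scale)

section \<open>Dickson's lemma\<close>

text \<open>A monotone subsequence always exists; a decreasing one in the naturals is constant from
  its minimum on, and that tail is increasing as well.\<close>

lemma incseq_subseq_nat:
 fixes s :: "nat => nat"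
 obtains f :: "nat => nat" where "strict_mono f" "incseq (\<lambda>n. s (f n))"
proof -
 from seq_monosub[of s] obtain f where f: "strict_mono f" "monoseq (\<lambda>n. s (f n))" by blast
 show ?thesis
 proof (cases "incseq (\<lambda>n. s (f n))")
  case True
  then show ?thesis using f that by blast
 next
  case False
  then have dec: "decseq (\<lambda>n. s (f n))" using f(2) by(auto simp: monoseq_iff)
  obtain N where N: "!!n. s (f N) <= s (f n)"
   using ex_has_least_nat[of "\<lambda>_. True" 0 "\<lambda>n. s (f n)"] by auto
  have "s (f (N + n)) = s (f N)" for n
   using N[of "N + n"] dec by(simp add: decseq_def le_antisym)
  moreover have "strict_mono (\<lambda>n. f (N + n))" using f(1) by(simp add: strict_mono_def)
  ultimately show ?thesis using that[of "\<lambda>n. f (N + n)"] by(simp add: incseq_def)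
 qed
qed

text \<open>The subsequence is refined once for each of the finitely many variables, since an
  increasing coordinate stays increasing along a further subsequence. In the end all coordinates
  increase at once.\<close>

lemma dickson_seq:
 fixes f :: "nat => 'v::finite multiset"
 obtains i j where "i < j" "f i <=# f j"
proof -
 have "\<exists>r::nat => nat. strict_mono r & (\<forall>v\<in>A. incseq (\<lambda>n. count (f (r n)) v))" if "finite A" for A
  using that
 proof (induction A)
  case empty
  show ?case by(rule exI[of _ id]) (auto simp: strict_mono_def)
 next
  case (insert v A)
  then obtain r :: "nat => nat" where r: "strict_mono r" "!!v. v \<in> A ==> incseq (\<lambda>n. count (f (r n)) v)" by blast
  obtain g :: "nat => nat" where g: "strict_mono g" "incseq (\<lambda>n. count (f (r (g n))) v)"
   by(rule incseq_subseq_nat[of "\<lambda>n. count (f (r n)) v"])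
  have "incseq (\<lambda>n. count (f (r (g n))) u)" if "u \<in> A" for u
   using r(2)[OF that] strict_mono_mono[OF g(1)] by(auto simp: incseq_def monoD)
  then show ?case using r g by(intro exI[of _ "r \<circ> g"]) (auto simp: strict_mono_def)
 qed
 from this[of UNIV] obtain r :: "nat => nat" where r: "strict_mono r" "!!v. incseq (\<lambda>n. count (f (r n)) v)" by auto
 have "f (r 0) <=# f (r 1)" by(rule mset_subset_eqI) (use r(2) in \<open>simp add: incseq_def\<close>)
 moreover have "r 0 < r 1" using r(1) by(simp add: strict_mono_def)
 ultimately show ?thesis using that by blast
qed

text \<open>A pair \<open>(M, j)\<close> stands for the monomial \<open>M\<close> times the
  generator \<open>j\<close> of a free module over a polynomial ring, monomials being multisets of
  variables; \<open>kshift a\<close> is multiplication by the monomial \<open>a\<close>.\<close>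

definition kshift :: "'v multiset => 'v multiset \<times> 'j => 'v multiset \<times> 'j" where
 "kshift a k = (a + fst k, snd k)"

lemma fst_kshift [simp]: "fst (kshift a k) = a + fst k"
 and snd_kshift [simp]: "snd (kshift a k) = snd k"
 by(simp_all add: kshift_def)

lemma kshift_eq_iff [simp]: "kshift a k = kshift a k' \<longleftrightarrow> k = k'"
 by(auto simp: kshift_def prod_eq_iff)

text \<open>\<open>L0\<close> collects the elements that are minimal under divisibility. If there
  were infinitely many, infinitely many would share a generator, and Dickson's lemma would make one
  divide another.\<close>

lemma dickson_basis:
 fixes L :: "('v::finite multiset \<times> 'j) set"
 assumes J: "finite J" and L: "L <= UNIV \<times> J"
 obtains L0 where "finite L0" "L0 <= L" "!!k. k \<in> L ==> \<exists>a. \<exists>k0\<in>L0. k = kshift a k0"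
proof -
 define L0 where "L0 = {k\<in>L. \<forall>k'\<in>L. snd k' = snd k & fst k' <=# fst k --> k' = k}"
 have "\<exists>a. \<exists>k0\<in>L0. k = kshift a k0" if "k \<in> L" for k
  using that
 proof (induction "size (fst k)" arbitrary: k rule: less_induct)
  case less
  show ?case
  proof (cases "k \<in> L0")
   case True
   then show ?thesis by(intro exI[of _ "{#}"] bexI[of _ k]) (simp_all add: kshift_def)
  next
   case False
   then obtain k' where k': "k' \<in> L" "snd k' = snd k" "fst k' <=# fst k" "k' \<noteq> k"
    using less.prems by(auto simp: L0_def)
   then have "fst k' \<subset># fst k" by(auto simp: prod_eq_iff subset_mset.order_iff_strict)
   then have "size (fst k') < size (fst k)" by(rule mset_subset_size)
   from less.hyps[OF this k'(1)] obtain a k0 where "k0 \<in> L0" "k' = kshift a k0" by blast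
   moreover obtain b where "fst k = fst k' + b" using k'(3) using mset_subset_eq_exists_conv by blast
   ultimately have "k = kshift (a + b) k0"
    using k'(2) by(simp add: kshift_def prod_eq_iff ac_simps)
   then show ?thesis using \<open>k0 \<in> L0\<close> by blast
  qed
 qed
 moreover have "finite L0"
 proof (rule ccontr)
  assume inf: "infinite L0"
  have "snd k \<in> J" if "k \<in> L0" for k
   using that L by(auto simp: L0_def mem_Times_iff dest!: subsetD simp del: split_paired_All)
  then have "L0 <= (\<Union>j\<in>J. {k\<in>L0. snd k = j})" by blast
  then have "infinite (\<Union>j\<in>J. {k\<in>L0. snd k = j})" using inf finite_subset by blast
  then obtain j where "infinite {k\<in>L0. snd k = j}" using J by blast
  then obtain f :: "nat => _" where f: "inj f" "range f <= {k\<in>L0. snd k = j}"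
   using infinite_countable_subset by blast
  obtain i i' where i: "i < i'" "fst (f i) <=# fst (f i')" by(rule dickson_seq[of "\<lambda>n. fst (f n)"])
  have fL: "f n \<in> L0" "snd (f n) = j" for n using f(2) by blast+
  have "f i \<in> L0" "f i' \<in> L0" "snd (f i) = snd (f i')" using fL by simp_all
  then have "f i = f i'" using i unfolding L0_def by blast
  then show False using f(1) i(1) by(auto simp: inj_eq)
 qed
 ultimately show ?thesis using that[of L0] unfolding L0_def by blast
qed

section \<open>A monomial order refining the degree\<close>

text \<open>Distinct primes are assigned to the variables and to the generators, so that a monomial
  becomes a number and unique factorization separates monomials. Degree is compared first, this
  number second; only finitely many monomials precede a given one, and counting them yields the rank
  \<open>r\<close>. The logarithm \<open>lv\<close> of the number is additive under shifts and at
  most linear in the degree, which the growth estimate needs besides the order itself.\<close>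

lemma monomial_order:
 fixes J :: "'j set"
 assumes J: "finite J"
 obtains r :: "'v::finite multiset \<times> 'j => nat" and lv :: "'v multiset \<times> 'j => real"
  and la :: "'v multiset => real" and c :: real
 where "inj_on r (UNIV \<times> J)"
  and "!!k k' a. k \<in> UNIV \<times> J ==> k' \<in> UNIV \<times> J ==> r k < r k' ==> r (kshift a k) < r (kshift a k')"
  and "!!k k'. k \<in> UNIV \<times> J ==> k' \<in> UNIV \<times> J ==> r k < r k' ==>
   size (fst k) < size (fst k') \<or> (size (fst k) = size (fst k') & lv k < lv k')"
  and "!!a k. k \<in> UNIV \<times> J ==> lv (kshift a k) = la a + lv k"
  and "!!a. la a >= 0" "!!k. lv k >= 0"
  and "!!k. k \<in> UNIV \<times> J ==> lv k <= c * (size (fst k) + 1)" "c >= 0"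
proof -
 define e where "e = enumerate {p::nat. prime p}"
 have pe: "prime (e i)" for i
  using enumerate_in_set[OF primes_infinite, of i] by(simp add: e_def)
 have inje: "inj e"
  unfolding e_def using strict_mono_enumerate[OF primes_infinite] by(rule strict_mono_imp_inj_on)
 obtain h :: "'v => nat" where h: "inj h"
  using finite_imp_inj_to_nat_seg[of "UNIV :: 'v set"] by auto
 obtain h' :: "'j => nat" where h': "inj_on h' J"
  using finite_imp_inj_to_nat_seg[OF J] by auto
 \<comment> \<open>Even positions of the enumeration serve the variables and odd ones the
   generators, which keeps the two families of primes disjoint.\<close>
 define p where "p v = e (2 * h v)" for v
 define q where "q i = e (2 * h' i + 1)" for i
 have pp: "prime (p v)" and qp: "prime (q i)" for v i by(simp_all add: p_def q_def pe)
 have injp: "inj p" by(rule injI) (simp add: p_def inj_eq[OF inje] inj_eq[OF h])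
 have injq: "q i = q j ==> i \<in> J ==> j \<in> J ==> i = j" for i j
  by(simp add: q_def inj_eq[OF inje] inj_on_eq_iff[OF h'])
 have pq: "p v \<noteq> q i" for v i
 proof
  assume "p v = q i"
  then have "2 * h v = 2 * h' i + 1" using inje by(auto simp: inj_def p_def q_def)
  then show False by presburger
 qed
 define V where "V a = prod_mset (image_mset p a)" for a
 define val where "val k = V (fst k) * q (snd k)" for k :: "'v multiset \<times> 'j"
 have Vpos: "V a >= 1" for a
  unfolding V_def by(induction a) (use pp in \<open>auto simp: Suc_le_eq prime_gt_0_nat\<close>)
 have valpos: "val k >= 1" for k
  using Vpos[of "fst k"] qp[of "snd k"] by(auto simp: val_def Suc_le_eq prime_gt_0_nat)
 have valshift: "val (kshift a k) = V a * val k" for a k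
  by(simp add: val_def V_def)
 have pf: "prime_factorization (val k) = image_mset p (fst k) + {#q (snd k)#}" for k
 proof -
  have "val k = prod_mset (image_mset p (fst k) + {#q (snd k)#})"
   by(simp add: val_def V_def)
  then show ?thesis
   by(simp only:) (rule prime_factorization_prod_mset_primes, use pp qp in auto)
 qed
 have valinj: "k = k'" if "val k = val k'" "k \<in> UNIV \<times> J" "k' \<in> UNIV \<times> J" for k k'
 proof -
  have eq: "image_mset p (fst k) + {#q (snd k)#} = image_mset p (fst k') + {#q (snd k')#}"
   using pf[of k] pf[of k'] that(1) by simp
  then have "q (snd k) \<in># image_mset p (fst k') + {#q (snd k')#}" by(metis add_mset_add_single union_single_eq_member)
  then have "q (snd k) = q (snd k')" using pq[symmetric] by(auto simp: pq)
  then have "snd k = snd k'" using injq that by(auto simp: mem_Times_iff)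
  moreover have "image_mset p (fst k) = image_mset p (fst k')" using eq \<open>q (snd k) = q (snd k')\<close> by simp
  then have "fst k = fst k'" by(simp add: inj_eq[OF multiset.inj_map[OF injp]])
  ultimately show ?thesis by(simp add: prod_eq_iff)
 qed
 define prec where "prec k k' \<longleftrightarrow> size (fst k) < size (fst k') \<or>
  (size (fst k) = size (fst k') & val k < val k')" for k k' :: "'v multiset \<times> 'j"
 define r where "r k = card {k' \<in> UNIV \<times> J. prec k' k}" for k
 have fin: "finite {k' \<in> UNIV \<times> J. prec k' k}" for k
 proof -
  have "finite (mset ` {xs :: 'v list. set xs <= UNIV & length xs <= size (fst k)})"
   by(rule finite_imageI[OF finite_lists_length_le]) simp
  moreover have "{a :: 'v multiset. size a <= size (fst k)} <= mset ` {xs. set xs <= UNIV & length xs <= size (fst k)}"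
  proof
   fix a :: "'v multiset" assume "a \<in> {a. size a <= size (fst k)}"
   moreover obtain xs where "mset xs = a" using ex_mset by blast
   ultimately show "a \<in> mset ` {xs. set xs <= UNIV & length xs <= size (fst k)}" by(auto simp: image_iff)
  qed
  ultimately have "finite ({a :: 'v multiset. size a <= size (fst k)} \<times> J)"
   using J finite_subset by blast
  then show ?thesis by(rule finite_subset[rotated]) (auto simp: prec_def)
 qed
 have mono: "r k < r k'" if "prec k k'" "k \<in> UNIV \<times> J" for k k'
  unfolding r_def by(rule psubset_card_mono[OF fin]) (use that in \<open>auto simp: prec_def\<close>)
 have total: "prec k k' \<or> prec k' k" if "k \<in> UNIV \<times> J" "k' \<in> UNIV \<times> J" "k \<noteq> k'" for k k'
  unfolding prec_def using valinj[OF _ that(1,2)] that(3) by(metis nat_neq_iff)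
 have iff: "prec k k'" if "r k < r k'" "k \<in> UNIV \<times> J" "k' \<in> UNIV \<times> J" for k k'
  using total[OF that(2,3)] mono[OF _ that(3)] that(1) by(metis less_asym less_irrefl)
 \<comment> \<open>A common bound of all primes in use; it gives
   \<open>val k <= B ^ (degree + 1)\<close>, the extra factor coming from the generator.\<close>
 define B where "B = Max (insert 1 (range p \<union> q ` J))"
 have finB: "finite (insert 1 (range p \<union> q ` J))" using J by simp
 have B: "p v <= B" "i \<in> J ==> q i <= B" "1 <= B" for v i
  unfolding B_def by(rule Max_ge[OF finB], simp)+
 have VB: "V a <= B ^ size a" for a
  unfolding V_def by(induction a) (auto intro: mult_le_mono B)
 have valB: "val k <= B ^ (size (fst k) + 1)" if "k \<in> UNIV \<times> J" for k
 proof -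
  have "snd k \<in> J" using that by(simp add: mem_Times_iff)
  then have "V (fst k) * q (snd k) <= B ^ size (fst k) * B" by(intro mult_le_mono VB B(2))
  then show ?thesis by(simp add: val_def mult.commute)
 qed
 show ?thesis
 proof (rule that[of r "\<lambda>k. ln (real (val k))" "\<lambda>a. ln (real (V a))" "ln (real B)"])
  show "inj_on r (UNIV \<times> J)"
   by(intro inj_onI) (metis total mono less_irrefl)
  show "r (kshift a k) < r (kshift a k')" if "k \<in> UNIV \<times> J" "k' \<in> UNIV \<times> J" "r k < r k'" for k k' a
  proof (rule mono)
   have "V a * val k < V a * val k'" if "val k < val k'" using that Vpos[of a] by simp
   then show "prec (kshift a k) (kshift a k')"
    using iff[OF that(3,1,2)] Vpos[of a] by(simp add: prec_def valshift)
  qed (use that in \<open>simp add: mem_Times_iff\<close>)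
  show "size (fst k) < size (fst k') \<or> (size (fst k) = size (fst k') & ln (real (val k)) < ln (real (val k')))"
   if "k \<in> UNIV \<times> J" "k' \<in> UNIV \<times> J" "r k < r k'" for k k'
   using iff[OF that(3,1,2)] valpos[of k] valpos[of k'] by(simp add: prec_def)
  show "ln (real (val (kshift a k))) = ln (real (V a)) + ln (real (val k))" for a k
   using Vpos[of a] valpos[of k] by(simp add: valshift ln_mult)
  show "ln (real (V a)) >= 0" for a using Vpos[of a] by simp
  show "ln (real (val k)) >= 0" for k using valpos[of k] by simp
  show "ln (real (val k)) <= ln (real B) * (size (fst k) + 1)" if "k \<in> UNIV \<times> J" for k
  proof -
   have "real (val k) <= real (B ^ (size (fst k) + 1))" using valB[OF that] by(simp only: of_nat_le_iff)
   moreover have "0 < real (val k)" using valpos[of k] by simp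
   ultimately have "ln (real (val k)) <= ln (real (B ^ (size (fst k) + 1)))" by(metis ln_mono)
   also have "... = ln (real B) * (size (fst k) + 1)"
    using B(3) by(simp only: of_nat_power ln_realpow mult.commute)
   finally show ?thesis .
  qed
  show "ln (real B) >= 0" using B(3) by simp
 qed
qed

section \<open>Extension of functionals with factorial growth\<close>

definition shift :: "'v multiset => (('v multiset \<times> 'j) \<Rightarrow>\<^sub>0 complex) => (('v multiset \<times> 'j) \<Rightarrow>\<^sub>0 complex)" where
 "shift a = push (\<lambda>k. single (kshift a k) 1)"

lemma lookup_shift: "lookup (shift a x) (kshift a k) = lookup x k"
 by(simp add: shift_def push_def fscale_single lookup_sum lookup_single when_def in_keys_iff)

lemma keys_shift: "keys (shift a x) = kshift a ` keys x"
proof (intro antisym subsetI)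
 show "k \<in> kshift a ` keys x" if "k \<in> keys (shift a x)" for k
  using that keys_push[of x "\<lambda>k. single (kshift a k) 1" "kshift a ` keys x"]
  unfolding shift_def by(auto split: if_splits)
 show "k \<in> keys (shift a x)" if "k \<in> kshift a ` keys x" for k
  using that by(auto simp: in_keys_iff lookup_shift)
qed

lemma lin_ext_shift: "lin_ext G (shift a x) = lin_ext (\<lambda>k. G (kshift a k)) x"
 by(simp add: shift_def lin_ext_push)

text \<open>The Cauchy bound for derivatives of order \<open>n\<close> at a point of holomorphy, and
  conversely the growth under which a Taylor series converges near the point. Suffixes, finite sums
  and division only change \<open>C\<close> and \<open>R\<close>.\<close>

abbreviation fb :: "real => real => nat => real" where "fb C R n \<equiv> C * R ^ n * fact n"

text \<open>
 Division with remainder by a Groebner basis. The order refines the degree, so a reduction step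
 does not raise the degree, and for suitable exponential weights it shrinks the reduced part by a
 factor \<open>1/2\<close>.
\<close>

theorem extension_with_bounds:
 fixes N :: "(('v::finite multiset \<times> 'j) \<Rightarrow>\<^sub>0 complex) set" and \<nu> :: "_ => complex"
 assumes J: "finite J"
  and keysN: "!!x. x \<in> N ==> keys x <= UNIV \<times> J"
  and subN: "fs.subspace N"
  and shiftN: "!!x a. x \<in> N ==> shift a x \<in> N"
  and \<nu>_add: "!!x y. x \<in> N ==> y \<in> N ==> \<nu> (x + y) = \<nu> x + \<nu> y"
  and \<nu>_scale: "!!c x. x \<in> N ==> \<nu> (fscale c x) = c * \<nu> x"
  and \<nu>_bound: "!!x. x \<in> N ==> \<exists>C R. \<forall>a. norm (\<nu> (shift a x)) <= fb C R (size a)"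
 obtains G :: "'v multiset \<times> 'j => complex" and C R :: real
  where "!!x. x \<in> N ==> \<nu> x = lin_ext G x"
   and "!!k. norm (G k) <= fb C R (size (fst k))"
   and "C >= 0" "R >= 0"
proof -
 obtain r :: "'v::finite multiset \<times> 'j => nat" and lv :: "'v multiset \<times> 'j => real"
  and la :: "'v multiset => real" and c :: real
 where r_inj: "inj_on r (UNIV \<times> J)"
  and r_shift: "!!k k' a. k \<in> UNIV \<times> J ==> k' \<in> UNIV \<times> J ==> r k < r k' ==> r (kshift a k) < r (kshift a k')"
  and r_less: "!!k k'. k \<in> UNIV \<times> J ==> k' \<in> UNIV \<times> J ==> r k < r k' ==>
   size (fst k) < size (fst k') \<or> (size (fst k) = size (fst k') & lv k < lv k')"
  and lv_shift: "!!a k. k \<in> UNIV \<times> J ==> lv (kshift a k) = la a + lv k"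
  and la_nn: "!!a. la a >= 0" and lv_nn: "!!k. lv k >= 0"
  and lv_le: "!!k. k \<in> UNIV \<times> J ==> lv k <= c * (size (fst k) + 1)" and c_nn: "c >= 0"
  by(rule monomial_order[OF J, where ?'v = 'v]) (rule that)
 define ld where "ld x = (SOME k. k \<in> keys x & (\<forall>k'\<in>keys x. r k' <= r k))"
  for x :: "('v multiset \<times> 'j) \<Rightarrow>\<^sub>0 complex"
 have ld: "ld x \<in> keys x & (\<forall>k'\<in>keys x. r k' <= r (ld x))" if "x \<noteq> 0" for x
  unfolding ld_def
 proof (rule someI_ex)
  have "Max (r ` keys x) \<in> r ` keys x" using that by(intro Max_in) auto
  then obtain k where "k \<in> keys x" "r k = Max (r ` keys x)" by auto
  then show "\<exists>k. k \<in> keys x & (\<forall>k'\<in>keys x. r k' <= r k)" by auto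
 qed
 have ld_in: "ld x \<in> keys x" if "x \<noteq> 0" for x using ld[OF that] by simp
 have ld_max: "r k < r (ld x) \<or> k = ld x" if "x \<in> N" "k \<in> keys x" for x k
 proof -
  have "x \<noteq> 0" using that(2) by auto
  then have "r k <= r (ld x)"
   using ld that(2) by blast
  moreover have "k \<in> UNIV \<times> J" "ld x \<in> UNIV \<times> J" using keysN[OF that(1)] that(2) ld_in[OF \<open>x \<noteq> 0\<close>] by auto
  ultimately show ?thesis using r_inj by(metis inj_on_eq_iff le_neq_implies_less)
 qed
 define L where "L = {ld x | x. x \<in> N & x \<noteq> 0}"
 have LJ: "L <= UNIV \<times> J" using ld_in keysN by(fastforce simp: L_def)
 obtain L0 where L0: "finite L0" "L0 <= L" "!!k. k \<in> L ==> \<exists>a. \<exists>k0\<in>L0. k = kshift a k0"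
  using dickson_basis[OF J LJ] by blast
 \<comment> \<open>Elements of \<open>N\<close> with the finitely many minimal leading monomials,
   normalized to leading coefficient 1: a Groebner basis of \<open>N\<close>.\<close>
 have "\<exists>x\<in>N. ld x = k0 & k0 \<in> keys x & lookup x k0 = 1" if k0: "k0 \<in> L0" for k0
 proof -
  obtain x where x: "x \<in> N" "x \<noteq> 0" "ld x = k0" using subsetD[OF L0(2) k0] by(auto simp: L_def)
  let ?l = "lookup x k0"
  have l: "?l \<noteq> 0" using ld_in[OF x(2)] x(3) by(simp add: in_keys_iff)
  have ks: "keys (fscale (1 / ?l) x) = keys x"
   using l by(auto simp: in_keys_iff lookup_fscale)
  show ?thesis
   using l x fs.subspace_scale[OF subN x(1), of "1 / ?l"] ld_in[OF x(2)]
   by(intro bexI[of _ "fscale (1 / ?l) x"]) (simp_all add: lookup_fscale ld_def ks)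
 qed
 then obtain g where g: "!!k0. k0 \<in> L0 ==> g k0 \<in> N" "!!k0. k0 \<in> L0 ==> ld (g k0) = k0"
   "!!k0. k0 \<in> L0 ==> k0 \<in> keys (g k0)" "!!k0. k0 \<in> L0 ==> lookup (g k0) k0 = 1"
  by metis
 define tl where "tl k0 = keys (g k0) - {k0}" for k0
 have tl: "t \<in> UNIV \<times> J" "r t < r k0" if "k0 \<in> L0" "t \<in> tl k0" for k0 t
  using ld_max[OF g(1)[OF that(1)], of t] keysN[OF g(1)[OF that(1)]] that g(2)[OF that(1)] by(auto simp: tl_def)
 have L0J: "k0 \<in> UNIV \<times> J" if "k0 \<in> L0" for k0 using that L0(2) LJ by blast
 \<comment> \<open>The monomials divisible by the leading monomial of a basis element. On the
   remaining, standard monomials the extension is set to 0.\<close>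
 define D where "D = {k. \<exists>a. \<exists>k0\<in>L0. k = kshift a k0}"
 have "\<forall>k\<in>D. \<exists>a c. c \<in> L0 & k = kshift a c" by(auto simp: D_def)
 then obtain b0 c0 where bc: "!!k. k \<in> D ==> c0 k \<in> L0 & k = kshift (b0 k) (c0 k)"
  by metis
 \<comment> \<open>The value at \<open>k\<close> is forced by asking for agreement with
   \<open>\<nu>\<close> on the shifted basis element with leading monomial \<open>k\<close>. Its
   tail has smaller rank, so the recursion is well founded.\<close>
 define H where "H F k = (if k \<in> D then \<nu> (shift (b0 k) (g (c0 k)))
   - (\<Sum>t\<in>tl (c0 k). lookup (g (c0 k)) t * F (kshift (b0 k) t)) else 0)" for F k
 define G where "G = wfrec (inv_image less_than r) H"
 have G: "G k = H G k" for k
 proof -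
  have "G k = H (cut G (inv_image less_than r) k) k"
   by(rule def_wfrec[OF G_def[THEN eq_reflection] wf_inv_image[OF wf_less_than]])
  also have "... = H G k"
  proof (cases "k \<in> D")
   case True
   have "r (kshift (b0 k) t) < r k" if "t \<in> tl (c0 k)" for t
    using r_shift[OF tl(1)[OF _ that] L0J tl(2)[OF _ that], of "b0 k"] bc[OF True] by metis
   then show ?thesis using True by(auto simp: H_def cut_def intro!: sum.cong)
  qed (simp add: H_def)
  finally show ?thesis .
 qed
 have DJ: "k \<in> UNIV \<times> J" if "k \<in> D" for k
  using L0J[of "c0 k"] bc[OF that] by(metis mem_Times_iff UNIV_I snd_kshift)
 \<comment> \<open>Subtracting a multiple of one shifted basis element kills the leading term and
   lowers the rank. Ranks are shifted by one in the measure so that 0 is left for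
   \<open>x = 0\<close>.\<close>
 have G_eq: "\<nu> x = lin_ext G x" if "x \<in> N" for x
  using that
 proof (induction "if x = 0 then 0 else Suc (r (ld x))" arbitrary: x rule: less_induct)
  case less
  show ?case
  proof (cases "x = 0")
   case True
   then show ?thesis using \<nu>_scale[OF less.prems, of 0] by simp
  next
   case False
   define k where "k = ld x"
   have kD: "k \<in> D" using less.prems False L0(3)[of k] by(auto simp: k_def L_def D_def)
   define c b where "c = c0 k" and "b = b0 k"
   have cb: "c \<in> L0" "kshift b c = k" using bc[OF kD] by(simp_all add: c_def b_def)
   define z where "z = shift b (g c)"
   define l where "l = lookup x k"
   define y where "y = x - fscale l z"
   have z: "z \<in> N" unfolding z_def by(intro shiftN g cb)
   have lz: "fscale l z \<in> N" by(rule fs.subspace_scale[OF subN z])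
   have y: "y \<in> N" unfolding y_def by(rule fs.subspace_diff[OF subN less.prems lz])
   have zk: "lookup z k = 1"
    using lookup_shift[of b "g c" c] g(4)[OF cb(1)] cb(2) by(simp add: z_def)
   have keysz: "r t < r k" if tz: "t \<in> keys z" "t \<noteq> k" for t
   proof -
    obtain s where s: "s \<in> keys (g c)" "t = kshift b s"
     using tz(1) unfolding z_def keys_shift by blast
    then have "s \<in> tl c" using that(2) cb(2) by(auto simp: tl_def)
    from r_shift[OF tl(1)[OF cb(1) this] L0J[OF cb(1)] tl(2)[OF cb(1) this], of b]
    show ?thesis using s(2) cb(2) by simp
   qed
   have keysy: "r t < r k" if "t \<in> keys y" for t
   proof -
    have "t \<noteq> k" using that by(auto simp: y_def l_def in_keys_iff lookup_minus lookup_fscale zk)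
    moreover have "t \<in> keys x \<or> t \<in> keys z"
     using that by(auto simp: y_def in_keys_iff lookup_minus lookup_fscale)
    ultimately show ?thesis using ld_max[OF less.prems, of t] keysz[of t] by(auto simp: k_def)
   qed
   have "(if y = 0 then 0 else Suc (r (ld y))) < (if x = 0 then 0 else Suc (r (ld x)))"
    using False keysy[OF ld_in[of y]] by(simp add: k_def)
   from less.hyps[OF this y] have 1: "\<nu> y = lin_ext G y" .
   have "lin_ext G z = (\<Sum>t\<in>keys (g c). lookup (g c) t * G (kshift b t))"
    by(simp add: z_def lin_ext_shift) (simp add: lin_ext_def)
   also have "... = G k + (\<Sum>t\<in>tl c. lookup (g c) t * G (kshift b t))"
    using g(3,4)[OF cb(1)] cb(2) by(simp add: tl_def sum.remove[of _ c])
   also have "... = \<nu> z"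
    using G[of k] kD by(simp add: H_def z_def c_def b_def)
   finally have 2: "\<nu> z = lin_ext G z" by simp
   have "x = y + fscale l z" by(simp add: y_def)
   then show ?thesis
    using \<nu>_add[OF y lz] \<nu>_scale[OF z, of l] 1 2 by(simp add: lin_ext_add lin_ext_fscale)
  qed
 qed
 \<comment> \<open>Constants uniform over the finite basis; \<open>R1 >= 1\<close> makes
   \<open>ln R1\<close> nonnegative.\<close>
 obtain C1 R1 :: real where CR1: "C1 >= 0" "R1 >= 1"
  "!!k0 a. k0 \<in> L0 ==> norm (\<nu> (shift a (g k0))) <= fb C1 R1 (size a)"
 proof -
  have "\<forall>k0\<in>L0. \<exists>C R. \<forall>a. norm (\<nu> (shift a (g k0))) <= fb C R (size a)"
   using \<nu>_bound g(1) by blast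
  then obtain Cf Rf :: "_ => real"
   where CR: "!!k0 a. k0 \<in> L0 ==> norm (\<nu> (shift a (g k0))) <= Cf k0 * Rf k0 ^ size a * fact (size a)"
   by metis
  define C1 R1 where "C1 = (\<Sum>k0\<in>L0. \<bar>Cf k0\<bar>)" and "R1 = 1 + (\<Sum>k0\<in>L0. \<bar>Rf k0\<bar>)"
  show ?thesis
  proof (rule that[of C1 R1])
   show "C1 >= 0" "R1 >= 1" by(simp_all add: C1_def R1_def sum_nonneg)
   fix k0 and a :: "'v multiset" assume k0: "k0 \<in> L0"
   have c: "\<bar>Cf k0\<bar> <= C1" unfolding C1_def using k0 L0(1) by(intro member_le_sum) auto
   have "\<bar>Rf k0\<bar> <= (\<Sum>k0\<in>L0. \<bar>Rf k0\<bar>)" using k0 L0(1) by(intro member_le_sum) auto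
   then have rr: "\<bar>Rf k0\<bar> <= R1" by(simp add: R1_def)
   have "Cf k0 * Rf k0 ^ size a <= \<bar>Cf k0\<bar> * \<bar>Rf k0\<bar> ^ size a"
    using abs_ge_self[of "Cf k0 * Rf k0 ^ size a"] by(simp add: abs_mult power_abs)
   also have "... <= C1 * R1 ^ size a"
    using c rr by(intro mult_mono power_mono) auto
   finally have "Cf k0 * Rf k0 ^ size a * fact (size a) <= fb C1 R1 (size a)"
    by(intro mult_right_mono) auto
   then show "norm (\<nu> (shift a (g k0))) <= fb C1 R1 (size a)"
    using CR[OF k0, of a] by linarith
  qed
 qed
 define A where "A = 1 + (\<Sum>k0\<in>L0. \<Sum>t\<in>tl k0. norm (lookup (g k0) t))"
 have fin_tl: "finite (tl k0)" for k0 by(simp add: tl_def)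
 have A1: "A >= 1" by(simp add: A_def sum_nonneg)
 have A: "(\<Sum>t\<in>tl k0. norm (lookup (g k0) t)) <= A" if "k0 \<in> L0" for k0
 proof -
  have "(\<Sum>t\<in>tl k0. norm (lookup (g k0) t))
    <= (\<Sum>k0\<in>L0. \<Sum>t\<in>tl k0. norm (lookup (g k0) t))"
   using that L0(1) by(intro member_le_sum) (auto intro: sum_nonneg)
  then show ?thesis by(simp add: A_def)
 qed
 \<comment> \<open>\<open>M\<close> exceeds \<open>lv\<close> on all tails, so in the weight
   \<open>W\<close> below the loss of one degree outweighs any gain in \<open>lv\<close>. Hence
   \<open>W\<close> drops strictly from a leading monomial to its tail, and by finiteness it drops
   by at least a uniform \<open>\<delta>\<close>.\<close>
 define M where "M = 1 + (\<Sum>k0\<in>L0. \<Sum>t\<in>tl k0. lv t)"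
 have M1: "M >= 1" by(simp add: M_def sum_nonneg lv_nn)
 have M: "lv t < M" if "k0 \<in> L0" "t \<in> tl k0" for k0 t
 proof -
  have "lv t <= (\<Sum>t\<in>tl k0. lv t)"
   using that fin_tl by(intro member_le_sum) (auto simp: lv_nn)
  also have "... <= (\<Sum>k0\<in>L0. \<Sum>t\<in>tl k0. lv t)"
   using that L0(1) by(intro member_le_sum) (auto intro: sum_nonneg simp: lv_nn)
  finally show ?thesis by(simp add: M_def)
 qed
 define W where "W k = M * size (fst k) + lv k" for k
 have W_less: "W t < W k0" "size (fst t) <= size (fst k0)" if "k0 \<in> L0" "t \<in> tl k0" for k0 t
 proof -
  note r = r_less[OF tl(1)[OF that] L0J[OF that(1)] tl(2)[OF that]]
  then show "size (fst t) <= size (fst k0)" by auto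
  show "W t < W k0"
  proof (cases "size (fst t) < size (fst k0)")
   case True
   then have "M * (size (fst t) + 1) <= M * size (fst k0)" using M1 by(intro mult_left_mono) auto
   then show ?thesis using M[OF that] lv_nn[of k0] by(simp add: W_def algebra_simps)
  next
   case False
   then show ?thesis using r by(simp add: W_def)
  qed
 qed
 obtain \<delta> where \<delta>: "\<delta> > 0" "!!k0 t. k0 \<in> L0 ==> t \<in> tl k0 ==> W t + \<delta> <= W k0"
 proof -
  define T where "T = insert 1 ((\<lambda>(k0, t). W k0 - W t) ` (SIGMA k0:L0. tl k0))"
  have T: "finite T" "T \<noteq> {}" unfolding T_def using L0(1) fin_tl by auto
  show ?thesis
  proof (rule that[of "Min T"])
   have "\<forall>x\<in>T. x > 0" unfolding T_def using W_less(1) by auto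
   then show "Min T > 0" using T by simp
   show "W t + Min T <= W k0" if "k0 \<in> L0" "t \<in> tl k0" for k0 t
   proof -
    have "W k0 - W t \<in> T" unfolding T_def using that by force
    then have "Min T <= W k0 - W t" using T(1) by simp
    then show ?thesis by simp
   qed
  qed
 qed
 \<comment> \<open>The first summand makes the weighted tail contribute at most half of its bound,
   \<open>A\<close> being a bound for the sum of tail coefficients; the second lets the weight
   absorb the rate \<open>R1\<close> of \<open>\<nu>\<close>.\<close>
 define la' where "la' = ln (2 * A) / \<delta> + ln R1"
 have la'0: "la' >= 0" using A1 \<delta>(1) CR1(2) by(simp add: la'_def)
 have la'1: "A * exp (- (la' * \<delta>)) <= 1 / 2"
 proof -
  have "ln (2 * A) <= la' * \<delta>" using \<delta>(1) CR1(2) by(simp add: la'_def distrib_right)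
  then have "exp (- (la' * \<delta>)) <= exp (- ln (2 * A))" by simp
  also have "... = 1 / (2 * A)" using A1 by(simp add: exp_minus inverse_eq_divide)
  finally have "A * exp (- (la' * \<delta>)) <= A * (1 / (2 * A))" using A1 by(intro mult_left_mono) auto
  then show ?thesis using A1 by simp
 qed
 have la'2: "R1 <= exp (la' * M)"
 proof -
  have "ln (2 * A) / \<delta> >= 0" using A1 \<delta>(1) by simp
  then have "ln R1 <= la' * 1" by(simp add: la'_def)
  also have "... <= la' * M" using la'0 M1 by(intro mult_left_mono)
  finally have "exp (ln R1) <= exp (la' * M)" by simp
  then show ?thesis using CR1(2) by simp
 qed
 \<comment> \<open>The induction closes with this value: \<open>C1\<close> from \<open>\<nu>\<close>
   plus half of \<open>K\<close> from the tail is \<open>K\<close> again.\<close>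
 define K where "K = 2 * C1"
 have bnd: "norm (G k) <= K * fact (size (fst k)) * exp (la' * W k)" if "k \<in> D" for k
  using that
 proof (induction "r k" arbitrary: k rule: less_induct)
  case less
  define c b where "c = c0 k" and "b = b0 k"
  have cb: "c \<in> L0" "kshift b c = k" using bc[OF less.prems] by(simp_all add: c_def b_def)
  let ?F = "fact (size (fst k)) * exp (la' * W k)"
  have szk: "size (fst k) = size b + size (fst c)" using arg_cong[OF cb(2), of "\<lambda>k. size (fst k)"] by simp
  have "lv k = la b + lv c" using lv_shift[OF L0J[OF cb(1)], of b] cb(2) by simp
  then have Wk: "W k = M * size b + la b + W c" by(simp add: W_def szk algebra_simps)
  have Wnn: "W k' >= 0" for k' using M1 lv_nn[of k'] by(simp add: W_def)
  have 1: "norm (\<nu> (shift b (g c))) <= C1 * ?F"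
  proof -
   have "R1 ^ size b <= exp (la' * M) ^ size b" using la'2 CR1(2) by(intro power_mono) auto
   also have "... = exp (la' * (M * size b))" by(simp only: exp_of_nat_mult[symmetric]) (simp only: ac_simps)
   also have "... <= exp (la' * W k)"
    using la'0 la_nn[of b] Wnn[of c] by(simp add: Wk mult_left_mono)
   finally have e: "R1 ^ size b <= exp (la' * W k)" .
   have "R1 ^ size b * fact (size b) <= exp (la' * W k) * fact (size (fst k))"
    using e CR1(2) by(intro mult_mono fact_mono) (auto simp: szk)
   then have "C1 * (R1 ^ size b * fact (size b)) <= C1 * ?F"
    using CR1(1) by(intro mult_left_mono) (auto simp: mult.commute)
   then show ?thesis using CR1(3)[OF cb(1), of b] by(simp add: mult.assoc)
  qed
  have 2: "norm (G (kshift b t)) <= K * ?F * exp (- (la' * \<delta>))" if t: "t \<in> tl c" for t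
  proof (cases "kshift b t \<in> D")
   case True
   have rl: "r (kshift b t) < r k"
    using r_shift[OF tl(1)[OF cb(1) t] L0J[OF cb(1)] tl(2)[OF cb(1) t], of b] cb(2) by simp
   have W: "W (kshift b t) + \<delta> <= W k"
    using \<delta>(2)[OF cb(1) t] lv_shift[OF tl(1)[OF cb(1) t], of b] unfolding Wk by(simp add: W_def algebra_simps)
   have "norm (G (kshift b t)) <= K * fact (size (fst (kshift b t))) * exp (la' * W (kshift b t))"
    by(rule less.hyps[OF rl True])
   also have "... <= K * fact (size (fst k)) * exp (la' * W k - la' * \<delta>)"
   proof (intro mult_mono)
    have "la' * (W (kshift b t) + \<delta>) <= la' * W k" using W la'0 by(rule mult_left_mono)
    then show "exp (la' * W (kshift b t)) <= exp (la' * W k - la' * \<delta>)" by(simp add: algebra_simps)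
    show "(fact (size (fst (kshift b t)))::real) <= fact (size (fst k))"
     using W_less(2)[OF cb(1) t] by(intro fact_mono) (simp add: szk)
   qed (use CR1(1) in \<open>auto simp: K_def\<close>)
   also have "... = K * ?F * exp (- (la' * \<delta>))" by(simp add: exp_diff exp_minus divide_inverse mult.assoc)
   finally show ?thesis .
  next
   case False
   then have "G (kshift b t) = 0" using G[of "kshift b t"] by(simp add: H_def)
   then show ?thesis using CR1(1) by(simp add: K_def)
  qed
  have "norm (G k) <= norm (\<nu> (shift b (g c))) + norm (\<Sum>t\<in>tl c. lookup (g c) t * G (kshift b t))"
   using G[of k] less.prems norm_triangle_ineq4[of "\<nu> (shift b (g c))"] by(simp add: H_def c_def b_def)
  also have "norm (\<Sum>t\<in>tl c. lookup (g c) t * G (kshift b t))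
    <= (\<Sum>t\<in>tl c. norm (lookup (g c) t) * (K * ?F * exp (- (la' * \<delta>))))"
   by(rule sum_norm_le) (simp only: norm_mult mult_left_mono[OF 2 norm_ge_zero])
  also have "... = (\<Sum>t\<in>tl c. norm (lookup (g c) t)) * (K * ?F * exp (- (la' * \<delta>)))"
   by(simp add: sum_distrib_right)
  also have "... <= A * (K * ?F * exp (- (la' * \<delta>)))"
   using A[OF cb(1)] CR1(1) by(intro mult_right_mono) (auto simp: K_def)
  also have "... = K * ?F * (A * exp (- (la' * \<delta>)))" by(simp only: ac_simps)
  also have "... <= K * ?F * (1 / 2)"
   using la'1 CR1(1) by(intro mult_left_mono) (auto simp: K_def)
  also have "norm (\<nu> (shift b (g c))) <= C1 * ?F" by(rule 1)
  finally show ?case by(simp add: K_def mult.assoc)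
 qed
 show ?thesis
 proof (rule that[of G "K * exp (la' * c)" "exp (la' * (M + c))"])
  fix k
  show "norm (G k) <= K * exp (la' * c) * exp (la' * (M + c)) ^ size (fst k) * fact (size (fst k))"
  proof (cases "k \<in> D")
   case True
   \<comment> \<open>The weight is at most linear in the degree, so its exponential is a constant
     times a geometric factor.\<close>
   have "la' * W k <= la' * ((M + c) * size (fst k) + c)"
    using lv_le[OF DJ[OF True]] la'0 by(intro mult_left_mono) (auto simp: W_def algebra_simps)
   then have "exp (la' * W k) <= exp (la' * c + size (fst k) * (la' * (M + c)))" by(simp add: algebra_simps)
   also have "... = exp (la' * c) * exp (la' * (M + c)) ^ size (fst k)"
    by(simp only: exp_add exp_of_nat_mult)
   finally have "K * fact (size (fst k)) * exp (la' * W k)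
     <= K * fact (size (fst k)) * (exp (la' * c) * exp (la' * (M + c)) ^ size (fst k))"
    using CR1(1) by(intro mult_left_mono) (auto simp: K_def)
   then show ?thesis using bnd[OF True] by(simp only: ac_simps)
  next
   case False
   then show ?thesis using G[of k] CR1(1) by(simp add: H_def K_def)
  qed
 qed (use G_eq CR1(1) in \<open>auto simp: K_def\<close>)
qed

abbreviation "osym \<equiv> opens symm"

section \<open>Holomorphic functions of a symmetric matrix\<close>

abbreviation (input) "ray f S B \<equiv> (\<lambda>t. f (S + mscale t B))"

lemma norm_mscale: "norm (mscale c (B :: 'n::finite mat)) = norm c * norm B"
proof -
 have "norm (mscale c B $ i) = norm c * norm (B $ i)" for i
  by(simp add: mscale_def norm_vec_def norm_mult L2_set_right_distrib)
 then show ?thesis by(simp add: norm_vec_def[of "mscale c B"] norm_vec_def[of B] L2_set_right_distrib)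
qed

interpretation mscale: bounded_bilinear "mscale :: complex => 'n::finite mat => 'n mat"
proof
 show "\<exists>K. \<forall>a b. norm (mscale a (b :: 'n mat)) <= norm a * norm b * K"
  by(intro exI[of _ 1]) (simp add: norm_mscale)
qed (simp_all add: mscale_def vec_eq_iff algebra_simps)

interpretation ms: vector_space "mscale :: complex => complex ^ 'a ^ 'b => _"
 by(rule vector_space_mscale)

lemma mscale_nth [simp]: "mscale c M $ i $ j = c * M $ i $ j"
 by(simp add: mscale_def)

lemma symm_iff: "S \<in> symm \<longleftrightarrow> (\<forall>i j. S $ i $ j = S $ j $ i)"
 by(auto simp: symm_def transpose_def vec_eq_iff)

lemma symm_closed [simp]:
 "0 \<in> symm" "S \<in> symm ==> T \<in> symm ==> S + T \<in> symm" "S \<in> symm ==> T \<in> symm ==> S - T \<in> symm"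
 "S \<in> symm ==> - S \<in> symm" "S \<in> symm ==> mscale c S \<in> symm"
 by(auto simp: symm_iff)

definition sball :: "'n::finite mat => real => 'n mat set" where
 "sball S r = {T \<in> symm. dist T S < r}"

lemma opens_iff:
 "U \<in> opens X \<longleftrightarrow> U <= symm & U <= X & (\<forall>S\<in>U. \<exists>e>0. sball S e <= U)"
 unfolding opens_def openin_euclidean_subtopology_iff sball_def by blast

lemma sball_opens: "sball S r \<in> osym"
 unfolding opens_def sball_def openin_euclidean_subtopology_iff
proof (safe)
 fix T assume T: "T \<in> symm" "dist T S < r"
 show "\<exists>e>0. \<forall>T'\<in>symm. dist T' T < e --> T' \<in> {T \<in> symm. dist T S < r}"
 proof (intro exI[of _ "r - dist T S"] conjI ballI impI)
  fix T' assume "T' \<in> symm" "dist T' T < r - dist T S"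
  then show "T' \<in> {T \<in> symm. dist T S < r}" using dist_triangle[of T' S T] by simp
 qed (use T in simp)
qed

lemma opens_symm: "U \<in> osym ==> U <= symm"
 by(simp add: opens_iff)

lemma opens_ball: "U \<in> osym ==> S \<in> U ==> \<exists>e>0. sball S e <= U"
 by(simp add: opens_iff)

lemma symm_opens: "symm \<in> osym"
 by(auto simp: opens_iff sball_def intro: exI[of _ 1])

lemma center_sball: "S \<in> symm ==> r > 0 ==> S \<in> sball S r"
 by(simp add: sball_def)

lemma open_line:
 assumes U: "U \<in> osym" and B: "B \<in> symm" and S: "S \<in> symm"
 shows "open {t. S + mscale t B \<in> U}"
 unfolding open_contains_ball
proof
 fix t assume "t \<in> {t. S + mscale t B \<in> U}"
 then obtain e where e: "e > 0" "sball (S + mscale t B) e <= U" using opens_ball[OF U] by blast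
 show "\<exists>d>0. ball t d <= {t. S + mscale t B \<in> U}"
 proof (intro exI[of _ "e / (norm B + 1)"] conjI subsetI)
  have nB: "norm B + 1 > 0" by(simp add: add_nonneg_pos)
  then show "e / (norm B + 1) > 0" using e by simp
  fix s assume "s \<in> ball t (e / (norm B + 1))"
  then have "norm (s - t) * (norm B + 1) < e"
   using nB by(simp add: dist_norm norm_minus_commute pos_less_divide_eq)
  moreover have "norm (s - t) * norm B <= norm (s - t) * (norm B + 1)" by(simp add: mult_left_mono)
  ultimately have "norm (mscale (s - t) B) < e" by(simp add: norm_mscale)
  moreover have "S + mscale s B - (S + mscale t B) = mscale (s - t) B" by(simp add: mscale.diff_left)
  ultimately have "S + mscale s B \<in> sball (S + mscale t B) e"
   using B S by(simp add: sball_def dist_norm)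
  then show "s \<in> {t. S + mscale t B \<in> U}" using e(2) by auto
 qed
qed

lemma ddir_line: "deriv (ray f S B) t = ddir B f (S + mscale t B)"
 unfolding ddir_def by(subst deriv_shift_0) (simp add: o_def mscale.add_left add.assoc)

lemma ddir_translate: "ddir B (\<lambda>T. f (S + T)) T = ddir B f (S + T)"
 by(simp add: ddir_def add.assoc)

lemma ddir_cong:
 assumes U: "U \<in> osym" and "S \<in> U" "B \<in> symm" and "!!T. T \<in> U ==> f T = g T"
 shows "ddir B f S = ddir B g S"
 unfolding ddir_def
proof (rule deriv_cong_ev)
 have "open {t. S + mscale t B \<in> U}" using assms opens_symm[OF U] by(intro open_line) auto
 then have "\<forall>\<^sub>F t in nhds 0. t \<in> {t. S + mscale t B \<in> U}"
  by(rule eventually_nhds_in_open) (use assms in \<open>simp add: mscale.zero_left\<close>)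
 then show "\<forall>\<^sub>F t in nhds 0. f (S + mscale t B) = g (S + mscale t B)"
  by eventually_elim (use assms in auto)
qed simp

lemma has_line_derivative:
 assumes L: "(f has_derivative L) (at S within symm)" "!!c B. L (mscale c B) = c * L B"
  and S: "S \<in> symm" and B: "B \<in> symm"
 shows "((ray f S B) has_field_derivative L B) (at 0)"
proof -
 have 1: "((\<lambda>t. S + mscale t B) has_derivative (\<lambda>t. mscale t B)) (at 0)"
  by(intro derivative_eq_intros mscale.FDERIV[THEN has_derivative_eq_rhs]) (auto simp: mscale.zero_right)
 have "((ray f S B) has_derivative (\<lambda>t. L (mscale t B))) (at 0)"
 proof (rule has_derivative_in_compose[OF 1])
  show "(f has_derivative L) (at (S + mscale 0 B) within range (\<lambda>t. S + mscale t B))"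
   using L(1) by(simp add: mscale.zero_left) (rule has_derivative_subset, use S B in auto)
 qed
 then show ?thesis
  by(simp add: has_field_derivative_def L(2) mult.commute[of _ "L B"])
qed

lemma holo_on_has_line_derivative:
 assumes f: "holo_on U f" and U: "U \<in> osym" and S: "S \<in> U" and B: "B \<in> symm"
 shows "((ray f S B) has_field_derivative ddir B f S) (at 0)"
proof -
 obtain L where L: "(f has_derivative L) (at S within symm)" "!!c B. L (mscale c B) = c * L B"
  using f S by(auto simp: holo_on_def)
 have "((ray f S B) has_field_derivative L B) (at 0)"
  using has_line_derivative[OF L _ B] S opens_symm[OF U] by auto
 then show ?thesis using DERIV_imp_deriv[of _ "L B"] by(simp add: ddir_def)
qed

lemma holo_on_ddir_add:
 assumes f: "holo_on U f" and U: "U \<in> osym" and S: "S \<in> U" and B: "B \<in> symm" and C: "C \<in> symm"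
 shows "ddir (B + C) f S = ddir B f S + ddir C f S"
proof -
 obtain L where L: "(f has_derivative L) (at S within symm)" "!!c B. L (mscale c B) = c * L B"
  using f S by(auto simp: holo_on_def)
 have Ss: "S \<in> symm" using S opens_symm[OF U] by auto
 have dd: "ddir B f S = L B" if B: "B \<in> symm" for B
  using has_line_derivative[OF L Ss B, THEN DERIV_imp_deriv] by(simp add: ddir_def)
 show ?thesis using dd[OF B] dd[OF C] dd[of "B + C"] B C linear_add[OF has_derivative_linear[OF L(1)]] by simp
qed

lemma ddir_mscale:
 assumes "((ray f S B) has_field_derivative d) (at 0)"
 shows "((\<lambda>t. f (S + mscale t (mscale c B))) has_field_derivative c * d) (at 0)"
proof -
 have "((\<lambda>t. f (S + mscale (t * c) B)) has_field_derivative d * c) (at 0)"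
  by(rule DERIV_chain2[where f = "\<lambda>t. f (S + mscale t B)" and g = "\<lambda>t. t * c"])
   (use assms in \<open>auto intro!: derivative_eq_intros\<close>)
 then show ?thesis by(simp add: mult.commute)
qed

lemma holo_on_ddir_mscale:
 assumes f: "holo_on U f" and U: "U \<in> osym" and S: "S \<in> U" and B: "B \<in> symm"
 shows "ddir (mscale c B) f S = c * ddir B f S"
 using ddir_mscale[OF holo_on_has_line_derivative[OF assms], THEN DERIV_imp_deriv]
 by(simp add: ddir_def)

lemma holo_on_has_line_derivative_at:
 assumes f: "holo_on U f" and U: "U \<in> osym" and S: "S + mscale t B \<in> U" and B: "B \<in> symm"
 shows "((ray f S B) has_field_derivative ddir B f (S + mscale t B)) (at t)"
proof -
 have "((\<lambda>u. f (S + mscale (t + u) B)) has_field_derivative ddir B f (S + mscale t B)) (at 0)"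
  using holo_on_has_line_derivative[OF f U S B] by(simp add: mscale.add_left add.assoc)
 then show ?thesis using DERIV_shift[of "\<lambda>u. f (S + mscale u B)" _ 0 t] by(simp add: add.commute)
qed

lemma holo_on_line:
 assumes f: "holo_on U f" and U: "U \<in> osym" and B: "B \<in> symm"
  and A: "!!t. t \<in> A ==> S + mscale t B \<in> U"
 shows "(ray f S B) holomorphic_on A"
proof (rule holomorphic_onI)
 fix t assume "t \<in> A"
 from holo_on_has_line_derivative_at[OF f U A[OF this] B]
 show "(ray f S B) field_differentiable at t within A"
  using field_differentiable_at_within field_differentiable_def by blast
qed

lemma holo_on_continuous_on:
 assumes f: "holo_on U f" and U: "U \<in> osym"
 shows "continuous_on U f"
 unfolding continuous_on_eq_continuous_within
proof
 fix S assume "S \<in> U"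
 then obtain L where L: "(f has_derivative L) (at S within symm)" using f by(auto simp: holo_on_def)
 then have "(f has_derivative L) (at S within U)" by(rule has_derivative_subset) (rule opens_symm[OF U])
 then show "continuous (at S within U) f" by(rule has_derivative_continuous)
qed

lemma holo_on_subset: "holo_on U f ==> V <= U ==> holo_on V f"
 unfolding holo_on_def by blast

section \<open>Taylor estimates and regularity of directional derivatives\<close>

lemma taylor_linear:
 fixes h :: "complex => complex"
 assumes h: "h holomorphic_on ball 0 R" and M: "!!t. t \<in> ball 0 R ==> norm (h t) <= M"
  and R: "R > 0" and t: "norm t <= R / 2"
 shows "norm (h t - h 0 - t * deriv h 0) <= 32 * M * (norm t)\<^sup>2 / R\<^sup>2"
proof -
 have sub: "ball 0 (R / 2 + R / 4) <= ball (0::complex) R" using R by(intro subset_ball) simp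
 \<comment> \<open>Cauchy's inequality on the disc of radius \<open>R / 4\<close> about
   \<open>s\<close>, which stays inside the ball; \<open>32 = 2! * 4^2\<close>.\<close>
 have b: "cmod ((deriv ^^ 2) h s) <= 32 * M / R\<^sup>2" if s: "s \<in> cball 0 (R / 2)" for s
 proof -
  have c: "cball s (R / 4) <= ball 0 R"
  proof
   fix u assume "u \<in> cball s (R / 4)"
   then have "norm u <= norm s + R / 4"
    using norm_triangle_ineq[of s "u - s"] by(simp add: dist_norm norm_minus_commute)
   then show "u \<in> ball 0 R" using s R by simp
  qed
  have "cmod ((deriv ^^ 2) h s) <= fact 2 * M / (R / 4)\<^sup>2"
  proof (rule Cauchy_inequality)
   show "h holomorphic_on ball s (R / 4)" using h c ball_subset_cball by(blast intro: holomorphic_on_subset)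
   show "continuous_on (cball s (R / 4)) h"
    using h c by(meson continuous_on_subset holomorphic_on_imp_continuous_on)
   show "cmod (h x) <= M" if "cmod (s - x) = R / 4" for x
    using that c M by(auto simp: dist_norm subset_iff)
  qed (use R in simp)
  then show ?thesis by(simp add: power_divide)
 qed
 have "cmod ((deriv ^^ 0) h t - (\<Sum>i\<le>1. (deriv ^^ i) h 0 * (t - 0) ^ i / fact i))
   <= 32 * M / R\<^sup>2 * cmod (t - 0) ^ Suc 1 / fact 1"
 proof (rule field_Taylor)
  show "convex (cball (0::complex) (R / 2))" by simp
  show "((deriv ^^ i) h has_field_derivative (deriv ^^ Suc i) h x) (at x within cball 0 (R / 2))"
   if "x \<in> cball 0 (R / 2)" "i <= 1" for i x
  proof -
   have "(deriv ^^ i) h holomorphic_on ball 0 R" by(rule holomorphic_higher_deriv[OF h]) simp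
   moreover have "x \<in> ball 0 R" using that(1) R by simp
   ultimately have "((deriv ^^ i) h has_field_derivative deriv ((deriv ^^ i) h) x) (at x)"
    by(intro holomorphic_derivI[of _ "ball 0 R"]) auto
   then show ?thesis by(simp add: has_field_derivative_at_within)
  qed
  show "cmod ((deriv ^^ Suc 1) h x) <= 32 * M / R\<^sup>2" if "x \<in> cball 0 (R / 2)" for x
   using b[OF that] by(simp add: numeral_2_eq_2)
 qed (use t R in auto)
 then show ?thesis by(simp add: algebra_simps power2_eq_square)
qed

text \<open>Restriction to the line through \<open>S\<close> in direction \<open>B\<close> reduces
  the estimate to one variable: for \<open>|t| < R\<close> with \<open>R = r / (2 |B|)\<close> the
  line stays in the ball, and \<open>R >= 2\<close> admits \<open>t = 1\<close>. Only
  differentiability along lines is assumed, because the estimate is also used to prove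
  holomorphy.\<close>

lemma taylor_linear_ddir:
 assumes U: "sball S0 r <= U" "U \<in> osym" and r: "r > 0"
  and line: "!!S B t. S + mscale t B \<in> U ==> B \<in> symm ==>
   (ray f S B) field_differentiable (at t)"
  and M: "!!S. S \<in> sball S0 r ==> norm (f S) <= M"
  and S: "S \<in> sball S0 (r / 2)" and B: "B \<in> symm" "norm B <= r / 4"
 shows "norm (f (S + B) - f S - ddir B f S) <= 128 * M * (norm B)\<^sup>2 / r\<^sup>2"
proof (cases "B = 0")
 case True
 then show ?thesis by(simp add: ddir_def)
next
 case False
 define R where "R = r / 2 / norm B"
 have R: "R > 0" "R >= 2" using r False B(2) by(simp_all add: R_def field_simps)
 have inU: "S + mscale t B \<in> sball S0 r" if "t \<in> ball 0 R" for t
 proof -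
  have "norm t * norm B < r / 2" using that False by(simp add: R_def pos_less_divide_eq)
  then have "dist (S + mscale t B) S < r / 2" by(simp add: dist_norm norm_mscale)
  moreover have "dist S S0 < r / 2" "S \<in> symm" using S by(simp_all add: sball_def)
  ultimately show ?thesis using dist_triangle[of "S + mscale t B" S0 S] B(1) by(simp add: sball_def)
 qed
 have "norm (f (S + mscale 1 B) - f (S + mscale 0 B) - 1 * deriv (ray f S B) 0)
   <= 32 * M * (norm (1::complex))\<^sup>2 / R\<^sup>2"
 proof (rule taylor_linear)
  show "(ray f S B) holomorphic_on ball 0 R"
   by(rule holomorphic_onI, rule field_differentiable_at_within, rule line) (use inU U B(1) in auto)
 qed (use inU M R in auto)
 then show ?thesis by(simp add: ddir_def mscale.zero_left R_def power_divide)
qed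

lemma locally_bounded:
 assumes c: "continuous_on U f" and U: "U \<in> osym" and S: "S \<in> U"
 obtains r M where "r > 0" "sball S r <= U" "!!T. T \<in> sball S r ==> norm (f T :: complex) <= M" "M >= 0"
proof -
 obtain e where e: "e > 0" "sball S e <= U" using opens_ball[OF U S] by blast
 obtain d where d: "d > 0" "!!T. T \<in> U ==> dist T S < d ==> dist (f T) (f S) < 1"
  using c S unfolding continuous_on_iff by(metis zero_less_one)
 show ?thesis
 proof (rule that[of "min d e" "norm (f S) + 1"])
  show "sball S (min d e) <= U" using e(2) by(auto simp: sball_def)
  fix T assume "T \<in> sball S (min d e)"
  then have "T \<in> U" "dist T S < d" using e(2) by(auto simp: sball_def)
  then have "dist (f T) (f S) < 1" by(rule d(2))
  then show "norm (f T) <= norm (f S) + 1"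
   using norm_triangle_ineq2[of "f T" "f S"] by(simp add: dist_norm)
 qed (use d e in auto)
qed

text \<open>Directional derivatives are controlled in symmetric directions only, while a derivative
  within \<open>symm\<close> has to be a linear map on all matrices; this projection supplies the
  extension.\<close>

definition sym_part :: "'n::finite mat => 'n mat" where
 "sym_part B = mscale (1/2) (B + transpose B)"

lemma sym_part_symm [simp]: "sym_part B \<in> symm"
 by(simp add: sym_part_def symm_iff transpose_def)

lemma sym_part_id [simp]: "B \<in> symm ==> sym_part B = B"
 by(simp add: sym_part_def symm_def vec_eq_iff)

abbreviation (input) "clin L \<equiv> (\<forall>c B. L (mscale c B) = c * L B)"

text \<open>Local boundedness makes the quadratic remainder of the Taylor estimate uniform in the
  direction. Together with additivity this turns the directional derivatives into a complex linear
  Frechet derivative.\<close>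

lemma holo_onI:
 assumes U: "U \<in> osym" and c: "continuous_on U f"
  and line: "!!S B. S \<in> U ==> B \<in> symm ==> (ray f S B) field_differentiable (at 0)"
  and add: "!!S B C. S \<in> U ==> B \<in> symm ==> C \<in> symm ==> ddir (B + C) f S = ddir B f S + ddir C f S"
 shows "holo_on U f"
 unfolding holo_on_def
proof
 fix S assume S: "S \<in> U"
 have sc: "ddir (mscale c B) f S = c * ddir B f S" if B: "B \<in> symm" for c B
 proof -
  obtain d where d: "((ray f S B) has_field_derivative d) (at 0)"
   using line[OF S B] by(auto simp: field_differentiable_def)
  from DERIV_imp_deriv[OF ddir_mscale[OF d, of c]] DERIV_imp_deriv[OF d] show ?thesis by(simp add: ddir_def)
 qed
 have line': "(ray f S B) field_differentiable (at t)" if SB: "S + mscale t B \<in> U" "B \<in> symm" for S B t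
 proof -
  obtain d where "((\<lambda>u. f (S + mscale (t + u) B)) has_field_derivative d) (at 0)"
   using line[OF SB] by(auto simp: field_differentiable_def mscale.add_left add.assoc)
  then have "((ray f S B) has_field_derivative d) (at t)"
   using DERIV_shift[of "\<lambda>u. f (S + mscale u B)" _ 0 t] by(simp add: add.commute)
  then show ?thesis by(auto simp: field_differentiable_def)
 qed
 define L where "L B = ddir (sym_part B) f S" for B
 have "linear L"
 proof
  show "L (B + C) = L B + L C" for B C
  proof -
   have "sym_part (B + C) = sym_part B + sym_part C"
    by(simp add: sym_part_def vec_eq_iff transpose_def algebra_simps)
   then show ?thesis using add[OF S, of "sym_part B" "sym_part C"] by(simp add: L_def)
  qed
  show "L (r *\<^sub>R B) = r *\<^sub>R L B" for r B
  proof -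
   have "sym_part (r *\<^sub>R B) = mscale (of_real r) (sym_part B)"
    by(simp add: sym_part_def vec_eq_iff transpose_def algebra_simps scaleR_conv_of_real[where 'a=complex])
   then show ?thesis using sc[of "sym_part B" "of_real r"] by(simp add: L_def scaleR_conv_of_real)
  qed
 qed
 then have bl: "bounded_linear L" by(simp add: linear_conv_bounded_linear)
 have Ls: "L B = ddir B f S" if "B \<in> symm" for B using that by(simp add: L_def)
 have Lc: "L (mscale c B) = c * L B" for c B
 proof -
  have "sym_part (mscale c B) = mscale c (sym_part B)"
   by(simp add: sym_part_def vec_eq_iff transpose_def algebra_simps)
  then show ?thesis using sc[of "sym_part B" c] by(simp add: L_def)
 qed
 obtain r M where r: "r > 0" "sball S r <= U" "!!T. T \<in> sball S r ==> norm (f T) <= M" "M >= 0"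
  by(rule locally_bounded[OF c U S]) (rule that)
 have Ss: "S \<in> symm" using S opens_symm[OF U] by auto
 have est: "norm (f T - f S - L (T - S)) <= 128 * M * (norm (T - S))\<^sup>2 / r\<^sup>2"
  if T: "T \<in> symm" "norm (T - S) <= r / 4" for T
 proof -
  have B: "T - S \<in> symm" using T Ss by simp
  have "norm (f (S + (T - S)) - f S - ddir (T - S) f S) <= 128 * M * (norm (T - S))\<^sup>2 / r\<^sup>2"
   by(rule taylor_linear_ddir[OF r(2) U r(1) line' r(3)]) (use B T(2) center_sball[OF Ss, of "r / 2"] r(1) in auto)
  then show ?thesis using Ls[OF B] by simp
 qed
 have "(f has_derivative L) (at S within symm)"
  unfolding has_derivative_within_alt
 proof (intro conjI allI impI bl)
  fix e :: real assume e: "e > 0"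
  \<comment> \<open>The second entry makes \<open>128 * M * |T - S| / r^2\<close> at most
    \<open>e\<close>; the \<open>+ 1\<close> guards against \<open>M = 0\<close>.\<close>
  define d where "d = min (r / 4) (e * r\<^sup>2 / (128 * M + 1))"
  have M1: "128 * M + 1 > 0" using r(4) by simp
  show "\<exists>d>0. \<forall>T\<in>symm. norm (T - S) < d --> norm (f T - f S - L (T - S)) <= e * norm (T - S)"
  proof (intro exI[of _ d] conjI ballI impI)
   show "d > 0" using r(1) e M1 by(simp add: d_def)
   fix T assume T: "T \<in> symm" "norm (T - S) < d"
   have "norm (T - S) * (128 * M + 1) <= e * r\<^sup>2"
    using T(2) M1 by(simp add: d_def pos_less_divide_eq)
   then have "128 * M * norm (T - S) <= e * r\<^sup>2" using norm_ge_zero[of "T - S"] by(simp only: distrib_left mult_1_right mult.commute[of "norm (T - S)"])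
   then have "128 * M * norm (T - S) * norm (T - S) <= e * r\<^sup>2 * norm (T - S)" by(intro mult_right_mono) auto
   then have "128 * M * (norm (T - S))\<^sup>2 / r\<^sup>2 <= e * norm (T - S)"
    using r(1) by(simp add: power2_eq_square field_simps)
   then show "norm (f T - f S - L (T - S)) <= e * norm (T - S)"
    using est[OF T(1)] T(2) by(simp add: d_def)
  qed
 qed
 then show "\<exists>L. (f has_derivative L) (at S within symm) & clin L"
  using Lc by blast
qed

text \<open>The Taylor remainder is quadratic in \<open>h\<close> with a constant valid on a whole
  ball, so after division by \<open>h\<close> convergence is uniform. Uniformity carries continuity
  and further derivatives over to \<open>ddir B f\<close>.\<close>

lemma difference_quotient_uniform:
 assumes f: "holo_on U f" and U: "U \<in> osym" and S0: "S0 \<in> U" and B: "B \<in> symm"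
 obtains r where "r > 0" "sball S0 r <= U"
  "uniform_limit (sball S0 r) (\<lambda>h S. (f (S + mscale h B) - f S) / h) (ddir B f) (at 0)"
  "\<forall>\<^sub>F h in at 0. \<forall>S\<in>sball S0 r. S + mscale h B \<in> U"
proof -
 obtain r M where r: "r > 0" "sball S0 r <= U" "!!T. T \<in> sball S0 r ==> norm (f T) <= M" "M >= 0"
  by(rule locally_bounded[OF holo_on_continuous_on[OF f U] U S0]) (rule that)
 define b where "b = norm B + 1"
 have b: "b > 0" "norm B <= b" by(simp_all add: b_def add_nonneg_pos)
 define h0 where "h0 = r / (4 * b)"
 have h0: "h0 > 0" using r b by(simp add: h0_def)
 have small: "norm (mscale h B) <= r / 4" if "norm h < h0" for h
 proof -
  have "norm h * norm B <= h0 * b" using that b h0 by(intro mult_mono) auto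
  then show ?thesis using b by(simp add: norm_mscale h0_def)
 qed
 have ev: "\<forall>\<^sub>F h in at (0::complex). h \<noteq> 0 & norm h < e" if "e > 0" for e
  using that unfolding eventually_at by(auto intro!: exI[of _ e] simp: dist_norm)
 have line: "(ray f S B) field_differentiable (at t)" if "S + mscale t B \<in> U" "B \<in> symm" for S B t
  using holo_on_has_line_derivative_at[OF f U that] by(auto simp: field_differentiable_def)
 have est: "norm ((f (S + mscale h B) - f S) / h - ddir B f S) <= 128 * M * b\<^sup>2 / r\<^sup>2 * norm h"
  if S: "S \<in> sball S0 (r / 2)" and h: "h \<noteq> 0" "norm h < h0" for S h
 proof -
  have SU: "S \<in> U" using S r by(auto simp: sball_def)
  have "norm (f (S + mscale h B) - f S - ddir (mscale h B) f S) <= 128 * M * (norm (mscale h B))\<^sup>2 / r\<^sup>2"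
   using taylor_linear_ddir[OF r(2) U r(1) line r(3) S _ small[OF h(2)]] B by simp
  also have "... <= 128 * M * (norm h * b)\<^sup>2 / r\<^sup>2"
   using b(2) r(4) by(intro divide_right_mono mult_left_mono power_mono) (auto simp: norm_mscale mult_left_mono)
  finally have "norm (f (S + mscale h B) - f S - h * ddir B f S) / norm h <= 128 * M * (norm h * b)\<^sup>2 / r\<^sup>2 / norm h"
   unfolding holo_on_ddir_mscale[OF f U SU B] by(rule divide_right_mono) simp
  also have "... = 128 * M * b\<^sup>2 / r\<^sup>2 * norm h"
   using h(1) by(simp add: power2_eq_square)
  also have "norm (f (S + mscale h B) - f S - h * ddir B f S) / norm h = norm ((f (S + mscale h B) - f S) / h - ddir B f S)"
   using h(1) by(simp add: norm_divide[symmetric] diff_divide_distrib)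
  finally show ?thesis .
 qed
 show ?thesis
 proof (rule that[of "r / 2"])
  show "r / 2 > 0" "sball S0 (r / 2) <= U" using r by(auto simp: sball_def)
  show "uniform_limit (sball S0 (r / 2)) (\<lambda>h S. (f (S + mscale h B) - f S) / h) (ddir B f) (at 0)"
   unfolding uniform_limit_iff
  proof (intro allI impI)
   fix e :: real assume e: "e > 0"
   define K where "K = 128 * M * b\<^sup>2 / r\<^sup>2 + 1"
   have K: "K > 0" using r(4) by(simp add: K_def add_nonneg_pos)
   have "\<forall>\<^sub>F h in at (0::complex). h \<noteq> 0 & norm h < min h0 (e / K)"
    by(rule ev) (use h0 e K in simp)
   then show "\<forall>\<^sub>F h in at 0. \<forall>S\<in>sball S0 (r / 2). dist ((f (S + mscale h B) - f S) / h) (ddir B f S) < e"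
   proof eventually_elim
    case (elim h)
    show ?case
    proof
     fix S assume S: "S \<in> sball S0 (r / 2)"
     have "norm ((f (S + mscale h B) - f S) / h - ddir B f S) <= (K - 1) * norm h"
      using est[OF S, of h] elim by(simp add: K_def)
     also have "... <= K * norm h" by(simp add: mult_right_mono)
     also have "... < e" using elim K by(simp add: pos_less_divide_eq mult.commute)
     finally show "dist ((f (S + mscale h B) - f S) / h) (ddir B f S) < e" by(simp add: dist_norm)
    qed
   qed
  qed
  have "S + mscale h B \<in> U" if "S \<in> sball S0 (r / 2)" "norm h < h0" for S h
  proof -
   have "dist (S + mscale h B) S <= r / 4" using small[OF that(2)] by(simp add: dist_norm)
   moreover have "dist S S0 < r / 2" "S \<in> symm" using that by(simp_all add: sball_def)
   ultimately have "S + mscale h B \<in> sball S0 r"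
    using dist_triangle[of "S + mscale h B" S0 S] B r(1) by(simp add: sball_def)
   then show ?thesis using r by auto
  qed
  then show "\<forall>\<^sub>F h in at 0. \<forall>S\<in>sball S0 (r / 2). S + mscale h B \<in> U"
   using ev[OF h0] by(auto elim!: eventually_mono)
 qed
qed

lemma continuous_on_ddir:
 assumes f: "holo_on U f" and U: "U \<in> osym" and B: "B \<in> symm"
 shows "continuous_on U (ddir B f)"
 unfolding continuous_on_eq_continuous_within
proof
 fix S assume S: "S \<in> U"
 obtain r where r: "r > 0" "sball S r <= U"
  and ul: "uniform_limit (sball S r) (\<lambda>h S. (f (S + mscale h B) - f S) / h) (ddir B f) (at 0)"
  and ev: "\<forall>\<^sub>F h in at 0. \<forall>T\<in>sball S r. T + mscale h B \<in> U"
  by(rule difference_quotient_uniform[OF f U S B]) (rule that)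
 have cf: "continuous_on U f" by(rule holo_on_continuous_on[OF f U])
 have "continuous_on (sball S r) (ddir B f)"
 proof (rule uniform_limit_theorem[OF _ ul])
  show "\<forall>\<^sub>F h in at 0. continuous_on (sball S r) (\<lambda>T. (f (T + mscale h B) - f T) / h)"
   using ev eventually_neq_at_within[of 0 0 UNIV]
  proof eventually_elim
   case (elim h)
   have "continuous_on (sball S r) (\<lambda>T. f (T + mscale h B))"
    by(rule continuous_on_compose2[OF cf]) (use elim in \<open>auto intro!: continuous_intros\<close>)
   then show ?case using continuous_on_subset[OF cf r(2)] elim by(intro continuous_intros) auto
  qed
 qed simp
 then have "continuous (at S within sball S r) (ddir B f)"
  using r S opens_symm[OF U] center_sball[of S r] by(auto simp: continuous_on_eq_continuous_within)
 moreover have "at S within sball S r = at S within U"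
  by(rule at_within_nhd[of S "ball S r"])
   (use r opens_symm[OF U] in \<open>auto simp: sball_def dist_commute\<close>)
 ultimately show "continuous (at S within U) (ddir B f)" by simp
qed

text \<open>The difference quotients in direction \<open>B\<close> converge uniformly along the line
  in direction \<open>C\<close>, so by Weierstrass the limit can be differentiated through them.
  Their derivatives are difference quotients of \<open>ddir C f\<close>; hence both mixed
  derivatives exist and agree.\<close>

lemma mixed_derivative:
 assumes f: "holo_on U f" and U: "U \<in> osym" and S: "S \<in> U" and B: "B \<in> symm" and C: "C \<in> symm"
 obtains d where "((ray (ddir B f) S C) has_field_derivative d) (at 0)"
  "((ray (ddir C f) S B) has_field_derivative d) (at 0)"
proof -
 obtain r where r: "r > 0" "sball S r <= U"
  and ul: "uniform_limit (sball S r) (\<lambda>h S. (f (S + mscale h B) - f S) / h) (ddir B f) (at 0)"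
  and ev: "\<forall>\<^sub>F h in at 0. \<forall>T\<in>sball S r. T + mscale h B \<in> U"
  by(rule difference_quotient_uniform[OF f U S B]) (rule that)
 have Ss: "S \<in> symm" using S opens_symm[OF U] by auto
 define q where "q = r / (2 * (norm C + 1))"
 have nC: "norm C + 1 > 0" by(simp add: add_nonneg_pos)
 have q: "q > 0" using r nC by(simp add: q_def)
 have inV: "S + mscale t C \<in> sball S r" if "t \<in> cball 0 q" for t
 proof -
  have "norm t * norm C <= q * (norm C + 1)" using that q by(intro mult_mono) auto
  also have "q * (norm C + 1) = r / 2" using nC by(simp add: q_def field_simps)
  also have "... < r" using r by simp
  finally show ?thesis using Ss C by(simp add: sball_def dist_norm norm_mscale)
 qed
 have ulc: "uniform_limit (cball 0 q) (\<lambda>h t. (f (S + mscale t C + mscale h B) - f (S + mscale t C)) / h)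
  (ray (ddir B f) S C) (at 0)"
  using ul unfolding uniform_limit_iff
 proof (intro allI impI, elim allE impE)
  fix e :: real
  assume "\<forall>\<^sub>F h in at 0. \<forall>S\<in>sball S r. dist ((f (S + mscale h B) - f S) / h) (ddir B f S) < e"
  then show "\<forall>\<^sub>F h in at 0. \<forall>t\<in>cball 0 q. dist ((f (S + mscale t C + mscale h B) - f (S + mscale t C)) / h)
    (ddir B f (S + mscale t C)) < e"
   by eventually_elim (use inV in blast)
 qed
 have der: "\<forall>\<^sub>F h in at 0. continuous_on (cball 0 q) (\<lambda>t. (f (S + mscale t C + mscale h B) - f (S + mscale t C)) / h) &
  (\<forall>w\<in>ball 0 q. ((\<lambda>t. (f (S + mscale t C + mscale h B) - f (S + mscale t C)) / h) has_field_derivative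
   (ddir C f (S + mscale w C + mscale h B) - ddir C f (S + mscale w C)) / h) (at w))"
  using ev eventually_neq_at_within[of 0 0 UNIV]
 proof eventually_elim
  case (elim h)
  have d: "((\<lambda>t. (f (S + mscale t C + mscale h B) - f (S + mscale t C)) / h) has_field_derivative
   (ddir C f (S + mscale w C + mscale h B) - ddir C f (S + mscale w C)) / h) (at w)" if w: "w \<in> cball 0 q" for w
  proof -
   have 1: "((ray f S C) has_field_derivative ddir C f (S + mscale w C)) (at w)"
    by(rule holo_on_has_line_derivative_at[OF f U _ C]) (use inV[OF w] r(2) in auto)
   have "((\<lambda>t. f ((S + mscale h B) + mscale t C)) has_field_derivative ddir C f ((S + mscale h B) + mscale w C)) (at w)"
    by(rule holo_on_has_line_derivative_at[OF f U _ C]) (use inV[OF w] elim in \<open>auto simp: ac_simps\<close>)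
   then have 2: "((\<lambda>t. f (S + mscale t C + mscale h B)) has_field_derivative ddir C f (S + mscale w C + mscale h B)) (at w)"
    by(simp add: ac_simps)
   show ?thesis using DERIV_diff[OF 2 1, THEN DERIV_cdivide] .
  qed
  then show ?case by(auto intro!: DERIV_continuous_on[OF has_field_derivative_at_within])
 qed
 obtain g' where "continuous_on (cball 0 q) (ray (ddir B f) S C)" and g': "!!w. w \<in> ball 0 q ==> ((ray (ddir B f) S C) has_field_derivative g' w) (at w) &
   ((\<lambda>h. (ddir C f (S + mscale w C + mscale h B) - ddir C f (S + mscale w C)) / h) \<longlongrightarrow> g' w) (at 0)"
  by(rule has_complex_derivative_uniform_limit[OF der ulc at_neq_bot q]) (rule that)
 have "((\<lambda>h. (ddir C f (S + mscale h B) - ddir C f S) / h) \<longlongrightarrow> g' 0) (at 0)"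
  using g'[of 0] q by(simp add: mscale.zero_left)
 then have "((ray (ddir C f) S B) has_field_derivative g' 0) (at 0)"
  by(simp add: DERIV_def mscale.zero_left)
 moreover have "((ray (ddir B f) S C) has_field_derivative g' 0) (at 0)" using g'[of 0] q by simp
 ultimately show ?thesis using that by blast
qed

lemma ddir_commute:
 assumes "holo_on U f" "U \<in> osym" "S \<in> U" "B \<in> symm" "C \<in> symm"
 shows "ddir B (ddir C f) S = ddir C (ddir B f) S"
 using mixed_derivative[OF assms] by(metis DERIV_imp_deriv ddir_def)

text \<open>Additivity in the direction is inherited by commuting the new derivative past
  \<open>B\<close>, where additivity for \<open>f\<close> itself is available.\<close>

lemma holo_on_ddir:
 assumes f: "holo_on U f" and U: "U \<in> osym" and B: "B \<in> symm"
 shows "holo_on U (ddir B f)"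
proof (rule holo_onI[OF U])
 show "continuous_on U (ddir B f)" by(rule continuous_on_ddir[OF assms])
 fix S assume S: "S \<in> U"
 show "(ray (ddir B f) S C) field_differentiable at 0" if "C \<in> symm" for C
  using mixed_derivative[OF f U S B that] unfolding field_differentiable_def by metis
 fix C D :: "'a mat" assume CD: "C \<in> symm" "D \<in> symm"
 have d: "((ray (ddir E f) S B) has_field_derivative ddir B (ddir E f) S) (at 0)"
  if "E \<in> symm" for E
  using mixed_derivative[OF f U S B that] DERIV_imp_deriv unfolding ddir_def by metis
 have "ddir (C + D) (ddir B f) S = ddir B (ddir (C + D) f) S"
  by(rule ddir_commute[OF f U S]) (use B CD in auto)
 also have "... = ddir B (\<lambda>S. ddir C f S + ddir D f S) S"
  by(rule ddir_cong[OF U S B]) (rule holo_on_ddir_add[OF f U _ CD])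
 also have "... = ddir B (ddir C f) S + ddir B (ddir D f) S"
  using DERIV_imp_deriv[OF DERIV_add[OF d[OF CD(1)] d[OF CD(2)]]] by(simp add: ddir_def[of B "\<lambda>S. ddir C f S + ddir D f S"])
 also have "... = ddir C (ddir B f) S + ddir D (ddir B f) S"
  using ddir_commute[OF f U S B] CD by simp
 finally show "ddir (C + D) (ddir B f) S = ddir C (ddir B f) S + ddir D (ddir B f) S" .
qed

lemma ddirI: "((ray f S B) has_field_derivative d) (at 0) ==> ddir B f S = d"
 unfolding ddir_def by(rule DERIV_imp_deriv)

section \<open>Rules for holomorphic functions and their directional derivatives\<close>

lemma holo_on_const: "holo_on U (\<lambda>S. c)"
 unfolding holo_on_def by(intro ballI exI[of _ "\<lambda>_. 0"]) auto

lemma holo_on_add: "holo_on U f ==> holo_on U g ==> holo_on U (\<lambda>S. f S + g S)"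
 unfolding holo_on_def
proof
 fix S assume "\<forall>S\<in>U. \<exists>L. (f has_derivative L) (at S within symm) & clin L"
  "\<forall>S\<in>U. \<exists>L. (g has_derivative L) (at S within symm) & clin L" "S \<in> U"
 then obtain L K where "(f has_derivative L) (at S within symm)" "clin L"
  "(g has_derivative K) (at S within symm)" "clin K" by blast
 then show "\<exists>L. ((\<lambda>S. f S + g S) has_derivative L) (at S within symm) & clin L"
  by(intro exI[of _ "\<lambda>B. L B + K B"]) (auto intro!: derivative_eq_intros simp: distrib_left)
qed

lemma holo_on_mult: "holo_on U f ==> holo_on U g ==> holo_on U (\<lambda>S. f S * g S)"
 unfolding holo_on_def
proof
 fix S assume "\<forall>S\<in>U. \<exists>L. (f has_derivative L) (at S within symm) & clin L"
  "\<forall>S\<in>U. \<exists>L. (g has_derivative L) (at S within symm) & clin L" "S \<in> U"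
 then obtain L K where "(f has_derivative L) (at S within symm)" "clin L"
  "(g has_derivative K) (at S within symm)" "clin K" by blast
 then show "\<exists>L. ((\<lambda>S. f S * g S) has_derivative L) (at S within symm) & clin L"
  by(intro exI[of _ "\<lambda>B. f S * K B + L B * g S"]) (auto intro!: derivative_eq_intros simp: algebra_simps)
qed

lemma holo_on_cmult: "holo_on U f ==> holo_on U (\<lambda>S. c * f S)"
 by(rule holo_on_mult[OF holo_on_const])

lemma holo_on_uminus: "holo_on U f ==> holo_on U (\<lambda>S. - f S)"
 using holo_on_cmult[of U f "-1"] by simp

lemma holo_on_diff: "holo_on U f ==> holo_on U g ==> holo_on U (\<lambda>S. f S - g S)"
 using holo_on_add[OF _ holo_on_uminus, of U f g] by simp

lemma holo_on_sum: "(!!a. a \<in> A ==> holo_on U (f a)) ==> holo_on U (\<lambda>S. \<Sum>a\<in>A. f a S)"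
 by(induction A rule: infinite_finite_induct) (auto intro: holo_on_const holo_on_add)

lemma holo_on_nth: "holo_on U (\<lambda>S. S $ i $ j)"
 unfolding holo_on_def
 by(intro ballI exI[of _ "\<lambda>B. B $ i $ j"])
  (auto intro!: bounded_linear_imp_has_derivative bounded_linear_compose[OF bounded_linear_vec_nth bounded_linear_vec_nth])

lemma ddir_nth: "ddir B (\<lambda>S. S $ i $ j) S = B $ i $ j"
 by(rule ddirI) (auto intro!: derivative_eq_intros)

lemma holo_on_cong:
 assumes U: "U \<in> osym" and fg: "!!S. S \<in> U ==> f S = g S" and f: "holo_on U f"
 shows "holo_on U g"
 unfolding holo_on_def
proof
 fix S assume S: "S \<in> U"
 then obtain L where L: "(f has_derivative L) (at S within symm)" "clin L"
  using f by(auto simp: holo_on_def)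
 obtain e where e: "e > 0" "sball S e <= U" using opens_ball[OF U S] by blast
 have "f T = g T" if "T \<in> symm" "dist T S < e" for T
  by(rule fg) (use that e(2) in \<open>auto simp: sball_def\<close>)
 moreover have "S \<in> symm" using S opens_symm[OF U] by blast
 ultimately have "(g has_derivative L) (at S within symm)"
  by(intro has_derivative_transform_within[OF L(1) e(1)]) blast+
 then show "\<exists>L. (g has_derivative L) (at S within symm) & clin L" using L(2) by blast
qed

lemma holo_on_translate:
 assumes f: "holo_on U f" and S0: "S0 \<in> symm"
 shows "holo_on {S. S0 + S \<in> U} (\<lambda>S. f (S0 + S))"
 unfolding holo_on_def
proof
 fix S assume "S \<in> {S. S0 + S \<in> U}"
 then obtain L where L: "(f has_derivative L) (at (S0 + S) within symm)" "clin L"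
  using f by(auto simp: holo_on_def)
 have "(+) S0 ` symm <= symm" using S0 by auto
 from has_derivative_subset[OF L(1) this]
 have 1: "(f has_derivative L) (at (S0 + S) within (+) S0 ` symm)" .
 have "((\<lambda>S. S0 + S) has_derivative (\<lambda>x. x)) (at S within symm)"
  by(auto intro!: derivative_eq_intros)
 from has_derivative_in_compose[OF this 1]
 have "((\<lambda>S. f (S0 + S)) has_derivative (\<lambda>x. L x)) (at S within symm)" .
 then show "\<exists>L. ((\<lambda>S. f (S0 + S)) has_derivative L) (at S within symm) & clin L"
  using L(2) by blast
qed

lemma opens_translate:
 assumes U: "U \<in> osym" and S0: "S0 \<in> symm"
 shows "{S. S0 + S \<in> U} \<in> osym"
 unfolding opens_iff
proof (intro conjI ballI subsetI)
 show "S \<in> symm" if "S \<in> {S. S0 + S \<in> U}" for S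
 proof -
  have a: "S0 + S \<in> symm" using that opens_symm[OF U] by auto
  from symm_closed(3)[OF this S0] show ?thesis by simp
 qed
 then show "S \<in> symm" if "S \<in> {S. S0 + S \<in> U}" for S using that by blast
 fix S assume "S \<in> {S. S0 + S \<in> U}"
 then obtain e where e: "e > 0" "sball (S0 + S) e <= U" using opens_ball[OF U] by blast
 then show "\<exists>e>0. sball S e <= {S. S0 + S \<in> U}"
  using S0 by(intro exI[of _ e]) (auto simp: sball_def subset_iff)
qed

context
 fixes U :: "'n::finite mat set" and S :: "'n mat" and B :: "'n mat"
 assumes U: "U \<in> osym" and S: "S \<in> U" and B: "B \<in> symm"
begin

lemma ddir_add: "holo_on U f ==> holo_on U g ==> ddir B (\<lambda>S. f S + g S) S = ddir B f S + ddir B g S"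
 by(intro ddirI DERIV_add) (rule holo_on_has_line_derivative[OF _ U S B]; assumption)+

lemma ddir_cmult: "holo_on U f ==> ddir B (\<lambda>S. c * f S) S = c * ddir B f S"
 by(intro ddirI DERIV_cmult) (rule holo_on_has_line_derivative[OF _ U S B]; assumption)+

lemma ddir_uminus: "holo_on U f ==> ddir B (\<lambda>S. - f S) S = - ddir B f S"
 using ddir_cmult[of f "-1"] by simp

lemma ddir_diff: "holo_on U f ==> holo_on U g ==> ddir B (\<lambda>S. f S - g S) S = ddir B f S - ddir B g S"
 by(intro ddirI DERIV_diff) (rule holo_on_has_line_derivative[OF _ U S B]; assumption)+

lemma ddir_mult: "holo_on U f ==> holo_on U g ==> ddir B (\<lambda>S. f S * g S) S = f S * ddir B g S + ddir B f S * g S"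
 using holo_on_has_line_derivative[OF _ U S B, of f] holo_on_has_line_derivative[OF _ U S B, of g]
 by(intro ddirI) (auto intro!: derivative_eq_intros simp: mscale.zero_left)

lemma ddir_sum: "(!!a. a \<in> A ==> holo_on U (f a)) ==> ddir B (\<lambda>S. \<Sum>a\<in>A. f a S) S = (\<Sum>a\<in>A. ddir B (f a) S)"
 by(intro ddirI DERIV_sum) (rule holo_on_has_line_derivative[OF _ U S B]; auto)

end

lemma ddir_const: "ddir B (\<lambda>S. c) S = 0"
 by(rule ddirI) simp

text \<open>Indexed by all ordered pairs, so every off-diagonal direction occurs twice. In return
  the coordinates \<open>cf B v\<close> of a symmetric matrix are simply its entries, without a case
  distinction on the diagonal.\<close>

definition Esym :: "'n * 'n => 'n::finite mat" where
 "Esym v = mscale (1/2) (mat_unit (fst v) (snd v) + mat_unit (snd v) (fst v))"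

definition cf :: "'n::finite mat => 'n * 'n => complex" where
 "cf B v = B $ fst v $ snd v"

lemma Esym_symm [simp]: "Esym v \<in> symm"
 unfolding symm_iff Esym_def mscale_nth by(simp add: mat_unit_def conj_commute add.commute)

lemma Esym_swap: "Esym (a, b) = Esym (b, a)"
 by(simp add: Esym_def add.commute)

lemma mat_unit_nth: "mat_unit a b $ i $ j = (if a = i & b = j then 1 else 0)"
 unfolding mat_unit_def vec_lambda_beta by(cases "a = i"; cases "b = j"; force)

lemma Esym_nth: "Esym v $ i $ j = (if v = (i, j) then 1 / 2 else 0) + (if v = (j, i) then 1 / 2 else 0)"
proof (cases v)
 case (Pair a b)
 show ?thesis
  unfolding Pair Esym_def mscale_nth vector_add_component mat_unit_nth fst_conv snd_conv prod.inject distrib_left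
  by(intro arg_cong2[where f = "(+)"]) (auto intro: if_cong)
qed

lemma symm_expand:
 assumes "B \<in> symm"
 shows "B = (SU v. mscale (cf B v) (Esym v))"
proof -
 have "(SU v. mscale (cf B v) (Esym v)) $ i $ j = B $ i $ j" for i j
 proof -
  have "(SU v. mscale (cf B v) (Esym v)) $ i $ j = cf B (i, j) * (1 / 2) + cf B (j, i) * (1 / 2)"
   by(simp only: sum_component mscale_nth Esym_nth distrib_left mult_delta_right sum.distrib
     sum.delta finite UNIV_I if_True)
  also have "cf B (j, i) = cf B (i, j)" using assms unfolding symm_iff cf_def by simp
  finally show ?thesis by(simp add: cf_def)
 qed
 then show ?thesis by(simp add: vec_eq_iff)
qed

lemma symm_sum: "(!!a. a \<in> A ==> f a \<in> symm) ==> sum f A \<in> symm"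
 by(induction A rule: infinite_finite_induct) auto

lemma holo_on_ddir_sum:
 assumes f: "holo_on U f" and U: "U \<in> osym" and S: "S \<in> U" and B: "!!a. a \<in> A ==> B a \<in> symm"
 shows "ddir (\<Sum>a\<in>A. B a) f S = (\<Sum>a\<in>A. ddir (B a) f S)"
 using B
proof (induction A rule: infinite_finite_induct)
 case (insert x F)
 then show ?case by(simp add: holo_on_ddir_add[OF f U S] symm_sum)
qed (auto simp: ddir_def)

lemma ddir_expand:
 assumes f: "holo_on U f" and U: "U \<in> osym" and S: "S \<in> U" and B: "B \<in> symm"
 shows "ddir B f S = (SU v. cf B v * ddir (Esym v) f S)"
proof -
 have "ddir B f S = ddir (SU v. mscale (cf B v) (Esym v)) f S" using symm_expand[OF B] by simp
 also have "... = (SU v. ddir (mscale (cf B v) (Esym v)) f S)"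
  by(rule holo_on_ddir_sum[OF f U S]) simp
 finally show ?thesis by(simp add: holo_on_ddir_mscale[OF f U S])
qed

section \<open>Iterated partial derivatives\<close>

primrec dl :: "('n * 'n) list => ('n::finite mat => complex) => 'n mat => complex" where
 "dl [] f = f"
| "dl (v # l) f = dl l (ddir (Esym v) f)"

lemma dl_cong:
 assumes U: "U \<in> osym"
 shows "(!!T. T \<in> U ==> f T = g T) ==> S \<in> U ==> dl l f S = dl l g S"
proof (induction l arbitrary: f g)
 case (Cons v l)
 have "dl l (ddir (Esym v) f) S = dl l (ddir (Esym v) g) S"
  by(rule Cons.IH) (auto intro!: ddir_cong[OF U] Cons.prems)
 then show ?case by simp
qed simp

lemma dl_translate: "dl l (\<lambda>T. f (S0 + T)) T = dl l f (S0 + T)"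
proof (induction l arbitrary: f)
 case (Cons v l)
 have "ddir (Esym v) (\<lambda>T. f (S0 + T)) = (\<lambda>T. ddir (Esym v) f (S0 + T))" by(rule ext) (rule ddir_translate)
 then show ?case using Cons by simp
qed simp

lemma dl_add:
 assumes U: "U \<in> osym" and S: "S \<in> U"
 shows "holo_on U f ==> holo_on U g ==> dl l (\<lambda>S. f S + g S) S = dl l f S + dl l g S"
proof (induction l arbitrary: f g)
 case (Cons v l)
 have "dl (v # l) (\<lambda>S. f S + g S) S = dl l (\<lambda>S. ddir (Esym v) f S + ddir (Esym v) g S) S"
  unfolding dl.simps by(rule dl_cong[OF U _ S]) (rule ddir_add[OF U _ Esym_symm Cons.prems])
 then show ?case using Cons by(simp add: holo_on_ddir[OF _ U])
qed simp

lemma dl_cmult: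
 assumes U: "U \<in> osym" and S: "S \<in> U"
 shows "holo_on U f ==> dl l (\<lambda>S. c * f S) S = c * dl l f S"
proof (induction l arbitrary: f)
 case (Cons v l)
 have "dl (v # l) (\<lambda>S. c * f S) S = dl l (\<lambda>S. c * ddir (Esym v) f S) S"
  unfolding dl.simps by(rule dl_cong[OF U _ S]) (rule ddir_cmult[OF U _ Esym_symm Cons.prems])
 then show ?case using Cons by(simp add: holo_on_ddir[OF _ U])
qed simp

lemma dl_diff:
 assumes U: "U \<in> osym" and S: "S \<in> U" and "holo_on U f" "holo_on U g"
 shows "dl l (\<lambda>S. f S - g S) S = dl l f S - dl l g S"
 using dl_add[OF U S assms(3) holo_on_cmult[OF assms(4)], of l "-1"] dl_cmult[OF U S assms(4), of l "-1"] by simp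

lemma dl_sum:
 assumes U: "U \<in> osym" and S: "S \<in> U"
 shows "(!!a. a \<in> A ==> holo_on U (f a)) ==> dl l (\<lambda>S. \<Sum>a\<in>A. f a S) S = (\<Sum>a\<in>A. dl l (f a) S)"
proof (induction A rule: infinite_finite_induct)
 case (insert x F)
 then show ?case by(simp add: dl_add[OF U S] holo_on_sum)
next
 case empty
 then show ?case using dl_cmult[OF U S holo_on_const, of l 0 0] by simp
next
 case (infinite A)
 then show ?case using dl_cmult[OF U S holo_on_const, of l 0 0] by simp
qed

lemma dl_mset:
 assumes U: "U \<in> osym" and S: "S \<in> U"
 shows "holo_on U f ==> mset l = mset l' ==> dl l f S = dl l' f S"
proof (induction l arbitrary: l' f)
 case (Cons v l)
 have move: "dl (x @ v # y) f S = dl (v # x @ y) f S" if "holo_on U f" for x y f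
  using that
 proof (induction x arbitrary: f)
  case (Cons u x)
  have "dl ((u # x) @ v # y) f S = dl (v # x @ y) (ddir (Esym u) f) S"
   using Cons.IH[OF holo_on_ddir[OF Cons.prems U]] by simp
  also have "... = dl (v # (u # x) @ y) f S"
   unfolding dl.simps append.simps
   by(rule dl_cong[OF U _ S]) (auto intro: ddir_commute[OF Cons.prems U])
  finally show ?case .
 qed simp
 have "v \<in> set l'" using Cons.prems(2) by(metis list.set_intros(1) set_mset_mset)
 then obtain x y where xy: "l' = x @ v # y" by(auto simp: in_set_conv_decomp)
 have "dl l (ddir (Esym v) f) S = dl (x @ y) (ddir (Esym v) f) S"
  by(rule Cons.IH) (use Cons.prems xy in \<open>auto intro: holo_on_ddir[OF _ U]\<close>)
 then show ?case using move[OF Cons.prems(1), of x y] xy by simp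
qed simp

abbreviation (input) "drv G v \<equiv> (\<lambda>l. G (v # l))"

text \<open>The sum of \<open>G l\<close> over all words \<open>l\<close> of length
  \<open>j\<close>, weighted by products of coordinates of \<open>B\<close>. If \<open>G\<close>
  lists the iterated derivatives at a point, it is \<open>j!\<close> times the homogeneous Taylor
  polynomial of degree \<open>j\<close>.\<close>

primrec Sw :: "nat => (('n * 'n) list => complex) => 'n::finite mat => complex" where
 "Sw 0 G B = G []"
| "Sw (Suc j) G B = (SU v. cf B v * Sw j (drv G v) B)"

text \<open>Each derivative along the line is expanded in the directions \<open>Esym v\<close>;
  linearity of \<open>Sw\<close> in its functional argument then pulls out the sum over the first
  letter.\<close>

lemma line_derivs_eq_Sw:
 assumes U: "U \<in> osym" and S: "S \<in> U" and B: "B \<in> symm"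
 shows "holo_on U f ==> (deriv ^^ j) (ray f S B) 0 = Sw j (\<lambda>l. dl l f S) B"
proof (induction j arbitrary: f)
 case 0
 then show ?case by(simp add: mscale.zero_left)
next
 case (Suc j)
 have 1: "deriv (ray f S B) = ray (ddir B f) S B"
  by(rule ext) (rule ddir_line)
 have lin: "Sw j (\<lambda>l. \<Sum>v\<in>A. c v * G v l) B = (\<Sum>v\<in>A. c v * Sw j (G v) B)"
  for A :: "('a * 'a) set" and c and G :: "'a * 'a => ('a * 'a) list => complex" and j
 proof (induction j arbitrary: G)
  case (Suc j)
  have "Sw (Suc j) (\<lambda>l. \<Sum>v\<in>A. c v * G v l) B = (SU u. \<Sum>v\<in>A. c v * (cf B u * Sw j (\<lambda>l. G v (u # l)) B))"
   by(simp add: Suc.IH sum_distrib_left mult.left_commute)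
  also have "... = (\<Sum>v\<in>A. SU u. c v * (cf B u * Sw j (\<lambda>l. G v (u # l)) B))" by(rule sum.swap)
  finally show ?case by(simp add: sum_distrib_left)
 qed simp
 have "(deriv ^^ Suc j) (ray f S B) 0 = (deriv ^^ j) (ray (ddir B f) S B) 0"
  by(simp add: funpow_Suc_right 1 del: funpow.simps)
 also have "... = Sw j (\<lambda>l. dl l (ddir B f) S) B" by(rule Suc.IH[OF holo_on_ddir[OF Suc.prems U B]])
 also have "(\<lambda>l. dl l (ddir B f) S) = (\<lambda>l. SU v. cf B v * dl (v # l) f S)"
 proof
  fix l
  have "dl l (ddir B f) S = dl l (\<lambda>S. SU v. cf B v * ddir (Esym v) f S) S"
   by(rule dl_cong[OF U _ S]) (rule ddir_expand[OF Suc.prems U _ B])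
  also have "... = (SU v. dl l (\<lambda>S. cf B v * ddir (Esym v) f S) S)"
   by(rule dl_sum[OF U S]) (simp add: holo_on_cmult holo_on_ddir[OF Suc.prems U])
  also have "... = (SU v. cf B v * dl (v # l) f S)"
   by(simp add: dl_cmult[OF U S holo_on_ddir[OF Suc.prems U]])
  finally show "dl l (ddir B f) S = (SU v. cf B v * dl (v # l) f S)" .
 qed
 also have "Sw j (\<lambda>l. SU v. cf B v * dl (v # l) f S) B = Sw (Suc j) (\<lambda>l. dl l f S) B"
  using lin[where A = UNIV and c = "cf B" and G = "\<lambda>v l. dl (v # l) f S"] by simp
 finally show ?case .
qed

lemma Sw_zero: "(!!l. length l = j ==> G l = 0) ==> Sw j G B = 0"
 by(induction j arbitrary: G) simp_all

text \<open>The derivatives of \<open>f\<close> along the line from \<open>S\<close> to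
  \<open>T\<close> are linear combinations of the \<open>dl l f S\<close>, so the one-variable
  identity theorem applies. The disc is chosen with radius \<open>q > 1\<close>, so that it contains
  \<open>t = 1\<close>.\<close>

lemma holo_identity:
 assumes f: "holo_on (sball S r) f" and S: "S \<in> symm" and z: "!!l. dl l f S = 0" and T: "T \<in> sball S r"
 shows "f T = 0"
proof -
 have r: "r > 0" using T by(auto simp: sball_def intro: le_less_trans[OF zero_le_dist])
 define B where "B = T - S"
 have B: "B \<in> symm" "norm B < r" using T S by(auto simp: B_def sball_def dist_norm)
 define h where "h = ray f S B"
 obtain c where c: "norm B < c" "c < r" using dense[OF B(2)] by blast
 have d: "c > 0" using c(1) by(rule le_less_trans[OF norm_ge_zero])
 define q where "q = r / c"
 have q: "q > 1" using d c(2) by(simp add: q_def)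
 have inb: "S + mscale t B \<in> sball S r" if "t \<in> ball 0 q" for t
 proof -
  have "norm t * norm B <= norm t * c" using c(1) by(intro mult_left_mono) auto
  also have "... < q * c" using that d by(intro mult_strict_right_mono) auto
  also have "... = r" using d by(simp add: q_def)
  finally show ?thesis using S B by(simp add: sball_def dist_norm norm_mscale)
 qed
 have "h 1 = 0"
 proof (rule holomorphic_fun_eq_0_on_ball[of h 0 q 1])
  show "h holomorphic_on ball 0 q"
   unfolding h_def by(rule holo_on_line[OF f sball_opens B(1)]) (rule inb)
  show "1 \<in> ball (0::complex) q" using q by simp
  show "(deriv ^^ n) h 0 = 0" for n
   unfolding h_def line_derivs_eq_Sw[OF sball_opens center_sball[OF S r] B(1) f]
   by(rule Sw_zero) (rule z)
 qed
 moreover have "S + mscale 1 B = T" unfolding B_def by(simp add: vec_eq_iff)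
 ultimately show ?thesis by(simp only: h_def)
qed

section \<open>Cauchy estimates\<close>

text \<open>Cauchy's inequality on a disc of radius \<open>\<delta> / (2 * e)\<close>, over which
  the line moves by at most \<open>\<delta> / 2\<close>.\<close>

lemma ddir_bound:
 assumes f: "holo_on (sball S \<rho>) f" and S: "S \<in> symm" and M: "!!T. T \<in> sball S \<rho> ==> norm (f T) <= M"
  and \<delta>: "\<delta> > 0" and T: "T \<in> sball S (\<rho> - \<delta>)" and B: "B \<in> symm" "norm B <= e" and e: "e > 0"
 shows "norm (ddir B f T) <= M * (2 * e / \<delta>)"
proof -
 define h where "h = ray f T B"
 define r where "r = \<delta> / (2 * e)"
 have r: "r > 0" using \<delta> e by(simp add: r_def)
 have inb: "T + mscale t B \<in> sball S \<rho>" if "norm t <= r" for t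
 proof -
  have "norm t * norm B <= r * e" using that B e r by(intro mult_mono) auto
  also have "... = \<delta> / 2" using e by(simp add: r_def)
  finally have "norm (mscale t B) < \<delta>" using \<delta> by(simp add: norm_mscale)
  moreover have "dist (T + mscale t B) S <= norm (mscale t B) + dist T S"
   using dist_triangle[of "T + mscale t B" S T] by(simp add: dist_norm)
  moreover have "dist T S < \<rho> - \<delta>" "T \<in> symm" using T by(simp_all add: sball_def)
  ultimately show ?thesis using B by(simp add: sball_def)
 qed
 have hol: "h holomorphic_on cball 0 r"
  unfolding h_def by(rule holo_on_line[OF f sball_opens B(1)]) (rule inb, simp)
 have "norm ((deriv ^^ 1) h 0) <= fact 1 * M / r ^ 1"
 proof (rule Cauchy_inequality)
  show "h holomorphic_on ball 0 r" using hol ball_subset_cball by(rule holomorphic_on_subset)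
  show "continuous_on (cball 0 r) h" using hol by(rule holomorphic_on_imp_continuous_on)
  show "norm (h t) <= M" if "norm (0 - t) = r" for t
   unfolding h_def by(rule M) (rule inb, use that in simp)
 qed (rule r)
 then show ?thesis by(simp add: ddir_def h_def r_def)
qed

text \<open>\<open>k ^ k / k!\<close> is a single term of the exponential series at
  \<open>k\<close>.\<close>

lemma power_le_fact: "real k ^ k <= exp 1 ^ k * fact k"
proof -
 have "(\<lambda>n. real k ^ n / fact n) sums exp (real k)"
  using exp_converges[of "real k"] by(simp add: divide_inverse mult.commute scaleR_conv_of_real)
 then have "(\<Sum>n\<in>{k}. real k ^ n / fact n) <= exp (real k)"
  using sum_le_suminf[of "\<lambda>n. real k ^ n / fact n" "{k}"] by(simp add: sums_iff)
 moreover have "exp (real k) = exp 1 ^ k" using exp_of_nat_mult[of k "1::real"] by simp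
 ultimately show ?thesis by(simp add: divide_le_eq)
qed

text \<open>Every derivative costs a margin \<open>\<delta>\<close> of the radius and a factor
  \<open>2 * e / \<delta>\<close>. For a word of length \<open>k\<close> the margin
  \<open>r / (2 * k)\<close> uses up half of the ball, and the resulting \<open>k ^ k\<close> is at
  most \<open>exp 1 ^ k * k!\<close>.\<close>

lemma dl_growth:
 assumes f: "holo_on U f" and U: "U \<in> osym" and S: "S \<in> U"
 obtains C R where "C >= 0" "R >= 0" "!!l. norm (dl l f S) <= fb C R (length l)"
proof -
 obtain r M where r: "r > 0" "sball S r <= U" "!!T. T \<in> sball S r ==> norm (f T) <= M" "M >= 0"
  by(rule locally_bounded[OF holo_on_continuous_on[OF f U] U S]) (rule that)
 have Ss: "S \<in> symm" using S opens_symm[OF U] by auto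
 define e where "e = 1 + (SU v. norm (Esym v :: 'a mat))"
 have e: "e > 0" by(simp add: e_def add_pos_nonneg sum_nonneg)
 have Ee: "norm (Esym v :: 'a mat) <= e" for v
  using member_le_sum[of v UNIV "\<lambda>v. norm (Esym v :: 'a mat)"] by(simp add: e_def)
 have step: "norm (dl l g T) <= M' * (2 * e / \<delta>) ^ length l"
  if "holo_on (sball S \<rho>) g" "!!T. T \<in> sball S \<rho> ==> norm (g T) <= M'" "\<delta> > 0"
   "T \<in> sball S (\<rho> - length l * \<delta>)" for l g T and \<rho> M' \<delta> :: real
  using that
 proof (induction l arbitrary: g \<rho> M')
  case (Cons v l)
  have sub: "sball S (\<rho> - \<delta>) <= sball S \<rho>" using Cons.prems(3) by(auto simp: sball_def)
  have "norm (dl l (ddir (Esym v) g) T) <= (M' * (2 * e / \<delta>)) * (2 * e / \<delta>) ^ length l"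
  proof (rule Cons.IH)
   show "holo_on (sball S (\<rho> - \<delta>)) (ddir (Esym v) g)"
    using holo_on_ddir[OF Cons.prems(1) sball_opens Esym_symm] sub by(rule holo_on_subset)
   show "norm (ddir (Esym v) g T) <= M' * (2 * e / \<delta>)" if "T \<in> sball S (\<rho> - \<delta>)" for T
    by(rule ddir_bound[OF Cons.prems(1) Ss Cons.prems(2) Cons.prems(3) that Esym_symm Ee e])
   show "T \<in> sball S (\<rho> - \<delta> - real (length l) * \<delta>)"
    using Cons.prems(4) by(simp add: algebra_simps)
  qed (rule Cons.prems(3))
  then show ?case by simp
 qed (auto simp: sball_def)
 show ?thesis
 proof (rule that[of M "4 * e * exp 1 / r"])
  show "M >= 0" by(rule r)
  show "4 * e * exp 1 / r >= 0" using e r by simp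
  fix l :: "('a * 'a) list"
  show "norm (dl l f S) <= fb M (4 * e * exp 1 / r) (length l)"
  proof (cases "l = []")
   case True
   then show ?thesis using r(3)[OF center_sball[OF Ss r(1)]] by simp
  next
   case False
   define k where "k = length l"
   have k: "k > 0" using False by(simp add: k_def)
   define \<delta> where "\<delta> = r / (2 * k)"
   have \<delta>: "\<delta> > 0" using r k by(simp add: \<delta>_def)
   have eq: "r - length l * \<delta> = r / 2" using k by(simp add: \<delta>_def k_def[symmetric])
   have "S \<in> sball S (r - length l * \<delta>)" unfolding eq by(rule center_sball[OF Ss]) (use r(1) in simp)
   then have "norm (dl l f S) <= M * (2 * e / \<delta>) ^ length l"
    by(intro step[OF holo_on_subset[OF f r(2)] r(3) \<delta>]) auto
   also have "2 * e / \<delta> = 4 * e / r * k" using r k by(simp add: \<delta>_def)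
   also have "M * (4 * e / r * k) ^ length l = M * ((4 * e / r) ^ k * real k ^ k)"
    by(simp only: power_mult_distrib k_def)
   also have "... <= M * ((4 * e / r) ^ k * (exp 1 ^ k * fact k))"
    using r e by(intro mult_left_mono power_le_fact) auto
   also have "... = fb M (4 * e * exp 1 / r) (length l)"
    by(simp add: k_def power_mult_distrib power_divide)
   finally show ?thesis .
  qed
 qed
qed

section \<open>Power series\<close>

definition PS :: "(('n * 'n) list => complex) => 'n::finite mat => complex" where
 "PS G S = suminf (\<lambda>j. Sw j G S / fact j)"

text \<open>What the iterated derivatives of an analytic function at a point satisfy: the growth
  that makes the series converge, independence of the order of differentiation, and the symmetry
  coming from \<open>Esym (a, b) = Esym (b, a)\<close>. The last is asked of the first letter only,
  as permutations carry it to the others.\<close>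

definition good :: "(('n * 'n) list => complex) => real => real => bool" where
 "good G K R \<longleftrightarrow> K >= 0 & R > 0 & (\<forall>l. norm (G l) <= fb K R (length l)) &
  (\<forall>l l'. mset l = mset l' --> G l = G l') & (\<forall>a b l. G ((a, b) # l) = G ((b, a) # l))"

lemma goodD:
 assumes "good G K R"
 shows "K >= 0" "R > 0" "norm (G l) <= fb K R (length l)"
  "mset l = mset l' ==> G l = G l'" "G ((a, b) # l) = G ((b, a) # l)"
 using assms unfolding good_def by blast+

text \<open>One more derivative multiplies the bound by \<open>length l + 1\<close>, which is at
  most \<open>2 ^ length l\<close>; this is why the rate doubles.\<close>

lemma good_Cons:
 fixes G :: "('n::finite \<times> 'n) list => complex"
 assumes g: "good G K R"
 shows "good (drv G v) (K * R) (2 * R)"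
 unfolding good_def
proof (intro conjI allI impI)
 show "K * R >= 0" "2 * R > 0" using goodD(1,2)[OF g] by auto
 fix l
 have "norm (G (v # l)) <= K * R ^ length (v # l) * fact (length (v # l))" by(rule goodD(3)[OF g])
 also have "... = K * R * R ^ length l * fact (length l) * real (Suc (length l))" by(simp add: algebra_simps)
 also have "... <= K * R * R ^ length l * fact (length l) * 2 ^ length l"
 proof (intro mult_left_mono)
  show "real (Suc (length l)) <= 2 ^ length l"
   using less_exp[of "length l"] by(metis Suc_leI of_nat_le_iff of_nat_numeral of_nat_power)
 qed (use goodD(1,2)[OF g] in auto)
 finally show "norm (G (v # l)) <= K * R * (2 * R) ^ length l * fact (length l)"
  by(simp add: power_mult_distrib ac_simps)
next
 show "G (v # l) = G (v # l')" if "mset l = mset l'" for l l'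
  by(rule goodD(4)[OF g]) (simp add: that)
 show "G (v # (a, b) # l) = G (v # (b, a) # l)" for a b l
 proof -
  have "G (v # (a, b) # l) = G ((a, b) # v # l)" by(rule goodD(4)[OF g]) simp
  also have "... = G ((b, a) # v # l)" by(rule goodD(5)[OF g])
  also have "... = G (v # (b, a) # l)" by(rule goodD(4)[OF g]) simp
  finally show ?thesis .
 qed
qed

lemma cf_le: "norm (cf S v) <= norm S"
 unfolding cf_def by(meson Finite_Cartesian_Product.norm_nth_le order_trans)

lemma Sw_bound:
 fixes G :: "('n::finite \<times> 'n) list => complex" and K b :: real
 assumes "!!l. length l = j ==> norm (G l) <= K" "norm S <= b"
 shows "norm (Sw j G S) <= K * (CARD('n * 'n) * b) ^ j"
 using assms(1)
proof (induction j arbitrary: G)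
 case (Suc j)
 have b: "b >= 0" using assms(2) norm_ge_zero order_trans by blast
 have IH: "norm (Sw j (drv G v) S) <= K * (CARD('n * 'n) * b) ^ j" for v
  by(rule Suc.IH) (simp add: Suc.prems)
 have "norm (Sw (Suc j) G S) <= (SU v. norm (cf S v * Sw j (drv G v) S))"
  by(simp only: Sw.simps norm_sum)
 also have "... <= (\<Sum>v\<in>(UNIV :: ('n * 'n) set). b * (K * (CARD('n * 'n) * b) ^ j))"
  unfolding norm_mult
  by(intro sum_mono mult_mono IH b order_trans[OF cf_le assms(2)]) auto
 also have "... = K * (CARD('n * 'n) * b) ^ Suc j" by(simp add: algebra_simps)
 finally show ?case .
qed simp

lemma continuous_on_cf [continuous_intros]: "continuous_on A (\<lambda>S. cf S v)"
 unfolding cf_def by(intro continuous_intros)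

lemma continuous_on_Sw: "continuous_on A (Sw j G)"
proof (induction j arbitrary: G)
 case (Suc j)
 have "continuous_on A (\<lambda>S. SU v. cf S v * Sw j (drv G v) S)"
  by(intro continuous_on_sum continuous_on_mult continuous_on_cf Suc)
 then show ?case by simp
qed simp

lemma cf_line: "cf (S + mscale t B) v = cf S v + t * cf B v"
 by(simp add: cf_def)

text \<open>By symmetry of \<open>G\<close> the letter that is differentiated can be moved to the
  front, so the product rule yields \<open>Suc j\<close> equal contributions.\<close>

lemma Sw_line_derivative:
 fixes G :: "('n::finite \<times> 'n) list => complex"
 assumes "!!l l'. mset l = mset l' ==> G l = G l'"
 shows "((\<lambda>t. Sw (Suc j) G (S + mscale t B)) has_field_derivative
  (of_nat (Suc j) * (SU u. cf B u * Sw j (drv G u) (S + mscale t B)))) (at t)"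
 using assms
proof (induction j arbitrary: G)
 case 0
 show ?case
  by(auto intro!: derivative_eq_intros simp: cf_line)
next
 case (Suc j)
 let ?S = "S + mscale t B"
 have sym: "(\<lambda>l. G (v # u # l)) = (\<lambda>l. G (u # v # l))" for u v
  by(rule ext) (rule Suc.prems, simp)
 have 1: "((\<lambda>t. Sw (Suc j) (drv G v) (S + mscale t B)) has_field_derivative
  (of_nat (Suc j) * (SU u. cf B u * Sw j (\<lambda>l. G (v # u # l)) ?S))) (at t)" for v
  by(rule Suc.IH) (rule Suc.prems, simp)
 have "((\<lambda>t. SU v. (cf S v + t * cf B v) * Sw (Suc j) (drv G v) (S + mscale t B)) has_field_derivative
  (SU v. (of_nat (Suc j) * (SU u. cf B u * Sw j (\<lambda>l. G (v # u # l)) ?S)) * cf ?S v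
    + cf B v * Sw (Suc j) (drv G v) ?S)) (at t)"
  by(rule DERIV_sum) (auto intro!: derivative_eq_intros 1 simp del: Sw.simps simp: cf_line)
 also have "(SU v. (of_nat (Suc j) * (SU u. cf B u * Sw j (\<lambda>l. G (v # u # l)) ?S)) * cf ?S v
    + cf B v * Sw (Suc j) (drv G v) ?S)
  = of_nat (Suc (Suc j)) * (SU u. cf B u * Sw (Suc j) (drv G u) ?S)"
 proof -
  have "(SU v. (SU u. cf B u * Sw j (\<lambda>l. G (v # u # l)) ?S) * cf ?S v)
   = (SU v u. cf B u * (cf ?S v * Sw j (\<lambda>l. G (u # v # l)) ?S))"
  proof (rule sum.cong[OF refl])
   fix v
   show "(SU u. cf B u * Sw j (\<lambda>l. G (v # u # l)) ?S) * cf ?S v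
    = (SU u. cf B u * (cf ?S v * Sw j (\<lambda>l. G (u # v # l)) ?S))"
    unfolding sum_distrib_right by(rule sum.cong) (simp_all only: sym[of v] ac_simps)
  qed
  also have "... = (SU u v. cf B u * (cf ?S v * Sw j (\<lambda>l. G (u # v # l)) ?S))" by(rule sum.swap)
  also have "... = (SU u. cf B u * Sw (Suc j) (drv G u) ?S)" by(simp add: sum_distrib_left)
  finally have "(SU v. (of_nat (Suc j) * (SU u. cf B u * Sw j (\<lambda>l. G (v # u # l)) ?S)) * cf ?S v)
   = of_nat (Suc j) * (SU u. cf B u * Sw (Suc j) (drv G u) ?S)"
   by(simp only: mult.assoc sum_distrib_left[symmetric])
  then show ?thesis
   by(simp only: sum.distrib of_nat_Suc[of "Suc j"] distrib_right mult_1_left add.commute)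
 qed
 finally show ?case by(simp only: Sw.simps(2)[of "Suc j"] cf_line)
qed

context
 fixes G :: "('n::finite \<times> 'n) list => complex" and K R :: real
 assumes G: "good G K R"
begin

lemma Sw_term_bound:
 fixes F :: "('n * 'n) list => complex"
 assumes "!!l. length l = j ==> norm (F l) <= C * R ^ j * fact j" "norm S <= b"
 shows "norm (Sw j F S / fact j) <= C * (real CARD('n * 'n) * R * b) ^ j"
proof -
 have "norm (Sw j F S) <= (C * R ^ j * fact j) * (real CARD('n * 'n) * b) ^ j"
  by(rule Sw_bound[OF _ assms(2)]) (rule assms(1))
 from divide_right_mono[OF this, of "fact j"] show ?thesis by(simp add: norm_divide power_mult_distrib ac_simps)
qed

lemma PS_term_bound: "norm S <= b ==> norm (Sw j G S / fact j) <= K * (real CARD('n * 'n) * R * b) ^ j"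
 by(rule Sw_term_bound) (use goodD(3)[OF G] in auto)

lemma PS_term_bound_Cons:
 "norm S <= b ==> norm (Sw j (drv G u) S / fact j) <= K * R * (of_nat (Suc j) * (real CARD('n * 'n) * R * b) ^ j)"
 using Sw_term_bound[of j "\<lambda>l. G (u # l)" "K * R * Suc j" S b] goodD(3)[OF G, of "u # _"] by(auto simp: algebra_simps)

section \<open>Convergence on the ball of radius \<open>\<rho>\<close>\<close>

context
 fixes \<rho> :: real
 assumes \<rho>: "real CARD('n * 'n) * R * \<rho> <= 1"
begin

lemma PS_radius: "b < \<rho> ==> b >= 0 ==> 0 <= real CARD('n * 'n) * R * b & real CARD('n * 'n) * R * b < 1"
proof
 assume b: "b < \<rho>" "b >= 0"
 have N: "real CARD('n * 'n) > 0" using zero_less_card_finite[where 'a = "'n * 'n"] by simp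
 then have "real CARD('n * 'n) * R > 0" using goodD(2)[OF G] by simp
 then show "0 <= real CARD('n * 'n) * R * b" using b by simp
 have "real CARD('n * 'n) * R * b < real CARD('n * 'n) * R * \<rho>" using b(1) \<open>real CARD('n * 'n) * R > 0\<close> by(rule mult_strict_left_mono)
 then show "real CARD('n * 'n) * R * b < 1" using \<rho> by(rule less_le_trans)
qed

lemma PS_summable:
 assumes "norm S < \<rho>"
 shows "summable (\<lambda>j. Sw j G S / fact j)"
proof (rule summable_comparison_test')
 show "summable (\<lambda>j. K * (real CARD('n * 'n) * R * norm S) ^ j)"
  using PS_radius[OF assms] by(intro summable_mult summable_geometric) simp
 show "norm (Sw j G S / fact j) <= K * (real CARD('n * 'n) * R * norm S) ^ j" if "j >= 0" for j
  by(rule PS_term_bound) simp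
qed

lemma PS_summable_Cons:
 assumes "norm S < \<rho>"
 shows "summable (\<lambda>j. Sw j (drv G u) S / fact j)"
proof (rule summable_comparison_test')
 show "summable (\<lambda>j. K * R * (of_nat (Suc j) * (real CARD('n * 'n) * R * norm S) ^ j))"
  using PS_radius[OF assms] by(intro summable_mult sums_summable[OF geometric_deriv_sums]) simp
 show "norm (Sw j (drv G u) S / fact j) <= K * R * (of_nat (Suc j) * (real CARD('n * 'n) * R * norm S) ^ j)" if "j >= 0" for j
  by(rule PS_term_bound_Cons) simp
qed

text \<open>Termwise differentiation by the Weierstrass test, on a disc so small that the norm along
  the line stays at most some \<open>b < \<rho>\<close>. The majorant is a differentiated geometric
  series.\<close>

lemma PS_line_derivative:
 assumes S: "norm S < \<rho>"
 shows "((\<lambda>t. PS G (S + mscale t B)) has_field_derivative (SU u. cf B u * PS (drv G u) S)) (at 0)"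
proof -
 obtain b where b: "norm S < b" "b < \<rho>" using dense[OF S] by blast
 have b0: "b >= 0" using b(1) norm_ge_zero[of S] by linarith
 define \<tau> where "\<tau> = (b - norm S) / (norm B + 1)"
 have nB: "norm B + 1 > 0" by(simp add: add_nonneg_pos)
 have \<tau>: "\<tau> > 0" using b nB by(simp add: \<tau>_def)
 have inb: "norm (S + mscale t B) <= b" if "t \<in> ball 0 \<tau>" for t
 proof -
  have "norm t * norm B <= \<tau> * (norm B + 1)" using that \<tau> by(intro mult_mono) auto
  also have "... = b - norm S" using nB by(simp add: \<tau>_def)
  finally show ?thesis using norm_triangle_ineq[of S "mscale t B"] by(simp add: norm_mscale)
 qed
 define f where "f n t = Sw n G (S + mscale t B) / fact n" for n t
 define f' where "f' n t = (case n of 0 => 0 | Suc j =>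
  (SU u. cf B u * (Sw j (drv G u) (S + mscale t B) / fact j)))" for n t
 have der: "(f n has_field_derivative f' n t) (at t)" for n t
 proof (cases n)
  case 0
  then show ?thesis unfolding f_def f'_def by simp
 next
  case (Suc j)
  have "((\<lambda>t. Sw (Suc j) G (S + mscale t B) / fact (Suc j)) has_field_derivative
   (of_nat (Suc j) * (SU u. cf B u * Sw j (drv G u) (S + mscale t B))) / fact (Suc j)) (at t)"
   by(rule DERIV_cdivide, rule Sw_line_derivative) (rule goodD(4)[OF G])
  also have "(of_nat (Suc j) * (SU u. cf B u * Sw j (drv G u) (S + mscale t B))) / fact (Suc j) = f' n t"
   unfolding f'_def Suc by(simp add: sum_divide_distrib del: of_nat_Suc)
  finally show ?thesis unfolding f_def Suc .
 qed
 define M where "M n = (case n of 0 => 0 | Suc j => real CARD('n * 'n) * (norm B * (K * R * (of_nat (Suc j) * (real CARD('n * 'n) * R * b) ^ j))))" for n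
 have le: "norm (f' n t) <= M n" if "t \<in> ball 0 \<tau>" for n t
 proof (cases n)
  case (Suc j)
  have "norm (SU u. cf B u * (Sw j (drv G u) (S + mscale t B) / fact j))
   <= (\<Sum>u\<in>(UNIV :: ('n * 'n) set). norm B * (K * R * (of_nat (Suc j) * (real CARD('n * 'n) * R * b) ^ j)))"
   by(rule sum_norm_le) (simp only: norm_mult, intro mult_mono cf_le PS_term_bound_Cons inb that, auto)
  then show ?thesis by(simp add: f'_def M_def Suc)
 qed (simp add: f'_def M_def)
 have "summable (\<lambda>j. M (Suc j))"
  unfolding M_def nat.case
  by(intro summable_mult sums_summable[OF geometric_deriv_sums]) (use PS_radius[OF b(2) b0] in simp)
 then have M: "summable M" by(simp only: summable_Suc_iff)
 have uc: "uniformly_convergent_on (ball 0 \<tau>) (\<lambda>n t. \<Sum>i<n. f' i t)"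
  using le M by(rule Weierstrass_m_test')
 have "((\<lambda>t. suminf (\<lambda>n. f n t)) has_field_derivative suminf (\<lambda>n. f' n 0)) (at 0)"
 proof (rule has_field_derivative_series'(2)[OF _ _ uc])
  show "convex (ball (0::complex) \<tau>)" by simp
  show "(f n has_field_derivative f' n t) (at t within ball 0 \<tau>)" for n t
   using der by(rule has_field_derivative_at_within)
  show "0 \<in> ball (0::complex) \<tau>" "0 \<in> interior (ball (0::complex) \<tau>)" using \<tau> by simp_all
  show "summable (\<lambda>n. f n 0)" unfolding f_def using PS_summable[OF S] by(simp add: mscale.zero_left)
 qed
 moreover have "suminf (\<lambda>n. f' n 0) = (SU u. cf B u * PS (drv G u) S)"
 proof -
  have sm: "summable (\<lambda>n. f' n 0)"
   by(rule summable_comparison_test'[OF M]) (rule le, use \<tau> in simp)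
  have "f' 0 0 = 0" by(simp add: f'_def)
  then have "suminf (\<lambda>n. f' n 0) = suminf (\<lambda>n. f' (Suc n) 0)" by(simp only: suminf_split_head[OF sm] diff_zero)
  also have "... = suminf (\<lambda>n. SU u. cf B u * (Sw n (drv G u) S / fact n))"
   by(simp add: f'_def mscale.zero_left)
  also have "... = (SU u. suminf (\<lambda>n. cf B u * (Sw n (drv G u) S / fact n)))"
   by(rule suminf_sum) (intro summable_mult PS_summable_Cons S)
  also have "... = (SU u. cf B u * PS (drv G u) S)"
   unfolding PS_def by(intro sum.cong refl suminf_mult PS_summable_Cons S)
  finally show ?thesis .
 qed
 ultimately show ?thesis by(simp add: f_def PS_def)
qed

lemma PS_continuous: "continuous_on (sball 0 \<rho>) (PS G)"
 unfolding continuous_on_eq_continuous_within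
proof
 fix S :: "'n mat" assume S: "S \<in> sball 0 \<rho>"
 then have "norm S < \<rho>" by(simp add: sball_def)
 then obtain b where b: "norm S < b" "b < \<rho>" using dense by blast
 have b0: "b >= 0" using b(1) norm_ge_zero[of S] by linarith
 have "uniformly_convergent_on (ball 0 b) (\<lambda>n S. \<Sum>j<n. Sw j G S / fact j)"
 proof (rule Weierstrass_m_test')
  show "norm (Sw j G S / fact j) <= K * (real CARD('n * 'n) * R * b) ^ j" if "S \<in> ball 0 b" for j S
   by(rule PS_term_bound) (use that in simp)
  show "summable (\<lambda>j. K * (real CARD('n * 'n) * R * b) ^ j)"
   using PS_radius[OF b(2) b0] by(intro summable_mult summable_geometric) simp
 qed
 then have "uniform_limit (ball 0 b) (\<lambda>n S. \<Sum>j<n. Sw j G S / fact j) (PS G) sequentially"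
  by(simp add: uniformly_convergent_uniform_limit_iff suminf_eq_lim PS_def[abs_def])
 then have "continuous_on (ball 0 b) (PS G)"
  by(rule uniform_limit_theorem[rotated])
   (auto intro!: always_eventually continuous_intros continuous_on_Sw)
 then have "continuous (at S) (PS G)" using b(1) by(simp add: continuous_on_eq_continuous_at)
 then show "continuous (at S within sball 0 \<rho>) (PS G)" by(rule continuous_at_imp_continuous_at_within)
qed

lemma ddir_PS: "norm S < \<rho> ==> ddir B (PS G) S = (SU u. cf B u * PS (drv G u) S)"
 by(rule ddirI) (rule PS_line_derivative)

lemma holo_on_PS: "holo_on (sball 0 \<rho>) (PS G)"
proof (rule holo_onI[OF sball_opens PS_continuous])
 fix S B C :: "'n mat" assume "S \<in> sball 0 \<rho>"
 then have S: "norm S < \<rho>" by(simp add: sball_def)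
 show "(\<lambda>t. PS G (S + mscale t B)) field_differentiable at 0"
  unfolding field_differentiable_def using PS_line_derivative[OF S] by blast
 show "ddir (B + C) (PS G) S = ddir B (PS G) S + ddir C (PS G) S"
  by(simp add: ddir_PS[OF S] cf_def distrib_right sum.distrib)
qed

text \<open>\<open>Esym v\<close> has coordinate 1/2 at \<open>v\<close> and 1/2 at its swap, the
  two adding up on the diagonal; the swap symmetry of \<open>G\<close> combines the halves.\<close>

lemma ddir_Esym_PS:
 assumes "norm S < \<rho>"
 shows "ddir (Esym v) (PS G) S = PS (drv G v) S"
proof -
 obtain a b where v: "v = (a, b)" by(cases v)
 have "ddir (Esym v) (PS G) S = (SU u. (if v = u then 1 / 2 * PS (drv G u) S else 0)
   + (if u = (b, a) then 1 / 2 * PS (drv G u) S else 0))"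
  unfolding ddir_PS[OF assms]
 proof (rule sum.cong[OF refl])
  fix u :: "'n * 'n"
  have "cf (Esym v) u = (if v = u then 1 / 2 else 0) + (if u = (b, a) then 1 / 2 else 0)"
   unfolding cf_def Esym_nth v by(cases u) (intro arg_cong2[where f = "(+)"]; auto intro: if_cong)
  then show "cf (Esym v) u * PS (drv G u) S = (if v = u then 1 / 2 * PS (drv G u) S else 0)
   + (if u = (b, a) then 1 / 2 * PS (drv G u) S else 0)"
   by(simp only: distrib_right mult_delta_left)
 qed
 also have "... = 1 / 2 * PS (drv G v) S + 1 / 2 * PS (drv G (b, a)) S"
  by(simp only: sum.distrib sum.delta sum.delta' finite UNIV_I if_True)
 also have "drv G (b, a) = drv G v" unfolding v by(rule ext) (rule goodD(5)[OF G])
 finally show ?thesis by simp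
qed

end

end

lemma PS_0: "PS G 0 = G []"
proof -
 have "Sw j G 0 / fact j = 0" if "j \<notin> {0}" for j
  using that by(cases j) (simp_all add: cf_def)
 then have "PS G 0 = (\<Sum>j\<in>{0}. Sw j G 0 / fact j)" unfolding PS_def by(intro suminf_finite) auto
 then show ?thesis by simp
qed

text \<open>The radius available for the shifted coefficients shrinks with every letter, but only
  the value at 0 is read off. The induction over the word therefore keeps \<open>G\<close>,
  \<open>K\<close> and \<open>R\<close> general.\<close>

lemma dl_PS: "good G K R ==> dl l (PS G) 0 = G l"
proof (induction l arbitrary: G K R)
 case Nil
 then show ?case by(simp add: PS_0)
next
 case (Cons v l)
 define \<rho> where "\<rho> = 1 / (real CARD('a * 'a) * R)"
 have NR: "real CARD('a * 'a) * R > 0" using goodD(2)[OF Cons.prems] by simp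
 have \<rho>: "real CARD('a * 'a) * R * \<rho> <= 1" "\<rho> > 0" using NR unfolding \<rho>_def by simp_all
 have "dl (v # l) (PS G) 0 = dl l (PS (drv G v)) 0"
  unfolding dl.simps
  by(rule dl_cong[OF sball_opens[of 0 \<rho>]])
   (use \<rho> in \<open>auto simp: sball_def intro!: ddir_Esym_PS[OF Cons.prems]\<close>)
 also have "... = G (v # l)" by(rule Cons.IH) (rule good_Cons[OF Cons.prems])
 finally show ?case .
qed

lemma Sw_add: "Sw j (\<lambda>l. G l + H l) S = Sw j G S + Sw j H S"
 by(induction j arbitrary: G H) (simp_all add: distrib_left sum.distrib)

lemma Sw_cmult: "Sw j (\<lambda>l. c * G l) S = c * Sw j G S"
 by(induction j arbitrary: G) (simp_all add: sum_distrib_left mult.left_commute)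

lemma PS_add:
 assumes "summable (\<lambda>j. Sw j G S / fact j)" "summable (\<lambda>j. Sw j H S / fact j)"
 shows "PS (\<lambda>l. G l + H l) S = PS G S + PS H S"
 unfolding PS_def Sw_add add_divide_distrib using suminf_add[OF assms] by simp

lemma PS_cmult:
 assumes "summable (\<lambda>j. Sw j G S / fact j)"
 shows "PS (\<lambda>l. c * G l) S = c * PS G S"
 unfolding PS_def Sw_cmult using suminf_mult[OF assms, of c] by simp

section \<open>Taylor polynomials\<close>

definition truncate :: "nat => (('n * 'n) list => complex) => ('n * 'n) list => complex" where
 "truncate r G l = (if length l <= r then G l else 0)"

text \<open>Bounds for every rate \<open>R\<close> make the series converge on all of
  \<open>symm\<close>. Truncations satisfy this, and the condition passes to derivatives.\<close>

definition polygood :: "(('n * 'n) list => complex) => bool" where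
 "polygood G \<longleftrightarrow> (\<forall>R>0. \<exists>K. good G K R)"

lemma polygood_truncate:
 fixes G :: "('n::finite \<times> 'n) list => complex"
 assumes "!!l l'. mset l = mset l' ==> G l = G l'" "!!a b l. G ((a, b) # l) = G ((b, a) # l)"
 shows "polygood (truncate r G)"
 unfolding polygood_def
proof (intro allI impI)
 fix R :: real assume R: "R > 0"
 define L where "L = {l :: ('n * 'n) list. set l <= UNIV & length l <= r}"
 have L: "finite L" unfolding L_def by(rule finite_lists_length_le) simp
 define K where "K = (\<Sum>l\<in>L. norm (G l) / (R ^ length l * fact (length l)))"
 have K: "K >= 0" unfolding K_def using R by(intro sum_nonneg) auto
 have "norm (truncate r G l) <= fb K R (length l)" for l
 proof (cases "l \<in> L")
  case True
  have "norm (G l) / (R ^ length l * fact (length l)) <= K"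
   unfolding K_def using R by(intro member_le_sum L True) auto
  then have "norm (G l) <= K * (R ^ length l * fact (length l))" using R by(simp add: pos_divide_le_eq)
  then show ?thesis using True by(simp add: truncate_def L_def mult.assoc)
 next
  case False
  then show ?thesis using K R by(simp add: truncate_def L_def)
 qed
 moreover have "truncate r G l = truncate r G l'" if "mset l = mset l'" for l l'
  using assms(1)[OF that] mset_eq_length[OF that] by(simp add: truncate_def)
 moreover have "truncate r G ((a, b) # l) = truncate r G ((b, a) # l)" for a b l
  unfolding truncate_def using assms(2)[of a b l] by simp
 ultimately show "\<exists>K. good (truncate r G) K R" unfolding good_def using K R by blast
qed

lemma polygood_Cons:
 fixes G :: "('n::finite \<times> 'n) list => complex"
 assumes "polygood G"
 shows "polygood (drv G v)"
 unfolding polygood_def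
proof (intro allI impI)
 fix R :: real assume "R > 0"
 then obtain K where "good G K (R / 2)" using assms unfolding polygood_def by(meson half_gt_zero)
 from good_Cons[OF this, of v] have "good (drv G v) (K * (R / 2)) R" by simp
 then show "\<exists>K. good (drv G v) K R" by blast
qed

lemma polygood_at:
 fixes G :: "('n::finite \<times> 'n) list => complex"
 assumes "polygood G"
 obtains K R \<rho> where "good G K R" "real CARD('n * 'n) * R * \<rho> <= 1" "norm (S :: 'n mat) < \<rho>"
proof -
 define \<rho> where "\<rho> = norm S + 1"
 have \<rho>: "\<rho> > 0" by(simp add: \<rho>_def add_nonneg_pos)
 define R where "R = 1 / (real CARD('n * 'n) * \<rho>)"
 have "real CARD('n * 'n) * \<rho> > 0" using \<rho> by simp
 then have "R > 0" "real CARD('n * 'n) * R * \<rho> = 1" using \<rho> by(simp_all add: R_def)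
 moreover obtain K where "good G K R" using assms \<open>R > 0\<close> unfolding polygood_def by blast
 ultimately show ?thesis using that[of K R \<rho>] by(simp add: \<rho>_def)
qed

lemma holo_on_PS_poly:
 assumes "polygood G"
 shows "holo_on symm (PS G)"
 unfolding holo_on_def
proof
 fix S :: "'a mat" assume S: "S \<in> symm"
 obtain K R \<rho> where g: "good G K R" "real CARD('a * 'a) * R * \<rho> <= 1" "norm S < \<rho>"
  by(rule polygood_at[OF assms, of S])
 have "S \<in> sball 0 \<rho>" using S g(3) by(simp add: sball_def)
 then show "\<exists>L. (PS G has_derivative L) (at S within symm) & clin L"
  using holo_on_PS[OF g(1,2)] unfolding holo_on_def by blast
qed

lemma dl_PS_poly: "polygood G ==> S \<in> symm ==> dl l (PS G) S = PS (\<lambda>k. G (l @ k)) S"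
proof (induction l arbitrary: G)
 case (Cons v l)
 have "ddir (Esym v) (PS G) T = PS (drv G v) T" for T
 proof -
  obtain K R \<rho> where g: "good G K R" "real CARD('a * 'a) * R * \<rho> <= 1" "norm T < \<rho>"
   by(rule polygood_at[OF Cons.prems(1), of T])
  show ?thesis by(rule ddir_Esym_PS[OF g])
 qed
 then have "ddir (Esym v) (PS G) = PS (drv G v)" by(rule ext)
 then show ?case using Cons.IH[OF polygood_Cons[OF Cons.prems(1)] Cons.prems(2)] by simp
qed simp

lemma PS_summable_poly: "polygood G ==> summable (\<lambda>j. Sw j G S / fact j)"
 by(rule polygood_at[of G S]) (auto intro: PS_summable)

section \<open>Sections and their derivatives\<close>

lemma gl_moduleD:
 assumes "gl_module R"
 shows "vector_space (gscale R)" "module.subspace (gscale R) (gspace R)"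
  "w \<in> gspace R ==> gact R A w \<in> gspace R"
  "w \<in> gspace R ==> w' \<in> gspace R ==> gact R A (w + w') = gact R A w + gact R A w'"
  "w \<in> gspace R ==> gact R A (gscale R c w) = gscale R c (gact R A w)"
  "w \<in> gspace R ==> gact R (A + B) w = gact R A w + gact R B w"
  "w \<in> gspace R ==> gact R (mscale c A) w = gscale R c (gact R A w)"
  "w \<in> gspace R ==> gact R (A ** B - B ** A) w = gact R A (gact R B w) - gact R B (gact R A w)"
 using assms unfolding gl_module_def by auto

lemma gl_module_closed:
 assumes "gl_module R"
 shows "0 \<in> gspace R" "w \<in> gspace R ==> w' \<in> gspace R ==> w + w' \<in> gspace R"
  "w \<in> gspace R ==> gscale R c w \<in> gspace R" "w \<in> gspace R ==> w' \<in> gspace R ==> w - w' \<in> gspace R"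
proof -
 interpret vector_space "gscale R" by(rule gl_moduleD[OF assms])
 note s = gl_moduleD(2)[OF assms]
 show "0 \<in> gspace R" "w \<in> gspace R ==> w' \<in> gspace R ==> w + w' \<in> gspace R"
  "w \<in> gspace R ==> gscale R c w \<in> gspace R" "w \<in> gspace R ==> w' \<in> gspace R ==> w - w' \<in> gspace R"
  using subspace_0[OF s] subspace_add[OF s] subspace_scale[OF s] subspace_diff[OF s] by auto
qed

abbreviation (input) "sl f i w \<equiv> (\<lambda>S. f i S w)"

lemma sectionsD:
 assumes "f \<in> sections R U"
 shows "S \<notin> U ==> f i S w = 0" "w \<notin> gspace R ==> f i S w = 0"
  "S \<in> U ==> w \<in> gspace R ==> w' \<in> gspace R ==> f i S (w + w') = f i S w + f i S w'"
  "S \<in> U ==> w \<in> gspace R ==> f i S (gscale R c w) = c * f i S w"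
  "w \<in> gspace R ==> holo_on U (sl f i w)"
 using assms unfolding sections_def by auto

lemma sectionsI:
 assumes "!!i S w. S \<notin> U \<or> w \<notin> gspace R ==> f i S w = 0"
  "!!i S w w'. S \<in> U ==> w \<in> gspace R ==> w' \<in> gspace R ==> f i S (w + w') = f i S w + f i S w'"
  "!!i S w c. S \<in> U ==> w \<in> gspace R ==> f i S (gscale R c w) = c * f i S w"
  "!!i w. w \<in> gspace R ==> holo_on U (sl f i w)"
 shows "f \<in> sections R U"
 using assms unfolding sections_def by blast

lemma sections_diff:
 assumes "gl_module R" "f \<in> sections R U" "S \<in> U" "w \<in> gspace R" "w' \<in> gspace R"
 shows "f i S (w - w') = f i S w - f i S w'"
 using sectionsD(3)[OF assms(2,3) gl_module_closed(4)[OF assms(1,4,5)] assms(5), of i] by simp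

abbreviation (input) "zs \<equiv> (\<lambda>i S w. 0)"
abbreviation (input) "ss f A \<equiv> (\<lambda>i S w. \<Sum>a\<in>A. f a i S w)"

lemma sections_zero: "zs \<in> sections R U"
 by(rule sectionsI) (auto intro: holo_on_const)

abbreviation (input) "lc a f b g \<equiv> (\<lambda>i S w. a * f i S w + b * g i S w)"

lemma sections_lin:
 assumes f: "f \<in> sections R U" and g: "g \<in> sections R U"
 shows "lc a f b g \<in> sections R U"
proof (rule sectionsI)
 fix i w assume w: "w \<in> gspace R"
 show "holo_on U (\<lambda>S. a * f i S w + b * g i S w)"
  by(intro holo_on_add holo_on_cmult sectionsD(5)[OF f w] sectionsD(5)[OF g w])
qed (auto simp: sectionsD[OF f] sectionsD[OF g] algebra_simps)

lemma sections_sum: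
 assumes "!!a. a \<in> A ==> f a \<in> sections R U"
 shows "ss f A \<in> sections R U"
 using assms
proof (induction A rule: infinite_finite_induct)
 case (insert x F)
 then show ?case using sections_lin[of "f x" R U "\<lambda>i S w. \<Sum>a\<in>F. f a i S w" 1 1] by simp
qed (auto intro: sections_zero)

lemma restr_apply: "S \<in> U ==> w \<in> gspace R ==> restr R U f i S w = f i S w"
 by(simp add: restr_def)

lemma restr_sections: "f \<in> sections R U ==> restr R U f = f"
 by(intro ext) (auto simp: restr_def sectionsD)

lemma restr_cong:
 "(!!i S w. S \<in> U ==> w \<in> gspace R ==> f i S w = g i S w) ==> restr R U f = restr R U g"
 by(intro ext) (auto simp: restr_def)

lemma restr_in_sections:
 assumes R: "gl_module R" and U: "U \<in> osym"
  and 1: "!!i S w w'. S \<in> U ==> w \<in> gspace R ==> w' \<in> gspace R ==> f i S (w + w') = f i S w + f i S w'"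
  and 2: "!!i S w c. S \<in> U ==> w \<in> gspace R ==> f i S (gscale R c w) = c * f i S w"
  and 3: "!!i w. w \<in> gspace R ==> holo_on U (sl f i w)"
 shows "restr R U f \<in> sections R U"
proof (rule sectionsI)
 fix i w assume w: "w \<in> gspace R"
 show "holo_on U (sl (restr R U f) i w)"
  by(rule holo_on_cong[OF U _ 3[OF w]]) (use w in \<open>simp add: restr_apply\<close>)
next
 fix i S w w' assume "S \<in> U" "w \<in> gspace R" "w' \<in> gspace R"
 then show "restr R U f i S (w + w') = restr R U f i S w + restr R U f i S w'"
  using gl_module_closed(2)[OF R] 1 by(simp add: restr_apply)
next
 fix i S w c assume "S \<in> U" "w \<in> gspace R"
 then show "restr R U f i S (gscale R c w) = c * restr R U f i S w"
  using gl_module_closed(3)[OF R] 2 by(simp add: restr_apply)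
qed (auto simp: restr_def)

lemma sections_restr:
 assumes "gl_module R" "V \<in> osym" "V <= U" "f \<in> sections R U"
 shows "restr R V f \<in> sections R V"
 by(rule restr_in_sections[OF assms(1,2)])
  (use assms(3) in \<open>auto simp: sectionsD[OF assms(4)] intro: holo_on_subset[OF sectionsD(5)[OF assms(4)]]\<close>)

lemma sections_ext:
 assumes "f \<in> sections R U" "g \<in> sections R U"
  and "!!i S w. S \<in> U ==> w \<in> gspace R ==> f i S w = g i S w"
 shows "f = g"
 by(intro ext) (metis assms sectionsD(1,2))

definition dB :: "('n::finite, 'w) glmod => 'n mat set => 'n mat => ('i, 'n, 'w) sect => ('i, 'n, 'w) sect" where
 "dB R U B f = restr R U (\<lambda>i S w. ddir B (sl f i w) S)"

lemma dB_sections: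
 assumes R: "gl_module R" and U: "U \<in> osym" and B: "B \<in> symm" and f: "f \<in> sections R U"
 shows "dB R U B f \<in> sections R U"
 unfolding dB_def
proof (rule restr_in_sections[OF R U])
 fix i S w w' assume S: "S \<in> U" and w: "w \<in> gspace R" "w' \<in> gspace R"
 have "ddir B (sl f i (w + w')) S = ddir B (\<lambda>S. f i S w + f i S w') S"
  by(rule ddir_cong[OF U S B]) (rule sectionsD(3)[OF f _ w])
 then show "ddir B (sl f i (w + w')) S = ddir B (sl f i w) S + ddir B (sl f i w') S"
  by(simp add: ddir_add[OF U S B] sectionsD(5)[OF f] w)
next
 fix i S w c assume S: "S \<in> U" and w: "w \<in> gspace R"
 have "ddir B (sl f i (gscale R c w)) S = ddir B (\<lambda>S. c * f i S w) S"
  by(rule ddir_cong[OF U S B]) (rule sectionsD(4)[OF f _ w])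
 then show "ddir B (sl f i (gscale R c w)) S = c * ddir B (sl f i w) S"
  by(simp add: ddir_cmult[OF U S B] sectionsD(5)[OF f] w)
next
 show "holo_on U (ddir B (sl f i w))" if "w \<in> gspace R" for i w
  by(rule holo_on_ddir[OF sectionsD(5)[OF f that] U B])
qed

definition dsec :: "('n::finite, 'w::ab_group_add) glmod => 'n mat set => ('n * 'n) list
  => ('i, 'n, 'w) sect => ('i, 'n, 'w) sect" where
 "dsec R U l f = restr R U (\<lambda>i S w. dl l (sl f i w) S)"

lemma dsec_Nil: "f \<in> sections R U ==> dsec R U [] f = f"
 by(simp add: dsec_def restr_sections)

lemma dsec_Cons:
 assumes "U \<in> osym"
 shows "dsec R U (v # l) f = dsec R U l (dB R U (Esym v) f)"
 unfolding dsec_def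
proof (rule restr_cong)
 fix i S w assume "S \<in> U" and w: "w \<in> gspace R"
 then show "dl (v # l) (sl f i w) S = dl l (sl (dB R U (Esym v) f) i w) S"
  unfolding dl.simps dB_def by(intro dl_cong[OF assms]) (auto simp: restr_apply)
qed

lemma dsec_sections:
 assumes "gl_module R" "U \<in> osym"
 shows "f \<in> sections R U ==> dsec R U l f \<in> sections R U"
 by(induction l arbitrary: f) (simp_all add: dsec_Nil dsec_Cons assms dB_sections)

section \<open>Algebra of homogeneous elements\<close>

text \<open>Only homogeneous elements are represented, so addition has a meaning for equal parity.
  The last clause is a default value that keeps closure statements free of parity
  conditions.\<close>

fun oadd :: "'n::finite osp => 'n osp => 'n osp" where
 "oadd (Ev M) (Ev N) = Ev (M + N)"
| "oadd (Od y) (Od z) = Od (y + z)"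
| "oadd X Y = X"

fun oscale :: "complex => 'n::finite osp => 'n osp" where
 "oscale c (Ev M) = Ev (mscale c M)"
| "oscale c (Od y) = Od (c *s y)"

text \<open>For symmetric \<open>B\<close> these are the even elements of the opposite nilradical;
  they act on the chart as translations in direction \<open>B\<close>.\<close>

definition low :: "'n::finite mat => 'n symp_mat" where
 "low B = (\<chi> a b. case a of Inl i => 0 | Inr i => (case b of Inl j => B $ i $ j | Inr j => 0))"

definition lowE :: "'n * 'n => 'n::finite osp" where
 "lowE v = Ev (low (Esym v))"

lemma is_odd_lowE [simp]: "\<not> is_odd (lowE v)"
 by(simp add: lowE_def)

lemma is_odd_bracket: "is_odd (bracket X Y) \<longleftrightarrow> is_odd X \<noteq> is_odd Y"
 by(cases X; cases Y) auto

lemma is_odd_oscale [simp]: "is_odd (oscale c X) = is_odd X"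
 by(cases X) auto

lemma is_odd_oadd [simp]: "is_odd (oadd X Y) = is_odd X"
 by(cases X; cases Y) auto

definition tw :: "(('n::finite osp list) \<Rightarrow>\<^sub>0 complex) => 'w => ('n, 'w) tens" where
 "tw t w = push (\<lambda>u. word u w) t"

definition prep :: "'n::finite osp list => ('n, 'w) tens => ('n, 'w) tens" where
 "prep u = push (\<lambda>k. word (u @ fst k) (snd k))"

abbreviation "lowp l \<equiv> prep (map lowE l)"

lemma prep_word [simp]: "prep u (word v w) = word (u @ v) w"
 unfolding prep_def word_def by(simp add: fs.scale_one)

lemma prep_prep: "prep u (prep v x) = prep (u @ v) x"
 unfolding prep_def push_push by(rule push_cong) (simp add: word_def fs.scale_one)

lemma ind_act_prep: "ind_act X x = prep [X] x"
 unfolding ind_act_def prep_def push_def word_def fscale_single by simp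

lemma prep_Nil [simp]: "prep [] x = x"
 unfolding prep_def word_def by(simp add: push_single_id)

lemma jet_pair_lin_ext: "jet_pair st R x f = lin_ext (\<lambda>k. jet_word st R (fst k) f (snd k)) x"
 by(simp add: jet_pair_def lin_ext_def)

lemma jet_pair_tw: "jet_pair st R (tw t w) f = lin_ext (\<lambda>u. jet_word st R u f w) t"
 by(simp add: tw_def jet_pair_lin_ext lin_ext_push word_def)

lemma jet_pair_word [simp]: "jet_pair st R (word u w) f = jet_word st R u f w"
 by(simp add: jet_pair_lin_ext word_def)

lemma jet_pair_add: "jet_pair st R (x + y) f = jet_pair st R x f + jet_pair st R y f"
 and jet_pair_diff: "jet_pair st R (x - y) f = jet_pair st R x f - jet_pair st R y f"
 and jet_pair_fscale: "jet_pair st R (fscale c x) f = c * jet_pair st R x f"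
 and jet_pair_zero [simp]: "jet_pair st R 0 f = 0"
 by(simp_all add: jet_pair_lin_ext lin_ext_add lin_ext_diff lin_ext_fscale)

lemma ksign_bracket_left: "ksign (bracket X Y) Z = ksign X Z * ksign Y Z"
 by(cases X; cases Y; cases Z) (simp_all add: ksign_def)

lemma ksign_bracket_right: "ksign Z (bracket X Y) = ksign Z X * ksign Z Y"
 by(cases X; cases Y; cases Z) (simp_all add: ksign_def)

lemma ksign_commute: "ksign X Y = ksign Y X"
 by(simp add: ksign_def conj_commute)

lemma ksign_square: "ksign X Y * ksign X Y = 1"
 by(simp add: ksign_def)

lemma ksign_cong: "is_odd X = is_odd X' ==> is_odd Y = is_odd Y' ==> ksign X Y = ksign X' Y'"
 by(simp add: ksign_def)

lemma bracket_oadd_left: "is_odd X = is_odd Y ==> bracket (oadd X Y) Z = oadd (bracket X Z) (bracket Y Z)"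
 by(cases X; cases Y; cases Z)
  (simp_all add: quad_def vec_eq_iff matrix_matrix_mult_def matrix_vector_mult_def algebra_simps
   sum.distrib sum_subtractf omega_def)

lemma bracket_swap: "bracket X Y = oscale (- ksign X Y) (bracket Y X)"
 by(cases X; cases Y)
  (simp_all add: ksign_def vec_eq_iff quad_def algebra_simps)

text \<open>The sign that \<open>jet_word\<close> accumulates while a prefix is peeled off;
  \<open>p\<close> says whether the remainder of the word contains an odd number of odd
  letters.\<close>

fun sgp :: "'n::finite osp list => bool => complex" where
 "sgp [] p = 1"
| "sgp (X # u) p = - (if is_odd X & odd (length (filter is_odd u)) \<noteq> p then - 1 else 1) * sgp u p"

lemma relators_cases:
 assumes "x \<in> relators G P R"
 obtains (add) u w w' where "x = word u (w + w') - word u w - word u w'"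
   "u \<in> lists G" "w \<in> gspace R" "w' \<in> gspace R"
 | (scale) u c w where "x = word u (gscale R c w) - fscale c (word u w)" "u \<in> lists G" "w \<in> gspace R"
 | (ev) u v a b M N w where "x = word (u @ [Ev (mscale a M + mscale b N)] @ v) w
    - fscale a (word (u @ [Ev M] @ v) w) - fscale b (word (u @ [Ev N] @ v) w)"
   "u \<in> lists G" "v \<in> lists G" "Ev M \<in> G" "Ev N \<in> G" "w \<in> gspace R"
 | (od) u v a b y z w where "x = word (u @ [Od (a *s y + b *s z)] @ v) w
    - fscale a (word (u @ [Od y] @ v) w) - fscale b (word (u @ [Od z] @ v) w)"
   "u \<in> lists G" "v \<in> lists G" "Od y \<in> G" "Od z \<in> G" "w \<in> gspace R"
 | (br) u v X Y w where "x = word (u @ [X, Y] @ v) w - fscale (ksign X Y) (word (u @ [Y, X] @ v) w)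
    - word (u @ [bracket X Y] @ v) w"
   "u \<in> lists G" "v \<in> lists G" "X \<in> G" "Y \<in> G" "w \<in> gspace R"
 | (par) u X w where "x = word (u @ [X]) w - word u (par_act R X w)"
   "u \<in> lists G" "X \<in> P" "w \<in> gspace R"
 using assms unfolding relators_def
 by(elim UnE CollectE exE conjE) (rule that; assumption)+

text \<open>Modulo the relations, this is what the commuting elements \<open>lowE v\<close> generate
  from the tensors \<open>\<tau> i \<otimes> w\<close>. Once it is known to be everything, the
  induced module of a finite-dimensional \<open>R\<close> is finitely generated over a polynomial
  ring, and Groebner bases become available.\<close>

definition tspan :: "'n::finite osp set => 'n osp set => ('n, 'w::ab_group_add) glmod
  => ('i => ('n osp list \<Rightarrow>\<^sub>0 complex)) => ('n, 'w) tens set" where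
 "tspan G P R \<tau> = fs.span (ind_null G P R \<union>
  {lowp l (tw (\<tau> i) w) | l i w. w \<in> gspace R})"

text \<open>
 The common features of the classical and the super situation. \<open>neg\<close> is the opposite nilradical,
 and \<open>\<tau> i\<close> is an element of its enveloping algebra that computes the value at \<open>o\<close> of the \<open>i\<close>-th
 component of a section.
\<close>

locale dual_setting =
 fixes st :: "('i::finite, 'n::finite, 'w::ab_group_add) setting"
  and neg :: "'n osp set"
  and \<tau> :: "'i => ('n osp list \<Rightarrow>\<^sub>0 complex)"
 assumes neg_alg: "neg <= alg st" and par_alg: "par st <= alg st"
  and bracket_alg: "X \<in> alg st ==> Y \<in> alg st ==> bracket X Y \<in> alg st"
  and oadd_alg: "X \<in> alg st ==> Y \<in> alg st ==> oadd X Y \<in> alg st"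
  and oscale_alg: "X \<in> alg st ==> oscale c X \<in> alg st"
  and low_neg: "B \<in> symm ==> Ev (low B) \<in> neg"
  and decomp: "X \<in> alg st ==> \<exists>Y\<in>neg. \<exists>Z\<in>par st. is_odd Y = is_odd Z & X = oadd Y Z"
  and jacobi: "X \<in> alg st ==> Y \<in> alg st ==> Z \<in> alg st ==>
   bracket X (bracket Y Z) = oadd (bracket (bracket X Y) Z) (oscale (ksign X Y) (bracket Y (bracket X Z)))"
  and par_bracket: "X \<in> par st ==> Y \<in> par st ==> bracket X Y \<in> par st"
  and par_act_closed: "gl_module (R :: ('n, 'w) glmod) ==> X \<in> par st ==> w \<in> gspace R ==> par_act R X w \<in> gspace R"
  and par_act_bracket: "gl_module R ==> X \<in> par st ==> Y \<in> par st ==> w \<in> gspace R ==>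
   par_act R (bracket X Y) w = par_act R X (par_act R Y w) - gscale R (ksign X Y) (par_act R Y (par_act R X w))"
  and act_sections: "gl_module R ==> X \<in> alg st ==> U \<in> osym ==> f \<in> sections R U ==>
   restr R U (sact st R X f) \<in> sections R U"
  and act_local: "gl_module R ==> X \<in> alg st ==> U \<in> osym ==>
   (!!i S w. S \<in> U ==> w \<in> gspace R ==> f i S w = g i S w) ==>
   S \<in> U ==> w \<in> gspace R ==> sact st R X f i S w = sact st R X g i S w"
  and act_lin: "gl_module R ==> X \<in> alg st ==> U \<in> osym ==> f \<in> sections R U ==> g \<in> sections R U ==>
   S \<in> U ==> w \<in> gspace R ==>
   sact st R X (lc a f b g) i S w = a * sact st R X f i S w + b * sact st R X g i S w"
  and act_oadd: "gl_module R ==> X \<in> alg st ==> Y \<in> alg st ==> is_odd X = is_odd Y ==> U \<in> osym ==>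
   f \<in> sections R U ==> S \<in> U ==> w \<in> gspace R ==>
   sact st R (oadd X Y) f i S w = sact st R X f i S w + sact st R Y f i S w"
  and act_oscale: "gl_module R ==> X \<in> alg st ==> U \<in> osym ==> f \<in> sections R U ==> S \<in> U ==>
   w \<in> gspace R ==> sact st R (oscale c X) f i S w = c * sact st R X f i S w"
  and act_low: "gl_module R ==> B \<in> symm ==> U \<in> osym ==> f \<in> sections R U ==> S \<in> U ==>
   w \<in> gspace R ==> sact st R (Ev (low B)) f i S w = - ddir B (sl f i w) S"
  and act_neg: "gl_module R ==> X \<in> neg ==> Y \<in> alg st ==> U \<in> osym ==> f \<in> sections R U ==> S \<in> U ==>
   w \<in> gspace R ==> sact st R X (restr R U (sact st R Y f)) i S w
    = ksign X Y * sact st R Y (restr R U (sact st R X f)) i S w + sact st R (bracket X Y) f i S w"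
  and act_par: "gl_module R ==> X \<in> par st ==> U \<in> osym ==> f \<in> sections R U ==> 0 \<in> U ==>
   w \<in> gspace R ==> sact st R X f (body st) 0 w = - f (body st) 0 (par_act R X w)"
  and \<tau>_keys: "keys (\<tau> i) <= lists neg"
  and \<tau>_pair: "gl_module R ==> U \<in> osym ==> f \<in> sections R U ==> 0 \<in> U ==> w \<in> gspace R ==>
   jet_pair st R (tw (\<tau> i) w) f = f i 0 w"
  and \<tau>_span: "gl_module R ==> u \<in> lists neg ==> w \<in> gspace R ==> word u w \<in> tspan (alg st) (par st) R \<tau>"
begin

abbreviation "jword \<equiv> jet_word st"
abbreviation "jpair \<equiv> jet_pair st"
abbreviation "algs \<equiv> lists (alg st)"
abbreviation "nulls \<equiv> ind_null (alg st) (par st)"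
abbreviation "spaces \<equiv> ind_space (alg st)"

lemma lowE_neg: "lowE v \<in> neg"
 unfolding lowE_def by(rule low_neg) simp

lemma lowE_alg: "lowE v \<in> alg st"
 by(rule subsetD[OF neg_alg lowE_neg])

lemma lowE_lists: "map lowE l \<in> lists neg" "map lowE l \<in> algs"
 by(induction l) (simp_all add: lowE_neg lowE_alg)

lemma neg_lists: "u \<in> lists neg ==> u \<in> algs"
 using lists_mono[OF neg_alg] by auto

context
 fixes R :: "('n, 'w) glmod"
 assumes R: "gl_module R"
begin

definition act :: "'n mat set => 'n osp => ('i, 'n, 'w) sect => ('i, 'n, 'w) sect" where
 "act U X f = restr R U (sact st R X f)"

lemma act_sec: "X \<in> alg st ==> U \<in> osym ==> f \<in> sections R U ==> act U X f \<in> sections R U"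
 unfolding act_def by(rule act_sections[OF R])

lemma act_inside: "S \<in> U ==> w \<in> gspace R ==> act U X f i S w = sact st R X f i S w"
 by(simp add: act_def restr_apply)

lemma act_outside: "\<not> (S \<in> U & w \<in> gspace R) ==> act U X f i S w = 0"
 by(simp only: act_def restr_def if_False)

lemma act_lin_fun:
 assumes "X \<in> alg st" "U \<in> osym" "f \<in> sections R U" "g \<in> sections R U"
 shows "act U X (lc a f b g) = lc a (act U X f) b (act U X g)"
 by(intro ext) (auto simp: act_def restr_def act_lin[OF R assms])

section \<open>Jet words: locality, linearity and splitting off a prefix\<close>

lemma jet_word_local:
 assumes V: "V \<in> osym" "0 \<in> V"
 shows "u \<in> algs ==> w \<in> gspace R ==>
  (!!i S w. S \<in> V ==> w \<in> gspace R ==> f i S w = g i S w) ==> jword R u f w = jword R u g w"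
proof (induction u arbitrary: f g)
 case Nil
 then show ?case using V by simp
next
 case (Cons X u)
 have "jword R u (sact st R X f) w = jword R u (sact st R X g) w"
  by(rule Cons.IH) (use Cons in \<open>auto intro!: act_local[OF R _ V(1)]\<close>)
 then show ?case by simp
qed

context
 fixes U :: "'n mat set"
 assumes U: "U \<in> osym" and 0: "0 \<in> U"
begin

lemma jet_word_Cons:
 assumes "X \<in> alg st" "u \<in> algs" "w \<in> gspace R" "f \<in> sections R U"
 shows "jword R (X # u) f w =
  - (if is_odd X & odd (length (filter is_odd u)) then - 1 else 1) * jword R u (act U X f) w"
proof -
 have "jword R u (act U X f) w = jword R u (sact st R X f) w"
  by(rule jet_word_local[OF U 0 assms(2,3)]) (simp add: act_def restr_apply)
 then show ?thesis by simp
qed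

lemma jet_word_lin:
 "u \<in> algs ==> w \<in> gspace R ==> f \<in> sections R U ==> g \<in> sections R U ==>
 jword R u (lc a f b g) w = a * jword R u f w + b * jword R u g w"
proof (induction u arbitrary: f g)
 case (Cons X u)
 then have X: "X \<in> alg st" and u: "u \<in> algs" by auto
 show ?case
  unfolding jet_word_Cons[OF X u Cons.prems(2) Cons.prems(3)] jet_word_Cons[OF X u Cons.prems(2) Cons.prems(4)]
   jet_word_Cons[OF X u Cons.prems(2) sections_lin[OF Cons.prems(3,4)]] act_lin_fun[OF X U Cons.prems(3,4)]
   Cons.IH[OF u Cons.prems(2) act_sec[OF X U Cons.prems(3)] act_sec[OF X U Cons.prems(4)]]
  by(simp add: algebra_simps)
qed simp

lemma jet_word_zero: "u \<in> algs ==> w \<in> gspace R ==> jword R u zs w = 0"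
 using jet_word_lin[OF _ _ sections_zero sections_zero, of u w 0 0] by simp

lemma jet_word_w:
 assumes "u \<in> algs" "f \<in> sections R U"
 shows "w \<in> gspace R ==> w' \<in> gspace R ==> jword R u f (w + w') = jword R u f w + jword R u f w'"
  "w \<in> gspace R ==> jword R u f (gscale R c w) = c * jword R u f w"
proof -
 have "(w \<in> gspace R --> w' \<in> gspace R --> jword R u f (w + w') = jword R u f w + jword R u f w') &
  (w \<in> gspace R --> jword R u f (gscale R c w) = c * jword R u f w)"
  if "u \<in> algs" "f \<in> sections R U" for u f
  using that(2,1)
 proof (induction u arbitrary: f)
  case Nil
  then show ?case using 0 by(simp add: sectionsD)
 next
  case (Cons X u)
  then have X: "X \<in> alg st" and u: "u \<in> algs" by auto
  show ?case
   using Cons.IH[OF act_sec[OF X U Cons.prems(1)] u] gl_module_closed[OF R]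
   by(simp add: jet_word_Cons[OF X u _ Cons.prems(1)] algebra_simps del: jet_word.simps)
 qed
 from this[OF assms] show "w \<in> gspace R ==> w' \<in> gspace R ==> jword R u f (w + w') = jword R u f w + jword R u f w'"
  "w \<in> gspace R ==> jword R u f (gscale R c w) = c * jword R u f w" by auto
qed

fun acts :: "'n osp list => ('i, 'n, 'w) sect => ('i, 'n, 'w) sect" where
 "acts [] f = f"
| "acts (X # u) f = acts u (act U X f)"

lemma acts_sec: "f \<in> sections R U ==> u \<in> algs ==> acts u f \<in> sections R U"
 by(induction u arbitrary: f) (auto intro: act_sec[OF _ U])

lemma acts_lin:
 "f \<in> sections R U ==> g \<in> sections R U ==> u \<in> algs ==>
  acts u (lc a f b g) = (\<lambda>i S w. a * acts u f i S w + b * acts u g i S w)"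
 by(induction u arbitrary: f g) (simp_all add: act_lin_fun[OF _ U] act_sec[OF _ U])

lemma jet_word_append:
 "f \<in> sections R U ==> u \<in> algs ==> z \<in> algs ==> w \<in> gspace R ==>
  jword R (u @ z) f w = sgp u (odd (length (filter is_odd z))) * jword R z (acts u f) w"
proof (induction u arbitrary: f)
 case (Cons X u)
 then have X: "X \<in> alg st" and u: "u \<in> algs" by auto
 have "jword R (X # (u @ z)) f w = - (if is_odd X & odd (length (filter is_odd (u @ z))) then - 1 else 1) *
   jword R (u @ z) (act U X f) w"
  by(rule jet_word_Cons[OF X _ Cons.prems(4,1)]) (use u Cons.prems in simp)
 also have "jword R (u @ z) (act U X f) w
   = sgp u (odd (length (filter is_odd z))) * jword R z (acts u (act U X f)) w"
  by(rule Cons.IH[OF act_sec[OF X U Cons.prems(1)] u Cons.prems(3,4)])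
 finally show ?case by(simp del: jet_word.simps)
qed simp

text \<open>The defect of the bracket relation of \<open>X\<close> and \<open>Y\<close> on sections.
  The coefficients 1 and -1 are spelled out so that it is literally an iterated linear combination
  of the form for which linearity is stated.\<close>

definition Zs :: "'n osp => 'n osp => ('i, 'n, 'w) sect => ('i, 'n, 'w) sect" where
 "Zs X Y f = (\<lambda>i S w. 1 * (1 * act U X (act U Y f) i S w + (- ksign X Y) * act U Y (act U X f) i S w)
  + (- 1) * act U (bracket X Y) f i S w)"

lemma Zs_sec:
 assumes "X \<in> alg st" "Y \<in> alg st" "f \<in> sections R U"
 shows "Zs X Y f \<in> sections R U"
 unfolding Zs_def by(intro sections_lin act_sec U bracket_alg assms)

lemma act_neg_fun:
 assumes "X \<in> neg" "Y \<in> alg st" "f \<in> sections R U"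
 shows "act U X (act U Y f) = (\<lambda>i S w. ksign X Y * act U Y (act U X f) i S w + act U (bracket X Y) f i S w)"
proof (intro ext)
 fix i S w
 show "act U X (act U Y f) i S w = ksign X Y * act U Y (act U X f) i S w + act U (bracket X Y) f i S w"
 proof (cases "S \<in> U & w \<in> gspace R")
  case True
  then show ?thesis
   using act_neg[OF R assms(1,2) U assms(3), of S w i] by(simp only: act_inside) (simp only: act_def)
 next
  case False
  show ?thesis by(simp only: act_outside[OF False] mult_zero_right add_0_left)
 qed
qed

lemma Zs_neg: "X \<in> neg ==> Y \<in> alg st ==> f \<in> sections R U ==> Zs X Y f = zs"
 by(simp add: Zs_def act_neg_fun)

lemma act_oadd_fun:
 assumes "X \<in> alg st" "Y \<in> alg st" "is_odd X = is_odd Y" "f \<in> sections R U"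
 shows "act U (oadd X Y) f = lc 1 (act U X f) 1 (act U Y f)"
 by(intro ext) (simp add: act_def restr_def act_oadd[OF R assms(1,2,3) U assms(4)])

lemma act_oscale_fun:
 assumes "X \<in> alg st" "f \<in> sections R U"
 shows "act U (oscale c X) f = (\<lambda>i S w. c * act U X f i S w)"
 by(intro ext) (simp add: act_def restr_def act_oscale[OF R assms(1) U assms(2)])

lemma Zs_oadd_left:
 assumes "X \<in> alg st" "Y \<in> alg st" "is_odd X = is_odd Y" "Z \<in> alg st" "f \<in> sections R U"
 shows "Zs (oadd X Y) Z f = (\<lambda>i S w. Zs X Z f i S w + Zs Y Z f i S w)"
proof -
 have k: "ksign (oadd X Y) Z = ksign X Z" "ksign Y Z = ksign X Z" using assms(3) by(auto intro!: ksign_cong)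
 have o: "is_odd (bracket X Z) = is_odd (bracket Y Z)" using assms(3) by(simp add: is_odd_bracket)
 note a = act_sec[OF assms(1) U] act_sec[OF assms(2) U] act_sec[OF assms(4) U]
 show ?thesis
  unfolding Zs_def k bracket_oadd_left[OF assms(3)]
   act_oadd_fun[OF assms(1-3) a(3)[OF assms(5)]] act_oadd_fun[OF assms(1-3,5)]
   act_lin_fun[OF assms(4) U a(1)[OF assms(5)] a(2)[OF assms(5)]]
   act_oadd_fun[OF bracket_alg[OF assms(1,4)] bracket_alg[OF assms(2,4)] o assms(5)]
  by(intro ext) algebra
qed

lemma Zs_swap:
 assumes "X \<in> alg st" "Y \<in> alg st" "f \<in> sections R U"
 shows "Zs X Y f = (\<lambda>i S w. - ksign X Y * Zs Y X f i S w)"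
proof -
 have "act U (bracket X Y) f = (\<lambda>i S w. - ksign X Y * act U (bracket Y X) f i S w)"
  unfolding bracket_swap[of X Y] by(rule act_oscale_fun[OF bracket_alg[OF assms(2,1)] assms(3)])
 then show ?thesis
  unfolding Zs_def ksign_commute[of Y X]
  by(simp add: algebra_simps fun_eq_iff) (simp add: ksign_square flip: mult.assoc)
qed

text \<open>By the Jacobi identity an element of \<open>neg\<close> passes a defect at the price of
  defects with bracketed arguments. Derivatives of defects along \<open>neg\<close> are therefore
  combinations of defects.\<close>

lemma act_Zs:
 assumes q: "q \<in> neg" and X: "X \<in> alg st" and Y: "Y \<in> alg st" and f: "f \<in> sections R U"
 shows "act U q (Zs X Y f) = (\<lambda>i S w. (ksign q X * ksign q Y) * Zs X Y (act U q f) i S w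
   + (Zs (bracket q X) Y f i S w + ksign q X * Zs X (bracket q Y) f i S w))"
proof -
 have qa: "q \<in> alg st" using q neg_alg by auto
 note b = bracket_alg[OF qa X] bracket_alg[OF qa Y] bracket_alg[OF X Y]
 note s = act_sec[OF _ U]
 define k where "k = ksign q X"
 define l where "l = ksign q Y"
 define m where "m = ksign X Y"
 have kk: "k * k = 1" "l * l = 1" "m * m = 1" by(simp_all add: k_def l_def m_def ksign_square)
 have 1: "act U q (act U X (act U Y f)) = (\<lambda>i S w. k * (l * act U X (act U Y (act U q f)) i S w + 1 * act U X (act U (bracket q Y) f) i S w)
   + act U (bracket q X) (act U Y f) i S w)"
  unfolding act_neg_fun[OF q X s[OF Y f]] act_neg_fun[OF q Y f] k_def l_def
  using act_lin_fun[OF X U s[OF Y s[OF qa f]] s[OF b(2) f], of "ksign q Y" 1] by simp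
 have 2: "act U q (act U Y (act U X f)) = (\<lambda>i S w. l * (k * act U Y (act U X (act U q f)) i S w + 1 * act U Y (act U (bracket q X) f) i S w)
   + act U (bracket q Y) (act U X f) i S w)"
  unfolding act_neg_fun[OF q Y s[OF X f]] act_neg_fun[OF q X f] k_def l_def
  using act_lin_fun[OF Y U s[OF X s[OF qa f]] s[OF b(1) f], of "ksign q X" 1] by simp
 have 3: "act U q (act U (bracket X Y) f) = (\<lambda>i S w. k * l * act U (bracket X Y) (act U q f) i S w
   + (act U (bracket (bracket q X) Y) f i S w + k * act U (bracket X (bracket q Y)) f i S w))"
 proof -
  have "is_odd (bracket (bracket q X) Y) = is_odd (oscale (ksign q X) (bracket X (bracket q Y)))"
   by(auto simp: is_odd_bracket)
  from act_oadd_fun[OF bracket_alg[OF b(1) Y] oscale_alg[OF bracket_alg[OF X b(2)]] this f]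
  have "act U (bracket q (bracket X Y)) f = (\<lambda>i S w. act U (bracket (bracket q X) Y) f i S w + k * act U (bracket X (bracket q Y)) f i S w)"
   unfolding jacobi[OF qa X Y] by(simp add: act_oscale_fun[OF bracket_alg[OF X b(2)] f] k_def)
  then show ?thesis unfolding act_neg_fun[OF q b(3) f] ksign_bracket_right by(simp add: k_def l_def)
 qed
 have "act U q (Zs X Y f) = (\<lambda>i S w. 1 * (1 * act U q (act U X (act U Y f)) i S w + (- m) * act U q (act U Y (act U X f)) i S w)
  + (- 1) * act U q (act U (bracket X Y) f) i S w)"
  unfolding Zs_def m_def
   act_lin_fun[OF qa U sections_lin[OF s[OF X s[OF Y f]] s[OF Y s[OF X f]]] s[OF b(3) f]]
   act_lin_fun[OF qa U s[OF X s[OF Y f]] s[OF Y s[OF X f]]] ..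
 also have "... = (\<lambda>i S w. (k * l) * Zs X Y (act U q f) i S w + (Zs (bracket q X) Y f i S w + k * Zs X (bracket q Y) f i S w))"
  unfolding Zs_def 1 2 3 ksign_bracket_left ksign_bracket_right k_def[symmetric] l_def[symmetric] m_def[symmetric]
   ksign_commute[of X q]
  using kk by(intro ext) algebra
 finally show ?thesis unfolding k_def l_def .
qed

text \<open>Both arguments are split along \<open>neg\<close> and the parabolic. A defect with an
  argument in \<open>neg\<close> vanishes identically; for two parabolic arguments the value at
  \<open>o\<close> only involves \<open>par_act\<close>, which respects brackets. Swapping the
  arguments up to sign lets additivity on the left serve both sides.\<close>

lemma Zs_base:
 assumes X: "X \<in> alg st" and Y: "Y \<in> alg st" and f: "f \<in> sections R U" and w: "w \<in> gspace R"
 shows "Zs X Y f (body st) 0 w = 0"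
proof -
 have pp: "Zs X Y f (body st) 0 w = 0" if X: "X \<in> par st" and Y: "Y \<in> par st" for X Y
 proof -
  have Xa: "X \<in> alg st" and Ya: "Y \<in> alg st" using X Y par_alg by auto
  have ev: "act U X g (body st) 0 w = - g (body st) 0 (par_act R X w)"
   if "X \<in> par st" "g \<in> sections R U" "w \<in> gspace R" for X g w
   using act_par[OF R that(1) U that(2) 0 that(3)] 0 that(3) by(simp add: act_def restr_apply)
  note pc = par_act_closed[OF R]
  have "f (body st) 0 (par_act R (bracket X Y) w) = f (body st) 0 (par_act R X (par_act R Y w))
    - ksign X Y * f (body st) 0 (par_act R Y (par_act R X w))"
   unfolding par_act_bracket[OF R X Y w]
   using sections_diff[OF R f 0] sectionsD(4)[OF f 0] gl_module_closed(3)[OF R] pc X Y w by simp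
  moreover have "Zs X Y f (body st) 0 w = f (body st) 0 (par_act R Y (par_act R X w))
    - ksign X Y * f (body st) 0 (par_act R X (par_act R Y w)) + f (body st) 0 (par_act R (bracket X Y) w)"
   unfolding Zs_def
   by(simp add: ev act_sec[OF _ U] f X Y Xa Ya w pc par_bracket)
  \<comment> \<open>Odd parabolic elements act by 0 on the fibre, so the zero vector occurs as an
    argument.\<close>
  moreover have "f (body st) 0 0 = 0" using sections_diff[OF R f 0 w w] by simp
  ultimately show ?thesis
   by(cases X; cases Y) (simp_all add: ksign_def del: bracket.simps)
 qed
 have p: "Zs X Y f (body st) 0 w = 0" if X: "X \<in> par st" and Y: "Y \<in> alg st" for X Y
 proof -
  have Xa: "X \<in> alg st" using X par_alg by auto
  obtain Y1 Y2 where Yd: "Y1 \<in> neg" "Y2 \<in> par st" "is_odd Y1 = is_odd Y2" "Y = oadd Y1 Y2"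
   using decomp[OF Y] by blast
  then have Ya: "Y1 \<in> alg st" "Y2 \<in> alg st" using neg_alg par_alg by auto
  have "Zs Y2 X f (body st) 0 w = 0" by(rule pp[OF Yd(2) X])
  then have "Zs Y X f (body st) 0 w = 0"
   unfolding Yd(4) Zs_oadd_left[OF Ya Yd(3) Xa f] Zs_neg[OF Yd(1) Xa f] by simp
  then show ?thesis unfolding Zs_swap[OF Xa Y f] by simp
 qed
 obtain X1 X2 where Xd: "X1 \<in> neg" "X2 \<in> par st" "is_odd X1 = is_odd X2" "X = oadd X1 X2"
  using decomp[OF X] by blast
 then have Xa: "X1 \<in> alg st" "X2 \<in> alg st" using neg_alg par_alg by auto
 show ?thesis
  unfolding Xd(4) Zs_oadd_left[OF Xa Xd(3) Y f] Zs_neg[OF Xd(1) Y f] using p[OF Xd(2) Y] by simp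
qed

text \<open>The first letter of the word replaces a defect by a combination of three, each of which
  is again killed by the shorter word; the induction ends with the value at
  \<open>o\<close>.\<close>

lemma acts_Zs_zero:
 "u \<in> lists neg ==> X \<in> alg st ==> Y \<in> alg st ==> f \<in> sections R U ==> w \<in> gspace R ==>
  acts u (Zs X Y f) (body st) 0 w = 0"
proof (induction u arbitrary: X Y f)
 case Nil
 then show ?case by(simp add: Zs_base)
next
 case (Cons q u)
 then have q: "q \<in> neg" "q \<in> alg st" and u: "u \<in> lists neg" "u \<in> algs" using neg_alg by auto
 note b = bracket_alg[OF q(2) Cons.prems(2)] bracket_alg[OF q(2) Cons.prems(3)]
 note z = Zs_sec[OF Cons.prems(2,3) act_sec[OF q(2) U Cons.prems(4)]] Zs_sec[OF b(1) Cons.prems(3,4)]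
  Zs_sec[OF Cons.prems(2) b(2) Cons.prems(4)]
 have e: "act U q (Zs X Y f) = (\<lambda>i S w. (ksign q X * ksign q Y) * Zs X Y (act U q f) i S w
   + 1 * (1 * Zs (bracket q X) Y f i S w + ksign q X * Zs X (bracket q Y) f i S w))"
  using act_Zs[OF q(1) Cons.prems(2-4)] by simp
 have "acts (q # u) (Zs X Y f) = (\<lambda>i S w. (ksign q X * ksign q Y) * acts u (Zs X Y (act U q f)) i S w
   + 1 * (1 * acts u (Zs (bracket q X) Y f) i S w + ksign q X * acts u (Zs X (bracket q Y) f) i S w))"
  unfolding acts.simps e
  by(subst acts_lin[OF z(1) sections_lin[OF z(2,3)] u(2)], subst acts_lin[OF z(2,3) u(2)]) (rule refl)
 then show ?case
  using Cons.IH[OF u(1) Cons.prems(2,3) act_sec[OF q(2) U Cons.prems(4)] Cons.prems(5)]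
   Cons.IH[OF u(1) b(1) Cons.prems(3-5)] Cons.IH[OF u(1) Cons.prems(2) b(2) Cons.prems(4,5)] by simp
qed

lemma act_lowE:
 assumes "f \<in> sections R U"
 shows "act U (lowE v) f = (\<lambda>i S w. - dB R U (Esym v) f i S w)"
 by(intro ext) (simp add: act_def restr_def dB_def lowE_def act_low[OF R Esym_symm U assms])

lemma jet_word_lowE_prefix:
 "f \<in> sections R U ==> u \<in> algs ==> w \<in> gspace R ==>
  jword R (map lowE l @ u) f w = jword R u (dsec R U l f) w"
proof (induction l arbitrary: f)
 case Nil
 then show ?case by(simp add: dsec_Nil)
next
 case (Cons v l)
 have lu: "map lowE l @ u \<in> algs" using Cons.prems(2) lowE_lists(2)[of l] by(simp only: append_in_lists_conv)
 note d = dB_sections[OF R U Esym_symm[of v] Cons.prems(1)]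
 have "jword R (map lowE (v # l) @ u) f w = - jword R (map lowE l @ u) (act U (lowE v) f) w"
  using jet_word_Cons[OF lowE_alg lu Cons.prems(3,1)] by(simp del: jet_word.simps)
 also have "... = jword R (map lowE l @ u) (dB R U (Esym v) f) w"
  using jet_word_lin[OF lu Cons.prems(3) d d, of "-1" 0] by(simp add: act_lowE[OF Cons.prems(1)] del: jet_word.simps)
 also have "... = jword R u (dsec R U l (dB R U (Esym v) f)) w"
  by(rule Cons.IH[OF d Cons.prems(2,3)])
 finally show ?case by(simp only: dsec_Cons[OF U, of _ v l])
qed

lemma jet_pair_prep_lowE_tw:
 assumes f: "f \<in> sections R U" and w: "w \<in> gspace R"
 shows "jpair R (lowp l (tw (\<tau> i) w)) f = dl l (sl f i w) 0"
proof -
 have "jpair R (lowp l (tw (\<tau> i) w)) f = lin_ext (\<lambda>u. jword R (map lowE l @ u) f w) (\<tau> i)"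
  by(simp add: prep_def tw_def push_push jet_pair_lin_ext lin_ext_push word_def)
 also have "... = lin_ext (\<lambda>u. jword R u (dsec R U l f) w) (\<tau> i)"
  by(rule lin_ext_cong, rule jet_word_lowE_prefix[OF f _ w]) (use \<tau>_keys neg_lists in blast)
 also have "... = dsec R U l f i 0 w"
  unfolding jet_pair_tw[symmetric] by(rule \<tau>_pair[OF R U dsec_sections[OF R U f] 0 w])
 also have "... = dl l (sl f i w) 0" using 0 w by(simp add: dsec_def restr_apply)
 finally show ?thesis .
qed

text \<open>The elements \<open>\<tau> i\<close>, prefixed by words in the \<open>lowE v\<close>,
  read off all partial derivatives of all components at \<open>o\<close>. Vanishing on words in
  \<open>neg\<close> thus makes the whole Taylor series vanish.\<close>

lemma vanish_near_origin:
 assumes f: "f \<in> sections R U" and z: "!!u w. u \<in> lists neg ==> w \<in> gspace R ==> jword R u f w = 0"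
  and ball: "sball 0 e <= U" and S: "S \<in> sball 0 e" and w: "w \<in> gspace R"
 shows "f i S w = 0"
proof (rule holo_identity[OF holo_on_subset[OF sectionsD(5)[OF f w] ball] _ _ S])
 fix l
 have "dl l (sl f i w) 0 = lin_ext (\<lambda>u. jword R (map lowE l @ u) f w) (\<tau> i)"
  unfolding jet_pair_prep_lowE_tw[OF f w, symmetric]
  by(simp add: prep_def tw_def push_push jet_pair_lin_ext lin_ext_push word_def)
 also have "... = 0"
  unfolding lin_ext_def
 proof (rule sum.neutral, rule ballI)
  fix u assume "u \<in> keys (\<tau> i)"
  then have "map lowE l @ u \<in> lists neg"
   using \<tau>_keys[of i] lowE_lists(1)[of l] by(auto simp only: append_in_lists_conv)
  then show "lookup (\<tau> i) u * jword R (map lowE l @ u) f w = 0" using z w by simp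
 qed
 finally show "dl l (sl f i w) 0 = 0" .
qed simp

text \<open>All jets of the defect along \<open>neg\<close> vanish at \<open>o\<close>, so the
  defect is zero as a section near \<open>o\<close>. Then every jet word ignores it, not only those
  in \<open>neg\<close>.\<close>

lemma jet_word_Zs:
 assumes X: "X \<in> alg st" and Y: "Y \<in> alg st" and f: "f \<in> sections R U" and w: "w \<in> gspace R" and u: "u \<in> algs"
 shows "jword R u (act U X (act U Y f)) w
  = ksign X Y * jword R u (act U Y (act U X f)) w + jword R u (act U (bracket X Y) f) w"
proof -
 note Z = Zs_sec[OF X Y f]
 obtain e where e: "e > 0" "sball 0 e <= U" using opens_ball[OF U 0] by blast
 have z: "jword R v (Zs X Y f) w = 0" if "v \<in> lists neg" "w \<in> gspace R" for v w
  using jet_word_append[OF Z neg_lists[OF that(1)], of "[]" w] acts_Zs_zero[OF that(1) X Y f that(2)] that(2) by simp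
 have "jword R u (Zs X Y f) w = jword R u zs w"
  by(rule jet_word_local[OF sball_opens _ u w]) (use vanish_near_origin[OF Z z e(2)] e center_sball[of 0 e] in auto)
 then have "jword R u (Zs X Y f) w = 0" using jet_word_zero[OF u w] by simp
 note act_secs = act_sec[OF X U act_sec[OF Y U f]] act_sec[OF Y U act_sec[OF X U f]] act_sec[OF bracket_alg[OF X Y] U f]
 have "jword R u (Zs X Y f) w = 1 * (1 * jword R u (act U X (act U Y f)) w
  + (- ksign X Y) * jword R u (act U Y (act U X f)) w) + (- 1) * jword R u (act U (bracket X Y) f) w"
  unfolding Zs_def jet_word_lin[OF u w sections_lin[OF act_secs(1,2)] act_secs(3)] jet_word_lin[OF u w act_secs(1,2)] ..
 then show ?thesis using \<open>jword R u (Zs X Y f) w = 0\<close> by(simp add: algebra_simps del: jet_word.simps)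
qed

lemma jet_word_bracket:
 assumes X: "X \<in> alg st" and Y: "Y \<in> alg st" and f: "f \<in> sections R U" and w: "w \<in> gspace R" and u: "u \<in> algs"
 shows "jword R (X # Y # u) f w = ksign X Y * jword R (Y # X # u) f w + jword R (bracket X Y # u) f w"
proof -
 have Xu: "X # u \<in> algs" and Yu: "Y # u \<in> algs" using X Y u by auto
 note c = jet_word_Cons[OF X Yu w f] jet_word_Cons[OF Y Xu w f] jet_word_Cons[OF bracket_alg[OF X Y] u w f]
  jet_word_Cons[OF Y u w act_sec[OF X U f]] jet_word_Cons[OF X u w act_sec[OF Y U f]]
 show ?thesis
  unfolding c using jet_word_Zs[OF X Y f w u]
  by(cases "is_odd X"; cases "is_odd Y"; cases "odd (length (filter is_odd u))")
   (simp_all add: ksign_def is_odd_bracket del: jet_word.simps)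
qed

lemma jet_word_comb:
 assumes f: "f \<in> sections R U" and u: "u \<in> algs" and v: "v \<in> algs" and w: "w \<in> gspace R"
  and X: "X \<in> alg st" and Y: "Y \<in> alg st" and o: "is_odd X = is_odd Y"
 shows "jword R (u @ [oadd (oscale a X) (oscale b Y)] @ v) f w
  = a * jword R (u @ [X] @ v) f w + b * jword R (u @ [Y] @ v) f w"
proof -
 let ?Z = "oadd (oscale a X) (oscale b Y)"
 have l: "[X] @ v \<in> algs" if "X \<in> alg st" for X using v that by simp
 have Z: "?Z \<in> alg st" by(rule oadd_alg[OF oscale_alg[OF X] oscale_alg[OF Y]])
 note g = acts_sec[OF f u]
 have "act U ?Z (acts u f) = (\<lambda>i S w. a * act U X (acts u f) i S w + b * act U Y (acts u f) i S w)"
  by(subst act_oadd_fun[OF oscale_alg[OF X] oscale_alg[OF Y] _ g])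
   (simp_all only: o act_oscale_fun[OF X g] act_oscale_fun[OF Y g] mult_1_left is_odd_oscale)
 then have "jword R (?Z # v) (acts u f) w = a * jword R (X # v) (acts u f) w + b * jword R (Y # v) (acts u f) w"
  by(simp add: o jet_word_Cons[OF Z v w g] jet_word_Cons[OF X v w g] jet_word_Cons[OF Y v w g]
    jet_word_lin[OF v w act_sec[OF X U g] act_sec[OF Y U g]] algebra_simps del: jet_word.simps)
 then show ?thesis
  unfolding jet_word_append[OF f u l[OF X] w] jet_word_append[OF f u l[OF Y] w] jet_word_append[OF f u l[OF Z] w]
  by(simp add: o algebra_simps del: jet_word.simps)
qed

text \<open>A prefix \<open>u\<close> in front of a relation is turned by
  \<open>jet_word_append\<close> into a sign and the section \<open>acts u f\<close>. What remains
  is linearity, the bracket relation for jets, or the value of a parabolic element at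
  \<open>o\<close>.\<close>

lemma jet_pair_null:
 assumes f: "f \<in> sections R U" and x: "x \<in> nulls R"
 shows "jpair R x f = 0"
proof -
 have "fs.span (relators (alg st) (par st) R) <= {x. jpair R x f = 0}"
 proof (rule fs.span_minimal)
  show "fs.subspace {x. jpair R x f = 0}"
   by(rule fs.subspaceI) (simp_all add: jet_pair_add jet_pair_fscale)
  note jl = jet_pair_diff jet_pair_fscale jet_pair_word
  show "relators (alg st) (par st) R <= {x. jpair R x f = 0}"
  proof (rule subsetI, rule CollectI)
   fix x assume "x \<in> relators (alg st) (par st) R"
   then show "jpair R x f = 0"
   proof (cases rule: relators_cases)
   case (add u w w')
   have "jpair R (word u (w + w') - word u w - word u w') f = 0"
    unfolding jl using add by(simp add: jet_word_w(1)[OF _ f])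
   then show ?thesis using add(1) by simp
  next
   case (scale u c w)
   have "jpair R (word u (gscale R c w) - fscale c (word u w)) f = 0"
    unfolding jl using scale by(simp add: jet_word_w(2)[OF _ f])
   then show ?thesis using scale(1) by simp
  next
   case (ev u v a b M N w)
   then show ?thesis
    using jet_word_comb[OF f _ _ ev(6,4,5), of u v a b] by(simp add: jl del: jet_word.simps)
  next
   case (od u v a b y z w)
   then show ?thesis
    using jet_word_comb[OF f _ _ od(6,4,5), of u v a b] by(simp add: jl del: jet_word.simps)
  next
   case (br u v X Y w)
   note u = br(2) and v = br(3) and X = br(4) and Y = br(5) and w = br(6)
   have l: "[X, Y] @ v \<in> algs" "[Y, X] @ v \<in> algs" "[bracket X Y] @ v \<in> algs"
    using v X Y bracket_alg[OF X Y] by simp_all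
   have p: "odd (length (filter is_odd ([Y, X] @ v))) = odd (length (filter is_odd ([X, Y] @ v)))"
    "odd (length (filter is_odd ([bracket X Y] @ v))) = odd (length (filter is_odd ([X, Y] @ v)))"
    by(auto simp: is_odd_bracket)
   show ?thesis
    unfolding br(1) jl jet_word_append[OF f u l(1) w] jet_word_append[OF f u l(2) w] jet_word_append[OF f u l(3) w] p
    using jet_word_bracket[OF X Y acts_sec[OF f u] w v] by(simp add: algebra_simps del: jet_word.simps bracket.simps)
  next
   case (par u X w)
   note u = par(2) and X = par(3) and w = par(4)
   have Xa: "X \<in> alg st" using X par_alg by auto
   note g = acts_sec[OF f u]
   have "act U X (acts u f) (body st) 0 w = - acts u f (body st) 0 (par_act R X w)"
    using act_par[OF R X U g 0 w] by(simp add: act_inside[OF 0 w])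
   then have "jword R [X] (acts u f) w = acts u f (body st) 0 (par_act R X w)"
    using jet_word_Cons[OF Xa _ w g, of "[]"] by simp
   \<comment> \<open>For odd \<open>X\<close> both sides of the parabolic relation are 0, so the
     sign of the prefix is immaterial.\<close>
   moreover have "odd (length (filter is_odd [X])) ==> acts u f (body st) 0 (par_act R X w) = 0"
    using sections_diff[OF R g 0 w w, of "body st"] by(cases X) auto
   ultimately show ?thesis
    unfolding par(1) jl
    using jet_word_append[OF f u, of "[X]" w] jet_word_append[OF f u, of "[]" "par_act R X w"] Xa w par_act_closed[OF R X w]
    by(cases "is_odd X") (simp_all del: jet_word.simps(2))
   qed
  qed
 qed
 then show ?thesis using x by(auto simp: ind_null_def)
qed

end
end
end

section \<open>Relations of the induced module and prefixing of words\<close>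

lemma prep_add: "prep u (x + y) = prep u x + prep u y"
 and prep_diff: "prep u (x - y) = prep u x - prep u y"
 and prep_fscale: "prep u (fscale c x) = fscale c (prep u x)"
 and prep_sum: "prep u (sum f A) = (\<Sum>a\<in>A. prep u (f a))"
 and prep_0 [simp]: "prep u 0 = 0"
 by(simp_all add: prep_def push_add push_diff push_fscale push_sum)

lemma prep_preimage_subspace:
 assumes "fs.subspace V"
 shows "fs.subspace {x. prep u x \<in> V}"
 using assms by(intro fs.subspaceI) (auto simp: prep_add prep_fscale fs.subspace_add fs.subspace_scale fs.subspace_0)

lemma subspace_null: "fs.subspace (ind_null G P R)"
 unfolding ind_null_def by(rule fs.subspace_span)

lemma subspace_tspan: "fs.subspace (tspan G P R \<tau>)"
 unfolding tspan_def by(rule fs.subspace_span)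

lemma null_tspan: "x \<in> ind_null G P R ==> x \<in> tspan G P R \<tau>"
 unfolding tspan_def by(rule fs.span_base) blast

lemma ind_space_subspace: "fs.subspace (ind_space G R)"
proof (rule fs.subspaceI)
 show "x + y \<in> ind_space G R" if "x \<in> ind_space G R" "y \<in> ind_space G R" for x y
  using that Poly_Mapping.keys_add[of x y] unfolding ind_space_def by blast
 show "fscale c x \<in> ind_space G R" if "x \<in> ind_space G R" for c x
  using that keys_fscale[of c x] unfolding ind_space_def by blast
qed (simp add: ind_space_def)

lemma word_ind_space: "u \<in> lists G ==> w \<in> gspace R ==> word u w \<in> ind_space G R"
 by(simp add: ind_space_def word_def)

lemma ind_space_subset:
 assumes "fs.subspace V" "!!u w. u \<in> lists G ==> w \<in> gspace R ==> word u w \<in> V"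
 shows "ind_space G R <= V"
proof
 fix x assume x: "x \<in> ind_space G R"
 have "x = push (\<lambda>k. word (fst k) (snd k)) x"
  by(simp add: word_def push_single_id)
 also have "... \<in> V"
  by(rule push_in_subspace[OF assms(1)], rule assms(2)) (use x in \<open>auto simp: ind_space_def\<close>)
 finally show "x \<in> V" .
qed

lemma lin_ind_space:
 assumes "fs.subspace V" "!!x y. d (x + y) = d x + d y" "!!c x. d (fscale c x) = fscale c (d x)"
  and "!!u w. u \<in> lists G ==> w \<in> gspace R ==> d (word u w) \<in> V" and y: "y \<in> ind_space G R"
 shows "d y \<in> V"
proof -
 have "d 0 = 0" using assms(3)[of 0 0] by simp
 then have "fs.subspace {y. d y \<in> V}"
  using assms(1-3) by(intro fs.subspaceI) (auto simp: fs.subspace_add fs.subspace_scale fs.subspace_0)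
 from ind_space_subset[OF this] assms(4) y show ?thesis by blast
qed

lemma prep_ind_space:
 assumes "u \<in> lists G" "x \<in> ind_space G R"
 shows "prep u x \<in> ind_space G R"
 by(rule lin_ind_space[OF ind_space_subspace _ _ _ assms(2)]) (use assms(1) in \<open>simp_all add: prep_add prep_fscale word_ind_space\<close>)

context
 fixes G P :: "'n::finite osp set" and R :: "('n, 'w::ab_group_add) glmod"
begin

lemmas relI = fs.span_base[of _ "relators G P R", folded ind_null_def, unfolded relators_def]

lemma rel_add: "u \<in> lists G ==> w \<in> gspace R ==> w' \<in> gspace R ==>
  word u (w + w') - word u w - word u w' \<in> ind_null G P R"
 by(rule relI, rule UnI1, rule UnI1, rule UnI1, rule UnI1, rule UnI1, blast)

lemma rel_scale: "u \<in> lists G ==> w \<in> gspace R ==> word u (gscale R c w) - fscale c (word u w) \<in> ind_null G P R"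
 by(rule relI, rule UnI1, rule UnI1, rule UnI1, rule UnI1, rule UnI2, blast)

lemma rel_ev: "u \<in> lists G ==> v \<in> lists G ==> Ev M \<in> G ==> Ev N \<in> G ==> w \<in> gspace R ==>
  word (u @ [Ev (mscale a M + mscale b N)] @ v) w
    - fscale a (word (u @ [Ev M] @ v) w) - fscale b (word (u @ [Ev N] @ v) w) \<in> ind_null G P R"
 by(rule relI, rule UnI1, rule UnI1, rule UnI1, rule UnI2, blast)

lemma rel_od: "u \<in> lists G ==> v \<in> lists G ==> Od y \<in> G ==> Od z \<in> G ==> w \<in> gspace R ==>
  word (u @ [Od (a *s y + b *s z)] @ v) w
    - fscale a (word (u @ [Od y] @ v) w) - fscale b (word (u @ [Od z] @ v) w) \<in> ind_null G P R"
 by(rule relI, rule UnI1, rule UnI1, rule UnI2, blast)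

lemma rel_br: "u \<in> lists G ==> v \<in> lists G ==> X \<in> G ==> Y \<in> G ==> w \<in> gspace R ==>
  word (u @ [X, Y] @ v) w - fscale (ksign X Y) (word (u @ [Y, X] @ v) w)
    - word (u @ [bracket X Y] @ v) w \<in> ind_null G P R"
 by(rule relI, rule UnI1, rule UnI2, blast)

lemma rel_par: "u \<in> lists G ==> X \<in> P ==> w \<in> gspace R ==>
  word (u @ [X]) w - word u (par_act R X w) \<in> ind_null G P R"
 by(rule relI, rule UnI2, blast)

lemma prep_null:
 assumes u: "u \<in> lists G" and x: "x \<in> ind_null G P R"
 shows "prep u x \<in> ind_null G P R"
proof -
 have "fs.span (relators G P R) <= {x. prep u x \<in> ind_null G P R}"
 proof (rule fs.span_minimal[OF _ prep_preimage_subspace[OF subspace_null]], rule subsetI, rule CollectI)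
  fix x assume "x \<in> relators G P R"
  then show "prep u x \<in> ind_null G P R"
  proof (cases rule: relators_cases)
   case (add v w w')
   then show ?thesis using rel_add[of "u @ v" w w'] u by(simp add: prep_diff prep_fscale)
  next
   case (scale v c w)
   then show ?thesis using rel_scale[of "u @ v" w c] u by(simp add: prep_diff prep_fscale)
  next
   case (ev v z a b M N w)
   then show ?thesis using rel_ev[of "u @ v" z M N w a b] u by(simp add: prep_diff prep_fscale)
  next
   case (od v z a b M N w)
   then show ?thesis using rel_od[of "u @ v" z M N w a b] u by(simp add: prep_diff prep_fscale)
  next
   case (br v z X Y w)
   then show ?thesis using rel_br[of "u @ v" z X Y w] u by(simp add: prep_diff prep_fscale)
  next
   case (par v X w)
   then show ?thesis using rel_par[of "u @ v" X w] u by(simp add: prep_diff prep_fscale)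
  qed
 qed
 then show ?thesis using x unfolding ind_null_def by auto
qed

lemma rel_Ev_zero:
 assumes "u \<in> lists G" "Ev M \<in> G" "w \<in> gspace R"
 shows "word (Ev 0 # u) w \<in> ind_null G P R"
 using rel_ev[of "[]" u M M w 0 0] assms by(simp add: ms.scale_zero_left)

lemma rel_oadd:
 assumes "u \<in> lists G" "X \<in> G" "Y \<in> G" "is_odd X = is_odd Y" "w \<in> gspace R"
 shows "word (oadd X Y # u) w - word (X # u) w - word (Y # u) w \<in> ind_null G P R"
 using rel_ev[of "[]" u _ _ w 1 1] rel_od[of "[]" u _ _ w 1 1] assms
 by(cases X; cases Y) (auto simp: ms.scale_one fs.scale_one)

end

lemma null_subst:
 assumes "x - y \<in> ind_null G P R" "fs.subspace V" "ind_null G P R <= V"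
 shows "x \<in> V \<longleftrightarrow> y \<in> V"
 using fs.subspace_add[OF assms(2), of "x - y" y] fs.subspace_diff[OF assms(2), of x "x - y"] assms by auto

lemma low_mult: "low A ** low B = 0"
 by(auto simp: vec_eq_iff matrix_matrix_mult_def low_def split: sum.splits intro!: sum.neutral)

context dual_setting
begin

context
 fixes R :: "('n, 'w) glmod"
 assumes R: "gl_module R"
begin

abbreviation null where "null \<equiv> nulls R"
abbreviation space where "space \<equiv> spaces R"

text \<open>The product of two lower block matrices is 0, so the bracket is \<open>Ev 0\<close>, and
  a word starting with \<open>Ev 0\<close> is null by linearity.\<close>

lemma lowE_commute:
 assumes "x \<in> space"
 shows "prep [lowE a, lowE b] x - prep [lowE b, lowE a] x \<in> null"
proof (rule lin_ind_space[OF subspace_null _ _ _ assms])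
 fix u w assume u: "u \<in> algs" and w: "w \<in> gspace R"
 have k: "ksign (lowE a) (lowE b) = 1" by(simp add: ksign_def)
 have br: "bracket (lowE a) (lowE b) = Ev 0" by(simp add: lowE_def low_mult)
 have "word ([lowE a, lowE b] @ u) w - word ([lowE b, lowE a] @ u) w - word (Ev 0 # u) w \<in> null"
  using rel_br[OF _ u lowE_alg lowE_alg w, of "[]" a b] unfolding k br by(simp add: fs.scale_one)
 moreover have "word (Ev 0 # u) w \<in> null"
  by(rule rel_Ev_zero[OF u _ w]) (use lowE_alg in \<open>unfold lowE_def\<close>)
 ultimately show "prep [lowE a, lowE b] (word u w) - prep [lowE b, lowE a] (word u w) \<in> null"
  using fs.subspace_add[OF subspace_null] by fastforce
qed (simp_all add: prep_add prep_fscale fs.scale_right_diff_distrib)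

lemma lowE_mset:
 "x \<in> space ==> mset l = mset l' ==> lowp l x - prep (map lowE l') x \<in> null"
proof (induction l arbitrary: l' x)
 case Nil
 then show ?case by(simp add: fs.subspace_0[OF subspace_null])
next
 case (Cons v l)
 note xs = Cons.prems(1)
 have tr: "a - c \<in> null" if "a - b \<in> null" "b - c \<in> null" for a b c
  using fs.subspace_add[OF subspace_null that] by simp
 have move: "lowp (xs @ v # ys) x - lowp (v # xs @ ys) x \<in> null" for xs ys
 proof (induction xs)
  case (Cons u xs)
  have 1: "prep [lowE u] (lowp (xs @ v # ys) x - lowp (v # xs @ ys) x) \<in> null"
   by(rule prep_null[OF _ Cons.IH]) (use lowE_alg in simp)
  have 2: "prep [lowE u, lowE v] (lowp (xs @ ys) x) - prep [lowE v, lowE u] (lowp (xs @ ys) x) \<in> null"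
   by(rule lowE_commute, rule prep_ind_space[OF lowE_lists(2) xs])
  show ?case
   using tr 1 2 by(simp add: prep_diff prep_prep)
 qed (simp add: fs.subspace_0[OF subspace_null])
 have "v \<in> set l'" using Cons.prems(2) by(metis list.set_intros(1) set_mset_mset)
 then obtain xs ys where l': "l' = xs @ v # ys" by(auto simp: in_set_conv_decomp)
 have "lowp l x - lowp (xs @ ys) x \<in> null"
  by(rule Cons.IH[OF Cons.prems(1)]) (use Cons.prems(2) l' in simp)
 then have 3: "prep [lowE v] (lowp l x - lowp (xs @ ys) x) \<in> null"
  by(intro prep_null) (use lowE_alg in simp_all)
 have 4: "lowp (v # xs @ ys) x - prep (map lowE l') x \<in> null"
  using fs.subspace_neg[OF subspace_null move[of xs ys]] by(simp add: l')
 from 3 have "lowp (v # l) x - lowp (v # xs @ ys) x \<in> null" by(simp add: prep_diff prep_prep)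
 from tr[OF this 4] show ?case .
qed

text \<open>The target of the spanning half of the Poincare-Birkhoff-Witt theorem: modulo relations,
  words in the opposite nilradical applied to the fibre.\<close>

definition negspan :: "('n, 'w) tens set" where
 "negspan = fs.span (null \<union> {word u w | u w. u \<in> lists neg & w \<in> gspace R})"

lemma subspace_negspan: "fs.subspace negspan"
 unfolding negspan_def by(rule fs.subspace_span)

lemma null_negspan: "null <= negspan"
 unfolding negspan_def using fs.span_superset by blast

lemma word_negspan: "u \<in> lists neg ==> w \<in> gspace R ==> word u w \<in> negspan"
 unfolding negspan_def by(rule fs.span_base) blast

lemma prep_negspanI:
 assumes X: "X \<in> alg st" and w: "!!u w. u \<in> lists neg ==> w \<in> gspace R ==> word (X # u) w \<in> negspan"
  and x: "x \<in> negspan"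
 shows "prep [X] x \<in> negspan"
proof -
 have "negspan <= {x. prep [X] x \<in> negspan}"
 proof (subst (1) negspan_def, rule fs.span_minimal[OF _ prep_preimage_subspace[OF subspace_negspan]], intro Un_least subsetI CollectI)
  show "prep [X] x \<in> negspan" if "x \<in> null" for x
   by(rule subsetD[OF null_negspan prep_null[OF _ that]]) (use X in simp)
  show "prep [X] x \<in> negspan" if "x \<in> {word u w |u w. u \<in> lists neg & w \<in> gspace R}" for x
   using that by(elim CollectE exE conjE) (simp only: prep_word append.simps w)
 qed
 then show ?thesis using x by blast
qed

lemma prep_neg_negspan: "q \<in> neg ==> x \<in> negspan ==> prep [q] x \<in> negspan"
 using neg_alg by(intro prep_negspanI word_negspan) auto

text \<open>The parabolic part of \<open>X\<close> is moved to the right past the first letter. The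
  bracket that appears is an arbitrary element of the algebra in front of a shorter word, which is
  why the induction keeps \<open>X\<close> general; at the end of the word the parabolic part acts
  on \<open>w\<close>.\<close>

lemma word_Cons_negspan:
 "u \<in> lists neg ==> X \<in> alg st ==> w \<in> gspace R ==> word (X # u) w \<in> negspan"
proof (induction u arbitrary: X)
 case Nil
 obtain Y Z where d: "Y \<in> neg" "Z \<in> par st" "is_odd Y = is_odd Z" "X = oadd Y Z" using decomp[OF Nil.prems(2)] by blast
 have a: "Y \<in> alg st" "Z \<in> alg st" using d neg_alg par_alg by auto
 have Y: "word [Y] w \<in> negspan" using d(1) Nil.prems by(intro word_negspan) auto
 have "word [Z] w - word [] (par_act R Z w) \<in> null" using rel_par[OF _ d(2) Nil.prems(3), of "[]"] by simp
 moreover have "word [] (par_act R Z w) \<in> negspan"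
  by(rule word_negspan) (use par_act_closed[OF R d(2) Nil.prems(3)] in auto)
 ultimately have Z: "word [Z] w \<in> negspan" using null_subst[OF _ subspace_negspan null_negspan] by blast
 have "word [oadd Y Z] w - (word [Y] w + word [Z] w) \<in> null"
  using rel_oadd[OF _ a d(3) Nil.prems(3), of "[]"] by(simp add: algebra_simps)
 then show ?case
  using null_subst[OF _ subspace_negspan null_negspan] fs.subspace_add[OF subspace_negspan Y Z] d(4) by blast
next
 case (Cons q u)
 then have q: "q \<in> neg" "q \<in> alg st" and u: "u \<in> lists neg" "u \<in> algs" using neg_alg by auto
 obtain Y Z where d: "Y \<in> neg" "Z \<in> par st" "is_odd Y = is_odd Z" "X = oadd Y Z" using decomp[OF Cons.prems(2)] by blast
 have a: "Y \<in> alg st" "Z \<in> alg st" using d neg_alg par_alg by auto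
 have qu: "q # u \<in> algs" using q u by simp
 have Y: "word (Y # q # u) w \<in> negspan" using d(1) q u Cons.prems by(intro word_negspan) auto
 have "word ([Z, q] @ u) w - fscale (ksign Z q) (word ([q, Z] @ u) w) - word ([bracket Z q] @ u) w \<in> null"
  using rel_br[OF _ u(2) a(2) q(2) Cons.prems(3), of "[]"] by simp
 then have "word (Z # q # u) w - (fscale (ksign Z q) (word (q # Z # u) w) + word (bracket Z q # u) w) \<in> null"
  by(simp add: algebra_simps)
 moreover have "word (bracket Z q # u) w \<in> negspan"
  by(rule Cons.IH[OF u(1) bracket_alg[OF a(2) q(2)] Cons.prems(3)])
 moreover have "word (q # Z # u) w \<in> negspan"
  using prep_neg_negspan[OF q(1) Cons.IH[OF u(1) a(2) Cons.prems(3)]] by simp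
 ultimately have Z: "word (Z # q # u) w \<in> negspan"
  using null_subst[OF _ subspace_negspan null_negspan]
   fs.subspace_add[OF subspace_negspan fs.subspace_scale[OF subspace_negspan]] by blast
 have "word (oadd Y Z # q # u) w - (word (Y # q # u) w + word (Z # q # u) w) \<in> null"
  using rel_oadd[OF qu a d(3) Cons.prems(3)] by(simp add: algebra_simps)
 then show ?case
  using null_subst[OF _ subspace_negspan null_negspan] fs.subspace_add[OF subspace_negspan Y Z] d(4) by blast
qed

lemma prep_negspan: "X \<in> alg st ==> x \<in> negspan ==> prep [X] x \<in> negspan"
 by(rule prep_negspanI[OF _ word_Cons_negspan])

lemma space_negspan: "space <= negspan"
proof (rule ind_space_subset[OF subspace_negspan])
 show "word u w \<in> negspan" if "u \<in> algs" "w \<in> gspace R" for u w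
  using that
 proof (induction u)
  case (Cons X u)
  then show ?case using prep_negspan[of X "word u w"] by simp
 qed (simp add: word_negspan)
qed

text \<open>Words in the whole algebra reduce to words in \<open>neg\<close>, and these to the
  generators by \<open>\<tau>_span\<close>.\<close>

lemma space_tspan: "space <= tspan (alg st) (par st) R \<tau>"
proof -
 have "negspan <= tspan (alg st) (par st) R \<tau>"
  unfolding negspan_def
  by(rule fs.span_minimal[OF _ subspace_tspan]) (auto intro: null_tspan \<tau>_span[OF R])
 then show ?thesis using space_negspan by blast
qed

end
end

section \<open>Functionals with factorial growth\<close>

definition growth :: "('v list => complex) => bool" where
 "growth F \<longleftrightarrow> (\<exists>C R. C >= 0 & R >= 0 & (\<forall>l. norm (F l) <= fb C R (length l)))"

lemma growth_zero: "growth (\<lambda>l. 0)"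
 unfolding growth_def by(intro exI[of _ 0] exI[of _ 0]) simp

lemma growth_cmult:
 assumes "growth F"
 shows "growth (\<lambda>l. c * F l)"
proof -
 obtain C R where C: "C >= 0" "R >= 0" "!!l. norm (F l) <= fb C R (length l)"
  using assms unfolding growth_def by blast
 have "norm (c * F l) <= fb (norm c * C) R (length l)" for l
  using mult_left_mono[OF C(3)[of l] norm_ge_zero[of c]] by(simp add: norm_mult mult.assoc)
 then show ?thesis unfolding growth_def using C(1,2) by(intro exI[of _ "norm c * C"] exI[of _ R]) simp
qed

lemma growth_add:
 assumes "growth F" "growth G"
 shows "growth (\<lambda>l. F l + G l)"
proof -
 obtain C R where C: "C >= 0" "R >= 0" "!!l. norm (F l) <= fb C R (length l)"
  using assms(1) unfolding growth_def by blast
 obtain D Q where D: "D >= 0" "Q >= 0" "!!l. norm (G l) <= fb D Q (length l)"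
  using assms(2) unfolding growth_def by blast
 have "norm (F l + G l) <= (C + D) * max R Q ^ length l * fact (length l)" for l
 proof -
  have "fb C R (length l) <= C * max R Q ^ length l * fact (length l)"
   using C by(intro mult_right_mono mult_left_mono power_mono) auto
  moreover have "fb D Q (length l) <= D * max R Q ^ length l * fact (length l)"
   using D by(intro mult_right_mono mult_left_mono power_mono) auto
  ultimately show ?thesis
   using norm_triangle_ineq[of "F l" "G l"] C(3)[of l] D(3)[of l] by(simp add: distrib_right)
 qed
 then show ?thesis unfolding growth_def using C(1,2) D(1) by(intro exI[of _ "C + D"] exI[of _ "max R Q"]) simp
qed

text \<open>A binomial coefficient gives \<open>(n + m)! <= n! * m! * 2 ^ (n + m)\<close>, so a
  fixed suffix doubles the rate and changes the constant.\<close>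

lemma growth_append:
 assumes "growth F"
 shows "growth (\<lambda>l. F (l @ k))"
proof -
 obtain C R where C: "C >= 0" "R >= 0" "!!l. norm (F l) <= fb C R (length l)"
  using assms unfolding growth_def by blast
 define K where "K = C * R ^ length k * 2 ^ length k * fact (length k)"
 have "norm (F (l @ k)) <= fb K (2 * R) (length l)" for l
 proof -
  let ?n = "length l" and ?m = "length k"
  have "fact (?n + ?m) = fact ?n * fact ?m * ((?n + ?m) choose ?n)"
   using binomial_fact_lemma[of ?n "?n + ?m"] by simp
  also have "... <= fact ?n * fact ?m * 2 ^ (?n + ?m)"
   by(intro mult_left_mono binomial_le_pow2) simp
  finally have "real (fact (?n + ?m)) <= real (fact ?n * fact ?m * 2 ^ (?n + ?m))" by(simp only: of_nat_le_iff)
  then have f: "fact (?n + ?m) <= (fact ?n * fact ?m * 2 ^ (?n + ?m) :: real)" by simp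
  have "norm (F (l @ k)) <= C * R ^ (?n + ?m) * fact (?n + ?m)" using C(3)[of "l @ k"] by simp
  also have "... <= C * R ^ (?n + ?m) * (fact ?n * fact ?m * 2 ^ (?n + ?m))"
   using C by(intro mult_left_mono f) auto
  also have "... = K * (2 * R) ^ ?n * fact ?n" by(simp add: K_def power_add power_mult_distrib)
  finally show ?thesis .
 qed
 then show ?thesis unfolding growth_def using C(1,2) by(intro exI[of _ K] exI[of _ "2 * R"]) (simp add: K_def)
qed

lemma push_diff_fun: "push (\<lambda>k. h k - h' k) x = push h x - push h' x"
 by(simp add: push_def fs.scale_right_diff_distrib sum_subtractf)

lemma push_fscale_fun: "push (\<lambda>k. fscale c (h k)) x = fscale c (push h x)"
 by(simp add: push_def fs.scale_sum_right mult.commute)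

context dual_setting
begin

context
 fixes R :: "('n, 'w) glmod"
 assumes R: "gl_module R"
begin

lemma null_space: "nulls R <= spaces R"
 unfolding ind_null_def
proof (rule fs.span_minimal[OF _ ind_space_subspace], rule subsetI)
 fix x assume "x \<in> relators (alg st) (par st) R"
 note s = fs.subspace_diff[OF ind_space_subspace] fs.subspace_scale[OF ind_space_subspace] word_ind_space
 from \<open>x \<in> relators (alg st) (par st) R\<close> show "x \<in> spaces R"
 proof (cases rule: relators_cases)
  case (add u w w')
  then show ?thesis unfolding add(1) by(intro s gl_module_closed[OF R])
 next
  case (scale u c w)
  then show ?thesis unfolding scale(1) by(intro s gl_module_closed[OF R])
 next
  case (ev u v a b M N w)
  have "Ev (mscale a M + mscale b N) \<in> alg st" using oadd_alg[OF oscale_alg[OF ev(4), of a] oscale_alg[OF ev(5), of b]] by simp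
  then show ?thesis unfolding ev(1) by(intro s) (use ev in simp_all)
 next
  case (od u v a b y z w)
  have "Od (a *s y + b *s z) \<in> alg st" using oadd_alg[OF oscale_alg[OF od(4), of a] oscale_alg[OF od(5), of b]] by simp
  then show ?thesis unfolding od(1) by(intro s) (use od in simp_all)
 next
  case (br u v X Y w)
  show ?thesis unfolding br(1) by(intro s) (use br bracket_alg[OF br(4,5)] in simp_all)
 next
  case (par u X w)
  show ?thesis unfolding par(1) by(intro s) (use par par_alg par_act_closed[OF R par(3,4)] in auto)
 qed
qed

lemma \<tau>_lists: "u \<in> keys (\<tau> i) ==> u \<in> algs"
 using \<tau>_keys neg_lists by blast

lemma tw_space: "w \<in> gspace R ==> tw (\<tau> i) w \<in> spaces R"
 unfolding tw_def by(rule push_in_subspace[OF ind_space_subspace]) (rule word_ind_space, rule \<tau>_lists)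

lemma tw_add: "w \<in> gspace R ==> w' \<in> gspace R ==>
  tw (\<tau> i) (w + w') - tw (\<tau> i) w - tw (\<tau> i) w' \<in> nulls R"
 unfolding tw_def push_diff_fun[symmetric]
 by(rule push_in_subspace[OF subspace_null]) (rule rel_add, rule \<tau>_lists)

lemma tw_scale: "w \<in> gspace R ==>
  tw (\<tau> i) (gscale R c w) - fscale c (tw (\<tau> i) w) \<in> nulls R"
 unfolding tw_def push_diff_fun[symmetric] push_fscale_fun[symmetric]
 by(rule push_in_subspace[OF subspace_null]) (rule rel_scale, rule \<tau>_lists)

text \<open>Growth passes to linear combinations and survives suffixes, so it suffices to know it on
  the tensors \<open>tw (\<tau> i) w\<close>. There the pairing is a partial derivative of a
  component, and the Cauchy bounds apply.\<close>

lemma jet_growth: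
 assumes U: "U \<in> osym" and 0: "0 \<in> U" and f: "f \<in> sections R U" and x: "x \<in> spaces R"
 shows "growth (\<lambda>l. jpair R (lowp l x) f)"
proof -
 have "tspan (alg st) (par st) R \<tau> <= {x. growth (\<lambda>l. jpair R (lowp l x) f)}"
  unfolding tspan_def
 proof (rule fs.span_minimal)
  show "fs.subspace {x. growth (\<lambda>l. jpair R (lowp l x) f)}"
   by(rule fs.subspaceI)
    (simp_all add: prep_add prep_fscale jet_pair_add jet_pair_fscale growth_add growth_cmult growth_zero)
  show "nulls R \<union> {lowp l (tw (\<tau> i) w) |l i w. w \<in> gspace R}
   <= {x. growth (\<lambda>l. jpair R (lowp l x) f)}"
  proof (intro Un_least subsetI CollectI)
   fix x assume "x \<in> nulls R"
   from jet_pair_null[OF R U 0 f prep_null[OF lowE_lists(2) this]]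
   show "growth (\<lambda>l. jpair R (lowp l x) f)" by(simp add: growth_zero)
  next
   fix x assume "x \<in> {lowp l (tw (\<tau> i) w) |l i w. w \<in> gspace R}"
   then obtain k i w where x: "x = lowp k (tw (\<tau> i) w)" and w: "w \<in> gspace R" by blast
   obtain C Q where "C >= 0" "Q >= 0" "!!l. norm (dl l (sl f i w) 0) <= fb C Q (length l)"
    by(rule dl_growth[OF sectionsD(5)[OF f w] U 0]) (rule that)
   then have "growth (\<lambda>l. dl l (sl f i w) 0)" unfolding growth_def by blast
   from growth_append[OF this, of k] show "growth (\<lambda>l. jpair R (lowp l x) f)"
    unfolding x prep_prep map_append[symmetric] jet_pair_prep_lowE_tw[OF R U 0 f w] .
  qed
 qed
 then show ?thesis using x space_tspan[OF R] by blast
qed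

lemma vanish_on_ball:
 assumes f: "f \<in> sections R (sball 0 e)" and z: "!!x. x \<in> spaces R ==> jpair R x f = 0"
 shows "f = zs"
proof (intro ext)
 fix i S w
 show "f i S w = 0"
 proof (cases "S \<in> sball 0 e & w \<in> gspace R")
  case True
  then have "0 < e" using le_less_trans[OF zero_le_dist[of S 0]] by(auto simp: sball_def)
  then have 0: "0 \<in> sball (0 :: 'n mat) e" by(intro center_sball) auto
  have z': "jword R u f w = 0" if "u \<in> lists neg" "w \<in> gspace R" for u w
   using z[OF word_ind_space[OF neg_lists[OF that(1)] that(2)]] by simp
  from vanish_near_origin[OF R sball_opens 0 f z' subset_refl, of S w i] True show ?thesis by simp
 next
  case False
  then show ?thesis using sectionsD(1,2)[OF f] by blast
 qed
qed

text \<open>The values of \<open>G\<close> on the generators prescribe all partial derivatives of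
  all components at \<open>o\<close>; they have the required symmetries because the
  \<open>lowE v\<close> commute modulo relations. The resulting power series realizes
  \<open>G\<close> on the generators, hence everywhere, since generators and relations span.\<close>

lemma realize_functional:
 fixes G :: "('n, 'w) tens => complex"
 assumes G_add: "!!x y. x \<in> spaces R ==> y \<in> spaces R ==> G (x + y) = G x + G y"
  and G_scale: "!!c x. x \<in> spaces R ==> G (fscale c x) = c * G x"
  and G_null: "!!x. x \<in> nulls R ==> G x = 0"
  and Q: "Q > 0" and bound: "!!i w. w \<in> gspace R ==> \<exists>K\<ge>0. \<forall>l.
   norm (G (lowp l (tw (\<tau> i) w))) <= fb K Q (length l)"
 obtains \<rho> f where "\<rho> > 0" "f \<in> sections R (sball 0 \<rho>)"
  "!!x. x \<in> spaces R ==> jpair R x f = G x"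
proof -
 define g where "g i w l = G (lowp l (tw (\<tau> i) w))" for i w l
 define \<rho> where "\<rho> = 1 / (real CARD('n * 'n) * Q)"
 have NQ: "real CARD('n * 'n) * Q > 0" using Q by simp
 have \<rho>: "real CARD('n * 'n) * Q * \<rho> <= 1" "\<rho> > 0" using NQ unfolding \<rho>_def by simp_all
 note sp = prep_ind_space[OF lowE_lists(2) tw_space]
 have G_eq: "G x = G y" if "x - y \<in> nulls R" "y \<in> spaces R" for x y
 proof -
  have "G x = G ((x - y) + y)" by simp
  also have "... = G (x - y) + G y" by(rule G_add) (use that null_space in auto)
  finally show ?thesis using G_null[OF that(1)] by simp
 qed
 have good: "\<exists>K. good (g i w) K Q" if w: "w \<in> gspace R" for i w
 proof -
  obtain K where K: "K >= 0" "!!l. norm (g i w l) <= fb K Q (length l)"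
   using bound[OF w, of i] unfolding g_def by blast
  have "g i w l = g i w l'" if "mset l = mset l'" for l l'
   unfolding g_def by(rule G_eq[OF lowE_mset[OF R tw_space[OF w] that] sp[OF w]])
  moreover have "g i w ((a, b) # l) = g i w ((b, a) # l)" for a b l
   unfolding g_def lowE_def list.map Esym_swap[of a b] ..
  ultimately show ?thesis using K Q unfolding good_def by blast
 qed
 have g_add: "g i (w + w') l = g i w l + g i w' l" if "w \<in> gspace R" "w' \<in> gspace R" for i w w' l
 proof -
  have "lowp l (tw (\<tau> i) (w + w')) - (lowp l (tw (\<tau> i) w) + lowp l (tw (\<tau> i) w'))
    \<in> nulls R"
   using prep_null[OF lowE_lists(2) tw_add[OF that], of l i] by(simp only: prep_diff prep_add diff_diff_eq)
  from G_eq[OF this] show ?thesis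
   unfolding g_def using G_add[OF sp[OF that(1)] sp[OF that(2)]] fs.subspace_add[OF ind_space_subspace sp[OF that(1)] sp[OF that(2)]]
   by simp
 qed
 have g_scale: "g i (gscale R c w) l = c * g i w l" if "w \<in> gspace R" for i c w l
 proof -
  have "lowp l (tw (\<tau> i) (gscale R c w)) - fscale c (lowp l (tw (\<tau> i) w))
    \<in> nulls R"
   using prep_null[OF lowE_lists(2) tw_scale[OF that], of l i c] by(simp add: prep_diff prep_fscale)
  from G_eq[OF this] show ?thesis
   unfolding g_def using G_scale[OF sp[OF that]] fs.subspace_scale[OF ind_space_subspace sp[OF that]] by simp
 qed
 have summ: "summable (\<lambda>j. Sw j (g i w) S / fact j)" if "w \<in> gspace R" "S \<in> sball 0 \<rho>" for i w S
  using good[OF that(1), of i] PS_summable[OF _ \<rho>(1)] that(2) by(auto simp: sball_def)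
 define f where "f = restr R (sball 0 \<rho>) (\<lambda>i S w. PS (g i w) S)"
 have f: "f \<in> sections R (sball 0 \<rho>)"
  unfolding f_def
 proof (rule restr_in_sections[OF R sball_opens])
  fix i and S :: "'n mat" and w w' assume S: "S \<in> sball 0 \<rho>" and w: "w \<in> gspace R" "w' \<in> gspace R"
  have "g i (w + w') = (\<lambda>l. g i w l + g i w' l)" by(rule ext) (rule g_add[OF w])
  then show "PS (g i (w + w')) S = PS (g i w) S + PS (g i w') S" using PS_add[OF summ[OF w(1) S] summ[OF w(2) S]] by simp
 next
  fix i and S :: "'n mat" and w c assume S: "S \<in> sball 0 \<rho>" and w: "w \<in> gspace R"
  have "g i (gscale R c w) = (\<lambda>l. c * g i w l)" by(rule ext) (rule g_scale[OF w])
  then show "PS (g i (gscale R c w)) S = c * PS (g i w) S" using PS_cmult[OF summ[OF w S]] by simp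
 next
  show "holo_on (sball 0 \<rho>) (PS (g i w))" if "w \<in> gspace R" for i w
   using good[OF that, of i] holo_on_PS[OF _ \<rho>(1)] by blast
 qed
 have 0: "0 \<in> sball (0 :: 'n mat) \<rho>" using \<rho>(2) by(intro center_sball) auto
 have "tspan (alg st) (par st) R \<tau> <= {x. x \<in> spaces R & jpair R x f = G x}"
  unfolding tspan_def
 proof (rule fs.span_minimal)
  show "fs.subspace {x. x \<in> spaces R & jpair R x f = G x}"
   using G_null[OF fs.subspace_0[OF subspace_null]]
   by(intro fs.subspaceI)
    (auto simp: fs.subspace_add[OF ind_space_subspace] fs.subspace_scale[OF ind_space_subspace]
     fs.subspace_0[OF ind_space_subspace] jet_pair_add jet_pair_fscale G_add G_scale)
  show "nulls R \<union> {lowp l (tw (\<tau> i) w) |l i w. w \<in> gspace R}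
   <= {x. x \<in> spaces R & jpair R x f = G x}"
  proof (intro Un_least subsetI CollectI conjI)
   fix x assume x: "x \<in> nulls R"
   show "x \<in> spaces R" using null_space x by auto
   show "jpair R x f = G x" using jet_pair_null[OF R sball_opens 0 f x] G_null[OF x] by simp
  next
   fix x assume "x \<in> {lowp l (tw (\<tau> i) w) |l i w. w \<in> gspace R}"
   then obtain l i w where x: "x = lowp l (tw (\<tau> i) w)" and w: "w \<in> gspace R" by blast
   show "x \<in> spaces R" unfolding x by(rule sp[OF w])
   have "jpair R x f = dl l (sl f i w) 0" unfolding x by(rule jet_pair_prep_lowE_tw[OF R sball_opens 0 f w])
   also have "... = dl l (PS (g i w)) 0"
    by(rule dl_cong[OF sball_opens _ 0]) (use w in \<open>simp add: f_def restr_apply\<close>)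
   also have "... = g i w l" using good[OF w, of i] dl_PS by blast
   finally show "jpair R x f = G x" by(simp add: g_def x)
  qed
 qed
 then show ?thesis using that[OF \<rho>(2) f] space_tspan[OF R] by blast
qed

end
end

section \<open>Dual operators commute with translations\<close>

definition tr :: "'n::finite mat => ('i, 'n, 'w) sect => ('i, 'n, 'w) sect" where
 "tr S0 f = (\<lambda>i S w. f i (S0 + S) w)"

lemma tr_tr: "tr S (tr T f) = tr (T + S) f"
 by(simp add: tr_def add.assoc)

lemma tr_0 [simp]: "tr 0 f = f"
 by(simp add: tr_def)

lemma sections_cmult: "f \<in> sections R U ==> (\<lambda>i S w. c * f i S w) \<in> sections R U"
 using sections_lin[of f R U f c 0] by simp

lemma symm_translate:
 assumes "S0 \<in> symm"
 shows "{S. S0 + S \<in> symm} = symm"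
proof (intro equalityI subsetI CollectI)
 show "S \<in> symm" if "S \<in> {S. S0 + S \<in> symm}" for S
  using symm_closed(3)[of "S0 + S" S0] that assms by simp
qed (use assms in simp)

lemma tr_sections:
 assumes f: "f \<in> sections R U" and S0: "S0 \<in> symm"
 shows "tr S0 f \<in> sections R {S. S0 + S \<in> U}"
proof (rule sectionsI)
 show "holo_on {S. S0 + S \<in> U} (sl (tr S0 f) i w)" if "w \<in> gspace R" for i w
  unfolding tr_def by(rule holo_on_translate[OF sectionsD(5)[OF f that] S0])
qed (auto simp: tr_def sectionsD[OF f])

lemma line_iterate: "(deriv ^^ j) (ray f S B) = ray ((ddir B ^^ j) f) S B"
proof (induction j)
 case (Suc j)
 have "(deriv ^^ Suc j) (ray f S B) = deriv (ray ((ddir B ^^ j) f) S B)"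
  by(simp add: Suc)
 also have "... = (\<lambda>t. ((ddir B ^^ Suc j) f) (S + mscale t B))"
  by(rule ext) (simp add: ddir_line)
 finally show ?case .
qed simp

lemma ddir_iterate_eq_Sw:
 assumes "U \<in> osym" "S \<in> U" "B \<in> symm" "holo_on U f"
 shows "(ddir B ^^ j) f S = Sw j (\<lambda>l. dl l f S) B"
 using line_derivs_eq_Sw[OF assms, of j] by(simp add: line_iterate mscale.zero_left)

text \<open>The whole line lies in \<open>symm\<close>, so its power series may be evaluated at
  \<open>t = 1\<close>, inside a disc of radius 2; by assumption it breaks off.\<close>

lemma line_taylor:
 assumes f: "holo_on symm f" and S: "S \<in> symm" and T: "T \<in> symm"
  and z: "!!j. j > r ==> (ddir S ^^ j) f T = 0"
 shows "f (T + S) = (\<Sum>j\<le>r. (ddir S ^^ j) f T / fact j)"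
proof -
 define h where "h = ray f T S"
 have "h holomorphic_on ball 0 2"
  unfolding h_def by(rule holo_on_line[OF f symm_opens S]) (use S T in simp)
 then have "(\<lambda>n. (deriv ^^ n) h 0 / fact n * (1 - 0) ^ n) sums h 1"
  by(rule holomorphic_power_series) simp
 then have "(\<lambda>n. (ddir S ^^ n) f T / fact n) sums f (T + S)"
  by(simp add: h_def line_iterate mscale.zero_left ms.scale_one)
 moreover have "(\<lambda>n. (ddir S ^^ n) f T / fact n) sums (\<Sum>n\<le>r. (ddir S ^^ n) f T / fact n)"
  by(rule sums_finite) (use z in auto)
 ultimately show ?thesis by(rule sums_unique2)
qed

lemma dB_iterate_sections:
 assumes R: "gl_module R" and B: "B \<in> symm" and f: "f \<in> sections R symm"
 shows "(dB R symm B ^^ j) f \<in> sections R symm"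
 by(induction j) (auto intro: f dB_sections[OF R symm_opens B])

lemma dB_iterate:
 assumes B: "B \<in> symm" and S: "S \<in> symm" and w: "w \<in> gspace R"
 shows "(dB R symm B ^^ j) f i S w = (ddir B ^^ j) (sl f i w) S"
 using S
proof (induction j arbitrary: S)
 case (Suc j)
 have "(dB R symm B ^^ Suc j) f i S w = ddir B (\<lambda>S. (dB R symm B ^^ j) f i S w) S"
  using Suc.prems w by(simp add: dB_def restr_apply)
 also have "... = ddir B ((ddir B ^^ j) (sl f i w)) S"
  by(rule ddir_cong[OF symm_opens Suc.prems B]) (rule Suc.IH)
 finally show ?case by simp
qed simp

text \<open>Polynomial sections of degree at most \<open>r\<close>, described by the vanishing of
  higher derivatives, a condition that is plainly invariant under translation.\<close>

definition polysec :: "('n::finite, 'w::ab_group_add) glmod => nat => ('i, 'n, 'w) sect => bool" where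
 "polysec R r p \<longleftrightarrow> p \<in> sections R symm &
  (\<forall>l i w S. length l > r --> S \<in> symm --> w \<in> gspace R --> dl l (sl p i w) S = 0)"

lemma polysec_iterate_zero:
 assumes p: "polysec R r p" and j: "j > r" and S: "S \<in> symm" and B: "B \<in> symm" and w: "w \<in> gspace R"
 shows "(ddir B ^^ j) (sl p i w) S = 0"
proof -
 have ps: "p \<in> sections R symm" using p by(simp add: polysec_def)
 have "(ddir B ^^ j) (sl p i w) S = Sw j (\<lambda>l. dl l (sl p i w) S) B"
  by(rule ddir_iterate_eq_Sw[OF symm_opens S B sectionsD(5)[OF ps w]])
 also have "... = 0" by(rule Sw_zero) (use p j S w in \<open>auto simp: polysec_def\<close>)
 finally show ?thesis .
qed

lemma polysec_tr:
 assumes p: "polysec R r p" and S0: "S0 \<in> symm"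
 shows "polysec R r (tr S0 p)"
proof -
 have *: "{S. S0 + S \<in> symm} = symm"
  by(rule symm_translate[OF S0])
 have ps: "p \<in> sections R symm" using p by(simp add: polysec_def)
 show ?thesis
  unfolding polysec_def
 proof (intro conjI allI impI)
  show "tr S0 p \<in> sections R symm" using tr_sections[OF ps S0] unfolding * .
  fix l :: "('a * 'a) list" and i w and S :: "'a mat" assume a: "r < length l" "S \<in> symm" "w \<in> gspace R"
  have d: "dl l (sl p i w) S = 0" if "S \<in> symm" for S using p a that unfolding polysec_def by blast
  show "dl l (sl (tr S0 p) i w) S = 0"
   unfolding tr_def dl_translate[of l "\<lambda>S. p i S w" S0 S] by(rule d) (use a S0 in simp)
 qed
qed

text \<open>The Taylor polynomial at \<open>S0\<close> is the power series of the truncated list of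
  derivatives, recentred at \<open>S0\<close>. Truncation and summation are linear, so it is again
  linear in \<open>w\<close>.\<close>

lemma taylor_section:
 assumes R: "gl_module R" and U: "U \<in> osym" and f: "f \<in> sections R U" and S0: "S0 \<in> U"
 obtains p where "polysec R r p"
  "!!l i w. w \<in> gspace R ==> length l <= r ==> dl l (sl p i w) S0 = dl l (sl f i w) S0"
proof -
 have S0s: "S0 \<in> symm" using S0 opens_symm[OF U] by auto
 define g where "g i w = truncate r (\<lambda>l. dl l (sl f i w) S0)" for i w
 have g: "polygood (g i w)" if "w \<in> gspace R" for i w
  unfolding g_def
  by(rule polygood_truncate) (auto intro: dl_mset[OF U S0 sectionsD(5)[OF f that]] simp: Esym_swap)
 have g_add: "g i (w + w') = (\<lambda>l. g i w l + g i w' l)" if w: "w \<in> gspace R" "w' \<in> gspace R" for i w w'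
 proof
  fix l
  have "dl l (sl f i (w + w')) S0 = dl l (\<lambda>S. f i S w + f i S w') S0"
   by(rule dl_cong[OF U _ S0]) (rule sectionsD(3)[OF f _ w])
  then show "g i (w + w') l = g i w l + g i w' l"
   by(simp add: g_def truncate_def dl_add[OF U S0] sectionsD(5)[OF f] w)
 qed
 have g_scale: "g i (gscale R c w) = (\<lambda>l. c * g i w l)" if w: "w \<in> gspace R" for i c w
 proof
  fix l
  have "dl l (sl f i (gscale R c w)) S0 = dl l (\<lambda>S. c * f i S w) S0"
   by(rule dl_cong[OF U _ S0]) (rule sectionsD(4)[OF f _ w])
  then show "g i (gscale R c w) l = c * g i w l"
   by(simp add: g_def truncate_def dl_cmult[OF U S0] sectionsD(5)[OF f] w)
 qed
 define p where "p = restr R symm (\<lambda>i S w. PS (g i w) (- S0 + S))"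
 have *: "{S. - S0 + S \<in> symm} = symm"
  by(rule symm_translate) (use S0s in simp)
 have p: "p \<in> sections R symm"
  unfolding p_def
 proof (rule restr_in_sections[OF R symm_opens])
  show "PS (g i (w + w')) (- S0 + S) = PS (g i w) (- S0 + S) + PS (g i w') (- S0 + S)"
   if "w \<in> gspace R" "w' \<in> gspace R" for i S w w'
   unfolding g_add[OF that] by(rule PS_add) (rule PS_summable_poly[OF g], rule that)+
  show "PS (g i (gscale R c w)) (- S0 + S) = c * PS (g i w) (- S0 + S)" if "w \<in> gspace R" for i S w c
   unfolding g_scale[OF that] by(rule PS_cmult) (rule PS_summable_poly[OF g], rule that)
  show "holo_on symm (\<lambda>S. PS (g i w) (- S0 + S))" if "w \<in> gspace R" for i w
   using holo_on_translate[OF holo_on_PS_poly[OF g[OF that, of i]], of "- S0"] S0s unfolding * by simp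
 qed
 have dp: "dl l (sl p i w) S = PS (\<lambda>k. g i w (l @ k)) (- S0 + S)" if w: "w \<in> gspace R" and S: "S \<in> symm" for l i w S
 proof -
  have "dl l (sl p i w) S = dl l (\<lambda>S. PS (g i w) (- S0 + S)) S"
   by(rule dl_cong[OF symm_opens _ S]) (use w in \<open>simp add: p_def restr_apply\<close>)
  also have "... = dl l (PS (g i w)) (- S0 + S)" by(rule dl_translate)
  also have "... = PS (\<lambda>k. g i w (l @ k)) (- S0 + S)"
   by(rule dl_PS_poly[OF g[OF w]]) (use S S0s in simp)
  finally show ?thesis .
 qed
 show ?thesis
 proof (rule that[of p])
  show "polysec R r p"
   unfolding polysec_def
  proof (intro conjI allI impI p)
   fix l :: "('a * 'a) list" and i w and S :: "'a mat" assume l: "r < length l" and S: "S \<in> symm" and w: "w \<in> gspace R"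
   have "(\<lambda>k. g i w (l @ k)) = (\<lambda>k. 0)" using l by(auto simp: g_def truncate_def)
   then have "dl l (sl p i w) S = PS (\<lambda>k. 0) (- S0 + S)" unfolding dp[OF w S] by simp
   also have "... = 0" by(simp add: PS_def Sw_zero)
   finally show "dl l (sl p i w) S = 0" .
  qed
  show "dl l (sl p i w) S0 = dl l (sl f i w) S0" if "w \<in> gspace R" "length l <= r" for l i w
   unfolding dp[OF that(1) S0s] using that(2) by(simp add: PS_0 g_def truncate_def)
 qed
qed

section \<open>Dual operators, polynomial sections and translations\<close>

context dual_setting
begin

context
 fixes R R' :: "('n, 'w) glmod" and \<phi> D
 assumes R: "gl_module R" and R': "gl_module R'" and D: "dual_operator st R R' \<phi> D"
begin

lemmas dual_op_parts = D[unfolded dual_operator_def diff_operator_def]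

lemma dual_op_sections: "U \<in> osym ==> f \<in> sections R U ==> D U f \<in> sections R' U"
 by(rule dual_op_parts[THEN conjunct1, THEN conjunct1, THEN bspec, THEN bspec])

lemma dual_op_lin:
 assumes "U \<in> osym" "f \<in> sections R U" "g \<in> sections R U"
 shows "D U (lc a f b g) = lc a (D U f) b (D U g)"
proof -
 have c: "D U (\<lambda>i S w. c * h i S w) = (\<lambda>i S w. c * D U h i S w)" if "h \<in> sections R U" for c h
  using dual_op_parts[THEN conjunct1, THEN conjunct2, THEN conjunct2, THEN conjunct1, THEN bspec, THEN bspec, OF assms(1) that]
  by(rule spec)
 have "D U (lc a f b g) = (\<lambda>i S w. D U (\<lambda>i S w. a * f i S w) i S w + D U (\<lambda>i S w. b * g i S w) i S w)"
  by(rule dual_op_parts[THEN conjunct1, THEN conjunct2, THEN conjunct1, THEN bspec, THEN bspec, THEN bspec])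
   (intro assms sections_cmult)+
 then show ?thesis unfolding c[OF assms(2)] c[OF assms(3)] .
qed

lemma dual_op_zero:
 assumes "U \<in> osym"
 shows "D U zs = zs"
 using dual_op_lin[OF assms sections_zero sections_zero, of 0 0] by simp

lemma dual_op_sum:
 assumes U: "U \<in> osym" and f: "!!a. a \<in> A ==> f a \<in> sections R U"
 shows "D U (\<lambda>i S w. \<Sum>a\<in>A. c a * f a i S w) = (\<lambda>i S w. \<Sum>a\<in>A. c a * D U (f a) i S w)"
 using f
proof (induction A rule: infinite_finite_induct)
 case (insert x F)
 have "(\<lambda>i S w. \<Sum>a\<in>F. c a * f a i S w) \<in> sections R U"
  by(rule sections_sum, rule sections_cmult) (simp add: insert)
 then show ?case using dual_op_lin[OF U, of "f x" "\<lambda>i S w. \<Sum>a\<in>F. c a * f a i S w" "c x" 1] insert by simp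
qed (simp_all add: dual_op_zero[OF U])

lemma dual_op_restr:
 "U \<in> osym ==> V \<in> osym ==> V <= U ==> f \<in> sections R U ==>
  D V (restr R V f) = restr R' V (D U f)"
 using dual_op_parts[THEN conjunct1, THEN conjunct2, THEN conjunct2, THEN conjunct2, THEN conjunct1,
   THEN bspec, THEN bspec, THEN bspec] by blast

lemma dual_op_pair:
 "U \<in> osym ==> 0 \<in> U ==> f \<in> sections R U ==> x \<in> spaces R' ==>
  jpair R' x (D U f) = jpair R (\<phi> x) f"
 using dual_op_parts[THEN conjunct2, THEN conjunct2, THEN bspec, THEN bspec] by blast

lemma dual_op_dB:
 assumes U: "U \<in> osym" and f: "f \<in> sections R U" and B: "B \<in> symm"
 shows "D U (dB R U B f) = dB R' U B (D U f)"
proof -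
 have X: "Ev (low B) \<in> alg st" using low_neg[OF B] neg_alg by auto
 have 1: "restr R U (sact st R (Ev (low B)) f) = lc (- 1) (dB R U B f) 0 (dB R U B f)"
  by(intro ext) (simp add: restr_def dB_def act_low[OF R B U f])
 have 2: "restr R' U (sact st R' (Ev (low B)) (D U f)) = (\<lambda>i S w. - dB R' U B (D U f) i S w)"
  by(intro ext) (simp add: restr_def dB_def act_low[OF R' B U dual_op_sections[OF U f]])
 have "D U (restr R U (sact st R (Ev (low B)) f)) = restr R' U (sact st R' (Ev (low B)) (D U f))"
  by(rule dual_op_parts[THEN conjunct2, THEN conjunct1, THEN bspec, THEN bspec, THEN bspec, OF X U f])
 then have "(\<lambda>i S w. - D U (dB R U B f) i S w) = (\<lambda>i S w. - dB R' U B (D U f) i S w)"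
  unfolding 1 2 dual_op_lin[OF U dB_sections[OF R U B f] dB_sections[OF R U B f]] by simp
 then show ?thesis by(simp add: fun_eq_iff)
qed

text \<open>On a polynomial section, translation by \<open>S\<close> is the exponential of the
  derivative in direction \<open>S\<close>, a finite sum. The operator commutes with these
  derivatives, so one and the same sum expands \<open>D p\<close> at \<open>S\<close> and
  \<open>D\<close> of the translate at 0.\<close>

lemma dual_op_poly:
 assumes p: "polysec R r p" and S: "S \<in> symm" and w: "w \<in> gspace R'"
 shows "D symm p i S w = D symm (tr S p) i 0 w"
proof -
 have ps: "p \<in> sections R symm" using p by(simp add: polysec_def)
 have it: "D symm ((dB R symm S ^^ j) p) = (dB R' symm S ^^ j) (D symm p)" for j
  by(induction j) (simp_all add: dual_op_dB[OF symm_opens dB_iterate_sections[OF R S ps] S])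
 have z: "(dB R symm S ^^ j) p = zs" if "j > r" for j
  by(rule sections_ext[OF dB_iterate_sections[OF R S ps] sections_zero])
   (simp add: dB_iterate[OF S] polysec_iterate_zero[OF p that _ S])
 have "D symm p i (0 + S) w = (\<Sum>j\<le>r. (ddir S ^^ j) (sl (D symm p) i w) 0 / fact j)"
 proof (rule line_taylor[OF sectionsD(5)[OF dual_op_sections[OF symm_opens ps] w] S symm_closed(1)])
  \<comment> \<open>The high derivatives of \<open>D p\<close> in direction \<open>S\<close> vanish
    too, being \<open>D\<close> of those of \<open>p\<close>.\<close>
  fix j assume "j > r"
  have "(dB R' symm S ^^ j) (D symm p) = zs"
   unfolding it[symmetric] z[OF \<open>j > r\<close>] by(rule dual_op_zero[OF symm_opens])
  then show "(ddir S ^^ j) (sl (D symm p) i w) 0 = 0"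
   using dB_iterate[OF S symm_closed(1) w, of j "D symm p" i] by simp
 qed
 also have "... = (\<Sum>j\<le>r. (1 / fact j) * D symm ((dB R symm S ^^ j) p) i 0 w)"
  unfolding it by(simp add: dB_iterate[OF S symm_closed(1) w])
 also have "... = D symm (\<lambda>i T w. \<Sum>j\<le>r. (1 / fact j) * (dB R symm S ^^ j) p i T w) i 0 w"
  by(subst dual_op_sum[OF symm_opens dB_iterate_sections[OF R S ps]]) simp
 also have "(\<lambda>i T w. \<Sum>j\<le>r. (1 / fact j) * (dB R symm S ^^ j) p i T w) = tr S p"
 proof (rule sections_ext[where R = R and U = symm])
  show "tr S p \<in> sections R symm" using polysec_tr[OF p S] by(simp add: polysec_def)
  show "(\<lambda>i T w. \<Sum>j\<le>r. (1 / fact j) * (dB R symm S ^^ j) p i T w) \<in> sections R symm"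
   by(rule sections_sum, rule sections_cmult, rule dB_iterate_sections[OF R S ps])
  fix i and T :: "'n mat" and w assume T: "T \<in> symm" and w: "w \<in> gspace R"
  have "p i (T + S) w = (\<Sum>j\<le>r. (ddir S ^^ j) (sl p i w) T / fact j)"
   by(rule line_taylor[OF sectionsD(5)[OF ps w] S T]) (rule polysec_iterate_zero[OF p _ T S w])
  then show "(\<Sum>j\<le>r. (1 / fact j) * (dB R symm S ^^ j) p i T w) = tr S p i T w"
   by(simp add: tr_def dB_iterate[OF S T w] add.commute)
 qed
 finally show ?thesis by simp
qed

definition jet_det :: "nat => bool" where
 "jet_det r \<longleftrightarrow> (\<forall>U f p S i w. U \<in> osym --> f \<in> sections R U --> polysec R r p --> S \<in> U -->
   (\<forall>l i w. w \<in> gspace R --> length l <= r --> dl l (sl p i w) S = dl l (sl f i w) S) -->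
   w \<in> gspace R' --> D U f i S w = D symm p i S w)"

text \<open>The order bound is applied to the difference of \<open>f\<close> and the restricted
  polynomial. Its derivatives along lines are combinations of partial derivatives up to order
  \<open>r\<close>, and these agree.\<close>

lemma dual_op_jet: "\<exists>r. jet_det r"
proof -
 obtain r where "\<forall>U\<in>osym. \<forall>f\<in>sections R U. \<forall>S\<in>U. jet_vanishes r S f --> (\<forall>i w. D U f i S w = 0)"
  using dual_op_parts[THEN conjunct1, THEN conjunct2, THEN conjunct2, THEN conjunct2, THEN conjunct2] by(elim exE)
 note r = this[THEN bspec, THEN bspec, THEN bspec, THEN mp]
 show ?thesis
  unfolding jet_det_def
 proof (intro exI[of _ r] allI impI)
  fix U and f p :: "('i, 'n, 'w) sect" and S i w
  assume U: "U \<in> osym" and f: "f \<in> sections R U" and p: "polysec R r p" and S: "S \<in> U"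
   and eq: "\<forall>l i w. w \<in> gspace R --> length l <= r --> dl l (sl p i w) S = dl l (sl f i w) S"
   and w: "w \<in> gspace R'"
  have Us: "U <= symm" by(rule opens_symm[OF U])
  have ps: "p \<in> sections R symm" using p by(simp add: polysec_def)
  have pU: "restr R U p \<in> sections R U" by(rule sections_restr[OF R U Us ps])
  define h where "h = lc 1 f (- 1) (restr R U p)"
  have h: "h \<in> sections R U" unfolding h_def by(rule sections_lin[OF f pU])
  have "jet_vanishes r S h"
   unfolding jet_vanishes_def
  proof (intro allI impI ballI)
   fix j and B :: "'n mat" and i w assume j: "j <= r" and B: "B \<in> symm"
   show "(deriv ^^ j) (\<lambda>t. h i (S + mscale t B) w) 0 = 0"
   proof (cases "w \<in> gspace R")
    case True
    have "(deriv ^^ j) (\<lambda>t. h i (S + mscale t B) w) 0 = Sw j (\<lambda>l. dl l (sl h i w) S) B"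
     by(rule line_derivs_eq_Sw[OF U S B sectionsD(5)[OF h True]])
    also have "... = 0"
    proof (rule Sw_zero)
     fix l :: "('n * 'n) list" assume l: "length l = j"
     have "dl l (sl h i w) S = dl l (\<lambda>S. f i S w - p i S w) S"
      by(rule dl_cong[OF U _ S]) (use True in \<open>simp add: h_def restr_apply\<close>)
     also have "... = dl l (sl f i w) S - dl l (sl p i w) S"
      by(rule dl_diff[OF U S sectionsD(5)[OF f True] holo_on_subset[OF sectionsD(5)[OF ps True] Us]])
     finally show "dl l (sl h i w) S = 0" using eq True l j by simp
    qed
    finally show ?thesis .
   next
    case False
    then have "(\<lambda>t. h i (S + mscale t B) w) = (\<lambda>t. 0)" using sectionsD(2)[OF h] by blast
    moreover have "(deriv ^^ j) (\<lambda>t. 0) = (\<lambda>t. 0 :: complex)" by(induction j) auto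
    ultimately show ?thesis by simp
   qed
  qed
  then have "D U h i S w = 0" using r[OF U h S] by blast
  moreover have "D U h = (\<lambda>i S w. 1 * D U f i S w + (- 1) * D U (restr R U p) i S w)"
   unfolding h_def by(rule dual_op_lin[OF U f pU])
  ultimately show "D U f i S w = D symm p i S w"
   using S w by(simp add: dual_op_restr[OF symm_opens U Us ps] restr_apply)
 qed
qed

text \<open>At a given point the section may be replaced by its Taylor polynomial, whose translate
  agrees with the translated section to the same order. For polynomials both sides equal the value
  at 0 of \<open>D\<close> on the translate by \<open>S0 + S\<close>.\<close>

theorem dual_op_translate:
 assumes U: "U \<in> osym" and f: "f \<in> sections R U" and S0: "S0 \<in> symm"
 shows "tr S0 (D U f) = D {S. S0 + S \<in> U} (tr S0 f)"
proof (rule sections_ext[where R = R' and U = "{S. S0 + S \<in> U}"])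
 note V = opens_translate[OF U S0]
 note tf = tr_sections[OF f S0]
 show "tr S0 (D U f) \<in> sections R' {S. S0 + S \<in> U}" by(rule tr_sections[OF dual_op_sections[OF U f] S0])
 show "D {S. S0 + S \<in> U} (tr S0 f) \<in> sections R' {S. S0 + S \<in> U}" by(rule dual_op_sections[OF V tf])
 fix i S w assume S: "S \<in> {S. S0 + S \<in> U}" and w: "w \<in> gspace R'"
 then have SU: "S0 + S \<in> U" and Ss: "S \<in> symm" using opens_symm[OF V] by auto
 obtain r where "jet_det r" using dual_op_jet by(elim exE)
 note r = this[unfolded jet_det_def, rule_format]
 obtain p where p: "polysec R r p"
  "!!l i w. w \<in> gspace R ==> length l <= r ==> dl l (sl p i w) (S0 + S) = dl l (sl f i w) (S0 + S)"
  by(rule taylor_section[OF R U f SU, of r]) (rule that)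
 have tp: "polysec R r (tr S0 p)" by(rule polysec_tr[OF p(1) S0])
 have "tr S0 (D U f) i S w = D symm p i (S0 + S) w"
  unfolding tr_def by(rule r[OF U f p(1) SU p(2) w])
 also have "... = D symm (tr (S0 + S) p) i 0 w"
  by(rule dual_op_poly[OF p(1) _ w]) (use S0 Ss in simp)
 also have "... = D symm (tr S (tr S0 p)) i 0 w" by(simp add: tr_tr)
 also have "... = D symm (tr S0 p) i S w" by(rule dual_op_poly[OF tp Ss w, symmetric])
 also have "... = D {S. S0 + S \<in> U} (tr S0 f) i S w"
 proof (rule r[OF V tf tp S _ w, symmetric])
  fix l :: "('n * 'n) list" and i w assume "w \<in> gspace R" "length l <= r"
  then show "dl l (sl (tr S0 p) i w) S = dl l (sl (tr S0 f) i w) S"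
   unfolding tr_def dl_translate[of l "\<lambda>S. p i S w" S0 S] dl_translate[of l "\<lambda>S. f i S w" S0 S] by(rule p(2))
 qed
 finally show "tr S0 (D U f) i S w = D {S. S0 + S \<in> U} (tr S0 f) i S w" .
qed

end
end

section \<open>Local exactness of the dual complex\<close>

lemma gscale_zero:
 assumes "gl_module R"
 shows "gscale R 0 w = 0"
proof -
 interpret vector_space "gscale R" by(rule gl_moduleD(1)[OF assms])
 show ?thesis by simp
qed

lemma growth_sum: "(!!a. a \<in> A ==> growth (F a)) ==> growth (\<lambda>l. \<Sum>a\<in>A. F a l)"
 by(induction A rule: infinite_finite_induct) (simp_all add: growth_zero growth_add)

lemma finite_pos_lower_bound:
 fixes \<rho> :: "'a => real"
 assumes "finite A" "!!a. a \<in> A ==> \<rho> a > 0"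
 obtains r where "r > 0" "!!a. a \<in> A ==> r <= \<rho> a"
proof (rule that[of "Min (insert 1 (\<rho> ` A))"])
 show "Min (insert 1 (\<rho> ` A)) > 0" using assms by simp
 show "Min (insert 1 (\<rho> ` A)) <= \<rho> a" if "a \<in> A" for a using assms(1) that by simp
qed

definition list_of :: "'v multiset => 'v list" where
 "list_of M = (SOME l. mset l = M)"

lemma mset_list_of [simp]: "mset (list_of M) = M"
 unfolding list_of_def by(rule someI_ex[OF ex_mset])

lemma length_list_of [simp]: "length (list_of M) = size M"
 by(metis mset_list_of size_mset)

lemma prep_push: "prep u (push h x) = push (\<lambda>k. prep u (h k)) x"
 unfolding prep_def push_push ..

lemma subspace_linI:
 assumes "0 \<in> V" "!!x y b. x \<in> V ==> y \<in> V ==> x + fscale b y \<in> V"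
 shows "fs.subspace V"
 using assms(1) assms(2)[of _ _ 1] assms(2)[OF assms(1)] by(intro fs.subspaceI) (simp_all add: fs.scale_one)

lemmas null_0 = fs.subspace_0[OF subspace_null]
 and null_add = fs.subspace_add[OF subspace_null]
 and null_scale = fs.subspace_scale[OF subspace_null]
 and null_neg = fs.subspace_neg[OF subspace_null]
 and null_sum = fs.subspace_sum[OF subspace_null]
 and space_0 = fs.subspace_0[OF ind_space_subspace]
 and space_add = fs.subspace_add[OF ind_space_subspace]
 and space_scale = fs.subspace_scale[OF ind_space_subspace]
 and space_sum = fs.subspace_sum[OF ind_space_subspace]

section \<open>Duality between chains and sections\<close>

context dual_setting
begin

abbreviation ltw :: "('n * 'n) list => 'i => 'w => ('n, 'w) tens" where
 "ltw l i w \<equiv> lowp l (tw (\<tau> i) w)"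

lemma ltw_add:
 assumes "gl_module R" "w \<in> gspace R" "w' \<in> gspace R"
 shows "ltw l i (w + w') - (ltw l i w + ltw l i w') \<in> nulls R"
 using prep_null[OF lowE_lists(2)[of l] tw_add[OF assms, of i]] by(simp add: prep_diff prep_add diff_diff_eq)

lemma ltw_scale:
 assumes "gl_module R" "w \<in> gspace R"
 shows "ltw l i (gscale R c w) - fscale c (ltw l i w) \<in> nulls R"
 using prep_null[OF lowE_lists(2)[of l] tw_scale[OF assms, of i c]] by(simp add: prep_diff prep_fscale)

lemma jet_word_sum:
 assumes R: "gl_module R" and U: "U \<in> osym" "0 \<in> U" and f: "!!a. a \<in> A ==> f a \<in> sections R U"
  and u: "u \<in> algs" and w: "w \<in> gspace R"
 shows "jword R u (ss f A) w = (\<Sum>a\<in>A. jword R u (f a) w)"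
 using f
proof (induction A rule: infinite_finite_induct)
 case (insert x F)
 have "ss f F \<in> sections R U" by(rule sections_sum) (use insert in auto)
 then show ?case
  using jet_word_lin[OF R U u w, of "f x" "\<lambda>i S w. \<Sum>a\<in>F. f a i S w" 1 1] insert by simp
qed (simp_all add: jet_word_zero[OF R U u w])

lemma jet_pair_sum:
 assumes R: "gl_module R" and U: "U \<in> osym" "0 \<in> U" and f: "!!a. a \<in> A ==> f a \<in> sections R U"
  and x: "x \<in> spaces R"
 shows "jpair R x (ss f A) = (\<Sum>a\<in>A. jpair R x (f a))"
proof -
 have "jpair R x (ss f A) = lin_ext (\<lambda>k. \<Sum>a\<in>A. jword R (fst k) (f a) (snd k)) x"
  unfolding jet_pair_lin_ext
  by(rule lin_ext_cong, rule jet_word_sum[OF R U f]) (use x in \<open>auto simp: ind_space_def\<close>)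
 also have "... = (\<Sum>a\<in>A. jpair R x (f a))"
  unfolding jet_pair_lin_ext lin_ext_def sum_distrib_left by(rule sum.swap)
 finally show ?thesis .
qed

lemma jet_pair_local:
 assumes R: "gl_module R" and V: "V \<in> osym" "0 \<in> V"
  and fg: "!!i S w. S \<in> V ==> w \<in> gspace R ==> f i S w = g i S w" and x: "x \<in> spaces R"
 shows "jpair R x f = jpair R x g"
 unfolding jet_pair_lin_ext
proof (rule lin_ext_cong)
 fix k assume "k \<in> keys x"
 then have "fst k \<in> algs" "snd k \<in> gspace R" using x unfolding ind_space_def by auto
 then show "jword R (fst k) f (snd k) = jword R (fst k) g (snd k)"
  by(rule jet_word_local[OF R V]) (rule fg)
qed

lemma jet_pair_fun_lin:
 assumes R: "gl_module R" and U: "U \<in> osym" "0 \<in> U" and f: "f \<in> sections R U" and g: "g \<in> sections R U"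
  and x: "x \<in> spaces R"
 shows "jpair R x (lc a f b g) = a * jpair R x f + b * jpair R x g"
proof -
 have "jpair R x (lc a f b g)
   = lin_ext (\<lambda>k. a * jword R (fst k) f (snd k) + b * jword R (fst k) g (snd k)) x"
  unfolding jet_pair_lin_ext
  by(rule lin_ext_cong, rule jet_word_lin[OF R U _ _ f g]) (use x in \<open>auto simp: ind_space_def\<close>)
 then show ?thesis
  by(simp add: jet_pair_lin_ext lin_ext_def sum.distrib sum_distrib_left algebra_simps)
qed

lemma ind_homD:
 assumes "ind_hom (alg st) (par st) R R' \<phi>"
 shows "x \<in> spaces R ==> \<phi> x \<in> spaces R'"
  "x \<in> spaces R ==> y \<in> spaces R ==> \<phi> (x + y) = \<phi> x + \<phi> y"
  "x \<in> spaces R ==> \<phi> (fscale c x) = fscale c (\<phi> x)"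
  "x \<in> nulls R ==> \<phi> x \<in> nulls R'"
  "X \<in> alg st ==> x \<in> spaces R ==> \<phi> (prep [X] x) - prep [X] (\<phi> x) \<in> nulls R'"
proof -
 note h = assms[unfolded ind_hom_def linear_on_fs_def ind_act_prep]
 show "x \<in> spaces R ==> \<phi> x \<in> spaces R'"
  by(rule subsetD[OF h[THEN conjunct1] imageI])
 show "x \<in> spaces R ==> y \<in> spaces R ==> \<phi> (x + y) = \<phi> x + \<phi> y"
  by(rule h[THEN conjunct2, THEN conjunct1, THEN conjunct1, THEN bspec, THEN bspec])
 show "x \<in> spaces R ==> \<phi> (fscale c x) = fscale c (\<phi> x)"
  by(rule h[THEN conjunct2, THEN conjunct1, THEN conjunct2, THEN spec, THEN bspec])
 show "x \<in> nulls R ==> \<phi> x \<in> nulls R'"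
  by(rule subsetD[OF h[THEN conjunct2, THEN conjunct2, THEN conjunct1] imageI])
 show "X \<in> alg st ==> x \<in> spaces R ==> \<phi> (prep [X] x) - prep [X] (\<phi> x) \<in> nulls R'"
  by(rule h[THEN conjunct2, THEN conjunct2, THEN conjunct2, THEN bspec, THEN bspec])
qed

lemma ind_hom_prep:
 assumes h: "ind_hom (alg st) (par st) R R' \<phi>" and x: "x \<in> spaces R"
 shows "u \<in> algs ==> \<phi> (prep u x) - prep u (\<phi> x) \<in> nulls R'"
proof (induction u)
 case Nil
 then show ?case by(simp add: null_0)
next
 case (Cons X u)
 then have X: "X \<in> alg st" and u: "u \<in> algs" by auto
 have 1: "\<phi> (prep [X] (prep u x)) - prep [X] (\<phi> (prep u x)) \<in> nulls R'"
  by(rule ind_homD(5)[OF h X prep_ind_space[OF u x]])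
 have 2: "prep [X] (\<phi> (prep u x) - prep u (\<phi> x)) \<in> nulls R'"
  by(rule prep_null[OF _ Cons.IH[OF u]]) (use X in simp)
 show ?case using null_add[OF 1 2] by(simp add: prep_diff prep_prep)
qed

context
 fixes I :: "nat => 'a set" and R :: "'a => ('n, 'w) glmod"
  and d :: "nat => 'a => 'a => ('n, 'w) tens => ('n, 'w) tens"
  and D :: "nat => 'a => 'a => 'n mat set => ('i, 'n, 'w) sect => ('i, 'n, 'w) sect"
 assumes finI: "finite (I m)"
  and Rgl: "j \<in> I m ==> gl_module (R j)"
  and Rfin: "j \<in> I m ==> \<exists>B. finite B & gspace (R j) = module.span (gscale (R j)) B"
  and hom: "j \<in> I (Suc m) ==> j' \<in> I m ==> ind_hom (alg st) (par st) (R j) (R j') (d m j j')"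
  and ex: "c \<in> chains (alg st) (I (Suc m)) R ==>
    (\<forall>j\<in>I m. chain_diff I d m c j \<in> nulls (R j)) \<longleftrightarrow>
    (\<exists>e\<in>chains (alg st) (I (Suc (Suc m))) R.
     \<forall>j\<in>I (Suc m). c j - chain_diff I d (Suc m) e j \<in> nulls (R j))"
  and dual: "j \<in> I (Suc m) ==> j' \<in> I m ==> dual_operator st (R j') (R j) (d m j j') (D m j' j)"
begin

abbreviation nul :: "'a => ('n, 'w) tens set" where "nul j \<equiv> nulls (R j)"
abbreviation "bdry \<equiv> chain_diff I d"
abbreviation "chn k \<equiv> chains (alg st) (I k) R"
abbreviation cobd :: "nat => 'n mat set => ('a => ('i, 'n, 'w) sect) => 'a => ('i, 'n, 'w) sect" where
 "cobd m U f j \<equiv> (\<lambda>i S w. \<Sum>j'\<in>I m. D m j' j U (f j') i S w)"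
abbreviation spc :: "'a => ('n, 'w) tens set" where "spc j \<equiv> spaces (R j)"

lemma chainsD: "c \<in> chn k ==> j \<in> I k ==> c j \<in> spc j"
 by(simp add: chains_def)

lemma chains_lin:
 "c \<in> chn k ==> c' \<in> chn k ==> (\<lambda>j. c j + fscale b (c' j)) \<in> chn k"
 by(simp add: chains_def space_add space_scale)

lemma chains_zero: "(\<lambda>j. 0) \<in> chn k"
 by(simp add: chains_def space_0)

lemma chains_prep: "c \<in> chn k ==> u \<in> algs ==> (\<lambda>j. prep u (c j)) \<in> chn k"
 by(simp add: chains_def prep_ind_space)

lemma chain_diff_lin:
 assumes "c \<in> chn (Suc m)" "c' \<in> chn (Suc m)" "j' \<in> I m"
 shows "bdry m (\<lambda>j. c j + fscale b (c' j)) j' = bdry m c j' + fscale b (bdry m c' j')"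
proof -
 have "d m j j' (c j + fscale b (c' j)) = d m j j' (c j) + fscale b (d m j j' (c' j))" if "j \<in> I (Suc m)" for j
  using ind_homD(2,3)[OF hom[OF that assms(3)]] chainsD[OF assms(1) that] chainsD[OF assms(2) that]
   space_scale[OF chainsD[OF assms(2) that], of b] by simp
 then show ?thesis by(simp add: chain_diff_def sum.distrib fs.scale_sum_right)
qed

lemma chain_diff_chains:
 assumes "c \<in> chn (Suc m)"
 shows "bdry m c \<in> chn m"
 unfolding chains_def chain_diff_def
 using ind_homD(1)[OF hom] chainsD[OF assms] by(auto intro!: space_sum)

lemma chain_diff_zero: "j' \<in> I m ==> bdry m (\<lambda>j. 0) j' = 0"
 using chain_diff_lin[OF chains_zero chains_zero, of j' m "-1"] by simp

lemma chain_diff_prep: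
 assumes "c \<in> chn (Suc m)" "u \<in> algs" "j' \<in> I m"
 shows "prep u (bdry m c j') - bdry m (\<lambda>j. prep u (c j)) j' \<in> nul j'"
proof -
 have "prep u (d m j j' (c j)) - d m j j' (prep u (c j)) \<in> nul j'" if "j \<in> I (Suc m)" for j
  using null_neg[OF ind_hom_prep[OF hom[OF that assms(3)] chainsD[OF assms(1) that] assms(2)]] by simp
 then have "(\<Sum>j\<in>I (Suc m). prep u (d m j j' (c j)) - d m j j' (prep u (c j))) \<in> nul j'"
  by(rule null_sum)
 then show ?thesis by(simp add: chain_diff_def prep_sum sum_subtractf)
qed

text \<open>A boundary is hit by its own chain, so the equivalence that expresses exactness makes it
  a cycle modulo relations.\<close>

lemma chain_diff_diff_null:
 assumes "e \<in> chn (Suc (Suc m))" "j' \<in> I m"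
 shows "bdry m (bdry (Suc m) e) j' \<in> nul j'"
proof -
 have "\<exists>e'\<in>chn (Suc (Suc m)). \<forall>j\<in>I (Suc m).
   bdry (Suc m) e j - bdry (Suc m) e' j \<in> nul j"
  by(rule bexI[OF _ assms(1)]) (simp add: null_0)
 then show ?thesis using ex[OF chain_diff_chains[OF assms(1)]] assms(2) by blast
qed

lemma D_sec:
 "U \<in> osym ==> (!!j. j \<in> I m ==> f j \<in> sections (R j) U) ==> j \<in> I m ==> q \<in> I (Suc m) ==>
  D m j q U (f j) \<in> sections (R q) U"
 by(rule dual_op_sections[OF Rgl Rgl dual])

lemma cobd_sec:
 "U \<in> osym ==> (!!j. j \<in> I m ==> f j \<in> sections (R j) U) ==> q \<in> I (Suc m) ==> cobd m U f q \<in> sections (R q) U"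
 by(intro sections_sum D_sec)

lemma chn_single:
 assumes "q \<in> I m" "y \<in> spc q"
 shows "(\<lambda>p. if p = q then y else 0) \<in> chn m"
 using assms by(auto simp: chains_def space_0)

lemma bdry_single:
 assumes "q \<in> I (Suc m)" "j \<in> I m"
 shows "bdry m (\<lambda>p. if p = q then y else 0) j = d m q j y"
proof -
 have "d m p j 0 = 0" if "p \<in> I (Suc m)" for p
  using ind_homD(3)[OF hom[OF that assms(2)] space_0, of 0] by simp
 then show ?thesis
  using assms finI by(simp add: chain_diff_def if_distrib[where f = "d m _ j"] sum.delta cong: if_cong)
qed

context
 fixes m :: nat and U :: "'n mat set" and g :: "'a => ('i, 'n, 'w) sect"
 assumes U: "U \<in> osym" and 0: "0 \<in> U"
  and g: "!!j. j \<in> I (Suc m) ==> g j \<in> sections (R j) U"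
  and closed: "!!j''. j'' \<in> I (Suc (Suc m)) ==>
   (cobd (Suc m) U g j'') = zs"
begin

definition tpair :: "('a => ('n, 'w) tens) => complex" where
 "tpair c = (\<Sum>j\<in>I (Suc m). jpair (R j) (c j) (g j))"

lemma tpair_lin: "tpair (\<lambda>j. c j + fscale b (c' j)) = tpair c + b * tpair c'"
 by(simp add: tpair_def jet_pair_add jet_pair_fscale sum.distrib sum_distrib_left)

lemma tpair_diff: "tpair (\<lambda>j. c j - c' j) = tpair c - tpair c'"
 using tpair_lin[of c "- 1" c'] by simp

lemma tpair_null: "(!!j. j \<in> I (Suc m) ==> c j \<in> nul j) ==> tpair c = 0"
 unfolding tpair_def by(rule sum.neutral) (blast intro: jet_pair_null[OF Rgl U 0 g])

text \<open>Transposing the differential turns the pairing of a boundary with \<open>g\<close> into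
  the pairing of \<open>e\<close> with the coboundary of \<open>g\<close>, which is zero.\<close>

lemma tpair_boundary:
 assumes e: "e \<in> chn (Suc (Suc m))"
 shows "tpair (bdry (Suc m) e) = 0"
proof -
 have "tpair (bdry (Suc m) e)
   = (\<Sum>j\<in>I (Suc m). \<Sum>q\<in>I (Suc (Suc m)). jpair (R j) (d (Suc m) q j (e q)) (g j))"
  unfolding tpair_def chain_diff_def jet_pair_lin_ext lin_ext_sum ..
 also have "... = (\<Sum>q\<in>I (Suc (Suc m)). \<Sum>j\<in>I (Suc m). jpair (R q) (e q) (D (Suc m) j q U (g j)))"
  by(subst sum.swap, intro sum.cong refl)
   (rule dual_op_pair[OF Rgl Rgl dual U 0 g chainsD[OF e], symmetric]; assumption)
 also have "... = (\<Sum>q\<in>I (Suc (Suc m)). jpair (R q) (e q) (cobd (Suc m) U g q))"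
  by(intro sum.cong refl jet_pair_sum[OF Rgl U 0 _ chainsD[OF e], symmetric])
   (auto intro: dual_op_sections[OF Rgl Rgl dual U g])
 also have "... = 0"
 proof (rule sum.neutral, rule ballI)
  fix q assume q: "q \<in> I (Suc (Suc m))"
  show "jpair (R q) (e q) (cobd (Suc m) U g q) = 0"
   unfolding closed[OF q]
   using jet_pair_sum[OF Rgl[OF q] U 0 _ chainsD[OF e q], of "{}"] by simp
 qed
 finally show ?thesis .
qed

text \<open>Exactness of the resolution makes a cycle a boundary up to relations. Hence the pairing
  with \<open>g\<close> depends on a chain only through its boundary, and it can be transported to
  the terms of degree \<open>m\<close>.\<close>

lemma tpair_cycle:
 assumes c: "c \<in> chn (Suc m)" and z: "!!j'. j' \<in> I m ==> bdry m c j' \<in> nul j'"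
 shows "tpair c = 0"
proof -
 obtain e where e: "e \<in> chn (Suc (Suc m))"
  "\<forall>j\<in>I (Suc m). c j - bdry (Suc m) e j \<in> nul j"
  using ex[OF c] z by blast
 have "tpair (\<lambda>j. c j - bdry (Suc m) e j) = 0"
  by(rule tpair_null) (use e(2) in simp)
 then show ?thesis using tpair_boundary[OF e(1)] by(simp add: tpair_diff)
qed

section \<open>A free module over a polynomial ring covering the terms of degree
  \<open>m\<close>\<close>

definition fbas :: "'a => 'w set" where
 "fbas j = (SOME B. finite B & gspace (R j) = module.span (gscale (R j)) B)"

lemma fbas: "j \<in> I m ==> finite (fbas j) & gspace (R j) = module.span (gscale (R j)) (fbas j)"
 unfolding fbas_def by(rule someI_ex) (rule Rfin)

lemma fbas_gspace:
 assumes "j \<in> I m" "w \<in> fbas j"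
 shows "w \<in> gspace (R j)"
proof -
 interpret vector_space "gscale (R j)" by(rule gl_moduleD(1)[OF Rgl[OF assms(1)]])
 show ?thesis using fbas[OF assms(1)] span_base[OF assms(2)] by simp
qed

definition J :: "('a * 'i * 'w) set" where
 "J = (SIGMA j:I m. UNIV \<times> fbas j)"

lemma finite_J: "finite J"
 unfolding J_def using finI fbas by auto

text \<open>The image in summand \<open>j\<close> of a monomial of the free module whose generators
  are triples of a summand, a component and a basis vector; generators of other summands go to 0.
  All summands share one free module, so the functional is extended on all of them at once.\<close>

definition gelt :: "'a => ('n * 'n) multiset \<times> ('a * 'i * 'w) => ('n, 'w) tens" where
 "gelt j k = (if fst (snd k) = j then prep (map lowE (list_of (fst k))) (tw (\<tau> (fst (snd (snd k)))) (snd (snd (snd k)))) else 0)"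

definition gmap :: "'a => ((('n * 'n) multiset \<times> ('a * 'i * 'w)) \<Rightarrow>\<^sub>0 complex) => ('n, 'w) tens" where
 "gmap j = push (gelt j)"

lemma gmap_lin: "gmap j (x + fscale b y) = gmap j x + fscale b (gmap j y)"
 by(simp add: gmap_def push_add push_fscale)

definition gspc :: "((('n * 'n) multiset \<times> ('a * 'i * 'w)) \<Rightarrow>\<^sub>0 complex) set" where
 "gspc = {x. keys x <= UNIV \<times> J}"

lemma gspc_lin: "x \<in> gspc ==> y \<in> gspc ==> x + fscale b y \<in> gspc"
 unfolding gspc_def using Poly_Mapping.keys_add[of x "fscale b y"] keys_fscale[of b y] by blast

lemma gspc_0: "0 \<in> gspc"
 by(simp add: gspc_def)

lemma gspc_shift: "x \<in> gspc ==> shift a x \<in> gspc"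
 unfolding gspc_def keys_shift mem_Collect_eq
proof (rule subsetI)
 fix k assume x: "keys x <= UNIV \<times> J" and "k \<in> kshift a ` keys x"
 then obtain k' where "k' \<in> keys x" "k = kshift a k'" by blast
 then show "k \<in> UNIV \<times> J" using subsetD[OF x] by(simp add: mem_Times_iff)
qed

text \<open>The orderings chosen for the multisets may differ on the two sides, but only by
  permuting the \<open>lowE v\<close>, hence by relations.\<close>

lemma gmap_shift:
 assumes x: "x \<in> gspc" and j: "j \<in> I m"
 shows "gmap j (shift a x) - lowp (list_of a) (gmap j x) \<in> nul j"
proof -
 have "gmap j (shift a x) - lowp (list_of a) (gmap j x)
   = push (\<lambda>k. gelt j (kshift a k) - lowp (list_of a) (gelt j k)) x"
  by(simp add: gmap_def shift_def push_push prep_push push_diff_fun fs.scale_one)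
 also have "... \<in> nul j"
 proof (rule push_in_subspace[OF subspace_null])
  fix k assume "k \<in> keys x"
  then have k: "snd k \<in> J" using x by(auto simp: gspc_def)
  show "gelt j (kshift a k) - lowp (list_of a) (gelt j k) \<in> nul j"
  proof (cases "fst (snd k) = j")
   case True
   obtain M i w where kk: "k = (M, j, i, w)" using True by(cases k) auto
   have w: "w \<in> gspace (R j)" using k fbas_gspace unfolding kk J_def by auto
   have "prep (map lowE (list_of (a + M))) (tw (\<tau> i) w) - lowp (list_of a @ list_of M) (tw (\<tau> i) w) \<in> nul j"
    by(rule lowE_mset[OF Rgl[OF j] tw_space[OF Rgl[OF j] w]]) simp
   then show ?thesis by(simp add: gelt_def kk kshift_def prep_prep)
  next
   case False
   then show ?thesis by(simp add: gelt_def null_0)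
  qed
 qed
 finally show ?thesis .
qed

text \<open>\<open>x\<close> represents, modulo relations, the boundary of the chain
  \<open>c\<close> in all summands simultaneously. The \<open>x\<close> for which such a
  \<open>c\<close> exists form the submodule from which the functional is extended.\<close>

definition liftb where
 "liftb x c \<longleftrightarrow> x \<in> gspc & c \<in> chn (Suc m) & (\<forall>j'\<in>I m. gmap j' x - bdry m c j' \<in> nul j')"

lemma liftb_lin:
 assumes "liftb x c" "liftb y c'"
 shows "liftb (x + fscale b y) (\<lambda>j. c j + fscale b (c' j))"
 unfolding liftb_def
proof (intro conjI ballI gspc_lin chains_lin)
 fix j' assume j': "j' \<in> I m"
 have "(gmap j' x - bdry m c j') + fscale b (gmap j' y - bdry m c' j') \<in> nul j'"
  using assms j' unfolding liftb_def by(intro null_add null_scale) auto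
 moreover have "c \<in> chn (Suc m)" "c' \<in> chn (Suc m)" using assms by(auto simp: liftb_def)
 ultimately show "gmap j' (x + fscale b y) - bdry m (\<lambda>j. c j + fscale b (c' j)) j' \<in> nul j'"
  unfolding gmap_lin by(simp add: chain_diff_lin j' fs.scale_right_diff_distrib algebra_simps)
qed (use assms in \<open>auto simp: liftb_def\<close>)

lemma liftb_0: "liftb 0 (\<lambda>j. 0)"
 by(simp add: liftb_def gspc_0 chains_zero chain_diff_zero gmap_def null_0)

lemma liftb_shift:
 assumes "liftb x c"
 shows "liftb (shift a x) (\<lambda>j. lowp (list_of a) (c j))"
 unfolding liftb_def
proof (intro conjI ballI)
 have x: "x \<in> gspc" and c: "c \<in> chn (Suc m)" using assms by(auto simp: liftb_def)
 show "shift a x \<in> gspc" by(rule gspc_shift[OF x])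
 show "(\<lambda>j. lowp (list_of a) (c j)) \<in> chn (Suc m)"
  by(rule chains_prep[OF c lowE_lists(2)])
 fix j' assume j': "j' \<in> I m"
 let ?l = "list_of a"
 have "gmap j' x - bdry m c j' \<in> nul j'" using assms j' by(auto simp: liftb_def)
 from null_add[OF null_add[OF gmap_shift[OF x j', of a]
   prep_null[OF lowE_lists(2)[of ?l] this]] chain_diff_prep[OF c lowE_lists(2)[of ?l] j']]
 show "gmap j' (shift a x) - bdry m (\<lambda>j. lowp (list_of a) (c j)) j' \<in> nul j'"
  by(simp add: prep_diff)
qed

lemma liftb_unique:
 assumes "liftb x c" "liftb x c'"
 shows "tpair c = tpair c'"
proof -
 have "liftb (x + fscale (- 1) x) (\<lambda>j. c j + fscale (- 1) (c' j))" by(rule liftb_lin[OF assms])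
 then have c: "(\<lambda>j. c j + fscale (- 1) (c' j)) \<in> chn (Suc m)"
  and z: "!!j'. j' \<in> I m ==> - bdry m (\<lambda>j. c j + fscale (- 1) (c' j)) j' \<in> nul j'"
  by(auto simp: liftb_def gmap_def)
 have "tpair (\<lambda>j. c j + fscale (- 1) (c' j)) = 0"
  by(rule tpair_cycle[OF c]) (use null_neg[OF z] in simp)
 then show ?thesis by(simp add: tpair_diff)
qed

definition bpair where "bpair x = tpair (SOME c. liftb x c)"

lemma bpair: "liftb x c ==> bpair x = tpair c"
 unfolding bpair_def by(rule liftb_unique[of x]) (rule someI[of "liftb x"], assumption+)

text \<open>On representatives of boundaries the functional is well defined and linear. Shifting a
  representative amounts to prefixing the fixed chain \<open>c\<close> by a longer word, so its
  growth is that of the jets of \<open>g\<close>, and division with bounds applies.\<close>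

lemma bpair_extension:
 obtains G C Q where "!!x c. liftb x c ==> tpair c = lin_ext G x" "C >= 0" "Q >= 0"
  "!!k. norm (G k) <= fb C Q (size (fst k))"
proof -
 define N where "N = {x. \<exists>c. liftb x c}"
 have sub: "fs.subspace N"
 proof (rule subspace_linI)
  show "0 \<in> N" using liftb_0 by(auto simp: N_def)
  show "x + fscale b y \<in> N" if "x \<in> N" "y \<in> N" for x y b using that liftb_lin unfolding N_def by blast
 qed
 obtain G C Q where G: "!!x. x \<in> N ==> bpair x = lin_ext G x" "!!k. norm (G k) <= fb C Q (size (fst k))"
  "C >= 0" "Q >= 0"
 proof (rule extension_with_bounds[OF finite_J _ sub, of bpair])
  show "keys x <= UNIV \<times> J" if "x \<in> N" for x using that by(auto simp: N_def liftb_def gspc_def)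
  show "shift a x \<in> N" if "x \<in> N" for x a using that liftb_shift by(auto simp: N_def)
  show "bpair (x + y) = bpair x + bpair y" if xy: "x \<in> N" "y \<in> N" for x y
  proof -
   obtain c c' where c: "liftb x c" "liftb y c'" using xy by(auto simp: N_def)
   from bpair[OF liftb_lin[OF this, of 1]] bpair[OF c(1)] bpair[OF c(2)] tpair_lin[of c 1 c'] show ?thesis by(simp add: fs.scale_one)
  qed
  show "bpair (fscale b x) = b * bpair x" if xx: "x \<in> N" for b x
  proof -
   obtain c where c: "liftb x c" using xx by(auto simp: N_def)
   have "tpair (\<lambda>j. 0) = 0" by(rule tpair_null) (simp add: null_0)
   then show ?thesis using bpair[OF liftb_lin[OF liftb_0 c, of b]] bpair[OF c] tpair_lin[of "\<lambda>j. 0" b c] by simp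
  qed
  show "\<exists>C Q. \<forall>a. norm (bpair (shift a x)) <= fb C Q (size a)" if xx: "x \<in> N" for x
  proof -
   obtain c where c: "liftb x c" using xx by(auto simp: N_def)
   then have cc: "c \<in> chn (Suc m)" by(auto simp: liftb_def)
   have "growth (\<lambda>l. \<Sum>j\<in>I (Suc m). jpair (R j) (lowp l (c j)) (g j))"
    by(intro growth_sum jet_growth[OF Rgl U 0 g chainsD[OF cc]])
   then have "growth (\<lambda>l. tpair (\<lambda>j. lowp l (c j)))" by(simp add: tpair_def)
   then obtain C Q where CQ: "!!l. norm (tpair (\<lambda>j. lowp l (c j))) <= fb C Q (length l)"
    unfolding growth_def by blast
   have "norm (bpair (shift a x)) <= fb C Q (size a)" for a
    using CQ[of "list_of a"] unfolding bpair[OF liftb_shift[OF c]] by simp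
   then show ?thesis by blast
  qed
 qed (rule that)
 show ?thesis
 proof (rule that[OF _ G(3,4,2)])
  show "tpair c = lin_ext G x" if "liftb x c" for x c
   using G(1)[of x] bpair[OF that] that by(auto simp: N_def)
 qed
qed

lemma gspace_induct:
 assumes j: "j \<in> I m" and w: "w \<in> gspace (R j)" and base: "!!b. b \<in> fbas j ==> P b" and zero: "P 0"
  and add: "!!w w'. w \<in> gspace (R j) ==> w' \<in> gspace (R j) ==> P w ==> P w' ==> P (w + w')"
  and scale: "!!c w. w \<in> gspace (R j) ==> P w ==> P (gscale (R j) c w)"
 shows "P w"
proof -
 interpret vs: vector_space "gscale (R j)" by(rule gl_moduleD(1)[OF Rgl[OF j]])
 have "module.span (gscale (R j)) (fbas j) <= {w \<in> gspace (R j). P w}"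
 proof (rule vs.span_minimal)
  show "fbas j <= {w \<in> gspace (R j). P w}" using fbas_gspace[OF j] base by blast
  show "vs.subspace {w \<in> gspace (R j). P w}"
   by(rule vs.subspaceI) (auto simp: gl_module_closed[OF Rgl[OF j]] zero intro: add scale)
 qed
 then show ?thesis using w fbas[OF j] by auto
qed

text \<open>In contrast to \<open>liftb\<close>, a single element \<open>y\<close> of summand
  \<open>j\<close> is represented, with relations in the other summands, so that lifts of the
  components of a chain can be added up.\<close>

definition lift where
 "lift j y x \<longleftrightarrow> x \<in> gspc & gmap j x - y \<in> nul j & (\<forall>j'\<in>I m. j' \<noteq> j --> gmap j' x \<in> nul j')"

lemma lift_lin:
 assumes "lift j y x" "lift j y' x'"
 shows "lift j (y + fscale b y') (x + fscale b x')"
proof -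
 have "(gmap j x - y) + fscale b (gmap j x' - y') \<in> nul j"
  using assms unfolding lift_def by(intro null_add null_scale) auto
 then have "gmap j (x + fscale b x') - (y + fscale b y') \<in> nul j"
  by(simp add: gmap_lin fs.scale_right_diff_distrib algebra_simps)
 moreover have "gmap j' (x + fscale b x') \<in> nul j'" if "j' \<in> I m" "j' \<noteq> j" for j'
  unfolding gmap_lin using assms that unfolding lift_def
  by(intro null_add null_scale) auto
 ultimately show ?thesis using assms gspc_lin unfolding lift_def by blast
qed

lemma gmap_zero [simp]: "gmap j 0 = 0"
 by(simp add: gmap_def)

lemma lift_null: "y \<in> nul j ==> lift j y 0"
 using null_neg[of y] by(simp add: lift_def gspc_0 null_0)

lemma lift_basis:
 assumes j: "j \<in> I m" and b: "b \<in> fbas j"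
 shows "lift j (ltw l i b) (single (mset l, j, i, b) 1)"
proof -
 have "gmap j' (single (mset l, j, i, b) 1) = gelt j' (mset l, j, i, b)" for j'
  by(simp add: gmap_def fs.scale_one)
 moreover have "prep (map lowE (list_of (mset l))) (tw (\<tau> i) b) - ltw l i b \<in> nul j"
  by(rule lowE_mset[OF Rgl[OF j] tw_space[OF Rgl[OF j] fbas_gspace[OF j b]]]) simp
 ultimately show ?thesis
  using j b by(simp add: lift_def gelt_def gspc_def J_def null_0)
qed

text \<open>Generators and relations span the summand. A generator with arbitrary \<open>w\<close>
  is reduced to the finite basis by linearity in \<open>w\<close>, which holds modulo
  relations.\<close>

lemma lift_ex:
 assumes j: "j \<in> I m" and y: "y \<in> spc j"
 shows "\<exists>x. lift j y x"
proof -
 let ?V = "{y. \<exists>x. lift j y x}"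
 have V: "fs.subspace ?V"
 proof (rule subspace_linI)
  show "0 \<in> ?V" using lift_null[of 0 j] null_0 by blast
  show "y + fscale b y' \<in> ?V" if "y \<in> ?V" "y' \<in> ?V" for y y' b using that lift_lin by blast
 qed
 have N: "nul j <= ?V" using lift_null by blast
 have t: "ltw l i w \<in> ?V" if w: "w \<in> gspace (R j)" for l i w
 proof (rule gspace_induct[OF j w])
  show "ltw l i b \<in> ?V" if "b \<in> fbas j" for b using lift_basis[OF j that] by blast
  show "ltw l i 0 \<in> ?V"
   using ltw_scale[OF Rgl[OF j] gl_module_closed(1)[OF Rgl[OF j]], of l i 0] N by(auto simp: gscale_zero[OF Rgl[OF j]])
  show "ltw l i (w + w') \<in> ?V"
   if "w \<in> gspace (R j)" "w' \<in> gspace (R j)" "ltw l i w \<in> ?V" "ltw l i w' \<in> ?V" for w w'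
   using null_subst[OF ltw_add[OF Rgl[OF j] that(1,2)] V N] fs.subspace_add[OF V that(3,4)] by blast
  show "ltw l i (gscale (R j) c w) \<in> ?V"
   if "w \<in> gspace (R j)" "ltw l i w \<in> ?V" for c w
   using null_subst[OF ltw_scale[OF Rgl[OF j] that(1)] V N] fs.subspace_scale[OF V that(2)] by blast
 qed
 have "tspan (alg st) (par st) (R j) \<tau> <= ?V"
  unfolding tspan_def by(rule fs.span_minimal[OF _ V]) (use N t in blast)
 then show ?thesis using space_tspan[OF Rgl[OF j]] y by blast
qed

context
 fixes G :: "('n * 'n) multiset \<times> ('a * 'i * 'w) => complex" and C Q :: real
 assumes G: "!!x c. liftb x c ==> tpair c = lin_ext G x" and C: "C >= 0" and Q: "Q >= 0"
  and G_bound: "!!k. norm (G k) <= fb C Q (size (fst k))"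
begin

text \<open>The extended functional, moved from the free module to summand \<open>j\<close>. The
  chosen lift is immaterial: two lifts differ by an element that maps to relations in every
  summand.\<close>

definition H where "H j y = lin_ext G (SOME x. lift j y x)"

text \<open>An element that maps to relations represents the boundary of the zero chain, where the
  pairing is 0.\<close>

lemma lin_ext_null:
 assumes "x \<in> gspc" "!!j. j \<in> I m ==> gmap j x \<in> nul j"
 shows "lin_ext G x = 0"
proof -
 have "liftb x (\<lambda>j. 0)" using assms by(simp add: liftb_def chains_zero chain_diff_zero)
 moreover have "tpair (\<lambda>j. 0) = 0" by(rule tpair_null) (simp add: null_0)
 ultimately show ?thesis using G by metis
qed

lemma H_eq:
 assumes "lift j y x"
 shows "H j y = lin_ext G x"
proof -
 let ?x = "SOME x. lift j y x"
 have x: "lift j y ?x" by(rule someI[of "lift j y", OF assms])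
 from lift_lin[OF x assms, of "-1"] have d: "lift j 0 (?x - x)" by simp
 then have "gmap j' (?x - x) \<in> nul j'" if "j' \<in> I m" for j'
  using that unfolding lift_def by(cases "j' = j") auto
 then have "lin_ext G (?x - x) = 0" using d by(intro lin_ext_null) (auto simp: lift_def)
 then show ?thesis by(simp add: H_def lin_ext_diff)
qed

lemma H_lin:
 assumes "j \<in> I m" "y \<in> spc j" "y' \<in> spc j"
 shows "H j (y + fscale b y') = H j y + b * H j y'"
proof -
 obtain x x' where x: "lift j y x" "lift j y' x'" using lift_ex assms by meson
 from H_eq[OF lift_lin[OF this, of b]] H_eq[OF x(1)] H_eq[OF x(2)] show ?thesis
  by(simp add: lin_ext_add lin_ext_fscale)
qed

lemma H_null: "y \<in> nul j ==> H j y = 0"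
 by(simp add: H_eq[OF lift_null])

lemma H_add: "j \<in> I m ==> y \<in> spc j ==> y' \<in> spc j ==> H j (y + y') = H j y + H j y'"
 using H_lin[of j y y' 1] by(simp add: fs.scale_one)

lemma H_scale: "j \<in> I m ==> y \<in> spc j ==> H j (fscale b y) = b * H j y"
 using H_lin[of j 0 y b] by(simp add: H_null null_0 space_0)

lemma H_cong:
 assumes "j \<in> I m" "y - y' \<in> nul j" "y' \<in> spc j"
 shows "H j y = H j y'"
 using H_add[OF assms(1) assms(3) subsetD[OF null_space[OF Rgl[OF assms(1)]] assms(2)]] H_null[OF assms(2)] by simp

text \<open>On a basis vector the lift is a single monomial and the bound is that of
  \<open>G\<close>; other \<open>w\<close> are reached by finitely many sums and multiples. The rate
  \<open>Q + 1\<close> is positive, as a radius of convergence requires, and the same for all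
  \<open>w\<close>.\<close>

lemma H_bound:
 assumes j: "j \<in> I m" and w: "w \<in> gspace (R j)"
 shows "\<exists>K\<ge>0. \<forall>l. norm (H j (ltw l i w)) <= fb K (Q + 1) (length l)"
  (is "\<exists>K\<ge>0. ?P K w")
proof (rule gspace_induct[OF j w])
 note sp = prep_ind_space[OF lowE_lists(2) tw_space[OF Rgl[OF j]]]
 note cl = gl_module_closed[OF Rgl[OF j]]
 have s: "H j (ltw l i (gscale (R j) c w)) = c * H j (ltw l i w)"
  if w: "w \<in> gspace (R j)" for l c w
  using H_cong[OF j ltw_scale[OF Rgl[OF j] w] space_scale[OF sp[OF w]]] H_scale[OF j sp[OF w]] by simp
 show "\<exists>K\<ge>0. ?P K b" if b: "b \<in> fbas j" for b
 proof (intro exI[of _ C] conjI allI C)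
  fix l :: "('n * 'n) list"
  have "norm (H j (ltw l i b)) <= fb C Q (length l)"
   using G_bound[of "(mset l, j, i, b)"] by(simp add: H_eq[OF lift_basis[OF j b]])
  also have "... <= fb C (Q + 1) (length l)"
   using C Q by(intro mult_right_mono mult_left_mono power_mono) auto
  finally show "norm (H j (ltw l i b)) <= fb C (Q + 1) (length l)" .
 qed
 show "\<exists>K\<ge>0. ?P K 0"
 proof -
  have "gscale (R j) 0 0 = 0" by(rule gscale_zero[OF Rgl[OF j]])
  then show ?thesis using s[OF cl(1), of _ 0] by(intro exI[of _ 0]) simp
 qed
 show "\<exists>K\<ge>0. ?P K (w + w')"
  if w: "w \<in> gspace (R j)" "w' \<in> gspace (R j)" and K: "\<exists>K\<ge>0. ?P K w" "\<exists>K\<ge>0. ?P K w'" for w w'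
 proof -
  obtain K K' where KK: "K >= 0" "?P K w" "K' >= 0" "?P K' w'" using K by blast
  have "?P (K + K') (w + w')"
  proof
   fix l :: "('n * 'n) list"
   have "H j (ltw l i (w + w')) = H j (ltw l i w) + H j (ltw l i w')"
    using H_cong[OF j ltw_add[OF Rgl[OF j] w] space_add[OF sp[OF w(1)] sp[OF w(2)]]]
     H_add[OF j sp[OF w(1)] sp[OF w(2)]] by simp
   also have "norm ... <= fb K (Q + 1) (length l) + K' * (Q + 1) ^ length l * fact (length l)"
    using KK by(intro norm_triangle_mono) auto
   finally show "norm (H j (ltw l i (w + w'))) <= fb (K + K') (Q + 1) (length l)"
    by(simp add: algebra_simps)
  qed
  then show ?thesis using KK by(intro exI[of _ "K + K'"]) auto
 qed
 show "\<exists>K\<ge>0. ?P K (gscale (R j) c w)" if w: "w \<in> gspace (R j)" and K: "\<exists>K\<ge>0. ?P K w" for c w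
 proof -
  obtain K where KK: "K >= 0" "?P K w" using K by blast
  show ?thesis
  proof (intro exI[of _ "norm c * K"] conjI allI)
   fix l :: "('n * 'n) list"
   show "norm (H j (ltw l i (gscale (R j) c w))) <= norm c * K * (Q + 1) ^ length l * fact (length l)"
    unfolding s[OF w] norm_mult using mult_left_mono[OF spec[OF KK(2), of l] norm_ge_zero[of c]] by(simp add: mult.assoc)
  qed (use KK in simp)
 qed
qed

text \<open>Lifts of the components of the boundary add up to one element that represents the whole
  boundary of \<open>c\<close>.\<close>

lemma tpair_H:
 assumes c: "c \<in> chn (Suc m)"
 shows "tpair c = (\<Sum>j\<in>I m. H j (bdry m c j))"
proof -
 let ?y = "bdry m c"
 have y: "?y j \<in> spc j" if "j \<in> I m" for j by(rule chainsD[OF chain_diff_chains[OF c] that])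
 have "\<forall>j\<in>I m. \<exists>x. lift j (?y j) x" using lift_ex[OF _ y] by blast
 from bchoice[OF this] obtain X where X: "!!j. j \<in> I m ==> lift j (?y j) (X j)" by blast
 have FJs: "fs.subspace gspc" by(rule subspace_linI[OF gspc_0 gspc_lin])
 have "liftb (sum X (I m)) c"
  unfolding liftb_def
 proof (intro conjI ballI c)
  show "sum X (I m) \<in> gspc" using X by(intro fs.subspace_sum[OF FJs]) (auto simp: lift_def)
  fix j' assume j': "j' \<in> I m"
  have "(\<Sum>j\<in>I m. gmap j' (X j) - (if j = j' then ?y j' else 0)) \<in> nul j'"
  proof (rule null_sum)
   fix j assume "j \<in> I m"
   from X[OF this] j' show "gmap j' (X j) - (if j = j' then ?y j' else 0) \<in> nul j'"
    by(cases "j = j'") (auto simp: lift_def)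
  qed
  then show "gmap j' (sum X (I m)) - ?y j' \<in> nul j'"
   using j' by(simp add: sum_subtractf finI gmap_def push_sum)
 qed
 from G[OF this] show ?thesis by(simp add: lin_ext_sum H_eq[OF X])
qed

text \<open>Each \<open>H j\<close> is realized by a section \<open>F j\<close>. By transposition
  the coboundary of \<open>F\<close> pairs with \<open>y\<close> as \<open>H\<close> does with the
  boundary of \<open>y\<close>, that is, as \<open>g\<close> does with \<open>y\<close>; sections
  with equal pairings agree on the ball.\<close>

lemma local_solution_aux:
 obtains r F where "r > 0" "sball 0 r <= U" "!!j. j \<in> I m ==> F j \<in> sections (R j) (sball 0 r)"
  "!!j. j \<in> I (Suc m) ==> (cobd m (sball 0 r) F j) = restr (R j) (sball 0 r) (g j)"
proof -
 have "\<exists>p. fst p > 0 & snd p \<in> sections (R j) (sball 0 (fst p)) & (\<forall>x\<in>spc j. jpair (R j) x (snd p) = H j x)"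
  if j: "j \<in> I m" for j
 proof -
  obtain \<rho> f where "\<rho> > 0" "f \<in> sections (R j) (sball 0 \<rho>)" "!!x. x \<in> spc j ==> jpair (R j) x f = H j x"
  proof (rule realize_functional[OF Rgl[OF j], of "H j" "Q + 1"])
   show "0 < Q + 1" using Q by simp
  qed (use j in \<open>simp_all add: H_add H_scale H_null H_bound\<close>)
  then show ?thesis by(intro exI[of _ "(\<rho>, f)"]) simp
 qed
 then obtain p where p: "!!j. j \<in> I m ==> fst (p j) > 0 & snd (p j) \<in> sections (R j) (sball 0 (fst (p j)))
   & (\<forall>x\<in>spc j. jpair (R j) x (snd (p j)) = H j x)" by metis
 \<comment> \<open>Every summand comes with its own radius of convergence; finiteness of the index
   set allows a common ball.\<close>
 obtain r0 where r0: "r0 > 0" "!!j. j \<in> I m ==> r0 <= fst (p j)"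
  by(rule finite_pos_lower_bound[OF finI, of _ "\<lambda>j. fst (p j)"]) (use p in blast)+
 obtain e where e: "e > 0" "sball 0 e <= U" using opens_ball[OF U 0] by blast
 define r where "r = min r0 e"
 define B :: "'n mat set" where "B = sball 0 r"
 define F where "F j = restr (R j) B (snd (p j))" for j
 have r: "r > 0" using r0 e by(simp add: r_def)
 have BU: "B <= U" using e(2) unfolding B_def r_def sball_def by auto
 have Bo: "B \<in> osym" unfolding B_def by(rule sball_opens)
 have B0: "0 \<in> B" unfolding B_def by(rule center_sball[OF _ r]) (use U 0 opens_symm in blast)
 have F: "F j \<in> sections (R j) B" if "j \<in> I m" for j
  unfolding F_def
 proof (rule sections_restr[OF Rgl[OF that] Bo])
  show "B <= sball 0 (fst (p j))" using r0(2)[OF that] unfolding B_def r_def sball_def by auto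
 qed (use p that in blast)
 have FH: "jpair (R j) x (F j) = H j x" if j: "j \<in> I m" and x: "x \<in> spc j" for j x
 proof -
  have "jpair (R j) x (F j) = jpair (R j) x (snd (p j))"
   by(rule jet_pair_local[OF Rgl[OF j] Bo B0 _ x]) (simp add: F_def restr_apply)
  then show ?thesis using p[OF j] x by simp
 qed
 have "cobd m B F j = restr (R j) B (g j)" if j: "j \<in> I (Suc m)" for j
 proof -
  note Rj = Rgl[OF j]
  let ?s = "cobd m B F j"
  have s: "?s \<in> sections (R j) B" by(rule cobd_sec[OF Bo F j])
  have gs: "restr (R j) B (g j) \<in> sections (R j) B" by(rule sections_restr[OF Rj Bo BU g[OF j]])
  have "(\<lambda>i S w. 1 * ?s i S w + (- 1) * restr (R j) B (g j) i S w) = zs"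
  proof (rule vanish_on_ball[OF Rj])
   show "(\<lambda>i S w. 1 * ?s i S w + (- 1) * restr (R j) B (g j) i S w) \<in> sections (R j) (sball 0 r)"
    unfolding B_def[symmetric] by(rule sections_lin[OF s gs])
   fix y assume y: "y \<in> spc j"
   \<comment> \<open>A chain concentrated in one summand isolates the equation for that
     summand.\<close>
   define c where "c = (\<lambda>q. if q = j then y else 0)"
   have c: "c \<in> chn (Suc m)" unfolding c_def by(rule chn_single[OF j y])
   have "tpair c = (\<Sum>q\<in>I (Suc m). if q = j then jpair (R j) y (g j) else 0)"
    unfolding tpair_def by(rule sum.cong) (auto simp: c_def)
   then have Gc: "tpair c = jpair (R j) y (g j)" using j finI by simp
   have "jpair (R j) y ?s = (\<Sum>j'\<in>I m. jpair (R j) y (D m j' j B (F j')))"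
    by(rule jet_pair_sum[OF Rj Bo B0 D_sec[OF Bo F _ j] y])
   also have "... = (\<Sum>j'\<in>I m. H j' (d m j j' y))"
   proof (rule sum.cong[OF refl])
    fix j' assume j': "j' \<in> I m"
    show "jpair (R j) y (D m j' j B (F j')) = H j' (d m j j' y)"
     unfolding dual_op_pair[OF Rgl[OF j'] Rj dual[OF j j'] Bo B0 F[OF j'] y]
     by(rule FH[OF j' ind_homD(1)[OF hom[OF j j'] y]])
   qed
   also have "... = tpair c" unfolding tpair_H[OF c] by(rule sum.cong) (simp_all add: c_def bdry_single[OF j])
   finally have 1: "jpair (R j) y ?s = jpair (R j) y (g j)" by(simp add: Gc)
   have 2: "jpair (R j) y (restr (R j) B (g j)) = jpair (R j) y (g j)"
    by(rule jet_pair_local[OF Rj Bo B0 _ y]) (simp add: restr_apply)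
   show "jpair (R j) y (\<lambda>i S w. 1 * ?s i S w + (- 1) * restr (R j) B (g j) i S w) = 0"
    unfolding jet_pair_fun_lin[OF Rj Bo B0 s gs y] 1 2 by simp
  qed
  from this[THEN fun_cong, THEN fun_cong, THEN fun_cong] show ?thesis by(intro ext) simp
 qed
 with r BU F show ?thesis using that unfolding B_def by blast
qed

end

lemma local_solution:
 obtains r F where "r > 0" "sball 0 r <= U" "!!j. j \<in> I m ==> F j \<in> sections (R j) (sball 0 r)"
  "!!j. j \<in> I (Suc m) ==> (cobd m (sball 0 r) F j) = restr (R j) (sball 0 r) (g j)"
proof -
 obtain G C Q where "!!x c. liftb x c ==> tpair c = lin_ext G x" "C >= 0" "Q >= 0"
  "!!k. norm (G k) <= fb C Q (size (fst k))"
  by(rule bpair_extension) (rule that)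
 from this(1-4) show ?thesis by(rule local_solution_aux) (assumption, rule that)
qed

end

text \<open>Pairing with \<open>tw (\<tau> i) w\<close> reads off the value at \<open>o\<close>.
  Transposing twice moves both differentials to the side of chains, where their composite is
  null.\<close>

lemma boundary_at_origin:
 assumes U: "U \<in> osym" and 0: "0 \<in> U" and f: "!!j. j \<in> I m ==> f j \<in> sections (R j) U"
  and q: "q \<in> I (Suc (Suc m))" and w: "w \<in> gspace (R q)"
 shows "(\<Sum>j'\<in>I (Suc m). D (Suc m) j' q U (cobd m U f j') i 0 w) = 0"
proof -
 let ?y = "tw (\<tau> i) w"
 let ?h = "cobd m U f"
 define e where "e = (\<lambda>p. if p = q then ?y else 0)"
 have y: "?y \<in> spc q" by(rule tw_space[OF Rgl[OF q] w])
 have e: "e \<in> chn (Suc (Suc m))" unfolding e_def by(rule chn_single[OF q y])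
 have h: "?h j \<in> sections (R j) U" if "j \<in> I (Suc m)" for j by(rule cobd_sec[OF U f that])
 have DDs: "D (Suc m) j q U (?h j) \<in> sections (R q) U" if "j \<in> I (Suc m)" for j by(rule D_sec[OF U h that q])
 have "(\<Sum>j'\<in>I (Suc m). D (Suc m) j' q U (?h j') i 0 w)
   = jpair (R q) ?y (cobd (Suc m) U ?h q)"
  by(rule \<tau>_pair[OF Rgl[OF q] U sections_sum[OF DDs] 0 w, symmetric])
 also have "... = (\<Sum>j'\<in>I (Suc m). jpair (R q) ?y (D (Suc m) j' q U (?h j')))"
  by(rule jet_pair_sum[OF Rgl[OF q] U 0 DDs y])
 also have "... = (\<Sum>j'\<in>I (Suc m). \<Sum>j\<in>I m. jpair (R j) (d m j' j (d (Suc m) q j' ?y)) (f j))"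
 proof (rule sum.cong[OF refl])
  fix j' assume j': "j' \<in> I (Suc m)"
  have dy: "d (Suc m) q j' ?y \<in> spc j'" by(rule ind_homD(1)[OF hom[OF q j'] y])
  have "jpair (R q) ?y (D (Suc m) j' q U (?h j')) = jpair (R j') (d (Suc m) q j' ?y) (?h j')"
   by(rule dual_op_pair[OF Rgl[OF j'] Rgl[OF q] dual[OF q j'] U 0 h[OF j'] y])
  also have "... = (\<Sum>j\<in>I m. jpair (R j') (d (Suc m) q j' ?y) (D m j j' U (f j)))"
   by(rule jet_pair_sum[OF Rgl[OF j'] U 0 D_sec[OF U f _ j'] dy])
  also have "... = (\<Sum>j\<in>I m. jpair (R j) (d m j' j (d (Suc m) q j' ?y)) (f j))"
   by(rule sum.cong[OF refl], rule dual_op_pair[OF Rgl Rgl[OF j'] dual[OF j'] U 0 f dy])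
  finally show "jpair (R q) ?y (D (Suc m) j' q U (?h j'))
   = (\<Sum>j\<in>I m. jpair (R j) (d m j' j (d (Suc m) q j' ?y)) (f j))" .
 qed
 also have "... = (\<Sum>j\<in>I m. jpair (R j) (bdry m (bdry (Suc m) e) j) (f j))"
  unfolding chain_diff_def[of I d m] jet_pair_lin_ext lin_ext_sum
  by(subst sum.swap) (simp add: e_def bdry_single[OF q])
 also have "... = 0"
  by(rule sum.neutral) (blast intro: jet_pair_null[OF Rgl U 0 f chain_diff_diff_null[OF e]])
 finally show ?thesis .
qed

section \<open>From the origin to arbitrary points\<close>

lemma tr_sum: "tr S0 (ss f A) = (\<lambda>i S w. \<Sum>a\<in>A. tr S0 (f a) i S w)"
 by(simp add: tr_def)

lemma tr_D:
 assumes j: "j \<in> I (Suc m)" "j' \<in> I m" and U: "U \<in> osym" and f: "f \<in> sections (R j') U" and S0: "S0 \<in> symm"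
 shows "tr S0 (D m j' j U f) = D m j' j {S. S0 + S \<in> U} (tr S0 f)"
 by(rule dual_op_translate[OF Rgl[OF j(2)] Rgl[OF j(1)] dual[OF j] U f S0])

lemma boundary_boundary:
 assumes U: "U \<in> osym" and f: "!!j. j \<in> I m ==> f j \<in> sections (R j) U" and q: "q \<in> I (Suc (Suc m))"
 shows "(\<lambda>i S w. \<Sum>j'\<in>I (Suc m). D (Suc m) j' q U (cobd m U f j') i S w) = zs"
proof (rule sections_ext)
 let ?h = "cobd m U f"
 have h: "?h j \<in> sections (R j) U" if "j \<in> I (Suc m)" for j by(rule cobd_sec[OF U f that])
 show "cobd (Suc m) U ?h q \<in> sections (R q) U"
  by(rule sections_sum, rule dual_op_sections[OF Rgl Rgl[OF q] dual[OF q] U h])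
 show "zs \<in> sections (R q) U" by(rule sections_zero)
 fix i S0 w assume S: "S0 \<in> U" and w: "w \<in> gspace (R q)"
 have S0: "S0 \<in> symm" using S opens_symm[OF U] by blast
 let ?V = "{S. S0 + S \<in> U}"
 have V: "?V \<in> osym" by(rule opens_translate[OF U S0])
 have "(\<Sum>j'\<in>I (Suc m). D (Suc m) j' q U (?h j') i S0 w) = (\<Sum>j'\<in>I (Suc m). tr S0 (D (Suc m) j' q U (?h j')) i 0 w)"
  by(simp add: tr_def)
 also have "... = (\<Sum>j'\<in>I (Suc m). D (Suc m) j' q ?V (cobd m ?V (\<lambda>j. tr S0 (f j)) j') i 0 w)"
  by(rule sum.cong[OF refl]) (simp add: tr_D[OF q _ U h S0] tr_sum tr_D[OF _ _ U f S0])
 also have "... = 0"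
  by(rule boundary_at_origin[OF V _ tr_sections[OF f S0] q w]) (use S in simp)
 finally show "(\<Sum>j'\<in>I (Suc m). D (Suc m) j' q U (?h j') i S0 w) = 0" .
qed

lemma tr_restr:
 "tr S0 (restr R' V f) = restr R' {S. S0 + S \<in> V} (tr S0 f)"
 by(simp add: tr_def restr_def)

lemma translate_ball:
 assumes "S0 \<in> symm"
 shows "{S. - S0 + S \<in> sball 0 r} = sball S0 r"
proof -
 have "- S0 \<in> symm" using assms by(simp add: symm_closed)
 then have "S - S0 \<in> symm \<longleftrightarrow> S \<in> symm" for S using symm_translate[of "- S0"] by auto
 then show ?thesis unfolding sball_def by(simp add: dist_norm)
qed

text \<open>Closedness is translated to the origin, the equation is solved there, and the solution
  is translated back; all differentials commute with both translations.\<close>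

lemma local_solution_anywhere:
 assumes U: "U \<in> osym" and S0: "S0 \<in> U"
  and g: "!!j. j \<in> I (Suc m) ==> g j \<in> sections (R j) U"
  and closed: "!!q. q \<in> I (Suc (Suc m)) ==>
   (cobd (Suc m) U g q) = zs"
 obtains r F where "r > 0" "sball S0 r <= U" "!!j. j \<in> I m ==> F j \<in> sections (R j) (sball S0 r)"
  "!!j. j \<in> I (Suc m) ==> (cobd m (sball S0 r) F j) = restr (R j) (sball S0 r) (g j)"
proof -
 have s: "S0 \<in> symm" using S0 opens_symm[OF U] by blast
 then have ms: "- S0 \<in> symm" by(simp add: symm_closed)
 let ?V = "{S. S0 + S \<in> U}"
 have V: "?V \<in> osym" by(rule opens_translate[OF U s])
 have V0: "0 \<in> ?V" using S0 by simp
 have tg: "tr S0 (g j) \<in> sections (R j) ?V" if "j \<in> I (Suc m)" for j by(rule tr_sections[OF g[OF that] s])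
 have tc: "cobd (Suc m) ?V (\<lambda>j. tr S0 (g j)) q = zs"
  if q: "q \<in> I (Suc (Suc m))" for q
 proof -
  have "(cobd (Suc m) ?V (\<lambda>j. tr S0 (g j)) q)
    = tr S0 (cobd (Suc m) U g q)"
   unfolding tr_sum by(intro ext sum.cong refl) (simp add: tr_D[OF q _ U g s])
  also have "... = zs" unfolding closed[OF q] by(simp add: tr_def)
  finally show ?thesis .
 qed
 obtain r F where r: "r > 0" "sball 0 r <= ?V" and F: "!!j. j \<in> I m ==> F j \<in> sections (R j) (sball 0 r)"
  and DF: "!!j. j \<in> I (Suc m) ==> (cobd m (sball 0 r) F j)
   = restr (R j) (sball 0 r) (tr S0 (g j))"
  by(rule local_solution[OF V V0 tg tc]) (assumption | rule that)+
 note tb = translate_ball[OF s, of r]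
 show ?thesis
 proof (rule that[of r "\<lambda>j. tr (- S0) (F j)"])
  show "sball S0 r <= U"
  proof
   fix S assume "S \<in> sball S0 r"
   then have "- S0 + S \<in> ?V" using r(2) unfolding tb[symmetric] by blast
   then show "S \<in> U" by simp
  qed
  show "tr (- S0) (F j) \<in> sections (R j) (sball S0 r)" if "j \<in> I m" for j
   using tr_sections[OF F[OF that] ms] unfolding tb .
  fix j assume j: "j \<in> I (Suc m)"
  have "(cobd m (sball S0 r) (\<lambda>j'. tr (- S0) (F j')) j)
    = tr (- S0) (cobd m (sball 0 r) F j)"
   unfolding tr_sum by(intro ext sum.cong refl) (simp only: tr_D[OF j _ sball_opens F ms] tb)
  also have "... = restr (R j) (sball S0 r) (g j)"
   unfolding DF[OF j] tr_restr tb tr_tr by simp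
  finally show "cobd m (sball S0 r) (\<lambda>j'. tr (- S0) (F j')) j = restr (R j) (sball S0 r) (g j)" .
 qed (rule r)
qed

theorem dual_complex_exact: "dual_complex_exact X I R D"
proof -
 have Us: "U \<in> osym" if "U \<in> opens X" for U
  using that by(auto simp: opens_iff)
 let ?Z = "(\<lambda>j i S w. 0) :: 'a => ('i, 'n, 'w) sect"
 have diff_eq: "sheaf_diff I D m U f j = cobd m U f j" if "j \<in> I (Suc m)" for m U j f
  using that by(simp add: sheaf_diff_def)
 have diff_out: "sheaf_diff I D m U f j = zs" if "j \<notin> I (Suc m)" for m U j f
  using that by(simp add: sheaf_diff_def)
 have term_sec: "f j \<in> sections (R j) U" if "f \<in> sheaf_term (I m) R U" "j \<in> I m" for m U j and f :: "'a => ('i, 'n, 'w) sect"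
  using that by(simp add: sheaf_term_def)
 have diff_term: "sheaf_diff I D m U f \<in> sheaf_term (I (Suc m)) R U" if U: "U \<in> osym" and f: "f \<in> sheaf_term (I m) R U"
  for m U and f :: "'a => ('i, 'n, 'w) sect"
  unfolding sheaf_term_def
 proof (intro CollectI conjI ballI allI impI diff_out)
  fix j assume j: "j \<in> I (Suc m)"
  show "sheaf_diff I D m U f j \<in> sections (R j) U"
   unfolding diff_eq[OF j]
   by(rule sections_sum, rule dual_op_sections[OF Rgl Rgl[OF j] dual[OF j] U term_sec[OF f]])
 qed
 have dd: "sheaf_diff I D (Suc m) U (sheaf_diff I D m U f) = ?Z" if U: "U \<in> osym" and f: "f \<in> sheaf_term (I m) R U"
  for m U and f :: "'a => ('i, 'n, 'w) sect"
 proof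
  fix q
  show "sheaf_diff I D (Suc m) U (sheaf_diff I D m U f) q = zs"
  proof (cases "q \<in> I (Suc (Suc m))")
   case True
   show ?thesis
    unfolding diff_eq[OF True] using boundary_boundary[OF U term_sec[OF f] True] by(simp add: diff_eq)
  qed (rule diff_out)
 qed
 have exact: "exact_sheaves (opens X) (sheaf_restr R) ?Z (sheaf_term (I m) R) (sheaf_diff I D m)
   (sheaf_term (I (Suc m)) R) (sheaf_diff I D (Suc m))" for m
  unfolding exact_sheaves_def
 proof (intro conjI ballI impI)
  fix U and f :: "'a => ('i, 'n, 'w) sect" assume "U \<in> opens X" and f: "f \<in> sheaf_term (I m) R U"
  then show "sheaf_diff I D m U f \<in> sheaf_term (I (Suc m)) R U"
   "sheaf_diff I D (Suc m) U (sheaf_diff I D m U f) = ?Z" using diff_term dd Us by blast+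
 next
  fix U S0 and g :: "'a => ('i, 'n, 'w) sect" assume UX: "U \<in> opens X" and g: "g \<in> sheaf_term (I (Suc m)) R U"
   and z: "sheaf_diff I D (Suc m) U g = ?Z" and S0: "S0 \<in> U"
  note U = Us[OF UX]
  have closed: "cobd (Suc m) U g q = zs" if "q \<in> I (Suc (Suc m))" for q
   using fun_cong[OF z, of q] unfolding diff_eq[OF that] .
  obtain r F where r: "r > 0" "sball S0 r <= U" and F: "!!j. j \<in> I m ==> F j \<in> sections (R j) (sball S0 r)"
   and DF: "!!j. j \<in> I (Suc m) ==> (cobd m (sball S0 r) F j)
    = restr (R j) (sball S0 r) (g j)"
   by(rule local_solution_anywhere[OF U S0 term_sec[OF g] closed]) (assumption | rule that)+
  define F' where "F' = (\<lambda>j. if j \<in> I m then F j else zs)"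
  have "F' \<in> sheaf_term (I m) R (sball S0 r)" using F by(simp add: sheaf_term_def F'_def)
  moreover have "sheaf_diff I D m (sball S0 r) F' = sheaf_restr R (sball S0 r) g"
  proof
   fix j
   show "sheaf_diff I D m (sball S0 r) F' j = sheaf_restr R (sball S0 r) g j"
   proof (cases "j \<in> I (Suc m)")
    case True
    show ?thesis unfolding diff_eq[OF True] sheaf_restr_def DF[OF True, symmetric] by(simp add: F'_def)
   next
    case False
    then have "g j = zs" using g by(simp add: sheaf_term_def)
    then show ?thesis unfolding diff_out[OF False] sheaf_restr_def restr_def by(simp only: if_cancel)
   qed
  qed
  moreover have "sball S0 r \<in> opens X"
   using sball_opens[of S0 r] r(2) UX by(auto simp: opens_def)
  moreover have "S0 \<in> sball S0 r"
   by(rule center_sball[OF _ r(1)]) (use S0 opens_symm[OF U] in blast)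
  ultimately show "\<exists>V\<in>opens X. S0 \<in> V & V <= U &
    (\<exists>f\<in>sheaf_term (I m) R V. sheaf_diff I D m V f = sheaf_restr R V g)"
   using r(2) by blast
 qed
 have zero_term: "?Z \<in> sheaf_term (I m) R U" for m U
  by(simp add: sheaf_term_def sections_zero)
 have zero_diff: "sheaf_diff I D 0 U ?Z = ?Z" if U: "U \<in> osym" for U
 proof
  fix j
  show "sheaf_diff I D 0 U ?Z j = zs"
  proof (cases "j \<in> I (Suc 0)")
   case True
   show ?thesis unfolding diff_eq[OF True]
    by(intro ext sum.neutral ballI) (simp add: dual_op_zero[OF Rgl Rgl[OF True] dual[OF True] U])
  qed (rule diff_out)
 qed
 have restr_zero: "sheaf_restr R U ?Z = ?Z" for U by(simp add: sheaf_restr_def restr_def)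
 have restr_ker: "sheaf_restr R U f = f" if "f \<in> sheaf_term (I 0) R U"
  for U and f :: "'a => ('i, 'n, 'w) sect"
 proof
  fix j
  show "sheaf_restr R U f j = f j"
  proof (cases "j \<in> I 0")
   case True
   then show ?thesis using restr_sections[OF term_sec[OF that True]] by(simp add: sheaf_restr_def)
  next
   case False
   then have "f j = zs" using that by(simp add: sheaf_term_def)
   then show ?thesis unfolding sheaf_restr_def restr_def by(simp only: if_cancel)
  qed
 qed
 \<comment> \<open>Exactness at the kernel and at degree 0 is formal; only zero sections and
   restrictions have to be matched.\<close>
 have e1: "exact_sheaves (opens X) (sheaf_restr R) ?Z (\<lambda>U. {?Z}) (\<lambda>U f. f)
   (\<lambda>U. {f \<in> sheaf_term (I 0) R U. sheaf_diff I D 0 U f = ?Z}) (\<lambda>U f. f)"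
  unfolding exact_sheaves_def
 proof (intro conjI ballI impI)
  fix U and f :: "'a => ('i, 'n, 'w) sect" assume U: "U \<in> opens X" and f: "f \<in> {?Z}"
  have "f = ?Z" using f by blast
  then show "f \<in> {f \<in> sheaf_term (I 0) R U. sheaf_diff I D 0 U f = ?Z}" "f = ?Z"
   using zero_term zero_diff[OF Us[OF U]] by simp_all
 next
  fix U S0 and g :: "'a => ('i, 'n, 'w) sect" assume "U \<in> opens X" "g = ?Z" "S0 \<in> U"
  then show "\<exists>V\<in>opens X. S0 \<in> V & V <= U & (\<exists>f\<in>{?Z}. f = sheaf_restr R V g)"
   using restr_zero by blast
 qed
 have e2: "exact_sheaves (opens X) (sheaf_restr R) ?Z
   (\<lambda>U. {f \<in> sheaf_term (I 0) R U. sheaf_diff I D 0 U f = ?Z}) (\<lambda>U f. f) (sheaf_term (I 0) R) (sheaf_diff I D 0)"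
  unfolding exact_sheaves_def
 proof (intro conjI ballI impI)
  fix U S0 and g :: "'a => ('i, 'n, 'w) sect" assume U: "U \<in> opens X" and g: "g \<in> sheaf_term (I 0) R U" "sheaf_diff I D 0 U g = ?Z" and S0: "S0 \<in> U"
  show "\<exists>V\<in>opens X. S0 \<in> V & V <= U &
    (\<exists>f\<in>{f \<in> sheaf_term (I 0) R V. sheaf_diff I D 0 V f = ?Z}. f = sheaf_restr R V g)"
   by(rule bexI[OF _ U]) (use g S0 in \<open>simp add: restr_ker\<close>)
 qed auto
 show ?thesis
  unfolding dual_complex_exact_def right_resolution_of_kernel_def Let_def
  using e1 e2 exact by(intro conjI allI)
qed

end
end

section \<open>The symplectic Lie algebra and its parabolic subalgebra\<close>

lemma omega_add_left: "omega (x + y) z = omega x z + omega y z"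
 and omega_add_right: "omega x (y + z) = omega x y + omega x z"
 and omega_scale_left: "omega (c *s x) z = c * omega x z"
 and omega_scale_right: "omega x (c *s z) = c * omega x z"
 and omega_minus_left: "omega (- x) z = - omega x z"
 and omega_diff_left: "omega (x - y) z = omega x z - omega y z"
 and omega_diff_right: "omega x (y - z) = omega x y - omega x z"
 by(simp_all add: omega_def sum.distrib sum_subtractf sum_distrib_left algebra_simps flip: sum_negf)

lemma omega_swap: "omega x y = - omega y x"
 by(simp add: omega_def algebra_simps flip: sum_negf)

lemma omega_axis_left: "omega (axis (Inr i) 1) z = - z $ Inl i" "omega (axis (Inl i) 1) z = z $ Inr i"
 using omega_swap[of _ z] by(simp_all add: omega_qE omega_pE)

definition skew :: "'n::finite symp_mat => bool" where
 "skew M \<longleftrightarrow> (\<forall>y z. omega (M *v y) z = - omega y (M *v z))"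

lemma skewD: "skew M ==> omega (M *v y) z = - omega y (M *v z)"
 by(simp add: skew_def)

lemma matrix_vector_mscale: "mscale c M *v y = c *s (M *v y)"
 by(simp add: vec_eq_iff matrix_vector_mult_def sum_distrib_left mult.assoc)

lemma matrix_vector_minus: "(A - B) *v (y :: complex ^ 'k) = A *v y - B *v y"
 by(simp add: vec_eq_iff matrix_vector_mult_def left_diff_distrib sum_subtractf)

lemma matrix_vector_add: "(A + B) *v (y :: complex ^ 'k) = A *v y + B *v y"
 by(simp add: vec_eq_iff matrix_vector_mult_def distrib_right sum.distrib)

lemma symp_mat_eqI:
 fixes M N :: "'n::finite symp_mat"
 assumes "!!y. M *v y = N *v y"
 shows "M = N"
 using assms by(simp add: matrix_eq)

lemma skew_quad: "skew (quad y z)"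
 unfolding skew_def quad_vec
 by(simp add: omega_add_left omega_add_right omega_scale_left omega_scale_right omega_swap[of _ y] omega_swap[of _ z])

lemma subspace_skew: "module.subspace mscale {M. skew M}"
proof (rule ms.subspaceI)
 show "0 \<in> {M. skew M}" using skew_quad[of 0 0]
  by(simp add: skew_def omega_def)
 show "M + N \<in> {M. skew M}" if "M \<in> {M. skew M}" "N \<in> {M. skew M}" for M N
  using that by(simp add: skew_def matrix_vector_add omega_add_left omega_add_right)
 show "mscale c M \<in> {M. skew M}" if "M \<in> {M. skew M}" for c M
  using that by(simp add: skew_def matrix_vector_mscale omega_scale_left omega_scale_right)
qed

lemma quad_swap: "quad y z = quad z y"
 by(simp add: quad_def vec_eq_iff algebra_simps)

text \<open>The expansion in dual bases that also defines \<open>osp_poly\<close>. Applied to a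
  vector \<open>w\<close>, each half of the symmetrized sum yields \<open>M w\<close>, one of them
  by skewness; the factor 1/2 compensates.\<close>

lemma skew_expand:
 assumes "skew M"
 shows "M = mscale (1/2) (SU i. quad (M *v qE i) (pE i) - quad (M *v pE i) (qE i))"
proof (rule symp_mat_eqI)
 fix w :: "'a symp"
 have s: "(\<Sum>i\<in>A. F i) *v w = (\<Sum>i\<in>A. F i *v w)" for A :: "'a set" and F :: "'a => 'a symp_mat"
  by(induction A rule: infinite_finite_induct) (simp_all add: matrix_vector_add)
 have Mw: "M *v w = (SU i. w $ Inl i *s (M *v pE i) + w $ Inr i *s (M *v qE i))"
  by(subst symp_expand[of w])
   (simp add: vec.linear_sum[OF matrix_vector_mul_linear_gen] vec.linear_scale[OF matrix_vector_mul_linear_gen]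
    matrix_vector_right_distrib)
 have "quad (M *v qE i) (pE i) *v w - quad (M *v pE i) (qE i) *v w
  = (w $ Inl i *s (M *v pE i) + w $ Inr i *s (M *v qE i)) + ((M *v w) $ Inl i *s pE i + (M *v w) $ Inr i *s qE i)" for i
  unfolding quad_vec
  by(simp add: skewD[OF assms] pE_def[of i] qE_def[of i] omega_axis_left algebra_simps vec_eq_iff)
 then have "(SU i. quad (M *v qE i) (pE i) - quad (M *v pE i) (qE i)) *v w = M *v w + M *v w"
  unfolding s matrix_vector_minus
  using Mw symp_expand[of "M *v w"] sum.distrib[of "\<lambda>i. w $ Inl i *s (M *v pE i) + w $ Inr i *s (M *v qE i)"
    "\<lambda>i. (M *v w) $ Inl i *s pE i + (M *v w) $ Inr i *s qE i" UNIV] by presburger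
 then show "M *v w = mscale (1/2) (SU i. quad (M *v qE i) (pE i) - quad (M *v pE i) (qE i)) *v w"
  by(simp add: matrix_vector_mscale vec_eq_iff)
qed

lemma subspace_sdot: "module.subspace mscale (sdot A B)"
 unfolding sdot_def by(rule ms.subspace_span)

lemma quad_sdot: "y \<in> A ==> z \<in> B ==> quad y z \<in> sdot A B"
 unfolding sdot_def by(rule ms.span_base) blast

lemma sdot_UNIV_iff: "M \<in> sdot UNIV UNIV \<longleftrightarrow> skew M"
proof
 assume "M \<in> sdot UNIV UNIV"
 moreover have "sdot UNIV UNIV <= {M. skew M}"
  unfolding sdot_def by(rule ms.span_minimal[OF _ subspace_skew]) (auto simp: skew_quad)
 ultimately show "skew M" by blast
next
 assume M: "skew M"
 show "M \<in> sdot UNIV UNIV"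
  by(subst skew_expand[OF M]) (intro ms.subspace_scale[OF subspace_sdot] ms.subspace_sum[OF subspace_sdot]
    ms.subspace_diff[OF subspace_sdot] quad_sdot UNIV_I)
qed

lemma Lp_iff: "y \<in> Lp \<longleftrightarrow> (\<forall>i. y $ Inr i = 0)"
proof
 have "vec.span (range pE) <= {y :: 'a symp. \<forall>i. y $ Inr i = 0}"
  by(rule vec.span_minimal) (auto simp: pE_def axis_def vec.subspace_def)
 then show "y \<in> Lp ==> \<forall>i. y $ Inr i = 0" by(auto simp: Lp_def)
next
 assume "\<forall>i. y $ Inr i = 0"
 then have "y = (SU i. y $ Inl i *s pE i)" by(subst symp_expand[of y]) simp
 also have "... \<in> Lp" unfolding Lp_def
  by(intro vec.span_sum vec.span_scale vec.span_base) simp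
 finally show "y \<in> Lp" .
qed

lemma pE_Lp [simp]: "pE i \<in> Lp"
 by(simp add: Lp_iff pE_def axis_def)

lemma qp_block_nth: "qp_block M $ i $ j = (M *v pE j) $ Inr i"
 by(simp add: qp_block_def pE_def matrix_vector_axis)

text \<open>In the expansion of a skew \<open>M\<close> that preserves \<open>Lp\<close>, every
  \<open>quad\<close> has a factor \<open>p_i\<close> or \<open>M p_i\<close> in \<open>Lp\<close>.
  Conversely \<open>quad a b\<close> with \<open>a\<close> in \<open>Lp\<close> maps
  \<open>Lp\<close> to itself because \<open>Lp\<close> is isotropic.\<close>

lemma sdot_Lp_iff: "M \<in> sdot Lp UNIV \<longleftrightarrow> skew M & (\<forall>y\<in>Lp. M *v y \<in> Lp)"
proof
 assume M: "M \<in> sdot Lp UNIV"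
 have "sdot Lp UNIV <= {M. skew M} \<inter> {M :: 'a symp_mat. \<forall>y\<in>Lp. M *v y \<in> Lp}"
  unfolding sdot_def
 proof (rule ms.span_minimal)
  show "ms.subspace ({M. skew M} \<inter> {M :: 'a symp_mat. \<forall>y\<in>Lp. M *v y \<in> Lp})"
  proof (rule ms.subspace_inter[OF subspace_skew], rule ms.subspaceI)
  qed (auto simp: Lp_iff matrix_vector_add matrix_vector_mscale)
  show "{quad a b |a b. a \<in> Lp & b \<in> UNIV} <= {M. skew M} \<inter> {M :: 'a symp_mat. \<forall>y\<in>Lp. M *v y \<in> Lp}"
  proof (safe intro!: skew_quad)
   fix a b y :: "'a symp" assume "a \<in> Lp" "y \<in> Lp"
   moreover then have "omega a y = 0" by(simp add: Lp_iff omega_def)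
   ultimately show "quad a b *v y \<in> Lp" by(simp add: quad_vec Lp_iff)
  qed
 qed
 then show "skew M & (\<forall>y\<in>Lp. M *v y \<in> Lp)" using M by blast
next
 assume M: "skew M & (\<forall>y\<in>Lp. M *v y \<in> Lp)"
 show "M \<in> sdot Lp UNIV"
  by(subst skew_expand[of M]) (use M in \<open>auto intro!: ms.subspace_scale[OF subspace_sdot] ms.subspace_sum[OF subspace_sdot]
    ms.subspace_diff[OF subspace_sdot] quad_sdot simp: quad_swap[of _ "pE _"]\<close>)
qed

lemma skew_bracket: "skew M ==> skew N ==> skew (M ** N - N ** M)"
 unfolding skew_def by(simp add: matrix_vector_minus matrix_vector_mul_assoc[symmetric] omega_diff_left omega_diff_right)

lemma skew_quad_bracket:
 assumes "skew M"
 shows "M ** quad y z - quad y z ** M = quad (M *v y) z + quad y (M *v z)"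
proof (rule symp_mat_eqI)
 fix w
 show "(M ** quad y z - quad y z ** M) *v w = (quad (M *v y) z + quad y (M *v z)) *v w"
  by(simp add: matrix_vector_minus matrix_vector_add matrix_vector_mul_assoc[symmetric] quad_vec
    matrix_vector_right_distrib skewD[OF assms] algebra_simps vec.scale)
qed

lemma skew_blocks:
 assumes "skew M"
 shows "pq_block M $ i $ j = pq_block M $ j $ i" "qp_block M $ i $ j = qp_block M $ j $ i"
  "qq_block M $ i $ j = - pp_block M $ j $ i"
proof -
 have *: "M $ a $ b = (M *v axis b 1) $ a" for a b by(simp add: matrix_vector_axis)
 have o: "omega (M *v axis b 1) (axis a 1) = - omega (axis b 1) (M *v axis a 1)" for a b
  by(rule skewD[OF assms])
 show "pq_block M $ i $ j = pq_block M $ j $ i" "qp_block M $ i $ j = qp_block M $ j $ i"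
  "qq_block M $ i $ j = - pp_block M $ j $ i"
  using o[of "Inr j" "Inr i"] o[of "Inl j" "Inl i"] o[of "Inl i" "Inr j"]
  by(simp_all add: pq_block_def qp_block_def qq_block_def pp_block_def omega_qE omega_pE omega_axis_left matrix_vector_axis)
qed

lemma low_mult_vec: "(low B *v y) $ Inl i = 0" "(low B *v y) $ Inr i = (SU j. B $ i $ j * y $ Inl j)"
 by(simp_all add: matrix_vector_mult_def low_def UNIV_Plus_UNIV[symmetric] sum.Plus del: UNIV_Plus_UNIV)

lemma skew_low:
 assumes "B \<in> symm"
 shows "skew (low B)"
proof -
 have "(SU i j. B $ i $ j * y $ Inl j * z $ Inl i) = (SU i j. B $ i $ j * y $ Inl i * z $ Inl j)"
  for y z :: "'a symp"
  by(subst sum.swap) (intro sum.cong refl, use assms in \<open>simp add: symm_iff\<close>)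
 then show ?thesis
  unfolding skew_def by(simp add: omega_def low_mult_vec sum_distrib_left sum_distrib_right sum_negf algebra_simps)
qed

lemma qp_block_symm: "skew M ==> qp_block M \<in> symm"
 by(subst symm_iff) (blast intro: skew_blocks)

lemma skew_diff: "skew M ==> skew N ==> skew (M - N)"
 using ms.subspace_diff[OF subspace_skew, of M N] by simp

lemma even_decomposition:
 assumes "skew M"
 shows "M - low (qp_block M) \<in> sdot Lp UNIV"
proof -
 have "(M - low (qp_block M)) *v pE i \<in> Lp" for i
  unfolding Lp_iff
  by(simp add: matrix_vector_minus pE_def low_def matrix_vector_axis qp_block_def)
 then have "(M - low (qp_block M)) *v y \<in> Lp" if "y \<in> Lp" for y
 proof -
  have "y = (SU i. y $ Inl i *s pE i)" using that by(subst symp_expand[of y]) (simp add: Lp_iff)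
  then have "(M - low (qp_block M)) *v y = (SU i. y $ Inl i *s ((M - low (qp_block M)) *v pE i))"
   by(metis (no_types, lifting) sum.cong vec.linear_scale[OF matrix_vector_mul_linear_gen] vec.linear_sum[OF matrix_vector_mul_linear_gen])
  then show ?thesis using \<open>!!i. (M - low (qp_block M)) *v pE i \<in> Lp\<close> by(simp add: Lp_iff)
 qed
 then show ?thesis
  unfolding sdot_Lp_iff using skew_diff[OF assms skew_low[OF qp_block_symm[OF assms]]] by blast
qed

text \<open>Parity by parity: with two odd arguments it is the equivariance of \<open>quad\<close>
  under skew matrices, and with three odd arguments a cyclic identity that follows from the
  antisymmetry of \<open>omega\<close>.\<close>

lemma bracket_jacobi:
 assumes "!!M. X = Ev M ==> skew M" "!!M. Y = Ev M ==> skew M" "!!M. Z = Ev M ==> skew M"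
 shows "bracket X (bracket Y Z) = oadd (bracket (bracket X Y) Z) (oscale (ksign X Y) (bracket Y (bracket X Z)))"
proof -
 have l: "quad (- y) z = - quad y z" "quad z (- y) = - quad z y" for y z :: "'a symp"
  by(simp_all add: vec_eq_iff quad_def omega_minus_left algebra_simps)
 have m: "mscale 1 M = M" "mscale (- 1) M = - M" for M :: "'a symp_mat" by(simp_all add: vec_eq_iff)
 note v = matrix_vector_minus matrix_vector_add matrix_vector_mul_assoc[symmetric] matrix_vector_right_distrib
  vec.diff vec.neg quad_vec
 show ?thesis
 proof (cases X)
  case X: (Ev M)
  note M = assms(1)[OF X]
  show ?thesis
  proof (cases Y; cases Z)
   fix N K assume YZ: "Y = Ev N" "Z = Ev K"
   show ?thesis unfolding X YZ
    by(simp add: ksign_def m, rule symp_mat_eqI) (simp add: v algebra_simps)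
  next
   fix y z assume YZ: "Y = Od y" "Z = Od z"
   show ?thesis unfolding X YZ by(simp add: ksign_def m skew_quad_bracket[OF M])
  qed (simp_all add: X ksign_def v algebra_simps)
 next
  case X: (Od x)
  show ?thesis
  proof (cases Y; cases Z)
   fix N z assume YZ: "Y = Ev N" "Z = Od z"
   note N = assms(2)[OF YZ(1)]
   show ?thesis unfolding X YZ by(simp add: ksign_def m skew_quad_bracket[OF N] l)
  next
   fix y K assume YZ: "Y = Od y" "Z = Ev K"
   note K = assms(3)[OF YZ(2)]
   have "K ** quad x y - quad x y ** K = quad y (K *v x) + quad x (K *v y)"
    using skew_quad_bracket[OF K] quad_swap by metis
   then show ?thesis unfolding X YZ by(simp add: ksign_def m l algebra_simps)
  next
   fix y z assume YZ: "Y = Od y" "Z = Od z"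
   show ?thesis unfolding X YZ
    by(simp add: ksign_def v omega_swap[of z x] omega_swap[of z y] omega_swap[of y x] vec_eq_iff algebra_simps)
  qed (simp_all add: X ksign_def v algebra_simps)
 qed
qed

section \<open>Block matrices and the parabolic subalgebra\<close>

lemma pp_block_add: "pp_block (M + N) = pp_block M + pp_block N"
 and pq_block_add: "pq_block (M + N) = pq_block M + pq_block N"
 and qp_block_add: "qp_block (M + N) = qp_block M + qp_block N"
 and qq_block_add: "qq_block (M + N) = qq_block M + qq_block N"
 and pp_block_mscale: "pp_block (mscale c M) = mscale c (pp_block M)"
 and pq_block_mscale: "pq_block (mscale c M) = mscale c (pq_block M)"
 and qp_block_mscale: "qp_block (mscale c M) = mscale c (qp_block M)"
 and qq_block_mscale: "qq_block (mscale c M) = mscale c (qq_block M)"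
 and pp_block_diff: "pp_block (M - N) = pp_block M - pp_block N"
 and pq_block_diff: "pq_block (M - N) = pq_block M - pq_block N"
 and qp_block_diff: "qp_block (M - N) = qp_block M - qp_block N"
 and qq_block_diff: "qq_block (M - N) = qq_block M - qq_block N"
 by(simp_all add: pp_block_def pq_block_def qp_block_def qq_block_def vec_eq_iff)

lemma sum_sum_type: "(\<Sum>a\<in>(UNIV :: ('n::finite + 'n) set). F a) = (SU i. F (Inl i)) + (SU i. F (Inr i))"
 by(simp add: UNIV_Plus_UNIV[symmetric] sum.Plus del: UNIV_Plus_UNIV)

lemma pp_block_mult: "pp_block (M ** N) = pp_block M ** pp_block N + pq_block M ** qp_block N"
 and pq_block_mult: "pq_block (M ** N) = pp_block M ** pq_block N + pq_block M ** qq_block N"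
 and qp_block_mult: "qp_block (M ** N) = qp_block M ** pp_block N + qq_block M ** qp_block N"
 and qq_block_mult: "qq_block (M ** N) = qp_block M ** pq_block N + qq_block M ** qq_block N"
 by(simp_all add: pp_block_def pq_block_def qp_block_def qq_block_def vec_eq_iff matrix_matrix_mult_def sum_sum_type)

lemma low_blocks [simp]: "pp_block (low C) = 0" "pq_block (low C) = 0" "qp_block (low C) = C" "qq_block (low C) = 0"
 by(simp_all add: pp_block_def pq_block_def qp_block_def qq_block_def low_def vec_eq_iff)

lemma qp_block_par:
 assumes "\<forall>y\<in>Lp. M *v y \<in> Lp"
 shows "qp_block M = 0"
 using assms pE_Lp by(fastforce simp: vec_eq_iff qp_block_nth Lp_iff)

lemma gact_zero:
 assumes R: "gl_module R" and w: "w \<in> gspace R"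
 shows "gact R 0 w = 0"
proof -
 have "gact R (mscale 0 0) w = gscale R 0 (gact R 0 w)" by(rule gl_moduleD(7)[OF R w])
 then show ?thesis by(simp add: gscale_zero[OF R])
qed

lemma gact_zero_right: "gl_module R ==> gact R A 0 = 0"
 using gl_moduleD(5)[of R 0 A 0] gl_module_closed(1)[of R] gscale_zero[of R] by metis

lemma Ev_sp_alg [simp]: "Ev M \<in> sp_alg \<longleftrightarrow> skew M" "Od y \<notin> sp_alg"
 by(auto simp: sp_alg_def sdot_UNIV_iff)

lemma Ev_osp_alg [simp]: "Ev M \<in> osp_alg \<longleftrightarrow> skew M" "Od y \<in> osp_alg"
 by(auto simp: osp_alg_def)

lemma Ev_sp_par: "Ev M \<in> sp_par \<longleftrightarrow> skew M & (\<forall>y\<in>Lp. M *v y \<in> Lp)" "Od y \<notin> sp_par"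
 by(auto simp: sp_par_def sdot_Lp_iff)

lemma Ev_osp_par: "Ev M \<in> osp_par \<longleftrightarrow> skew M & (\<forall>y\<in>Lp. M *v y \<in> Lp)" "Od y \<in> osp_par \<longleftrightarrow> y \<in> Lp"
 by(auto simp: osp_par_def Ev_sp_par)

lemma Lp_diff: "y \<in> Lp ==> z \<in> Lp ==> y - z \<in> Lp"
 by(simp add: Lp_iff)

lemma Lp_isotropic: "y \<in> Lp ==> z \<in> Lp ==> omega y z = 0"
 by(simp add: Lp_iff omega_def)

lemma osp_par_bracket:
 assumes X: "X \<in> osp_par" and Y: "Y \<in> osp_par"
 shows "bracket X Y \<in> osp_par"
proof (cases X; cases Y)
 fix M N assume "X = Ev M" "Y = Ev N"
 then show ?thesis using X Y
  by(simp add: Ev_osp_par skew_bracket matrix_vector_minus matrix_vector_mul_assoc[symmetric] Lp_diff)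
next
 fix y z assume "X = Od y" "Y = Od z"
 then show ?thesis using X Y
  by(simp add: Ev_osp_par skew_quad quad_vec Lp_isotropic, simp add: Lp_iff)
qed (use X Y in \<open>auto simp: Ev_osp_par\<close>, simp_all add: Lp_iff)

lemma osp_par_act_closed: "gl_module R ==> w \<in> gspace R ==> par_act R X w \<in> gspace R"
 by(cases X) (simp_all add: gl_moduleD gl_module_closed)

lemma osp_par_act_bracket:
 assumes R: "gl_module R" and X: "X \<in> osp_par" and Y: "Y \<in> osp_par" and w: "w \<in> gspace R"
 shows "par_act R (bracket X Y) w = par_act R X (par_act R Y w) - gscale R (ksign X Y) (par_act R Y (par_act R X w))"
proof -
 interpret vs: vector_space "gscale R" by(rule gl_moduleD(1)[OF R])
 show ?thesis
 proof (cases X; cases Y)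
  fix M N assume XY: "X = Ev M" "Y = Ev N"
  then have "qp_block M = 0" "qp_block N = 0" using X Y by(auto simp: Ev_osp_par intro!: qp_block_par)
  then have "pp_block (M ** N - N ** M) = pp_block M ** pp_block N - pp_block N ** pp_block M"
   by(simp add: pp_block_diff pp_block_mult)
  then show ?thesis by(simp add: XY ksign_def gl_moduleD(8)[OF R w])
 next
  fix y z assume XY: "X = Od y" "Y = Od z"
  then have yz: "y \<in> Lp" "z \<in> Lp" using X Y by(auto simp: Ev_osp_par)
  have "pp_block (quad y z) $ i $ j = 0" for i j
   using yz by(simp add: pp_block_def quad_def omega_pE Lp_iff)
  then have "pp_block (quad y z) = 0" by(simp add: vec_eq_iff)
  then show ?thesis by(simp add: XY gact_zero[OF R w])
 qed (simp_all add: ksign_def gact_zero_right[OF R])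
qed

lemma osp_decomposition:
 assumes "X \<in> osp_alg"
 shows "(\<exists>C M. C \<in> symm & Ev M \<in> osp_par & X = oadd (Ev (low C)) (Ev M)) \<or>
  (\<exists>y z. (\<forall>i. y $ Inl i = 0) & z \<in> Lp & X = oadd (Od y) (Od z))"
proof (cases X)
 case (Ev M)
 then have M: "skew M" using assms by simp
 show ?thesis
  using even_decomposition[OF M] qp_block_symm[OF M] Ev
  by(intro disjI1 exI[of _ "qp_block M"] exI[of _ "M - low (qp_block M)"]) (simp add: Ev_osp_par sdot_Lp_iff)
next
 case (Od x)
 have "x = (\<chi> a. case a of Inl i => 0 | Inr i => x $ Inr i) + (\<chi> a. case a of Inl i => x $ Inl i | Inr i => 0)"
  by(simp add: vec_eq_iff split: sum.split)
 then show ?thesis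
  unfolding Od by(intro disjI2 exI[of _ "\<chi> a. case a of Inl i => 0 | Inr i => x $ Inr i"]
   exI[of _ "\<chi> a. case a of Inl i => x $ Inl i | Inr i => 0"]) (simp add: Lp_iff)
qed

section \<open>The even part of the action\<close>

lemma frame_h_nth: "frame_h M S $ i $ k = pp_block M $ i $ k + (SU j. pq_block M $ i $ j * S $ j $ k)"
 by(simp add: frame_h_def matrix_matrix_mult_def)

lemma frame_delta_nth: "frame_delta M S $ i $ k = qp_block M $ i $ k + (SU j. qq_block M $ i $ j * S $ j $ k)
 - (SU j. S $ i $ j * frame_h M S $ j $ k)"
 by(simp add: frame_delta_def matrix_matrix_mult_def)

lemma frame_add: "frame_h (M + N) S = frame_h M S + frame_h N S" "frame_delta (M + N) S = frame_delta M S + frame_delta N S"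
 by(simp_all add: vec_eq_iff frame_h_nth frame_delta_nth pp_block_add pq_block_add qp_block_add qq_block_add
   sum.distrib algebra_simps)

lemma frame_mscale: "frame_h (mscale c M) S = mscale c (frame_h M S)" "frame_delta (mscale c M) S = mscale c (frame_delta M S)"
 by(simp_all add: vec_eq_iff frame_h_nth frame_delta_nth pp_block_mscale pq_block_mscale qp_block_mscale qq_block_mscale
   sum_distrib_left algebra_simps)

lemma frame_low [simp]: "frame_h (low C) S = 0" "frame_delta (low C) S = C"
 by(simp_all add: vec_eq_iff frame_h_nth frame_delta_nth)

text \<open>Skewness brings the expression into the Riccati form
  \<open>C - A^t S - S A - S B S\<close> with \<open>A\<close> the \<open>pp\<close>-block and
  symmetric \<open>B\<close> and \<open>C\<close>, so the vector field is tangent to the symmetric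
  matrices.\<close>

lemma frame_delta_symm:
 assumes M: "skew M" and S: "S \<in> symm"
 shows "frame_delta M S \<in> symm"
proof -
 have tB: "transpose (pq_block M) = pq_block M" and tC: "transpose (qp_block M) = qp_block M"
  using skew_blocks(1,2)[OF M] by(auto simp: vec_eq_iff transpose_def)
 have tD: "transpose (qq_block M) = - pp_block M" and D: "qq_block M = - transpose (pp_block M)"
  using skew_blocks(3)[OF M] by(auto simp: vec_eq_iff transpose_def)
 have tS: "transpose S = S" using S by(simp add: symm_def)
 have neg: "X ** (- Y) = - (X ** Y)" "(- X) ** Y = - (X ** Y)" for X Y :: "'a mat"
  by(simp_all add: vec_eq_iff matrix_matrix_mult_def sum_negf)
 have tr: "transpose (X + Y) = transpose X + transpose Y" "transpose (X - Y) = transpose X - transpose Y"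
   "transpose (- X) = - transpose X" for X Y :: "'a mat"
  by(simp_all add: vec_eq_iff transpose_def)
 have "frame_delta M S = qp_block M - transpose (pp_block M) ** S - S ** pp_block M - S ** pq_block M ** S"
  by(simp add: frame_delta_def frame_h_def matrix_add_ldistrib D neg matrix_mul_assoc algebra_simps)
 then show ?thesis
  unfolding symm_def by(simp add: tr matrix_transpose_mul tS tB tC matrix_mul_assoc)
qed

lemma holo_on_frame_h: "holo_on U (\<lambda>S. frame_h M S $ i $ k)"
 unfolding frame_h_nth by(intro holo_on_add holo_on_const holo_on_sum holo_on_mult holo_on_nth)

lemma holo_on_frame_delta: "holo_on U (\<lambda>S. frame_delta M S $ i $ k)"
 unfolding frame_delta_nth
 by(intro holo_on_add holo_on_diff holo_on_const holo_on_sum holo_on_mult holo_on_nth holo_on_frame_h)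

lemma ddir_frame_h: "C \<in> symm ==> S \<in> symm ==> ddir C (\<lambda>S. frame_h M S $ i $ k) S = (pq_block M ** C) $ i $ k"
 unfolding frame_h_nth
 by(simp add: ddir_add[OF symm_opens] ddir_const ddir_sum[OF symm_opens] ddir_cmult[OF symm_opens] ddir_nth
   holo_on_const holo_on_sum holo_on_cmult holo_on_nth matrix_matrix_mult_def)

lemma ddir_frame_delta: "C \<in> symm ==> S \<in> symm ==> ddir C (\<lambda>S. frame_delta M S $ i $ k) S =
  (qq_block M ** C - C ** frame_h M S - S ** (pq_block M ** C)) $ i $ k"
 unfolding frame_delta_nth
 by(simp add: ddir_add[OF symm_opens] ddir_diff[OF symm_opens] ddir_const ddir_sum[OF symm_opens] ddir_cmult[OF symm_opens]
   ddir_mult[OF symm_opens] ddir_nth ddir_frame_h holo_on_frame_h holo_on_mult holo_on_add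
   holo_on_const holo_on_sum holo_on_cmult holo_on_nth matrix_matrix_mult_def sum.distrib)

lemma frame_h_bracket_low: "frame_h (low C ** M - M ** low C) S = - (pq_block M ** C)"
 by(simp add: frame_h_def pp_block_diff pq_block_diff pp_block_mult pq_block_mult)

lemma frame_delta_bracket_low:
 "frame_delta (low C ** M - M ** low C) S = - (qq_block M ** C - C ** frame_h M S - S ** (pq_block M ** C))"
proof -
 have neg: "X ** (- Y) = - (X ** Y)" for X Y :: "'a mat"
  by(simp add: vec_eq_iff matrix_matrix_mult_def sum_negf)
 show ?thesis
  unfolding frame_delta_def frame_h_bracket_low
  by(simp add: qp_block_diff qq_block_diff qp_block_mult qq_block_mult frame_h_def matrix_add_ldistrib matrix_mul_assoc neg)
qed

lemma skew_bracket_low: "C \<in> symm ==> skew M ==> skew (low C ** M - M ** low C)"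
 by(rule skew_bracket[OF skew_low])

lemma section_sum:
 assumes R: "gl_module R" and f: "f \<in> sections R U" and S: "S \<in> U" and w: "!!a. a \<in> A ==> w a \<in> gspace R"
 shows "f i S (sum w A) = (\<Sum>a\<in>A. f i S (w a)) & sum w A \<in> gspace R"
 using w
proof (induction A rule: infinite_finite_induct)
 case (insert x F)
 then show ?case using sectionsD(3)[OF f S] gl_module_closed(2)[OF R] by simp
qed (use sections_diff[OF R f S gl_module_closed(1)[OF R] gl_module_closed(1)[OF R], of i] gl_module_closed(1)[OF R] in simp_all)

lemma gact_sum:
 assumes R: "gl_module R" and w: "w \<in> gspace R"
 shows "gact R (sum A I) w = (\<Sum>a\<in>I. gact R (A a) w)"
 by(induction I rule: infinite_finite_induct) (simp_all add: gl_moduleD(6)[OF R w] gact_zero[OF R w])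

lemma mat_unit_expand: "A = (SU j k. mscale (A $ j $ k) (mat_unit j k))"
proof -
 have "(SU j k. A $ j $ k * (if j = a & k = b then 1 else 0)) = A $ a $ b" for a b
 proof -
  have "(SU j k. A $ j $ k * (if j = a & k = b then 1 else 0)) = (SU j. if j = a then A $ j $ b else 0)"
   by(rule sum.cong) (auto simp: if_distrib cong: if_cong)
  then show ?thesis by simp
 qed
 then show ?thesis by(simp add: vec_eq_iff mat_unit_nth)
qed

lemma section_gact:
 assumes R: "gl_module R" and f: "f \<in> sections R U" and S: "S \<in> U" and w: "w \<in> gspace R"
 shows "f i S (gact R A w) = (SU j k. A $ j $ k * f i S (gact R (mat_unit j k) w))"
proof -
 note sc = gl_module_closed(3)[OF R gl_moduleD(3)[OF R w]]
 note ss = section_sum[OF R f S, THEN conjunct1] section_sum[OF R f S, THEN conjunct2]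
 have "gact R A w = (SU j k. gscale R (A $ j $ k) (gact R (mat_unit j k) w))"
  by(subst mat_unit_expand[of A]) (simp add: gact_sum[OF R w] gl_moduleD(7)[OF R w])
 then show ?thesis
  by(simp add: ss sc sectionsD(4)[OF f S gl_moduleD(3)[OF R w]])
qed

definition pd :: "'n::finite mat => ('i, 'n, 'w) sect => ('i, 'n, 'w) sect" where
 "pd B f = (\<lambda>i S w. ddir B (sl f i w) S)"

text \<open>The part of the even action that treats each component separately. It is the whole
  action in the classical situation and a summand of it in the super one.\<close>

definition even_act :: "('n::finite, 'w) glmod => 'n symp_mat => ('i, 'n, 'w) sect => ('i, 'n, 'w) sect" where
 "even_act R M f = (\<lambda>i S w. - ddir (frame_delta M S) (sl f i w) S - f i S (gact R (frame_h M S) w))"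

definition hol :: "('n::finite, 'w) glmod => 'n mat set => ('i, 'n, 'w) sect => bool" where
 "hol R U f \<longleftrightarrow> (\<forall>i. \<forall>w\<in>gspace R. holo_on U (sl f i w))"

lemma holD: "hol R U f ==> w \<in> gspace R ==> holo_on U (sl f i w)"
 by(simp add: hol_def)

lemma sections_hol: "f \<in> sections R U ==> hol R U f"
 by(simp add: hol_def sectionsD(5))

context
 fixes R :: "('n::finite, 'w::ab_group_add) glmod" and U :: "'n mat set"
 assumes R: "gl_module R" and U: "U \<in> osym"
begin

lemma gspace_unit [simp]: "w \<in> gspace R ==> gact R A w \<in> gspace R"
 by(rule gl_moduleD(3)[OF R])

lemma U_symm: "S \<in> U ==> S \<in> symm"
 using opens_symm[OF U] by blast

lemma hol_pd: "hol R U f ==> B \<in> symm ==> hol R U (pd B f)"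
 unfolding hol_def pd_def by(blast intro: holo_on_ddir[OF _ U])

text \<open>Here the coefficients are scalar functions of \<open>S\<close>, so holomorphy and the
  product rule can be applied term by term.\<close>

lemma even_act_expand:
 assumes f: "f \<in> sections R U" and S: "S \<in> U" and w: "w \<in> gspace R" and M: "skew M"
 shows "even_act R M f i S w = - (SU v. frame_delta M S $ fst v $ snd v * pd (Esym v) f i S w)
  - (SU j k. frame_h M S $ j $ k * f i S (gact R (mat_unit j k) w))"
proof -
 have "ddir (frame_delta M S) (sl f i w) S = (SU v. frame_delta M S $ fst v $ snd v * pd (Esym v) f i S w)"
  using ddir_expand[OF sectionsD(5)[OF f w] U S frame_delta_symm[OF M U_symm[OF S]]] by(simp add: cf_def pd_def)
 then show ?thesis unfolding even_act_def by(simp only: section_gact[OF R f S w, symmetric])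
qed

lemma pd_sections: "f \<in> sections R U ==> B \<in> symm ==> restr R U (pd B f) \<in> sections R U"
 using dB_sections[OF R U, of B f] by(simp add: dB_def pd_def)

lemma pd_restr: "S \<in> U ==> w \<in> gspace R ==> B \<in> symm ==> pd B (restr R U f) i S w = pd B f i S w"
 unfolding pd_def by(rule ddir_cong[OF U]) (auto simp: restr_apply)

lemma even_act_sections:
 assumes f: "f \<in> sections R U" and M: "skew M"
 shows "restr R U (even_act R M f) \<in> sections R U"
proof (rule restr_in_sections[OF R U])
 fix i S w w' assume S: "S \<in> U" and w: "w \<in> gspace R" "w' \<in> gspace R"
 note d = frame_delta_symm[OF M U_symm[OF S]]
 have "ddir (frame_delta M S) (sl f i (w + w')) S = ddir (frame_delta M S) (\<lambda>S. f i S w + f i S w') S"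
  by(rule ddir_cong[OF U S d]) (rule sectionsD(3)[OF f _ w])
 then show "even_act R M f i S (w + w') = even_act R M f i S w + even_act R M f i S w'"
  using S w by(simp add: even_act_def ddir_add[OF U S d sectionsD(5)[OF f w(1)] sectionsD(5)[OF f w(2)]]
    gl_moduleD(4)[OF R] sectionsD(3)[OF f])
next
 fix i S w c assume S: "S \<in> U" and w: "w \<in> gspace R"
 note d = frame_delta_symm[OF M U_symm[OF S]]
 have "ddir (frame_delta M S) (sl f i (gscale R c w)) S = ddir (frame_delta M S) (\<lambda>S. c * f i S w) S"
  by(rule ddir_cong[OF U S d]) (rule sectionsD(4)[OF f _ w])
 then show "even_act R M f i S (gscale R c w) = c * even_act R M f i S w"
  using S w by(simp add: even_act_def ddir_cmult[OF U S d sectionsD(5)[OF f w]] gl_moduleD(5)[OF R] sectionsD(4)[OF f] algebra_simps)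
next
 fix i w assume w: "w \<in> gspace R"
 have "holo_on U (\<lambda>S. - (SU v. frame_delta M S $ fst v $ snd v * pd (Esym v) f i S w)
  - (SU j k. frame_h M S $ j $ k * f i S (gact R (mat_unit j k) w)))"
  using w by(intro holo_on_diff holo_on_uminus holo_on_sum holo_on_mult holo_on_frame_h holo_on_frame_delta
    holD[OF hol_pd[OF sections_hol[OF f]]] sectionsD(5)[OF f]) auto
 from holo_on_cong[OF U _ this] show "holo_on U (sl (even_act R M f) i w)"
  by(simp add: even_act_expand[OF f _ w M])
qed

lemma even_act_local:
 assumes "!!i S w. S \<in> U ==> w \<in> gspace R ==> f i S w = g i S w" "skew M" "S \<in> U" "w \<in> gspace R"
 shows "even_act R M f i S w = even_act R M g i S w"
 unfolding even_act_def
 using ddir_cong[OF U assms(3) frame_delta_symm[OF assms(2) U_symm[OF assms(3)]], of "\<lambda>S. f i S w" "\<lambda>S. g i S w"] assms by simp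

text \<open>Translation by \<open>C\<close> has constant coefficients, so the commutator only
  differentiates the coefficients \<open>frame_h\<close> and \<open>frame_delta\<close>. Their
  derivatives are, up to sign, the corresponding coefficients of the bracket.\<close>

lemma even_act_low:
 assumes C: "C \<in> symm" and M: "skew M" and f: "f \<in> sections R U" and S: "S \<in> U" and w: "w \<in> gspace R"
 shows "pd C (even_act R M f) i S w
  = even_act R M (restr R U (pd C f)) i S w - even_act R (low C ** M - M ** low C) f i S w"
proof -
 let ?N = "low C ** M - M ** low C"
 note h = sectionsD(5)[OF f] holD[OF hol_pd[OF sections_hol[OF f]]] holo_on_frame_h holo_on_frame_delta
 have "pd C (even_act R M f) i S w = ddir C (\<lambda>S. - (SU v. frame_delta M S $ fst v $ snd v * pd (Esym v) f i S w)
  - (SU j k. frame_h M S $ j $ k * f i S (gact R (mat_unit j k) w))) S"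
  unfolding pd_def[of C] by(rule ddir_cong[OF U S C]) (rule even_act_expand[OF f _ w M])
 also have "... = - (SU v. frame_delta M S $ fst v $ snd v * ddir C (sl (pd (Esym v) f) i w) S
    - frame_delta ?N S $ fst v $ snd v * pd (Esym v) f i S w)
  - (SU j k. frame_h M S $ j $ k * ddir C (\<lambda>S. f i S (gact R (mat_unit j k) w)) S
    - frame_h ?N S $ j $ k * f i S (gact R (mat_unit j k) w))"
  using w by(simp add: ddir_diff[OF U S C] ddir_uminus[OF U S C] ddir_sum[OF U S C] ddir_mult[OF U S C] h
    holo_on_uminus holo_on_sum holo_on_mult ddir_frame_h[OF C U_symm[OF S]] ddir_frame_delta[OF C U_symm[OF S]] frame_h_bracket_low frame_delta_bracket_low)
   (simp add: algebra_simps)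
 also have "... = (- (SU v. frame_delta M S $ fst v $ snd v * pd (Esym v) (restr R U (pd C f)) i S w)
   - (SU j k. frame_h M S $ j $ k * restr R U (pd C f) i S (gact R (mat_unit j k) w)))
  - (- (SU v. frame_delta ?N S $ fst v $ snd v * pd (Esym v) f i S w)
   - (SU j k. frame_h ?N S $ j $ k * f i S (gact R (mat_unit j k) w)))"
 proof -
  have "ddir C (sl (pd (Esym v) f) i w) S = pd (Esym v) (restr R U (pd C f)) i S w" for v
   unfolding pd_restr[OF S w Esym_symm] unfolding pd_def
   by(rule ddir_commute[OF sectionsD(5)[OF f w] U S C Esym_symm])
  moreover have "ddir C (sl f i (gact R A w)) S = restr R U (pd C f) i S (gact R A w)" for A
   using S w by(simp add: restr_apply pd_def)
  ultimately show ?thesis by(simp add: sum_subtractf)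
 qed
 also have "... = even_act R M (restr R U (pd C f)) i S w - even_act R ?N f i S w"
  unfolding even_act_expand[OF f S w skew_bracket_low[OF C M]] even_act_expand[OF pd_sections[OF f C] S w M] ..
 finally show ?thesis .
qed

lemma even_act_lin:
 assumes M: "skew M" and f: "f \<in> sections R U" and g: "g \<in> sections R U" and S: "S \<in> U" and w: "w \<in> gspace R"
 shows "even_act R M (lc a f b g) i S w = a * even_act R M f i S w + b * even_act R M g i S w"
 using w by(simp add: even_act_def ddir_add[OF U S] ddir_cmult[OF U S] frame_delta_symm[OF M U_symm[OF S]] S sectionsD[OF f] sectionsD[OF g] holo_on_cmult sectionsD(5)[OF f] sectionsD(5)[OF g]
   algebra_simps)

lemma even_act_add:
 assumes M: "skew M" "skew N" and f: "f \<in> sections R U" and S: "S \<in> U" and w: "w \<in> gspace R"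
 shows "even_act R (M + N) f i S w = even_act R M f i S w + even_act R N f i S w"
 using sectionsD(3)[OF f S gspace_unit[OF w] gspace_unit[OF w]] w S
 by(simp add: even_act_def frame_add gl_moduleD(6)[OF R]
   holo_on_ddir_add[OF sectionsD(5)[OF f w] U S frame_delta_symm[OF M(1) U_symm[OF S]] frame_delta_symm[OF M(2) U_symm[OF S]]])

lemma even_act_mscale:
 assumes M: "skew M" and f: "f \<in> sections R U" and S: "S \<in> U" and w: "w \<in> gspace R"
 shows "even_act R (mscale c M) f i S w = c * even_act R M f i S w"
 using sectionsD(4)[OF f S gspace_unit[OF w]] w S
 by(simp add: even_act_def frame_mscale gl_moduleD(7)[OF R] algebra_simps
   holo_on_ddir_mscale[OF sectionsD(5)[OF f w] U S frame_delta_symm[OF M U_symm[OF S]]])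

lemma section_zero: "f \<in> sections R U ==> S \<in> U ==> f i S 0 = 0"
 using sections_diff[OF R _ _ gl_module_closed(1)[OF R] gl_module_closed(1)[OF R], of f U S i] by simp

lemma even_act_low_eq:
 assumes "f \<in> sections R U" "S \<in> U" "w \<in> gspace R"
 shows "even_act R (low B) f i S w = - pd B f i S w"
 using section_zero[OF assms(1,2)] by(simp add: even_act_def pd_def gact_zero[OF R assms(3)])

lemma even_act_par:
 assumes M: "\<forall>y\<in>Lp. M *v y \<in> Lp" and f: "f \<in> sections R U" and 0: "0 \<in> U" and w: "w \<in> gspace R"
 shows "even_act R M f i 0 w = - f i 0 (gact R (pp_block M) w)"
proof -
 have "frame_delta M 0 = 0" "frame_h M 0 = pp_block M"
  by(simp_all add: frame_delta_def frame_h_def qp_block_par[OF M])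
 moreover have "ddir 0 (sl f i w) 0 = 0" by(simp add: ddir_def)
 ultimately show ?thesis by(simp add: even_act_def)
qed

end

lemma tw_tspan: "w \<in> gspace R ==> lowp l (tw (\<tau> i) w) \<in> tspan G P R \<tau>"
 unfolding tspan_def by(rule fs.span_base) blast

lemma low_zero [simp]: "low 0 = 0"
 by(simp add: low_def vec_eq_iff split: sum.split)

lemma low_sum: "low (\<Sum>a\<in>A. mscale (c a) (B a)) = (\<Sum>a\<in>A. mscale (c a) (low (B a)))"
proof -
 have "low (X + mscale r Y) = low X + mscale r (low Y)" for X Y :: "'a mat" and r
  by(simp add: low_def vec_eq_iff split: sum.split)
 then have 1: "low (mscale r Y + X) = mscale r (low Y) + low X" for X Y :: "'a mat" and r
  by(simp add: add.commute)
 show ?thesis by(induction A rule: infinite_finite_induct) (simp_all add: 1)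
qed

lemma prep_low_null:
 assumes G: "!!B. B \<in> symm ==> Ev (low B) \<in> G" and B: "!!a. a \<in> A ==> B a \<in> symm" and A: "finite A"
  and y: "y \<in> ind_space G R"
 shows "prep [Ev (low (\<Sum>a\<in>A. mscale (c a) (B a)))] y - (\<Sum>a\<in>A. fscale (c a) (prep [Ev (low (B a))] y)) \<in> ind_null G P R"
  (is "?d y \<in> _")
proof (rule lin_ind_space[OF subspace_null _ _ _ y])
 fix u w assume u: "u \<in> lists G" and w: "w \<in> gspace R"
 show "?d (word u w) \<in> ind_null G P R"
  using A B
 proof (induction A rule: finite_induct)
  case empty
  have "Ev (0 :: 'a symp_mat) \<in> G" using G[of 0] by simp
  then show ?case using rel_Ev_zero[OF u _ w, of 0 P] by simp
 next
  case (insert x F)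
  let ?S = "\<Sum>a\<in>F. mscale (c a) (B a)"
  have "?S \<in> symm" by(rule symm_sum) (use insert in simp)
  then have "word ([] @ [Ev (mscale (c x) (low (B x)) + mscale 1 (low ?S))] @ u) w
    - fscale (c x) (word ([] @ [Ev (low (B x))] @ u) w) - fscale 1 (word ([] @ [Ev (low ?S)] @ u) w) \<in> ind_null G P R"
   by(intro rel_ev u w) (use G insert in simp_all)
  moreover have "low (\<Sum>a\<in>insert x F. mscale (c a) (B a)) = mscale (c x) (low (B x)) + mscale 1 (low ?S)"
   using insert(1,2) low_sum[of c B "insert x F"] low_sum[of c B F] by simp
  ultimately have 1: "word (Ev (low (\<Sum>a\<in>insert x F. mscale (c a) (B a))) # u) w
    - fscale (c x) (word (Ev (low (B x)) # u) w) - word (Ev (low ?S) # u) w \<in> ind_null G P R"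
   by(simp add: fs.scale_one)
  have 2: "word (Ev (low ?S) # u) w - (\<Sum>a\<in>F. fscale (c a) (word (Ev (low (B a)) # u) w)) \<in> ind_null G P R"
   using insert by simp
  from fs.subspace_add[OF subspace_null 1 2] show ?case
   using insert(1,2) by(simp add: algebra_simps)
 qed
qed (simp_all add: prep_add prep_fscale fs.scale_right_distrib fs.scale_right_diff_distrib fs.scale_sum_right sum.distrib mult.commute)

text \<open>The span absorbs a letter \<open>lowE v\<close> by construction, and a general lower
  matrix is a combination of these modulo relations.\<close>

lemma prep_low_tspan:
 assumes R: "gl_module R" and G: "!!B. B \<in> symm ==> Ev (low B) \<in> G" and \<tau>: "!!i. keys (\<tau> i) <= lists G"
  and C: "C \<in> symm" and x: "x \<in> tspan G P R \<tau>"
 shows "prep [Ev (low C)] x \<in> tspan G P R \<tau>"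
proof -
 have N: "ind_null G P R <= tspan G P R \<tau>" using null_tspan by blast
 have lw: "lowE v \<in> G" for v unfolding lowE_def by(rule G) simp
 have "tspan G P R \<tau> <= {x. prep [Ev (low C)] x \<in> tspan G P R \<tau>}"
 proof (subst (1) tspan_def, rule fs.span_minimal)
  show "fs.subspace {x. prep [Ev (low C)] x \<in> tspan G P R \<tau>}"
   by(rule prep_preimage_subspace[OF subspace_tspan])
  show "ind_null G P R \<union> {lowp l (tw (\<tau> i) w) |l i w. w \<in> gspace R} <= {x. prep [Ev (low C)] x \<in> tspan G P R \<tau>}"
  proof (rule Un_least; rule subsetI; rule CollectI)
   show "prep [Ev (low C)] y \<in> tspan G P R \<tau>" if "y \<in> ind_null G P R" for y
    using N prep_null[OF _ that, of "[Ev (low C)]"] G[OF C] by auto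
  next
   fix y assume "y \<in> {lowp l (tw (\<tau> i) w) |l i w. w \<in> gspace R}"
   then obtain l i w where y: "y = lowp l (tw (\<tau> i) w)" and w: "w \<in> gspace R" by blast
   have ty: "tw (\<tau> i) w \<in> ind_space G R"
    unfolding tw_def by(rule push_in_subspace[OF ind_space_subspace]) (use \<tau> w in \<open>blast intro: word_ind_space\<close>)
   have ys: "y \<in> ind_space G R" unfolding y by(rule prep_ind_space[OF _ ty]) (use lw in auto)
   have "(SU v. fscale (cf C v) (prep [Ev (low (Esym v))] y)) \<in> tspan G P R \<tau>"
   proof (intro fs.subspace_sum[OF subspace_tspan] fs.subspace_scale[OF subspace_tspan])
    show "prep [Ev (low (Esym v))] y \<in> tspan G P R \<tau>" for v
     using tw_tspan[OF w, of "v # l" \<tau> i G P] by(simp add: y prep_prep lowE_def)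
   qed
   moreover have "prep [Ev (low (SU v. mscale (cf C v) (Esym v)))] y
     - (SU v. fscale (cf C v) (prep [Ev (low (Esym v))] y)) \<in> ind_null G P R"
    by(rule prep_low_null[OF G _ _ ys]) simp_all
   ultimately have "prep [Ev (low (SU v. mscale (cf C v) (Esym v)))] y \<in> tspan G P R \<tau>"
    by(simp only: null_subst[OF _ subspace_tspan N])
   then show "prep [Ev (low C)] y \<in> tspan G P R \<tau>" by(simp only: symm_expand[OF C, symmetric])
  qed
 qed
 then show ?thesis using x by blast
qed

section \<open>The classical situation\<close>

lemma act_classical_Ev: "sact classical R (Ev M) f = even_act R M f"
 by(simp add: classical_def even_act_def)

lemma classical_simps [simp]: "alg classical = sp_alg" "par classical = sp_par" "body classical = ()"
 by(simp_all add: classical_def)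

lemma sp_algE: "X \<in> sp_alg ==> (!!M. X = Ev M ==> skew M ==> P) ==> P"
 by(cases X) auto

text \<open>The opposite nilradical is purely even and sections have one component, so the empty
  word reads it off.\<close>

lemma dual_setting_classical:
 "dual_setting (classical :: (unit, 'n::finite, 'w::ab_group_add) setting) (Ev ` low ` symm) (\<lambda>_. single [] 1)"
proof
 let ?s = "classical :: (unit, 'n, 'w) setting"
 show "Ev ` low ` symm <= alg ?s" using skew_low by auto
 show "par ?s <= alg ?s"
 proof
  fix X :: "'n osp" assume "X \<in> par classical" then show "X \<in> alg classical" by(cases X) (auto simp: Ev_sp_par)
 qed
 show "bracket X Y \<in> alg classical" if "X \<in> alg classical" "Y \<in> alg classical" for X Y :: "'n osp"
  using that by(auto elim!: sp_algE intro: skew_bracket)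
 show "oadd X Y \<in> alg classical" if "X \<in> alg classical" "Y \<in> alg classical" for X Y :: "'n osp"
  using that ms.subspace_add[OF subspace_skew] by(auto elim!: sp_algE)
 show "oscale c X \<in> alg classical" if "X \<in> alg classical" for X :: "'n osp" and c
  using that ms.subspace_scale[OF subspace_skew] by(auto elim!: sp_algE)
 show "\<exists>Y\<in>Ev ` low ` symm. \<exists>Z\<in>par classical. is_odd Y = is_odd Z & X = oadd Y Z" if X: "X \<in> alg classical" for X :: "'n osp"
 proof -
  obtain M where M: "X = Ev M" "skew M" using X by(auto elim!: sp_algE)
  show ?thesis
   using even_decomposition[OF M(2)] qp_block_symm[OF M(2)] M
   by(intro bexI[of _ "Ev (low (qp_block M))"] bexI[of _ "Ev (M - low (qp_block M))"]) (simp_all add: Ev_sp_par sdot_Lp_iff)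
 qed
 show "bracket X (bracket Y Z) = oadd (bracket (bracket X Y) Z) (oscale (ksign X Y) (bracket Y (bracket X Z)))"
  if "X \<in> alg classical" "Y \<in> alg classical" "Z \<in> alg classical" for X Y Z :: "'n osp"
  by(rule bracket_jacobi) (use that in auto)
 have sub: "sp_par <= osp_par" by(auto simp: osp_par_def)
 show "bracket X Y \<in> par classical" if "X \<in> par classical" "Y \<in> par classical" for X Y :: "'n osp"
 proof -
  have "bracket X Y \<in> osp_par" using that sub osp_par_bracket[of X Y] by auto
  then show ?thesis using that by(cases X; cases Y) (auto simp: Ev_sp_par Ev_osp_par)
 qed
 show "par_act R X w \<in> gspace R" if "gl_module R" "w \<in> gspace R" for R :: "('n, 'w) glmod" and X w
  by(rule osp_par_act_closed[OF that])
 show "par_act R (bracket X Y) w = par_act R X (par_act R Y w) - gscale R (ksign X Y) (par_act R Y (par_act R X w))"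
  if "gl_module R" "X \<in> par classical" "Y \<in> par classical" "w \<in> gspace R" for R :: "('n, 'w) glmod" and X Y w
  using osp_par_act_bracket[OF that(1) _ _ that(4), of X Y] that sub by auto
 fix R :: "('n, 'w) glmod" and U :: "'n mat set" and f :: "(unit, 'n, 'w) sect"
 assume R: "gl_module R" and U: "U \<in> osym"
 show "restr R U (sact classical R X f) \<in> sections R U" if "X \<in> alg classical" "f \<in> sections R U" for X
  using that by(auto simp: act_classical_Ev intro: even_act_sections[OF R U] elim!: sp_algE)
 show "sact classical R X f i S w = sact classical R X g i S w"
  if "X \<in> alg classical" "!!i S w. S \<in> U ==> w \<in> gspace R ==> f i S w = g i S w" "S \<in> U" "w \<in> gspace R" for X i S w g
  using that(1) by(auto simp: act_classical_Ev elim!: sp_algE intro: even_act_local[OF R U that(2) _ that(3,4)])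
 assume f: "f \<in> sections R U"
 show "sact classical R X (lc a f b g) i S w = a * sact classical R X f i S w + b * sact classical R X g i S w"
  if "X \<in> alg classical" "g \<in> sections R U" "S \<in> U" "w \<in> gspace R" for X i S w g a b
 proof -
  obtain M where M: "X = Ev M" "skew M" using \<open>X \<in> alg classical\<close> by(auto elim!: sp_algE)
  show ?thesis unfolding M(1) act_classical_Ev by(rule even_act_lin[OF R U M(2) f that(2-4)])
 qed
 show "sact classical R (oadd X Y) f i S w = sact classical R X f i S w + sact classical R Y f i S w"
  if "X \<in> alg classical" "Y \<in> alg classical" "S \<in> U" "w \<in> gspace R" for X Y i S w
  using that by(auto simp: act_classical_Ev elim!: sp_algE intro: even_act_add[OF R U _ _ f])
 show "sact classical R (oscale c X) f i S w = c * sact classical R X f i S w"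
  if "X \<in> alg classical" "S \<in> U" "w \<in> gspace R" for X i S w c
  using that by(auto simp: act_classical_Ev elim!: sp_algE intro: even_act_mscale[OF R U _ f])
 show "sact classical R (Ev (low B)) f i S w = - ddir B (sl f i w) S" if "S \<in> U" "w \<in> gspace R" for B i S w
  using even_act_low_eq[OF R U f that] by(simp add: act_classical_Ev pd_def)
 show "sact classical R X (restr R U (sact classical R Y f)) i S w
    = ksign X Y * sact classical R Y (restr R U (sact classical R X f)) i S w + sact classical R (bracket X Y) f i S w"
  if XX: "X \<in> Ev ` low ` symm" and YY: "Y \<in> alg classical" and S: "S \<in> U" and w: "w \<in> gspace R" for X Y i S w
 proof -
  obtain C where C: "C \<in> symm" "X = Ev (low C)" using XX by auto
  obtain M where M: "Y = Ev M" "skew M" using YY by(auto elim!: sp_algE)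
  have "restr R U (even_act R (low C) f) = lc 0 f (- 1) (restr R U (pd C f))"
   by(intro ext) (simp add: restr_def even_act_low_eq[OF R U f])
  then have "even_act R M (restr R U (even_act R (low C) f)) i S w = - even_act R M (restr R U (pd C f)) i S w"
   using even_act_lin[OF R U M(2) f pd_sections[OF R U f C(1)] S w, of 0 "- 1"] by simp
  moreover have "even_act R (low C) (restr R U (even_act R M f)) i S w = - pd C (even_act R M f) i S w"
   using even_act_low_eq[OF R U even_act_sections[OF R U f M(2)] S w] pd_restr[OF R U S w C(1)] by simp
  ultimately show ?thesis
   using even_act_low[OF R U C(1) M(2) f S w] by(simp add: C M act_classical_Ev ksign_def)
 qed
 show "sact classical R X f (body classical) 0 w = - f (body classical) 0 (par_act R X w)"
  if "X \<in> par classical" "0 \<in> U" "w \<in> gspace R" for X w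
  using that(1) by(cases X) (auto simp: act_classical_Ev Ev_sp_par intro: even_act_par[OF R U _ f that(2,3)])
 show "jet_pair classical R (tw (single [] 1) w) f = f i 0 w" for i w
  by(simp add: tw_def fs.scale_one)
next
 let ?s = "classical :: (unit, 'n, 'w) setting"
 show "word u w \<in> tspan (alg ?s) (par ?s) R (\<lambda>_ :: unit. single [] 1)"
  if "gl_module R" "u \<in> lists (Ev ` low ` symm)" "w \<in> gspace R" for R :: "('n, 'w) glmod" and u :: "'n osp list" and w
  using that(2)
 proof (induction u)
  case Nil
  have "lowp [] (tw (single [] 1) w) \<in> tspan sp_alg sp_par R (\<lambda>_ :: unit. single [] 1)"
   by(rule tw_tspan[OF that(3)])
  then show ?case by(simp add: tw_def fs.scale_one)
 next
  case (Cons X u)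
  then obtain C where C: "C \<in> symm" "X = Ev (low C)" by auto
  have "prep [X] (word u w) \<in> tspan sp_alg sp_par R (\<lambda>_ :: unit. single [] 1)"
   unfolding C(2) by(rule prep_low_tspan[OF that(1) _ _ C(1)]) (use Cons in \<open>auto simp: skew_low\<close>)
  then show ?case by simp
 qed
qed auto

section \<open>Clifford relations\<close>

text \<open>The operator \<open>theta\<close> at fixed \<open>S\<close> and \<open>w\<close>: the
  Clifford relations concern functions of the index set alone.\<close>

definition th :: "'n::{finite,linorder} => ('n set => complex) => 'n set => complex" where
 "th k F I = (if k \<in> I then theta_sign k I * F (I - {k}) else 0)"

definition dt :: "'n::{finite,linorder} => ('n set => complex) => 'n set => complex" where
 "dt k F I = (if k \<in> I then 0 else theta_sign k I * F (insert k I))"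

lemma theta_th: "theta k f I S w = th k (\<lambda>I. f I S w) I"
 by(simp add: theta_def th_def)

lemma dtheta_dt: "dtheta k f I S w = dt k (\<lambda>I. f I S w) I"
 by(simp add: dtheta_def dt_def)

lemma th_add: "th k (\<lambda>I. F I + G I) I = th k F I + th k G I"
 and th_diff: "th k (\<lambda>I. F I - G I) I = th k F I - th k G I"
 and th_uminus: "th k (\<lambda>I. - F I) I = - th k F I"
 and th_cmult: "th k (\<lambda>I. c * F I) I = c * th k F I"
 and th_zero: "th k (\<lambda>I. 0) I = 0"
 and th_sum: "th k (\<lambda>I. \<Sum>a\<in>A. H a I) I = (\<Sum>a\<in>A. th k (H a) I)"
 by(simp_all add: th_def algebra_simps sum_distrib_left)

lemma dt_add: "dt k (\<lambda>I. F I + G I) I = dt k F I + dt k G I"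
 and dt_diff: "dt k (\<lambda>I. F I - G I) I = dt k F I - dt k G I"
 and dt_uminus: "dt k (\<lambda>I. - F I) I = - dt k F I"
 and dt_cmult: "dt k (\<lambda>I. c * F I) I = c * dt k F I"
 and dt_zero: "dt k (\<lambda>I. 0) I = 0"
 and dt_sum: "dt k (\<lambda>I. \<Sum>a\<in>A. H a I) I = (\<Sum>a\<in>A. dt k (H a) I)"
 by(simp_all add: dt_def algebra_simps sum_distrib_left)

lemmas th_lin = th_add th_diff th_uminus th_cmult th_zero th_sum
lemmas dt_lin = dt_add dt_diff dt_uminus dt_cmult dt_zero dt_sum

lemma theta_sign_square: "theta_sign k I * theta_sign k I = 1" "theta_sign k I * (theta_sign k I * x) = x"
 by(simp_all add: theta_sign_def flip: power_add mult.assoc)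

lemma theta_sign_insert:
 assumes "i \<notin> I" "i \<noteq> j"
 shows "theta_sign j (insert i I) = (if i < j then - 1 else 1) * theta_sign j I"
proof (cases "i < j")
 case True
 then have "{a \<in> insert i I. a < j} = insert i {a \<in> I. a < j}" by auto
 then show ?thesis using True assms by(simp add: theta_sign_def)
next
 case False
 then have "{a \<in> insert i I. a < j} = {a \<in> I. a < j}" by auto
 then show ?thesis using False by(simp add: theta_sign_def)
qed

lemma theta_sign_remove:
 assumes "i \<in> I" "i \<noteq> j"
 shows "theta_sign j (I - {i}) = (if i < j then - 1 else 1) * theta_sign j I"
 using theta_sign_insert[of i "I - {i}" j] assms by(simp add: insert_absorb)

lemma theta_sign_self: "theta_sign k (insert k I) = theta_sign k I" "theta_sign k (I - {k}) = theta_sign k I"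
proof -
 have "{a \<in> insert k I. a < k} = {a \<in> I. a < k}" "{a \<in> I - {k}. a < k} = {a \<in> I. a < k}" by auto
 then show "theta_sign k (insert k I) = theta_sign k I" "theta_sign k (I - {k}) = theta_sign k I"
  by(simp_all add: theta_sign_def)
qed

lemma th_th: "th i (th j F) I = - th j (th i F) I"
proof (cases "i \<in> I & j \<in> I & i \<noteq> j")
 case True
 have e: "I - {i} - {j} = I - {j} - {i}" by blast
 consider "i < j" "\<not> j < i" "j \<noteq> i" | "j < i" "\<not> i < j" "j \<noteq> i" using True by fastforce
 then show ?thesis using True by cases (simp_all add: th_def theta_sign_remove e)
qed (auto simp: th_def)

lemma dt_dt: "dt i (dt j F) I = - dt j (dt i F) I"
proof (cases "i \<notin> I & j \<notin> I & i \<noteq> j")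
 case True
 then consider "i < j" "\<not> j < i" "j \<noteq> i" | "j < i" "\<not> i < j" "j \<noteq> i" by fastforce
 then show ?thesis using True by cases (simp_all add: dt_def theta_sign_insert insert_commute)
qed (auto simp: dt_def)

lemma dt_th: "dt k (th j F) I = (if j = k then F I else 0) - th j (dt k F) I"
proof (cases "j = k")
 case True
 then show ?thesis by(cases "k \<in> I") (simp_all add: dt_def th_def theta_sign_self theta_sign_square insert_absorb)
next
 case False
 then consider "j < k" "\<not> k < j" "k \<noteq> j" | "k < j" "\<not> j < k" "k \<noteq> j" by fastforce
 then show ?thesis using False
  by cases (cases "j \<in> I"; cases "k \<in> I"; simp add: dt_def th_def theta_sign_insert theta_sign_remove insert_Diff_if)+
qed

text \<open>Renaming the indices and anticommuting the two \<open>th\<close> shows that only the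
  part of \<open>F\<close> antisymmetric in the indices survives. For symmetric \<open>F\<close> the
  sum is 0.\<close>

lemma th_th_symm_sum:
 assumes "!!i j. c i j = c j i"
 shows "(SU i j. c i j * th i (th j (F i j)) I) = (SU i j. c i j * (th i (th j (F i j)) I - th i (th j (F j i)) I) / 2)"
proof -
 let ?s = "\<lambda>G. SU i j. c i j * G i j"
 have "?s (\<lambda>i j. th i (th j (F i j)) I) = ?s (\<lambda>i j. th j (th i (F j i)) I)"
  by(subst sum.swap) (simp add: assms)
 also have "... = - ?s (\<lambda>i j. th i (th j (F j i)) I)"
  by(subst th_th) (simp add: sum_negf)
 finally show ?thesis
  by(simp add: right_diff_distrib diff_divide_distrib sum_subtractf flip: sum_divide_distrib)
qed

section \<open>Odd vector fields\<close>

definition rho :: "('n::finite, 'w) glmod => 'n => 'n => ('i, 'n, 'w) sect => ('i, 'n, 'w) sect" where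
 "rho R i k f = (\<lambda>I S w. f I S (gact R (mat_unit i k) w))"

text \<open>Up to sign this is the action of \<open>q_l\<close>. These odd vector fields
  supercommute to even translations, and their coefficients do not depend on
  \<open>S\<close>.\<close>

definition DD :: "'n::{finite,linorder} => ('n set, 'n, 'w) sect => ('n set, 'n, 'w) sect" where
 "DD l f = (\<lambda>I S w. dt l (\<lambda>I. f I S w) I + (SU j. th j (\<lambda>I. pd (Esym (j, l)) f I S w) I))"

abbreviation (input) "fib f S w \<equiv> (\<lambda>I. f I S w)"

lemma hol_add: "hol R U f ==> hol R U g ==> hol R U (\<lambda>i S w. f i S w + g i S w)"
 and hol_diff: "hol R U f ==> hol R U g ==> hol R U (\<lambda>i S w. f i S w - g i S w)"
 and hol_uminus: "hol R U f ==> hol R U (\<lambda>i S w. - f i S w)"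
 and hol_mult: "holo_on U \<phi> ==> hol R U f ==> hol R U (\<lambda>i S w. \<phi> S * f i S w)"
 and hol_cmult: "hol R U f ==> hol R U (\<lambda>i S w. c * f i S w)"
 by(simp_all add: hol_def holo_on_add holo_on_diff holo_on_uminus holo_on_mult holo_on_cmult)

lemma hol_sum: "(!!a. a \<in> A ==> hol R U (F a)) ==> hol R U (ss F A)"
 by(simp add: hol_def holo_on_sum)

lemma
 fixes R :: "('n::{finite,linorder}, 'w) glmod" and f :: "('n set, 'n, 'w) sect"
 assumes "hol R U f"
 shows hol_theta: "hol R U (theta k f)" and hol_dtheta: "hol R U (dtheta k f)"
proof -
 have "holo_on U (sl (theta k f) I w)" "holo_on U (sl (dtheta k f) I w)" if "w \<in> gspace R" for I w
  using holD[OF assms that] by(cases "k \<in> I"; simp add: theta_def dtheta_def holo_on_cmult holo_on_const)+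
 then show "hol R U (theta k f)" "hol R U (dtheta k f)" by(simp_all add: hol_def)
qed

context
 fixes R :: "('n::{finite,linorder}, 'w::ab_group_add) glmod" and U :: "'n mat set"
 assumes R: "gl_module R" and U: "U \<in> osym"
begin

lemma hol_rho: "hol R U f ==> hol R U (rho R i k f)"
 by(simp add: hol_def rho_def gl_moduleD(3)[OF R])

lemma hol_th: "hol R U (f :: ('n set, 'n, 'w) sect) ==> hol R U (\<lambda>I S w. th k (fib f S w) I)"
 using hol_theta[of R U f k] by(simp add: theta_th[abs_def])

lemma hol_dt: "hol R U (f :: ('n set, 'n, 'w) sect) ==> hol R U (\<lambda>I S w. dt k (fib f S w) I)"
 using hol_dtheta[of R U f k] by(simp add: dtheta_dt[abs_def])

lemma hol_DD: "hol R U f ==> hol R U (DD l f)"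
 unfolding DD_def by(intro hol_add hol_sum hol_th hol_dt hol_pd[OF R U]) auto

context
 fixes S :: "'n mat" and w :: 'w
 assumes S: "S \<in> U" and w: "w \<in> gspace R"
begin

lemma pd_theta: "hol R U f ==> B \<in> symm ==> pd B (theta k f) I S w = th k (fib (pd B f) S w) I"
 by(simp add: pd_def theta_def th_def ddir_cmult[OF U S] holD[OF _ w] ddir_const)

lemma pd_dtheta: "hol R U f ==> B \<in> symm ==> pd B (dtheta k f) I S w = dt k (fib (pd B f) S w) I"
 by(simp add: pd_def dtheta_def dt_def ddir_cmult[OF U S] holD[OF _ w] ddir_const)

lemma pd_pd: "hol R U f ==> B \<in> symm ==> C \<in> symm ==> pd B (pd C f) i S w = pd C (pd B f) i S w"
 unfolding pd_def by(rule ddir_commute[OF holD[OF _ w] U S])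

lemma pd_rho: "pd B (rho R i k f) I S w = pd B f I S (gact R (mat_unit i k) w)"
 by(simp add: pd_def rho_def)

lemma pd_mult: "holo_on U \<phi> ==> hol R U f ==> B \<in> symm ==>
  pd B (\<lambda>i S w. \<phi> S * f i S w) i S w = \<phi> S * pd B f i S w + ddir B \<phi> S * f i S w"
 by(simp add: pd_def ddir_mult[OF U S] holD[OF _ w])

lemma pd_cmult: "hol R U f ==> B \<in> symm ==> pd B (\<lambda>i S w. c * f i S w) i S w = c * pd B f i S w"
 by(simp add: pd_def ddir_cmult[OF U S] holD[OF _ w])

lemma pd_add: "hol R U f ==> hol R U g ==> B \<in> symm ==> pd B (\<lambda>i S w. f i S w + g i S w) i S w = pd B f i S w + pd B g i S w"
 and pd_diff: "hol R U f ==> hol R U g ==> B \<in> symm ==> pd B (\<lambda>i S w. f i S w - g i S w) i S w = pd B f i S w - pd B g i S w"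
 and pd_uminus: "hol R U f ==> B \<in> symm ==> pd B (\<lambda>i S w. - f i S w) i S w = - pd B f i S w"
 by(simp_all add: pd_def ddir_add[OF U S] ddir_diff[OF U S] ddir_uminus[OF U S] holD[OF _ w])

lemma pd_sum: "(!!a. a \<in> A ==> hol R U (F a)) ==> B \<in> symm ==>
  pd B (ss F A) i S w = (\<Sum>a\<in>A. pd B (F a) i S w)"
 by(simp add: pd_def ddir_sum[OF U S] holD[OF _ w])

lemma pd_local: "(!!i S w. S \<in> U ==> w \<in> gspace R ==> f i S w = g i S w) ==> B \<in> symm ==> pd B f i S w = pd B g i S w"
 unfolding pd_def by(rule ddir_cong[OF U S]) (simp_all add: w)

lemma DD_local: "(!!i S w. S \<in> U ==> w \<in> gspace R ==> f i S w = g i S w) ==> DD l f I S w = DD l g I S w"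
 using pd_local[of f g] by(simp add: DD_def S w)

lemma DD_mult:
 assumes \<phi>: "holo_on U \<phi>" and f: "hol R U f"
 shows "DD l (\<lambda>I S w. \<phi> S * f I S w) I S w
  = \<phi> S * DD l f I S w + (SU j. ddir (Esym (j, l)) \<phi> S * th j (fib f S w) I)"
 by(simp add: DD_def pd_mult[OF \<phi> f] th_lin dt_lin sum.distrib sum_distrib_left distrib_left add.assoc)

lemma DD_cmult: "hol R U f ==> DD l (\<lambda>I S w. c * f I S w) I S w = c * DD l f I S w"
 by(simp add: DD_def pd_cmult th_lin dt_lin sum_distrib_left algebra_simps)

lemma DD_add: "hol R U f ==> hol R U g ==> DD l (\<lambda>i S w. f i S w + g i S w) I S w = DD l f I S w + DD l g I S w"
 and DD_diff: "hol R U f ==> hol R U g ==> DD l (\<lambda>i S w. f i S w - g i S w) I S w = DD l f I S w - DD l g I S w"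
 and DD_uminus: "hol R U f ==> DD l (\<lambda>i S w. - f i S w) I S w = - DD l f I S w"
 by(simp_all add: DD_def pd_add pd_diff pd_uminus th_lin dt_lin sum.distrib sum_subtractf sum_negf algebra_simps)

lemma DD_sum:
 assumes "!!a. a \<in> A ==> hol R U (F a)"
 shows "DD l (ss F A) I S w = (\<Sum>a\<in>A. DD l (F a) I S w)"
proof -
 have "pd (Esym v) (ss F A) I S w = (\<Sum>a\<in>A. pd (Esym v) (F a) I S w)" for v I
  by(rule pd_sum[OF assms Esym_symm])
 then show ?thesis unfolding DD_def by(simp only: th_lin dt_lin sum.distrib sum.swap[of _ UNIV A])
qed

lemma DD_theta:
 assumes f: "hol R U f"
 shows "DD l (theta i f) I S w = (if i = l then f I S w else 0) - th i (fib (DD l f) S w) I"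
proof -
 have "DD l (theta i f) I S w = dt l (th i (fib f S w)) I + (SU j. th j (th i (fib (pd (Esym (j, l)) f) S w)) I)"
  unfolding DD_def pd_theta[OF f Esym_symm] theta_th by simp
 also have "... = (if i = l then f I S w else 0) - (th i (dt l (fib f S w)) I + (SU j. th i (th j (fib (pd (Esym (j, l)) f) S w)) I))"
  unfolding dt_th by(subst th_th) (simp add: sum_negf)
 also have "... = (if i = l then f I S w else 0) - th i (fib (DD l f) S w) I"
  unfolding DD_def th_lin by simp
 finally show ?thesis .
qed

lemma DD_dtheta:
 assumes f: "hol R U f"
 shows "DD l (dtheta k f) I S w = pd (Esym (k, l)) f I S w - dt k (fib (DD l f) S w) I"
proof -
 have "DD l (dtheta k f) I S w = dt l (dt k (fib f S w)) I + (SU j. th j (dt k (fib (pd (Esym (j, l)) f) S w)) I)"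
  unfolding DD_def pd_dtheta[OF f Esym_symm] dtheta_dt by simp
 moreover have "dt k (fib (DD l f) S w) I = dt k (dt l (fib f S w)) I + (SU j. dt k (th j (fib (pd (Esym (j, l)) f) S w)) I)"
  unfolding DD_def dt_lin by simp
 moreover have "(SU j. dt k (th j (fib (pd (Esym (j, l)) f) S w)) I)
  = pd (Esym (k, l)) f I S w - (SU j. th j (dt k (fib (pd (Esym (j, l)) f) S w)) I)"
  unfolding dt_th by(simp add: sum_subtractf)
 ultimately show ?thesis using dt_dt[of l k "\<lambda>I. f I S w" I] by simp
qed

lemma DD_pd:
 assumes f: "hol R U f" and B: "B \<in> symm"
 shows "DD l (pd B f) I S w = pd B (DD l f) I S w"
proof -
 note h = hol_pd[OF R U f Esym_symm]
 have "pd B (DD l f) I S w = pd B (\<lambda>I S w. dtheta l f I S w + (SU j. theta j (pd (Esym (j, l)) f) I S w)) I S w"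
  unfolding DD_def theta_th dtheta_dt ..
 also have "... = dt l (fib (pd B f) S w) I + (SU j. th j (\<lambda>I. pd B (pd (Esym (j, l)) f) I S w) I)"
  by(simp only: pd_add[OF hol_dtheta[OF f] hol_sum[OF hol_theta[OF h]] B] pd_sum[OF hol_theta[OF h] B]
    pd_dtheta[OF f B] pd_theta[OF h B])
 finally show ?thesis unfolding DD_def pd_pd[OF f B Esym_symm] by simp
qed

text \<open>In exchanging the two odd fields, the \<open>dt\<close> of each meets the
  \<open>th\<close> of the other once. Both contributions are the derivative along
  \<open>Esym (k, l)\<close>, whence the factor 2.\<close>

lemma DD_DD:
 assumes f: "hol R U f"
 shows "DD l (DD k f) I S w = 2 * pd (Esym (k, l)) f I S w - DD k (DD l f) I S w"
proof -
 note h = hol_pd[OF R U f Esym_symm]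
 have "DD l (DD k f) I S w = DD l (\<lambda>I S w. dtheta k f I S w + (SU j. theta j (pd (Esym (j, k)) f) I S w)) I S w"
  unfolding DD_def[of k] theta_th dtheta_dt ..
 also have "... = DD l (dtheta k f) I S w + (SU j. DD l (theta j (pd (Esym (j, k)) f)) I S w)"
  by(simp only: DD_add[OF hol_dtheta[OF f] hol_sum[OF hol_theta[OF h]]] DD_sum[OF hol_theta[OF h]])
 also have "... = pd (Esym (k, l)) f I S w - dt k (fib (DD l f) S w) I
  + (pd (Esym (l, k)) f I S w - (SU j. th j (\<lambda>I. DD l (pd (Esym (j, k)) f) I S w) I))"
  by(simp add: DD_dtheta[OF f] DD_theta[OF h] sum_subtractf)
 also have "... = 2 * pd (Esym (k, l)) f I S w - DD k (DD l f) I S w"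
  unfolding DD_pd[OF f Esym_symm] by(simp add: DD_def[of k "DD l f"] Esym_swap[of l k])
 finally show ?thesis .
qed

end

lemma DD_rho: "DD l (rho R i k f) I S w = DD l f I S (gact R (mat_unit i k) w)"
 by(simp add: DD_def pd_def rho_def)

end

section \<open>Commutators of odd vector fields\<close>

lemma Esym_entry: "Esym (j, l) $ a $ c = (if a = j then if c = l then 1 / 2 else 0 else 0) + (if c = j then if a = l then 1 / 2 else 0 else 0)"
proof -
 have if_pair: "(1/2 :: complex) * ((if P & Q then 1 else 0) + (if Q' & P' then 1 else 0))
   = (if P then if Q then 1 / 2 else 0 else 0) + (if P' then if Q' then 1 / 2 else 0 else 0)" for P Q P' Q'
  by simp
 have "Esym (j, l) $ a $ c = (1/2) * ((if j = a & l = c then 1 else 0) + (if l = a & j = c then 1 else 0))"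
  unfolding Esym_def mscale_nth vector_add_component mat_unit_nth fst_conv snd_conv ..
 from trans[OF this if_pair] show ?thesis
  by(simp only: eq_commute[of j a] eq_commute[of l c] eq_commute[of l a] eq_commute[of j c])
qed

lemma mult_Esym: "(B ** Esym (j, l)) $ i $ k = (if k = l then B $ i $ j / 2 else 0) + (if k = j then B $ i $ l / 2 else 0)"
 by(simp add: matrix_matrix_mult_def Esym_entry distrib_left sum.distrib if_distrib[where f = "\<lambda>x. _ * x"] cong: if_cong)

lemma Esym_mult: "(Esym (j, l) ** B) $ i $ k = (if i = j then B $ l $ k / 2 else 0) + (if i = l then B $ j $ k / 2 else 0)"
proof -
 have "(SU a. (if i = j then if a = l then 1 / 2 else 0 else 0) * B $ a $ k) = (if i = j then B $ l $ k / 2 else 0)"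
  by(simp add: if_distrib[where f = "\<lambda>x. x * _"] cong: if_cong)
 moreover have "(SU a. (if a = j then if i = l then 1 / 2 else 0 else 0) * B $ a $ k) = (if i = l then B $ j $ k / 2 else 0)"
  by(simp add: if_distrib[where f = "\<lambda>x. x * _"] cong: if_cong)
 ultimately show ?thesis by(simp add: matrix_matrix_mult_def Esym_entry distrib_right sum.distrib)
qed

lemma sum_half_delta: "(SU b. X b * (if P then if c' = b then 1 / 2 else 0 else 0)) = (if P then X c' / 2 else 0)"
 for X :: "'a::finite => complex"
proof (cases P)
 case True
 have "(SU b. X b * (if c' = b then 1 / 2 else 0)) = (SU b. if c' = b then X b / 2 else 0)"
  by(rule sum.cong) auto
 also have "... = X c' / 2" by(simp only: sum.delta' finite UNIV_I if_True)
 finally show ?thesis by(simp only: True if_True)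
next
 case False
 then show ?thesis by(simp only: if_False mult_zero_right sum.neutral_const)
qed

lemma sum_half_delta_Esym:
 "(SU b. mscale (X b) (Esym (j, b))) $ a $ c = (if a = j then X c / 2 else 0) + (if c = j then X a / 2 else 0)"
proof -
 have "(SU b. mscale (X b) (Esym (j, b))) $ a $ c = (SU b. X b * (if a = j then if c = b then 1 / 2 else 0 else 0))
  + (SU b. X b * (if c = j then if a = b then 1 / 2 else 0 else 0))"
  unfolding sum_component mscale_nth Esym_entry distrib_left sum.distrib ..
 then show ?thesis unfolding sum_half_delta .
qed

text \<open>Skewness of \<open>M\<close> and symmetry of \<open>S\<close> identify the terms on the
  left of \<open>Esym (j, l)\<close> with the transpose of those on the right. The variation of
  \<open>frame_delta\<close> is thereby expressed through entries of \<open>frame_h\<close>, and can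
  combine with the other commutator terms.\<close>

lemma frame_delta_variation:
 assumes M: "skew M" and S: "S \<in> symm"
 shows "qq_block M ** Esym (j, l) - Esym (j, l) ** frame_h M S - S ** (pq_block M ** Esym (j, l))
  = - (SU b. mscale (frame_h M S $ l $ b) (Esym (j, b)) + mscale (frame_h M S $ j $ b) (Esym (l, b)))"
proof -
 let ?h = "frame_h M S" and ?E = "Esym (j, l)"
 have s: "S $ a $ b = S $ b $ a" for a b using S symm_iff by blast
 have E: "?E $ a $ b = ?E $ b $ a" for a b using Esym_symm symm_iff by blast
 have h: "qq_block M $ a $ x - (S ** pq_block M) $ a $ x = - ?h $ x $ a" for a x
  by(simp add: skew_blocks(3)[OF M] frame_h_nth matrix_matrix_mult_def s[of a] skew_blocks(1)[OF M, of _ x] mult.commute)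
 have "(qq_block M ** ?E) $ a $ c - (S ** (pq_block M ** ?E)) $ a $ c = - (?E ** ?h) $ c $ a" for a c
 proof -
  have "(qq_block M ** ?E) $ a $ c - ((S ** pq_block M) ** ?E) $ a $ c
    = (SU x. (qq_block M $ a $ x - (S ** pq_block M) $ a $ x) * ?E $ x $ c)"
   by(simp add: matrix_matrix_mult_def[of _ ?E] left_diff_distrib sum_subtractf)
  also have "... = - (?E ** ?h) $ c $ a"
   unfolding h by(simp add: matrix_matrix_mult_def[of ?E] E[of c] sum_negf mult.commute)
  finally show ?thesis by(simp only: matrix_mul_assoc)
 qed
 then have e: "(qq_block M ** ?E - ?E ** ?h - S ** (pq_block M ** ?E)) $ a $ c = - (?E ** ?h) $ c $ a - (?E ** ?h) $ a $ c" for a c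
  unfolding vector_minus_component by(simp add: algebra_simps)
 show ?thesis
  unfolding vec_eq_iff e vector_uminus_component sum.distrib vector_add_component sum_half_delta_Esym Esym_mult
  by(intro allI) (simp only: minus_add_distrib diff_conv_add_uminus ac_simps)
qed

lemma rho_apply: "rho R i k f I S w = f I S (gact R (mat_unit i k) w)"
 by(simp add: rho_def)

definition extra_act :: "('n::{finite,linorder}, 'w) glmod => 'n symp_mat => ('n set, 'n, 'w) sect => ('n set, 'n, 'w) sect" where
 "extra_act R M f = (\<lambda>I S w. (SU i k. frame_h M S $ i $ k * theta i (dtheta k f) I S w)
  - (1/2) * (SU i j k. pq_block M $ i $ j * theta j (theta k (rho R i k f)) I S w))"

lemma act_super_Ev: "act_super R (Ev M) f = (\<lambda>I S w. even_act R M f I S w + extra_act R M f I S w)"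
 by(intro ext) (simp add: even_act_def extra_act_def theta_th rho_def)

text \<open>The even action falls into four summands: the vector field on \<open>S\<close>, the
  rotation of the \<open>\<theta>\<close>s, the fibre action, and the correction of the fibre action
  that is quadratic in the \<open>\<theta>\<close>s.\<close>

definition T1 where "T1 M f = (\<lambda>i S w. SU v. frame_delta M S $ fst v $ snd v * pd (Esym v) f i S w)"
definition T2 where "T2 M f = (\<lambda>I S w. SU i k. frame_h M S $ i $ k * theta i (dtheta k f) I S w)"
definition T3 where "T3 R M f = (\<lambda>I S w. SU i k. frame_h M S $ i $ k * rho R i k f I S w)"
definition T4 where "T4 R M f = (\<lambda>I S w. SU i j k. pq_block M $ i $ j * theta j (theta k (rho R i k f)) I S w)"

context
 fixes R :: "('n::{finite,linorder}, 'w::ab_group_add) glmod" and U :: "'n mat set" and M :: "'n symp_mat"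
 assumes R: "gl_module R" and U: "U \<in> osym" and M: "skew M"
begin

lemma act_super_expand:
 assumes "f \<in> sections R U" "S \<in> U" "w \<in> gspace R"
 shows "act_super R (Ev M) f I S w = - T1 M f I S w + T2 M f I S w - T3 R M f I S w - (1/2) * T4 R M f I S w"
 unfolding act_super_Ev even_act_expand[OF R U assms M] extra_act_def T1_def T2_def T3_def T4_def rho_def[of R _ _ f]
 by simp

lemmas hols = hol_theta hol_dtheta hol_pd[OF R U] hol_rho[OF R U] hol_DD[OF R U] hol_sum hol_mult hol_cmult

context
 fixes S :: "'n mat" and w :: 'w and f :: "('n set, 'n, 'w) sect" and l :: 'n
 assumes S: "S \<in> U" and w: "w \<in> gspace R" and f: "hol R U f"
begin

abbreviation "hh \<equiv> frame_h M S"
abbreviation "BB \<equiv> pq_block M"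

lemma DD_T1: "DD l (T1 M f) I S w = T1 M (DD l f) I S w
  - (SU j b. hh $ l $ b * th j (fib (pd (Esym (j, b)) f) S w) I)
  - (SU j b. hh $ j $ b * th j (fib (pd (Esym (l, b)) f) S w) I)"
proof -
 \<comment> \<open>The variation of \<open>frame_delta\<close> in direction
   \<open>Esym (j, l)\<close>, in the form given by \<open>frame_delta_variation\<close>.\<close>
 let ?D = "\<lambda>j. - (SU b. mscale (hh $ l $ b) (Esym (j, b)) + mscale (hh $ j $ b) (Esym (l, b)))"
 note Ss = U_symm[OF R U S]
 have K: "(\<lambda>I. SU v. ?D j $ fst v $ snd v * pd (Esym v) f I S w)
   = (\<lambda>I. - (SU b. hh $ l $ b * pd (Esym (j, b)) f I S w) - (SU b. hh $ j $ b * pd (Esym (l, b)) f I S w))" for j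
 proof
  fix I
  note hf = holD[OF f w, of I]
  have sy: "mscale (hh $ l $ b) (Esym (j, b)) + mscale (hh $ j $ b) (Esym (l, b)) \<in> symm" for b
   by(intro symm_closed Esym_symm)
  have D: "?D j \<in> symm" by(intro symm_closed symm_sum sy)
  have "(SU v. ?D j $ fst v $ snd v * pd (Esym v) f I S w) = ddir (?D j) (sl f I w) S"
   unfolding ddir_expand[OF hf U S D] by(simp add: cf_def pd_def)
  also have "... = ddir (mscale (- 1) (SU b. mscale (hh $ l $ b) (Esym (j, b)) + mscale (hh $ j $ b) (Esym (l, b)))) (sl f I w) S"
   by(rule arg_cong[where f = "\<lambda>B. ddir B (sl f I w) S"]) (simp add: vec_eq_iff)
  also have "... = - (SU b. hh $ l $ b * pd (Esym (j, b)) f I S w + hh $ j $ b * pd (Esym (l, b)) f I S w)"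
  proof -
   have "ddir (mscale (- 1) (SU b. mscale (hh $ l $ b) (Esym (j, b)) + mscale (hh $ j $ b) (Esym (l, b)))) (sl f I w) S
    = - 1 * ddir (SU b. mscale (hh $ l $ b) (Esym (j, b)) + mscale (hh $ j $ b) (Esym (l, b))) (sl f I w) S"
    by(rule holo_on_ddir_mscale[OF hf U S symm_sum[OF sy]])
   then show ?thesis
    by(simp add: holo_on_ddir_mscale[OF hf U S] holo_on_ddir_sum[OF hf U S] holo_on_ddir_add[OF hf U S] sy pd_def)
  qed
  finally show "(SU v. ?D j $ fst v $ snd v * pd (Esym v) f I S w)
   = - (SU b. hh $ l $ b * pd (Esym (j, b)) f I S w) - (SU b. hh $ j $ b * pd (Esym (l, b)) f I S w)"
   by(simp add: sum.distrib)
 qed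
 have "DD l (T1 M f) I S w = (SU v. frame_delta M S $ fst v $ snd v * DD l (pd (Esym v) f) I S w
   + (SU j. ?D j $ fst v $ snd v * th j (fib (pd (Esym v) f) S w) I))"
  unfolding T1_def
  by(simp only: DD_sum[OF R U S w] DD_mult[OF R U S w] hols f holo_on_frame_delta Esym_symm
    ddir_frame_delta[OF Esym_symm Ss] frame_delta_variation[OF M Ss])
 also have "... = T1 M (DD l f) I S w + (SU j. th j (\<lambda>I. SU v. ?D j $ fst v $ snd v * pd (Esym v) f I S w) I)"
  unfolding T1_def th_lin DD_pd[OF R U S w f Esym_symm] sum.distrib by(simp only: sum.swap[of _ UNIV "UNIV :: ('n * 'n) set"])
 finally show ?thesis unfolding K by(simp add: th_lin sum_subtractf sum_negf)
qed

lemma half_sum_Esym: "(SU i k j. (BB ** Esym (j, l)) $ i $ k * F i k j)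
  = (1/2) * (SU i j. BB $ i $ j * F i l j) + (1/2) * (SU i j. BB $ i $ l * F i j j)"
proof -
 have "(SU k j. (BB ** Esym (j, l)) $ i $ k * F i k j)
   = (SU j. BB $ i $ j / 2 * F i l j) + (SU j. BB $ i $ l / 2 * F i j j)" for i
  by(subst sum.swap) (simp add: mult_Esym distrib_right sum.distrib if_distrib[where f = "\<lambda>x. x * _"] cong: if_cong)
 then show ?thesis by(simp add: sum.distrib sum_distrib_left)
qed

lemma DD_T2: "DD l (T2 M f) I S w = T2 M (DD l f) I S w
  + (SU k. hh $ l $ k * dt k (fib f S w) I)
  - (SU i k. hh $ i $ k * th i (fib (pd (Esym (k, l)) f) S w) I)
  + (1/2) * (SU i j. BB $ i $ l * th j (th i (dt j (fib f S w))) I)"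
proof -
 \<comment> \<open>The \<open>pq\<close>-block is symmetric while the two \<open>th\<close>
   anticommute.\<close>
 have z: "(SU i j. BB $ i $ j * th j (th i (dt l (fib f S w))) I) = 0"
  by(subst sum.swap, subst th_th_symm_sum) (use skew_blocks(1)[OF M] in simp_all)
 have "DD l (T2 M f) I S w = (SU i k. hh $ i $ k * DD l (theta i (dtheta k f)) I S w
   + (SU j. (BB ** Esym (j, l)) $ i $ k * th j (fib (theta i (dtheta k f)) S w) I))"
  unfolding T2_def
  by(simp only: DD_sum[OF R U S w] DD_mult[OF R U S w] hols f holo_on_frame_h
    ddir_frame_h[OF Esym_symm U_symm[OF R U S]])
 also have "... = (SU i k. hh $ i $ k * DD l (theta i (dtheta k f)) I S w)
   + (1/2) * (SU i j. BB $ i $ l * th j (th i (dt j (fib f S w))) I)"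
  unfolding sum.distrib half_sum_Esym by(simp add: theta_th dtheta_dt z)
 also have "(SU i k. hh $ i $ k * DD l (theta i (dtheta k f)) I S w)
   = (SU i k. hh $ i $ k * ((if i = l then dt k (fib f S w) I else 0)
    - th i (fib (pd (Esym (k, l)) f) S w) I + theta i (dtheta k (DD l f)) I S w))"
 proof (intro sum.cong refl arg_cong2[of _ _ _ _ "(*)"])
  show "DD l (theta i (dtheta k f)) I S w = (if i = l then dt k (fib f S w) I else 0)
    - th i (fib (pd (Esym (k, l)) f) S w) I + theta i (dtheta k (DD l f)) I S w" for i k
   by(simp add: DD_theta[OF R U S w] DD_dtheta[OF R U S w] hols f th_lin theta_th dtheta_dt cong: if_cong)
 qed
 also have "(SU i k. hh $ i $ k * ((if i = l then dt k (fib f S w) I else 0)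
    - th i (fib (pd (Esym (k, l)) f) S w) I + theta i (dtheta k (DD l f)) I S w))
  = T2 M (DD l f) I S w + (SU i. if i = l then SU k. hh $ l $ k * dt k (fib f S w) I else 0)
  - (SU i k. hh $ i $ k * th i (fib (pd (Esym (k, l)) f) S w) I)"
  unfolding T2_def sum.distrib[symmetric] sum_subtractf[symmetric]
  by(rule sum.cong) (auto simp: algebra_simps sum.distrib sum_subtractf)
 finally show ?thesis by simp
qed

lemma DD_T3: "DD l (T3 R M f) I S w = T3 R M (DD l f) I S w
  + (1/2) * (SU i j. BB $ i $ j * th j (fib (rho R i l f) S w) I)
  + (1/2) * (SU i j. BB $ i $ l * th j (fib (rho R i j f) S w) I)"
proof -
 have "DD l (T3 R M f) I S w = (SU i k. hh $ i $ k * DD l (rho R i k f) I S w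
   + (SU j. (BB ** Esym (j, l)) $ i $ k * th j (fib (rho R i k f) S w) I))"
  unfolding T3_def
  by(simp only: DD_sum[OF R U S w] DD_mult[OF R U S w] hols f holo_on_frame_h
    ddir_frame_h[OF Esym_symm U_symm[OF R U S]])
 moreover have "DD l (rho R i k f) I S w = rho R i k (DD l f) I S w" for i k
  unfolding DD_rho[OF R U] rho_apply ..
 ultimately show ?thesis
  unfolding sum.distrib half_sum_Esym T3_def by(simp only: add.assoc)
qed

lemma DD_T4: "DD l (T4 R M f) I S w = T4 R M (DD l f) I S w
  + (SU i k. BB $ i $ l * th k (fib (rho R i k f) S w) I)
  - (SU i j. BB $ i $ j * th j (fib (rho R i l f) S w) I)"
proof -
 have 1: "DD l (T4 R M f) I S w = (SU i j k. BB $ i $ j * DD l (theta j (theta k (rho R i k f))) I S w)"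
  unfolding T4_def by(simp only: DD_sum[OF R U S w] DD_cmult[OF R U S w] hols f)
 have 2: "DD l (theta j (theta k (rho R i k f))) I S w = (if j = l then th k (fib (rho R i k f) S w) I else 0)
   - (if k = l then th j (fib (rho R i k f) S w) I else 0) + theta j (theta k (rho R i k (DD l f))) I S w" for i j k
 proof -
  have "th j (\<lambda>I. if k = l then rho R i k f I S w else 0) I = (if k = l then th j (fib (rho R i k f) S w) I else 0)"
   by(simp add: th_def)
  then show ?thesis
   by(simp add: DD_theta[OF R U S w] DD_rho[OF R U] hols f th_lin theta_th, simp add: rho_def)
 qed
 have 3: "(SU j k. BB $ i $ j * ((if j = l then th k (fib (rho R i k f) S w) I else 0)
   - (if k = l then th j (fib (rho R i k f) S w) I else 0) + theta j (theta k (rho R i k (DD l f))) I S w))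
  = (SU j k. BB $ i $ j * theta j (theta k (rho R i k (DD l f))) I S w)
  + (SU j. if j = l then SU k. BB $ i $ l * th k (fib (rho R i k f) S w) I else 0)
  - (SU j k. if k = l then BB $ i $ j * th j (fib (rho R i k f) S w) I else 0)" for i
  unfolding sum.distrib[symmetric] sum_subtractf[symmetric]
  by(rule sum.cong) (auto simp: algebra_simps sum.distrib sum_subtractf if_distrib[where f = "\<lambda>x. _ * x"] cong: if_cong)
 show ?thesis unfolding 1 2 3 by(simp add: T4_def sum.distrib sum_subtractf)
qed

end

text \<open>Among the four commutators, the terms with \<open>pd (Esym (l, b))\<close> from
  \<open>T1\<close> cancel those of \<open>T2\<close>, and the terms with \<open>rho R i l\<close>
  cancel between \<open>T3\<close> and \<open>T4\<close>. The remaining terms with coefficients from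
  row \<open>l\<close> of \<open>frame_h\<close> assemble into the fields
  \<open>DD k\<close>.\<close>

lemma DD_act_Ev:
 assumes S: "S \<in> U" and w: "w \<in> gspace R" and f: "f \<in> sections R U" and df: "restr R U (DD l f) \<in> sections R U"
 shows "DD l (act_super R (Ev M) f) I S w = act_super R (Ev M) (restr R U (DD l f)) I S w
  + (SU k. frame_h M S $ l $ k * DD k f I S w)
  + (1/2) * (SU i j. pq_block M $ i $ l * th j (th i (dt j (fib f S w))) I)
  - (SU i j. pq_block M $ i $ l * th j (fib (rho R i j f) S w) I)"
proof -
 note h = sections_hol[OF f]
 let ?h = "frame_h M S"
 note hs = hol_theta hol_dtheta hol_pd[OF R U] hol_rho[OF R U] hol_sum hol_mult hol_cmult
 have hT: "hol R U (T1 M f)" "hol R U (T2 M f)" "hol R U (T3 R M f)" "hol R U (T4 R M f)"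
  unfolding T1_def T2_def T3_def T4_def
  by(intro hs h holo_on_frame_delta holo_on_frame_h Esym_symm)+
 have e: "T1 M (restr R U (DD l f)) I S w = T1 M (DD l f) I S w" "T2 M (restr R U (DD l f)) I S w = T2 M (DD l f) I S w"
  "T3 R M (restr R U (DD l f)) I S w = T3 R M (DD l f) I S w" "T4 R M (restr R U (DD l f)) I S w = T4 R M (DD l f) I S w"
  using S w by(simp_all add: T1_def T2_def T3_def T4_def theta_th dtheta_dt rho_def restr_apply pd_restr[OF R U] gl_moduleD(3)[OF R])
 have "DD l (act_super R (Ev M) f) I S w
   = DD l (\<lambda>I S w. - T1 M f I S w + T2 M f I S w - T3 R M f I S w - (1/2) * T4 R M f I S w) I S w"
  by(rule DD_local[OF R U S w]) (rule act_super_expand[OF f])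
 also have "... = - DD l (T1 M f) I S w + DD l (T2 M f) I S w - DD l (T3 R M f) I S w - (1/2) * DD l (T4 R M f) I S w"
  by(simp only: DD_diff[OF R U S w] DD_add[OF R U S w] DD_uminus[OF R U S w] DD_cmult[OF R U S w] hT
    hol_add hol_diff hol_uminus hol_cmult)
 also have "... = (- T1 M (DD l f) I S w + T2 M (DD l f) I S w - T3 R M (DD l f) I S w - (1/2) * T4 R M (DD l f) I S w)
  + ((SU j b. ?h $ l $ b * th j (fib (pd (Esym (j, b)) f) S w) I) + (SU k. ?h $ l $ k * dt k (fib f S w) I))
  + (1/2) * (SU i j. pq_block M $ i $ l * th j (th i (dt j (fib f S w))) I)
  - (SU i j. pq_block M $ i $ l * th j (fib (rho R i j f) S w) I)"
  unfolding DD_T1[OF S w h] DD_T2[OF S w h] DD_T3[OF S w h] DD_T4[OF S w h]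
  by(simp add: Esym_swap[of l] algebra_simps)
 also have "(SU j b. ?h $ l $ b * th j (fib (pd (Esym (j, b)) f) S w) I) + (SU k. ?h $ l $ k * dt k (fib f S w) I)
  = (SU k. ?h $ l $ k * DD k f I S w)"
  by(subst sum.swap) (simp add: DD_def distrib_left sum.distrib sum_distrib_left)
 finally show ?thesis unfolding act_super_expand[OF df S w] e .
qed

end

section \<open>The action of odd elements\<close>

lemma sym_outer_expand: "sym_outer c k = (SU l. mscale (c $ l) (Esym (k, l)))"
 unfolding vec_eq_iff sum_half_delta_Esym sym_outer_def by(auto simp: add_divide_distrib)

lemma sym_outer_symm: "sym_outer c k \<in> symm"
 unfolding sym_outer_expand by(intro symm_sum symm_closed Esym_symm)

lemma odd_shift_nth: "odd_shift y S $ k = y $ Inr k - (SU j. S $ k $ j * y $ Inl j)"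
 by(simp add: odd_shift_def q_part_def p_part_def matrix_vector_mult_def)

lemma p_part_nth: "p_part y $ k = y $ Inl k"
 by(simp add: p_part_def)

lemma holo_on_odd_shift: "holo_on U (\<lambda>S. odd_shift y S $ k)"
 unfolding odd_shift_nth by(intro holo_on_diff holo_on_const holo_on_sum holo_on_mult holo_on_nth)

lemma ddir_odd_shift: "C \<in> symm ==> S \<in> symm ==> ddir C (\<lambda>S. odd_shift y S $ k) S = - (SU j. C $ k $ j * y $ Inl j)"
 unfolding odd_shift_nth
 by(simp add: ddir_diff[OF symm_opens] ddir_const ddir_sum[OF symm_opens] ddir_mult[OF symm_opens] ddir_nth
   holo_on_const holo_on_sum holo_on_mult holo_on_nth)

text \<open>First of the three summands of the odd action. In it the derivative in
  \<open>\<theta>\<close> and the induced variation of \<open>S\<close> are already combined into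
  the fields \<open>DD k\<close>.\<close>

definition O1 :: "'n::{finite,linorder} symp => ('n set, 'n, 'w) sect => ('n set, 'n, 'w) sect" where
 "O1 y f = (\<lambda>I S w. SU k. odd_shift y S $ k * DD k f I S w)"
definition O2 :: "'n::{finite,linorder} symp => ('n set, 'n, 'w) sect => ('n set, 'n, 'w) sect" where
 "O2 y f = (\<lambda>I S w. SU j k. y $ Inl j * theta j (theta k (dtheta k f)) I S w)"
definition O3 :: "('n::{finite,linorder}, 'w) glmod => 'n symp => ('n set, 'n, 'w) sect => ('n set, 'n, 'w) sect" where
 "O3 R y f = (\<lambda>I S w. SU i k. y $ Inl i * theta k (rho R i k f) I S w)"

context
 fixes R :: "('n::{finite,linorder}, 'w::ab_group_add) glmod" and U :: "'n mat set"
 assumes R: "gl_module R" and U: "U \<in> osym"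
begin

lemma act_Od_expand:
 assumes f: "hol R U f" and S: "S \<in> U" and w: "w \<in> gspace R"
 shows "act_super R (Od y) f I S w = - O1 y f I S w - (1/2) * O2 y f I S w - O3 R y f I S w"
proof -
 let ?c = "odd_shift y S"
 have "theta k (\<lambda>I' S' w'. ddir (sym_outer (odd_shift y S') k) (\<lambda>S''. f I' S'' w') S') I S w
   = (SU l. ?c $ l * th k (fib (pd (Esym (k, l)) f) S w) I)" for k
 proof -
  have "ddir (sym_outer ?c k) (sl f I w) S = (SU l. ?c $ l * pd (Esym (k, l)) f I S w)" for I
   using holD[OF f w, of I]
   by(simp add: sym_outer_expand holo_on_ddir_sum[OF _ U S] holo_on_ddir_mscale[OF _ U S] pd_def)
  then show ?thesis unfolding theta_th by(simp add: th_lin)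
 qed
 then have "(SU k. theta k (\<lambda>I' S' w'. ddir (sym_outer (odd_shift y S') k) (\<lambda>S''. f I' S'' w') S') I S w)
   = (SU l k. ?c $ l * th k (fib (pd (Esym (k, l)) f) S w) I)"
  by(subst sum.swap) (simp only:)
 then show ?thesis
  by(simp add: O1_def O2_def O3_def DD_def theta_th dtheta_dt p_part_nth rho_def sum.distrib sum_distrib_left distrib_left)
qed

lemmas hols' = hol_theta hol_dtheta hol_pd[OF R U] hol_rho[OF R U] hol_DD[OF R U] hol_sum hol_mult hol_cmult

lemma hol_O: "hol R U f ==> hol R U (O1 y f)" "hol R U f ==> hol R U (O2 y f)" "hol R U f ==> hol R U (O3 R y f)"
 unfolding O1_def O2_def O3_def by(intro hols' holo_on_odd_shift; assumption)+

context
 fixes S :: "'n mat" and w :: 'w and f :: "('n set, 'n, 'w) sect" and l :: 'n and y :: "'n symp"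
 assumes S: "S \<in> U" and w: "w \<in> gspace R" and f: "hol R U f"
begin

text \<open>Besides exchanging \<open>DD l\<close> with \<open>DD k\<close>, the coefficient
  \<open>odd_shift\<close> gets differentiated. It is affine in \<open>S\<close>, and the two
  entries of \<open>Esym (j, l)\<close> produce the two terms with factor 1/2.\<close>

lemma DD_O1: "DD l (O1 y f) I S w = - O1 y (DD l f) I S w + 2 * (SU k. odd_shift y S $ k * pd (Esym (k, l)) f I S w)
  - (1/2) * (y $ Inl l * (SU j. th j (fib (DD j f) S w) I)) - (1/2) * (SU j. y $ Inl j * th j (fib (DD l f) S w) I)"
proof -
 have e: "(SU i. Esym (j, l) $ k $ i * y $ Inl i) = (if k = j then y $ Inl l / 2 else 0) + (if k = l then y $ Inl j / 2 else 0)" for j k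
 proof -
  have 1: "(SU i. (if P then if i = b then 1 / 2 else 0 else 0) * Y i) = (if P then Y b / 2 else 0)"
   "(SU i. (if i = b then if P then 1 / 2 else 0 else 0) * Y i) = (if P then Y b / 2 else 0)"
   for P b and Y :: "'n => complex"
   by(cases P; simp add: if_distrib[where f = "\<lambda>x. x * _"] cong: if_cong)+
  show ?thesis unfolding Esym_entry distrib_right sum.distrib 1 ..
 qed
 have "DD l (O1 y f) I S w = (SU k. odd_shift y S $ k * DD l (DD k f) I S w
   + (SU j. - (SU i. Esym (j, l) $ k $ i * y $ Inl i) * th j (fib (DD k f) S w) I))"
  unfolding O1_def
  by(simp only: DD_sum[OF R U S w] DD_mult[OF R U S w] hols' f holo_on_odd_shift
    ddir_odd_shift[OF Esym_symm U_symm[OF R U S]])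
 moreover have "(SU k. odd_shift y S $ k * DD l (DD k f) I S w)
   = - O1 y (DD l f) I S w + 2 * (SU k. odd_shift y S $ k * pd (Esym (k, l)) f I S w)"
 proof -
  have "DD l (DD k f) I S w = 2 * pd (Esym (k, l)) f I S w - DD k (DD l f) I S w" for k by(rule DD_DD[OF R U S w f])
  then have "(SU k. odd_shift y S $ k * DD l (DD k f) I S w)
    = (SU k. 2 * (odd_shift y S $ k * pd (Esym (k, l)) f I S w) - odd_shift y S $ k * DD k (DD l f) I S w)"
   by(intro sum.cong refl) (simp only: right_diff_distrib mult.left_commute)
  then show ?thesis by(simp only: sum_subtractf O1_def sum_distrib_left[symmetric]) simp
 qed
 moreover have "(SU k j. - (SU i. Esym (j, l) $ k $ i * y $ Inl i) * th j (fib (DD k f) S w) I)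
   = - (1/2) * (y $ Inl l * (SU j. th j (fib (DD j f) S w) I)) - (1/2) * (SU j. y $ Inl j * th j (fib (DD l f) S w) I)"
 proof -
  have "(SU k. - ((if k = j then y $ Inl l / 2 else 0) + (if k = l then y $ Inl j / 2 else 0)) * th j (fib (DD k f) S w) I)
   = (SU k. if k = j then - (y $ Inl l / 2) * th j (fib (DD j f) S w) I else 0)
   + (SU k. if k = l then - (y $ Inl j / 2) * th j (fib (DD l f) S w) I else 0)" for j
   unfolding sum.distrib[symmetric] by(rule sum.cong) (auto simp: algebra_simps)
  then have z: "(SU k. - ((if k = j then y $ Inl l / 2 else 0) + (if k = l then y $ Inl j / 2 else 0)) * th j (fib (DD k f) S w) I)
   = - (y $ Inl l / 2) * th j (fib (DD j f) S w) I - (y $ Inl j / 2) * th j (fib (DD l f) S w) I" for j by simp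
  show ?thesis unfolding e by(subst sum.swap) (simp only: z, simp add: sum_subtractf sum_negf sum_distrib_left)
 qed
 ultimately show ?thesis by(simp add: sum.distrib)
qed

lemma DD_O2: "DD l (O2 y f) I S w = - O2 y (DD l f) I S w
  + y $ Inl l * (SU k. th k (dt k (fib f S w)) I) - (SU j. y $ Inl j * th j (dt l (fib f S w)) I)
  + (SU j k. y $ Inl j * th j (th k (fib (pd (Esym (k, l)) f) S w)) I)"
proof -
 have 1: "DD l (O2 y f) I S w = (SU j k. y $ Inl j * DD l (theta j (theta k (dtheta k f))) I S w)"
  unfolding O2_def by(simp only: DD_sum[OF R U S w] DD_cmult[OF R U S w] hols' f)
 have if_th: "th j (\<lambda>I. if k = l then F I else 0) I = (if k = l then th j F I else 0)" for j k and F :: "'n set => complex"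
  by(simp add: th_def)
 have 2: "DD l (theta j (theta k (dtheta k f))) I S w = (if j = l then th k (dt k (fib f S w)) I else 0)
   - (if k = l then th j (dt k (fib f S w)) I else 0) + th j (th k (fib (pd (Esym (k, l)) f) S w)) I
   - theta j (theta k (dtheta k (DD l f))) I S w" for j k
  by(simp add: DD_theta[OF R U S w] DD_dtheta[OF R U S w] hols' f th_lin theta_th dtheta_dt if_th cong: if_cong)
 have 3: "(SU j k. y $ Inl j * (if j = l then th k (dt k (fib f S w)) I else 0))
  = y $ Inl l * (SU k. th k (dt k (fib f S w)) I)"
 proof -
  have "(SU k. y $ Inl j * (if j = l then th k (dt k (fib f S w)) I else 0))
   = (if j = l then y $ Inl l * (SU k. th k (dt k (fib f S w)) I) else 0)" for j
   by(simp add: sum_distrib_left)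
  then show ?thesis by simp
 qed
 have 4: "(SU k. y $ Inl j * (if k = l then th j (dt k (fib f S w)) I else 0)) = y $ Inl j * th j (dt l (fib f S w)) I" for j
  by(simp add: if_distrib[where f = "\<lambda>x. _ * x"] cong: if_cong)
 show ?thesis
  unfolding 1 2 by(simp add: right_diff_distrib distrib_left sum.distrib sum_subtractf 3 4 O2_def)
qed

lemma DD_O3: "DD l (O3 R y f) I S w = - O3 R y (DD l f) I S w + (SU i. y $ Inl i * rho R i l f I S w)"
proof -
 have 1: "DD l (O3 R y f) I S w = (SU i k. y $ Inl i * DD l (theta k (rho R i k f)) I S w)"
  unfolding O3_def by(simp only: DD_sum[OF R U S w] DD_cmult[OF R U S w] hols' f)
 have 2: "DD l (theta k (rho R i k f)) I S w = (if k = l then rho R i k f I S w else 0) - theta k (rho R i k (DD l f)) I S w" for i k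
  unfolding DD_theta[OF R U S w hol_rho[OF R U f]] DD_rho[OF R U] theta_th rho_apply[of R i k "DD l f"] ..
 have 4: "(SU k. y $ Inl i * (if k = l then rho R i k f I S w else 0)) = y $ Inl i * rho R i l f I S w" for i
  by(simp add: if_distrib[where f = "\<lambda>x. _ * x"] cong: if_cong)
 show ?thesis unfolding 1 2 by(simp add: right_diff_distrib sum_subtractf 4 O3_def)
qed

text \<open>The part quadratic in \<open>th\<close> pairs the antisymmetric product of
  \<open>th j\<close> and \<open>th i\<close> with the symmetric \<open>Esym (i, j)\<close>, hence
  vanishes.\<close>

lemma theta_DD_sum: "(SU j. th j (fib (DD j f) S w) I) = (SU k. th k (dt k (fib f S w)) I)"
proof -
 have "(SU j i. 1 * th j (th i (fib (pd (Esym (i, j)) f) S w)) I) = 0"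
  by(subst th_th_symm_sum) (simp_all add: Esym_swap)
 then show ?thesis by(simp add: DD_def th_lin sum.distrib)
qed

text \<open>The terms with coefficient \<open>y $ Inl l\<close> from \<open>O1\<close> and
  \<open>O2\<close> cancel by \<open>theta_DD_sum\<close>. After \<open>DD l\<close> is expanded in
  the other half-terms, those quadratic in \<open>th\<close> cancel as well, and the halves with
  \<open>dt l\<close> add up.\<close>

lemma DD_act_Od_hol:
 "DD l (\<lambda>I S w. - O1 y f I S w - (1/2) * O2 y f I S w - O3 R y f I S w) I S w =
  - (- O1 y (DD l f) I S w - (1/2) * O2 y (DD l f) I S w - O3 R y (DD l f) I S w)
  - 2 * (SU k. odd_shift y S $ k * pd (Esym (k, l)) f I S w)
  + (SU j. y $ Inl j * th j (dt l (fib f S w)) I) - (SU i. y $ Inl i * rho R i l f I S w)"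
proof -
 have "(SU j. y $ Inl j * th j (fib (DD l f) S w) I) = (SU j. y $ Inl j * th j (dt l (fib f S w)) I)
  + (SU j k. y $ Inl j * th j (th k (fib (pd (Esym (k, l)) f) S w)) I)"
  by(simp add: DD_def th_lin distrib_left sum.distrib sum_distrib_left)
 moreover have "DD l (\<lambda>I S w. - O1 y f I S w - (1/2) * O2 y f I S w - O3 R y f I S w) I S w
   = - DD l (O1 y f) I S w - (1/2) * DD l (O2 y f) I S w - DD l (O3 R y f) I S w"
  by(simp only: DD_diff[OF R U S w] DD_uminus[OF R U S w] DD_cmult[OF R U S w] hol_O f hol_diff hol_uminus hol_cmult)
 ultimately show ?thesis unfolding DD_O1 DD_O2 DD_O3 theta_DD_sum by(simp add: algebra_simps)
qed

end

lemma DD_act_Od: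
 assumes S: "S \<in> U" and w: "w \<in> gspace R" and f: "f \<in> sections R U" and df: "restr R U (DD l f) \<in> sections R U"
 shows "DD l (act_super R (Od y) f) I S w = - act_super R (Od y) (restr R U (DD l f)) I S w
  - 2 * (SU k. odd_shift y S $ k * pd (Esym (k, l)) f I S w)
  + (SU j. y $ Inl j * th j (dt l (fib f S w)) I) - (SU i. y $ Inl i * rho R i l f I S w)"
proof -
 note h = sections_hol[OF f]
 have d: "DD k (restr R U (DD l f)) I S w = DD k (DD l f) I S w" for k I
  by(rule DD_local[OF R U S w]) (simp add: restr_apply)
 have e: "O1 y (restr R U (DD l f)) I S w = O1 y (DD l f) I S w" "O2 y (restr R U (DD l f)) I S w = O2 y (DD l f) I S w"
  "O3 R y (restr R U (DD l f)) I S w = O3 R y (DD l f) I S w"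
  using S w by(simp_all add: O1_def O2_def O3_def theta_th dtheta_dt rho_def restr_apply d gl_moduleD(3)[OF R])
 have "DD l (act_super R (Od y) f) I S w
   = DD l (\<lambda>I S w. - O1 y f I S w - (1/2) * O2 y f I S w - O3 R y f I S w) I S w"
  by(rule DD_local[OF R U S w]) (rule act_Od_expand[OF h])
 then show ?thesis
  unfolding DD_act_Od_hol[OF S w h] act_Od_expand[OF sections_hol[OF df] S w] e .
qed

end

lemma sum_bilinear_swap: "(\<Sum>k\<in>A. (\<Sum>l\<in>B. b l * c l k) * F k) = (\<Sum>l\<in>B. b l * (\<Sum>k\<in>A. c l k * F k))"
 for F :: "'b => complex"
 unfolding sum_distrib_left sum_distrib_right by(subst sum.swap) (simp only: mult.assoc)

lemma quad_q_entries:
 assumes b: "!!i. b $ Inl i = 0"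
 shows "pp_block (quad b y) $ i $ j = - (b $ Inr j * y $ Inl i)" "pq_block (quad b y) = 0"
  "qp_block (quad b y) $ i $ j = - (y $ Inr j * b $ Inr i) - b $ Inr j * y $ Inr i"
  "qq_block (quad b y) $ i $ j = y $ Inl j * b $ Inr i"
 by(simp_all add: pp_block_def pq_block_def qp_block_def qq_block_def quad_def omega_pE omega_qE b vec_eq_iff)

section \<open>The super action on sections and its brackets with the opposite nilradical\<close>

context
 fixes R :: "('n::{finite,linorder}, 'w::ab_group_add) glmod" and U :: "'n mat set"
 assumes R: "gl_module R" and U: "U \<in> osym"
begin

lemma sections_eq_on: "g \<in> sections R U ==> (!!i S w. S \<in> U ==> w \<in> gspace R ==> f i S w = g i S w) ==> restr R U f \<in> sections R U"
 using restr_cong[of U R f g] by(simp add: restr_sections)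

lemma sections_theta: "f \<in> sections R U ==> theta k f \<in> sections R U"
 and sections_dtheta: "f \<in> sections R U ==> dtheta k f \<in> sections R U"
proof -
 assume f: "f \<in> sections R U"
 note h = hol_theta[OF sections_hol[OF f], of k] hol_dtheta[OF sections_hol[OF f], of k]
 show "theta k f \<in> sections R U"
  by(rule sectionsI) (auto simp: theta_def sectionsD[OF f] algebra_simps intro: holD[OF h(1), unfolded theta_def])
 show "dtheta k f \<in> sections R U"
  by(rule sectionsI) (auto simp: dtheta_def sectionsD[OF f] algebra_simps intro: holD[OF h(2), unfolded dtheta_def])
qed

lemma sections_mult: "holo_on U \<phi> ==> f \<in> sections R U ==> (\<lambda>i S w. \<phi> S * f i S w) \<in> sections R U"
 by(rule sectionsI) (auto simp: sectionsD algebra_simps intro: holo_on_mult)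

lemma sections_rho: "f \<in> sections R U ==> restr R U (rho R i k f) \<in> sections R U"
 by(rule restr_in_sections[OF R U])
  (simp_all add: rho_def gl_moduleD(3-5)[OF R] sectionsD)

lemma sections_add: "f \<in> sections R U ==> g \<in> sections R U ==> (\<lambda>i S w. f i S w + g i S w) \<in> sections R U"
 and sections_minus: "f \<in> sections R U ==> g \<in> sections R U ==> (\<lambda>i S w. f i S w - g i S w) \<in> sections R U"
 and sections_uminus: "f \<in> sections R U ==> (\<lambda>i S w. - f i S w) \<in> sections R U"
 using sections_lin[of f R U g 1 1] sections_lin[of f R U g 1 "-1"] sections_lin[of f R U f "-1" 0] by simp_all

lemma sections_DD:
 assumes f: "f \<in> sections R U"
 shows "restr R U (DD l f) \<in> sections R U"
proof (rule sections_eq_on)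
 show "(\<lambda>I S w. dtheta l f I S w + (SU j. theta j (restr R U (pd (Esym (j, l)) f)) I S w)) \<in> sections R U"
  by(intro sections_add sections_sum sections_theta sections_dtheta pd_sections[OF R U] f Esym_symm)
qed (simp add: DD_def theta_th dtheta_dt restr_apply)

lemma sections_act_super:
 assumes f: "f \<in> sections R U" and X: "X \<in> osp_alg"
 shows "restr R U (act_super R X f) \<in> sections R U"
proof (cases X)
 case (Ev M)
 then have M: "skew M" using X by simp
 show ?thesis
  unfolding Ev
 proof (rule sections_eq_on)
  show "(\<lambda>I S w. restr R U (even_act R M f) I S w + ((SU i k. frame_h M S $ i $ k * theta i (dtheta k f) I S w)
   - (SU i j k. (1/2 * pq_block M $ i $ j) * theta j (theta k (restr R U (rho R i k f))) I S w))) \<in> sections R U"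
   by(intro sections_add sections_minus sections_sum sections_mult sections_theta sections_dtheta sections_rho
     even_act_sections[OF R U] f M holo_on_frame_h holo_on_const)
 qed (simp add: act_super_Ev extra_act_def theta_th dtheta_dt restr_apply sum_distrib_left mult.assoc del: act_super.simps)
next
 case (Od y)
 show ?thesis
  unfolding Od
 proof (rule sections_eq_on)
  show "(\<lambda>I S w. - (SU k. odd_shift y S $ k * restr R U (DD k f) I S w)
   - (SU j k. (1/2 * y $ Inl j) * theta j (theta k (dtheta k f)) I S w)
   - (SU i k. y $ Inl i * theta k (restr R U (rho R i k f)) I S w)) \<in> sections R U"
   by(intro sections_uminus sections_minus sections_sum sections_mult sections_theta sections_dtheta sections_rho
     sections_DD f holo_on_odd_shift holo_on_const)
 qed (simp add: act_Od_expand[OF R U sections_hol[OF f]] O1_def O2_def O3_def theta_th dtheta_dt restr_apply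
   sum_distrib_left mult.assoc del: act_super.simps)
qed

lemma act_super_local:
 assumes eq: "!!i S w. S \<in> U ==> w \<in> gspace R ==> f i S w = g i S w" and X: "X \<in> osp_alg" and S: "S \<in> U" and w: "w \<in> gspace R"
 shows "act_super R X f I S w = act_super R X g I S w"
proof -
 note gw = gl_moduleD(3)[OF R w]
 show ?thesis
 proof (cases X)
  case (Ev M)
  then have M: "skew M" using X by simp
  have "even_act R M f I S w = even_act R M g I S w"
   by(rule even_act_local[OF R U _ M S w]) (rule eq)
  then show ?thesis
   unfolding Ev act_super_Ev
   by(simp add: extra_act_def theta_th dtheta_dt rho_def eq S w gw)
 next
  case (Od y)
  have "ddir (sym_outer (odd_shift y S) k) (sl f I w) S = ddir (sym_outer (odd_shift y S) k) (sl g I w) S" for k I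
   by(rule ddir_cong[OF U S sym_outer_symm]) (rule eq[OF _ w])
  then show ?thesis unfolding Od by(simp add: theta_th dtheta_dt eq S w gw)
 qed
qed

lemma act_super_lin:
 assumes X: "X \<in> osp_alg" and f: "f \<in> sections R U" and g: "g \<in> sections R U" and S: "S \<in> U" and w: "w \<in> gspace R"
 shows "act_super R X (lc a f b g) I S w = a * act_super R X f I S w + b * act_super R X g I S w"
proof (cases X)
 case (Ev M)
 then have M: "skew M" using X by simp
 show ?thesis
  unfolding Ev act_super_Ev even_act_lin[OF R U M f g S w]
  by(simp add: extra_act_def theta_th dtheta_dt rho_def th_lin dt_lin sum.distrib sum_distrib_left algebra_simps)
next
 case (Od y)
 note hf = sections_hol[OF f] and hg = sections_hol[OF g]
 have h: "hol R U (lc a f b g)" by(intro hol_add hol_cmult hf hg)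
 have "DD k (lc a f b g) I S w = a * DD k f I S w + b * DD k g I S w" for k I
  by(simp add: DD_add[OF R U S w] DD_cmult[OF R U S w] hol_cmult hf hg)
 then show ?thesis
  unfolding Od act_Od_expand[OF R U h S w] act_Od_expand[OF R U hf S w] act_Od_expand[OF R U hg S w]
  by(simp add: O1_def O2_def O3_def theta_th dtheta_dt rho_def th_lin dt_lin sum.distrib sum_distrib_left algebra_simps)
qed

lemma act_super_sum:
 assumes X: "X \<in> osp_alg" and S: "S \<in> U" and w: "w \<in> gspace R" and f: "!!a. a \<in> A ==> f a \<in> sections R U" and A: "finite A"
 shows "act_super R X (\<lambda>i S w. \<Sum>a\<in>A. c a * f a i S w) I S w = (\<Sum>a\<in>A. c a * act_super R X (f a) I S w)"
 using A f
proof (induction A rule: finite_induct)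
 case empty
 show ?case using act_super_lin[OF X sections_zero sections_zero S w, of 0 0] by(simp del: act_super.simps)
next
 case (insert x F)
 have "(\<lambda>i S w. \<Sum>a\<in>F. c a * f a i S w) \<in> sections R U"
  by(rule sections_sum, rule sections_cmult) (use insert in simp)
 from act_super_lin[OF X insert.prems[of x] this S w, of "c x" 1] show ?case
  using insert by(simp del: act_super.simps)
qed

lemma act_super_oadd:
 assumes X: "X \<in> osp_alg" "Y \<in> osp_alg" "is_odd X = is_odd Y" and f: "f \<in> sections R U" and S: "S \<in> U" and w: "w \<in> gspace R"
 shows "act_super R (oadd X Y) f I S w = act_super R X f I S w + act_super R Y f I S w"
proof (cases X; cases Y)
 fix M N assume XY: "X = Ev M" "Y = Ev N"
 then have M: "skew M" "skew N" using X by simp_all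
 show ?thesis
  unfolding XY oadd.simps act_super_Ev even_act_add[OF R U M f S w]
  by(simp add: extra_act_def frame_add pq_block_add sum.distrib algebra_simps)
next
 fix y z assume XY: "X = Od y" "Y = Od z"
 note h = sections_hol[OF f]
 have "odd_shift (y + z) S $ k = odd_shift y S $ k + odd_shift z S $ k" for k
  by(simp add: odd_shift_nth sum.distrib algebra_simps)
 then show ?thesis
  unfolding XY oadd.simps act_Od_expand[OF R U h S w]
  by(simp add: O1_def O2_def O3_def sum.distrib distrib_right add_divide_distrib)
qed (use X in simp_all)

lemma act_super_oscale:
 assumes X: "X \<in> osp_alg" and f: "f \<in> sections R U" and S: "S \<in> U" and w: "w \<in> gspace R"
 shows "act_super R (oscale c X) f I S w = c * act_super R X f I S w"
proof (cases X)
 case (Ev M)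
 then have M: "skew M" using X by simp
 show ?thesis
  unfolding Ev oscale.simps act_super_Ev even_act_mscale[OF R U M f S w]
  by(simp add: extra_act_def frame_mscale pq_block_mscale sum_distrib_left algebra_simps)
next
 case (Od y)
 note h = sections_hol[OF f]
 have "odd_shift (c *s y) S $ k = c * odd_shift y S $ k" for k
  by(simp add: odd_shift_nth sum_distrib_left right_diff_distrib mult.left_commute)
 then show ?thesis
  unfolding Od oscale.simps act_Od_expand[OF R U h S w]
  by(simp add: O1_def O2_def O3_def sum_distrib_left right_diff_distrib mult.assoc)
qed

lemma act_super_low:
 assumes f: "f \<in> sections R U" and S: "S \<in> U" and w: "w \<in> gspace R"
 shows "act_super R (Ev (low B)) f I S w = - pd B f I S w"
 unfolding act_super_Ev even_act_low_eq[OF R U f S w] by(simp add: extra_act_def)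

lemma act_super_par:
 assumes X: "X \<in> osp_par" and f: "f \<in> sections R U" and 0: "0 \<in> U" and w: "w \<in> gspace R"
 shows "act_super R X f {} 0 w = - f {} 0 (par_act R X w)"
proof (cases X)
 case (Ev M)
 then have M: "\<forall>y\<in>Lp. M *v y \<in> Lp" using X by(simp add: Ev_osp_par)
 show ?thesis unfolding Ev act_super_Ev even_act_par[OF R U M f 0 w] by(simp add: extra_act_def theta_def)
next
 case (Od y)
 then have "y \<in> Lp" using X by(simp add: Ev_osp_par)
 then have "odd_shift y 0 = 0" by(simp add: vec_eq_iff odd_shift_nth Lp_iff)
 then show ?thesis unfolding Od by(simp add: theta_def section_zero[OF R U f 0])
qed

lemma low_act_Ev:
 assumes C: "C \<in> symm" and M: "skew M" and f: "f \<in> sections R U" and S: "S \<in> U" and w: "w \<in> gspace R"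
 shows "pd C (act_super R (Ev M) f) I S w
  = act_super R (Ev M) (restr R U (pd C f)) I S w - act_super R (Ev (low C ** M - M ** low C)) f I S w"
proof -
 let ?N = "low C ** M - M ** low C"
 note h = sections_hol[OF f]
 note hs = hol_theta hol_dtheta hol_rho[OF R U] hol_sum hol_mult hol_cmult
 have q: "pq_block ?N = 0" by(simp add: pq_block_diff pq_block_mult)
 \<comment> \<open>Only the restriction is known to be a section; holomorphy on \<open>U\<close> is
   unaffected by values elsewhere.\<close>
 have ev: "hol R U (even_act R M f)"
 proof -
  have "hol R U (restr R U (even_act R M f))" by(rule sections_hol[OF even_act_sections[OF R U f M]])
  then show ?thesis unfolding hol_def
   using holo_on_cong[OF U, of "\<lambda>S. restr R U (even_act R M f) _ S _" "\<lambda>S. even_act R M f _ S _"]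
   by(metis (no_types, lifting) U holo_on_cong restr_apply)
 qed
 have T: "hol R U (T2 M f)" "hol R U (T4 R M f)"
  unfolding T2_def T4_def by(intro hs h holo_on_frame_h)+
 have ex: "extra_act R M f = (\<lambda>I S w. T2 M f I S w - (1/2) * T4 R M f I S w)" for M f
  by(simp add: extra_act_def T2_def T4_def)
 have 2: "pd C (T2 M f) I S w = T2 M (restr R U (pd C f)) I S w - T2 ?N f I S w"
 proof -
  have "pd C (T2 M f) I S w = (SU i k. frame_h M S $ i $ k * pd C (theta i (dtheta k f)) I S w
    + (pq_block M ** C) $ i $ k * theta i (dtheta k f) I S w)"
   unfolding T2_def
   by(simp only: pd_sum[OF R U S w] pd_mult[OF R U S w] hs h C holo_on_frame_h ddir_frame_h[OF C U_symm[OF R U S]])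
  also have "... = T2 M (restr R U (pd C f)) I S w - T2 ?N f I S w"
   by(simp add: T2_def frame_h_bracket_low pd_theta[OF R U S w] pd_dtheta[OF R U S w] hs h C theta_th dtheta_dt restr_apply S w
     sum.distrib sum_negf)
  finally show ?thesis .
 qed
 have 4: "pd C (T4 R M f) I S w = T4 R M (restr R U (pd C f)) I S w"
 proof -
  have "pd C (T4 R M f) I S w = (SU i j k. pq_block M $ i $ j * pd C (theta j (theta k (rho R i k f))) I S w)"
   unfolding T4_def by(simp only: pd_sum[OF R U S w] pd_cmult[OF R U S w] hs h C)
  then show ?thesis
   by(simp add: T4_def pd_theta[OF R U S w] hs h C theta_th pd_rho[OF R U S w] rho_apply restr_apply S gl_moduleD(3)[OF R w])
 qed
 have "pd C (act_super R (Ev M) f) I S w = pd C (even_act R M f) I S w + (pd C (T2 M f) I S w - (1/2) * pd C (T4 R M f) I S w)"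
  unfolding act_super_Ev ex
  by(simp only: pd_add[OF R U S w] pd_diff[OF R U S w] pd_cmult[OF R U S w] ev T hol_diff hol_cmult C)
 then show ?thesis
  unfolding act_super_Ev ex even_act_low[OF R U C M f S w] 2 4 by(simp add: T4_def q)
qed

lemma low_act_Od:
 assumes C: "C \<in> symm" and f: "f \<in> sections R U" and S: "S \<in> U" and w: "w \<in> gspace R"
 shows "pd C (act_super R (Od y) f) I S w
  = act_super R (Od y) (restr R U (pd C f)) I S w - act_super R (Od (low C *v y)) f I S w"
proof -
 note h = sections_hol[OF f]
 note hs = hol_theta hol_dtheta hol_rho[OF R U] hol_sum hol_mult hol_cmult hol_DD[OF R U]
 note hc = sections_hol[OF pd_sections[OF R U f C]]
 have "DD k (pd C f) I S w = DD k (restr R U (pd C f)) I S w" for k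
  by(rule DD_local[OF R U S w]) (simp add: restr_apply)
 then have d: "pd C (DD k f) I S w = DD k (restr R U (pd C f)) I S w" for k
  using DD_pd[OF R U S w h C, of k I] by simp
 have os: "odd_shift (low C *v y) S $ k = (SU j. C $ k $ j * y $ Inl j)" for k
  by(simp add: odd_shift_nth low_mult_vec)
 have 1: "pd C (O1 y f) I S w = O1 y (restr R U (pd C f)) I S w - O1 (low C *v y) f I S w"
 proof -
  have "pd C (O1 y f) I S w = (SU k. odd_shift y S $ k * pd C (DD k f) I S w + - (SU j. C $ k $ j * y $ Inl j) * DD k f I S w)"
   unfolding O1_def
   by(simp only: pd_sum[OF R U S w] pd_mult[OF R U S w] hs h C holo_on_odd_shift ddir_odd_shift[OF C U_symm[OF R U S]])
  then show ?thesis unfolding d O1_def os by(simp add: sum_subtractf)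
 qed
 have 2: "pd C (O2 y f) I S w = O2 y (restr R U (pd C f)) I S w"
 proof -
  have "pd C (O2 y f) I S w = (SU j k. y $ Inl j * pd C (theta j (theta k (dtheta k f))) I S w)"
   unfolding O2_def by(simp only: pd_sum[OF R U S w] pd_cmult[OF R U S w] hs h C)
  then show ?thesis
   by(simp add: O2_def pd_theta[OF R U S w] pd_dtheta[OF R U S w] hs h C theta_th dtheta_dt restr_apply S w)
 qed
 have 3: "pd C (O3 R y f) I S w = O3 R y (restr R U (pd C f)) I S w"
 proof -
  have "pd C (O3 R y f) I S w = (SU i k. y $ Inl i * pd C (theta k (rho R i k f)) I S w)"
   unfolding O3_def by(simp only: pd_sum[OF R U S w] pd_cmult[OF R U S w] hs h C)
  then show ?thesis
   by(simp add: O3_def pd_theta[OF R U S w] hs h C theta_th pd_rho[OF R U S w] rho_apply restr_apply S gl_moduleD(3)[OF R w])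
 qed
 have "pd C (act_super R (Od y) f) I S w = pd C (\<lambda>I S w. - O1 y f I S w - (1/2) * O2 y f I S w - O3 R y f I S w) I S w"
  by(rule pd_local[OF R U S w _ C]) (rule act_Od_expand[OF R U h])
 also have "... = - pd C (O1 y f) I S w - (1/2) * pd C (O2 y f) I S w - pd C (O3 R y f) I S w"
  by(simp only: pd_diff[OF R U S w] pd_uminus[OF R U S w] pd_cmult[OF R U S w] hol_O[OF R U h] hol_diff hol_uminus hol_cmult C)
 finally show ?thesis
  unfolding 1 2 3 act_Od_expand[OF R U h S w] act_Od_expand[OF R U hc S w]
  by(simp add: O2_def O3_def low_mult_vec)
qed

lemma act_q_vector:
 assumes b: "!!i. b $ Inl i = 0" and f: "hol R U f" and S: "S \<in> U" and w: "w \<in> gspace R"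
 shows "act_super R (Od b) f I S w = - (SU l. b $ Inr l * DD l f I S w)"
 unfolding act_Od_expand[OF R U f S w] by(simp add: O1_def O2_def O3_def odd_shift_nth b)

lemma restr_act_q_vector:
 assumes b: "!!i. b $ Inl i = 0" and f: "f \<in> sections R U"
 shows "restr R U (act_super R (Od b) f) = (\<lambda>I S w. SU l. - b $ Inr l * restr R U (DD l f) I S w)"
proof (intro ext)
 fix I S w
 show "restr R U (act_super R (Od b) f) I S w = (SU l. - b $ Inr l * restr R U (DD l f) I S w)"
  by(cases "S \<in> U & w \<in> gspace R")
   (auto simp: restr_def act_q_vector[OF b sections_hol[OF f]] sum_negf simp del: act_super.simps)
qed

text \<open>The residual terms of \<open>DD_act_Ev\<close>, weighted by the coordinates of
  \<open>b\<close>, form the action of the odd vector \<open>- (M *v b)\<close>: with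
  \<open>h = frame_h M S\<close> and \<open>B\<close> the \<open>pq\<close>-block, its
  \<open>odd_shift\<close> is \<open>b^t h\<close> and its \<open>p\<close>-part is
  \<open>- B b\<close>.\<close>

lemma q_act_Ev:
 assumes b: "!!i. b $ Inl i = 0" and M: "skew M" and f: "f \<in> sections R U" and S: "S \<in> U" and w: "w \<in> gspace R"
 shows "act_super R (Od b) (restr R U (act_super R (Ev M) f)) I S w
  = act_super R (Ev M) (restr R U (act_super R (Od b) f)) I S w + act_super R (Od (- (M *v b))) f I S w"
proof -
 let ?h = "frame_h M S" and ?B = "pq_block M"
 have X: "Ev M \<in> osp_alg" using M by simp
 note h = sections_hol[OF f]
 note Ss = U_symm[OF R U S]
 have s: "S $ a $ c = S $ c $ a" for a c using Ss symm_iff by blast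
 have Mb: "(M *v b) $ Inl i = (SU l. ?B $ i $ l * b $ Inr l)" "(M *v b) $ Inr i = - (SU l. pp_block M $ l $ i * b $ Inr l)" for i
 proof -
  have "(M *v b) $ Inr i = (SU l. qq_block M $ i $ l * b $ Inr l)" 
   by(simp add: matrix_vector_mult_def sum_sum_type b qq_block_def)
  then show "(M *v b) $ Inr i = - (SU l. pp_block M $ l $ i * b $ Inr l)"
   by(simp add: skew_blocks(3)[OF M] sum_negf)
  show "(M *v b) $ Inl i = (SU l. ?B $ i $ l * b $ Inr l)"
   by(simp add: matrix_vector_mult_def sum_sum_type b pq_block_def)
 qed
 have a: "(- (M *v b)) $ Inl i = - (SU l. b $ Inr l * ?B $ i $ l)" for i
  by(simp add: Mb mult.commute)
 have c: "odd_shift (- (M *v b)) S $ k = (SU l. b $ Inr l * ?h $ l $ k)" for k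
 proof -
  have "(SU j. S $ k $ j * (SU l. b $ Inr l * ?B $ j $ l)) = (SU l. b $ Inr l * (SU j. ?B $ l $ j * S $ j $ k))"
   unfolding sum_distrib_left
   by(subst sum.swap) (intro sum.cong refl, simp add: s[of k] skew_blocks(1)[OF M, of _ "_"] mult.left_commute mult.commute)
  then show ?thesis
   unfolding odd_shift_nth a by(simp add: Mb(2) sum_negf frame_h_nth distrib_left sum.distrib mult.commute)
 qed
 let ?th2 = "\<lambda>i j. th j (th i (dt j (fib f S w))) I" and ?r = "\<lambda>i j. th j (fib (rho R i j f) S w) I"
 have K: "DD l (act_super R (Ev M) f) I S w = act_super R (Ev M) (restr R U (DD l f)) I S w
  + (SU k. ?h $ l $ k * DD k f I S w)
  + (1/2) * (SU i j. ?B $ i $ l * ?th2 i j) - (SU i j. ?B $ i $ l * ?r i j)" for l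
  by(rule DD_act_Ev[OF R U M S w f sections_DD[OF f]])
 have d: "DD l (restr R U (act_super R (Ev M) f)) I S w = DD l (act_super R (Ev M) f) I S w" for l
  by(rule DD_local[OF R U S w]) (simp only: restr_apply)
 have L: "act_super R (Od b) (restr R U (act_super R (Ev M) f)) I S w
   = - (SU l. b $ Inr l * act_super R (Ev M) (restr R U (DD l f)) I S w)
   - (SU l. b $ Inr l * (SU k. ?h $ l $ k * DD k f I S w))
   - (1/2) * (SU l. b $ Inr l * (SU i. ?B $ i $ l * (SU j. ?th2 i j)))
   + (SU l. b $ Inr l * (SU i. ?B $ i $ l * (SU j. ?r i j)))"
  unfolding act_q_vector[OF b sections_hol[OF sections_act_super[OF f X]] S w] d K
  by(simp add: distrib_left right_diff_distrib sum.distrib sum_subtractf sum_distrib_left mult.left_commute del: act_super.simps)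
 have E: "act_super R (Ev M) (restr R U (act_super R (Od b) f)) I S w
   = - (SU l. b $ Inr l * act_super R (Ev M) (restr R U (DD l f)) I S w)"
  unfolding restr_act_q_vector[OF b f]
  by(subst act_super_sum[OF X S w sections_DD[OF f] finite_class.finite_UNIV])  (simp add: sum_negf del: act_super.simps)
 have N: "act_super R (Od (- (M *v b))) f I S w = - (SU k. (SU l. b $ Inr l * ?h $ l $ k) * DD k f I S w)
   - (1/2) * (SU i. (SU l. b $ Inr l * ?B $ i $ l) * (SU j. ?th2 i j))
   + (SU i. (SU l. b $ Inr l * ?B $ i $ l) * (SU j. ?r i j))"
 proof -
  \<comment> \<open>\<open>O2\<close> contains the two \<open>th\<close> in the opposite order,
    which accounts for the sign.\<close>
  have "theta i (theta j (dtheta j f)) I S w = - ?th2 i j" for i j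
   unfolding theta_th dtheta_dt by(subst th_th) simp
  then show ?thesis
   unfolding act_Od_expand[OF R U h S w] O1_def O2_def O3_def a c
   by(simp add: sum_negf sum_distrib_left theta_th)
 qed
 show ?thesis
  unfolding L E N sum_bilinear_swap by simp
qed

text \<open>Since \<open>b\<close> has no \<open>p\<close>-part, \<open>quad b y\<close> has no
  \<open>pq\<close>-block, and its action has no term quadratic in the \<open>\<theta>\<close>s. Its
  other coefficients are products of entries of \<open>b\<close> with entries of \<open>y\<close> or
  of \<open>odd_shift y S\<close>, which match the residual terms of
  \<open>DD_act_Od\<close>.\<close>

lemma q_act_Od:
 assumes b: "!!i. b $ Inl i = 0" and f: "f \<in> sections R U" and S: "S \<in> U" and w: "w \<in> gspace R"
 shows "act_super R (Od b) (restr R U (act_super R (Od y) f)) I S w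
  = - act_super R (Od y) (restr R U (act_super R (Od b) f)) I S w + act_super R (Ev (quad b y)) f I S w"
proof -
 let ?M = "quad b y" and ?c = "odd_shift y S"
 have X: "Od y \<in> osp_alg" by simp
 have M: "skew ?M" by(rule skew_quad)
 note h = sections_hol[OF f]
 note Ss = U_symm[OF R U S]
 have s: "S $ a $ c = S $ c $ a" for a c using Ss symm_iff by blast
 have fh: "frame_h ?M S $ i $ k = - (y $ Inl i * b $ Inr k)" for i k
  by(simp add: frame_h_nth quad_q_entries[OF b] mult.commute)
 have fd: "frame_delta ?M S $ i $ k = - (b $ Inr i * ?c $ k) - b $ Inr k * ?c $ i" for i k
 proof -
  have "(SU j. y $ Inl j * b $ Inr i * S $ j $ k) = b $ Inr i * (SU j. S $ k $ j * y $ Inl j)"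
   unfolding sum_distrib_left by(intro sum.cong refl) (simp add: s[of k])
  moreover have "(SU j. S $ i $ j * - (y $ Inl j * b $ Inr k)) = - (b $ Inr k * (SU j. S $ i $ j * y $ Inl j))"
   unfolding sum_distrib_left sum_negf[symmetric] by(intro sum.cong refl) simp
  ultimately show ?thesis
   unfolding frame_delta_nth fh quad_q_entries[OF b] odd_shift_nth by(simp add: algebra_simps)
 qed
 \<comment> \<open>Written in the \<open>Esym (k, l)\<close>, the vector field of
   \<open>quad b y\<close> becomes the derivative term left over by
   \<open>DD_act_Od\<close>.\<close>
 have D: "frame_delta ?M S = (SU l k. mscale (- 2 * (b $ Inr l * ?c $ k)) (Esym (k, l)))"
 proof -
  have "(SU l k. mscale (- 2 * (b $ Inr l * ?c $ k)) (Esym (k, l))) $ i $ j = - (b $ Inr i * ?c $ j) - b $ Inr j * ?c $ i" for i j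
  proof -
   have "(SU k. mscale (- 2 * (b $ Inr l * ?c $ k)) (Esym (k, l))) $ i $ j
    = (if i = l then - (b $ Inr l * ?c $ j) else 0) + (if j = l then - (b $ Inr l * ?c $ i) else 0)" for l
    unfolding Esym_swap[of _ l] sum_half_delta_Esym by simp
   then show ?thesis unfolding sum_component by(simp add: sum.distrib)
  qed
  then show ?thesis unfolding vec_eq_iff fd by simp
 qed
 have dd: "ddir (frame_delta ?M S) (sl f I w) S = - 2 * (SU l. b $ Inr l * (SU k. ?c $ k * pd (Esym (k, l)) f I S w))"
 proof -
  have e: "ddir (SU l k. mscale (e l k) (Esym (k, l))) (sl f I w) S
    = (SU l k. e l k * pd (Esym (k, l)) f I S w)" for e :: "'n => 'n => complex"
   using sectionsD(5)[OF f w, of I]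
   by(simp add: holo_on_ddir_sum[OF _ U S] holo_on_ddir_mscale[OF _ U S] symm_sum pd_def)
  show ?thesis unfolding D e by(simp add: sum_distrib_left mult.assoc)
 qed
 have K: "DD l (act_super R (Od y) f) I S w = - act_super R (Od y) (restr R U (DD l f)) I S w
  - 2 * (SU k. ?c $ k * pd (Esym (k, l)) f I S w)
  + (SU j. y $ Inl j * th j (dt l (fib f S w)) I) - (SU i. y $ Inl i * rho R i l f I S w)" for l
  by(rule DD_act_Od[OF R U S w f sections_DD[OF f]])
 have d: "DD l (restr R U (act_super R (Od y) f)) I S w = DD l (act_super R (Od y) f) I S w" for l
  by(rule DD_local[OF R U S w]) (simp only: restr_apply)
 have L: "act_super R (Od b) (restr R U (act_super R (Od y) f)) I S w
   = (SU l. b $ Inr l * act_super R (Od y) (restr R U (DD l f)) I S w)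
   + 2 * (SU l. b $ Inr l * (SU k. ?c $ k * pd (Esym (k, l)) f I S w))
   - (SU l. b $ Inr l * (SU j. y $ Inl j * th j (dt l (fib f S w)) I))
   + (SU l. b $ Inr l * (SU i. y $ Inl i * rho R i l f I S w))"
  unfolding act_q_vector[OF b sections_hol[OF sections_act_super[OF f X]] S w] d K
  by(simp add: distrib_left right_diff_distrib sum.distrib sum_subtractf sum_negf sum_distrib_left[symmetric] mult.left_commute del: act_super.simps)
 have E: "act_super R (Od y) (restr R U (act_super R (Od b) f)) I S w
   = - (SU l. b $ Inr l * act_super R (Od y) (restr R U (DD l f)) I S w)"
  unfolding restr_act_q_vector[OF b f]
  by(subst act_super_sum[OF X S w sections_DD[OF f] finite_class.finite_UNIV])  (simp add: sum_negf del: act_super.simps)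
 have N: "act_super R (Ev ?M) f I S w
  = 2 * (SU l. b $ Inr l * (SU k. ?c $ k * pd (Esym (k, l)) f I S w))
   - (SU l. b $ Inr l * (SU j. y $ Inl j * th j (dt l (fib f S w)) I))
   + (SU l. b $ Inr l * (SU i. y $ Inl i * rho R i l f I S w))"
 proof -
  have e1: "f I S (gact R (frame_h ?M S) w) = (SU i k. - (y $ Inl i * b $ Inr k) * rho R i k f I S w)"
   using section_gact[OF R f S w, of I "frame_h ?M S"] unfolding fh rho_apply .
  have sw: "(SU i k. - (y $ Inl i * b $ Inr k) * F i k) = - (SU l. b $ Inr l * (SU i. y $ Inl i * F i l))"
   for F :: "'n => 'n => complex"
   by(subst sum.swap) (simp add: sum_negf sum_distrib_left mult.assoc mult.left_commute)
  show ?thesis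
   unfolding act_super_Ev even_act_def extra_act_def dd e1 fh quad_q_entries(2)[OF b] sw theta_th dtheta_dt by simp
 qed
 show ?thesis unfolding L E N by simp
qed

end

section \<open>Evaluation of the components at the origin\<close>

definition pre :: "'n::finite osp => ('n osp list \<Rightarrow>\<^sub>0 complex) => ('n osp list \<Rightarrow>\<^sub>0 complex)" where
 "pre X = push (\<lambda>u. single (X # u) 1)"

lemma tw_pre: "tw (pre X t) w = prep [X] (tw t w)"
 by(simp add: tw_def pre_def prep_def push_push word_def fs.scale_one)

lemma tw_diff: "tw (s - t) w = tw s w - tw t w"
 and tw_fscale: "tw (fscale c t) w = fscale c (tw t w)"
 and tw_Sum: "tw (sum T A) w = (\<Sum>a\<in>A. tw (T a) w)"
 by(simp_all add: tw_def push_diff push_fscale push_sum)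

lemma keys_pre: "keys (pre X t) <= (#) X ` keys t"
proof
 fix v assume v: "v \<in> keys (pre X t)"
 then have "lookup (pre X t) v \<noteq> 0" by(simp add: in_keys_iff)
 then have "(\<Sum>u\<in>keys t. lookup t u * (1 when X # u = v)) \<noteq> 0"
  by(simp add: pre_def push_def lookup_sum lookup_fscale lookup_single)
 then obtain u where "u \<in> keys t" "lookup t u * (1 when X # u = v) \<noteq> 0"
  by(meson sum.neutral)
 then show "v \<in> (#) X ` keys t" by(auto simp: when_def split: if_splits)
qed

text \<open>Obtained by solving for a component. At a set \<open>J\<close> of indices above
  \<open>k\<close>, the field \<open>DD k\<close> yields the component at \<open>insert k J\<close>
  plus derivatives of the components at \<open>J - {j}\<close>, and the subtracted sum removes the
  latter. Taking \<open>k\<close> minimal makes the sign of inserting it 1; the power of -1 undoes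
  the sign that the pairing attaches to an odd letter.\<close>

function tau :: "'n::{finite,linorder} set => ('n osp list \<Rightarrow>\<^sub>0 complex)" where
 "tau I = (if I = {} then single [] 1
  else fscale ((- 1) ^ card (I - {Min I})) (pre (Od (qE (Min I))) (tau (I - {Min I})))
    - (\<Sum>j\<in>I - {Min I}. fscale (theta_sign j (I - {Min I})) (pre (lowE (j, Min I)) (tau (I - {Min I} - {j})))))"
 by auto
termination
proof (relation "inv_image less_than card")
 fix I :: "'n::{finite,linorder} set" and j assume "I \<noteq> {}"
 then have "Min I \<in> I" by(intro Min_in) auto
 then show "(I - {Min I}, I) \<in> inv_image less_than card"
  using card_Diff1_less[OF finite, of "Min I" I] by(simp del: card_Diff_singleton)
 then show "(I - {Min I} - {j}, I) \<in> inv_image less_than card"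
  using card_mono[of "I - {Min I}" "I - {Min I} - {j}"] by(simp add: Diff_subset del: card_Diff_singleton)
qed simp

declare tau.simps [simp del]

lemma tau_empty [simp]: "tau {} = single [] 1"
 by(simp add: tau.simps)

lemma tau_insert:
 assumes "\<forall>i\<in>J. k < i"
 shows "tau (insert k J) = fscale ((- 1) ^ card J) (pre (Od (qE k)) (tau J))
  - (\<Sum>j\<in>J. fscale (theta_sign j J) (pre (lowE (j, k)) (tau (J - {j}))))"
proof -
 have "Min (insert k J) = k" using assms by(intro Min_eqI) (auto intro: less_imp_le)
 moreover have "insert k J - {k} = J" using assms by auto
 ultimately show ?thesis by(subst tau.simps) simp
qed

text \<open>The hypothesis covers all sets of at most the size of \<open>J\<close>, because
  \<open>tau\<close> recurs to \<open>J\<close> and also to the sets \<open>J - {j}\<close>, which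
  need not arise by removing minima.\<close>

lemma finite_min_induct [case_names empty insert]:
 fixes I :: "'n::{finite,linorder} set"
 assumes "P {}" and step: "!!k J. \<forall>i\<in>J. k < i ==> (!!K. card K <= card J ==> P K) ==> P (insert k J)"
 shows "P I"
proof (induction "card I" arbitrary: I rule: less_induct)
 case less
 show ?case
 proof (cases "I = {}")
  case False
  then have m: "Min I \<in> I" by(intro Min_in) auto
  have lt: "\<forall>i\<in>I - {Min I}. Min I < i" using Min_le[of I] by(auto simp: less_le)
  have c: "card (I - {Min I}) < card I" by(rule card_Diff1_less[OF finite m])
  have "P (insert (Min I) (I - {Min I}))"
   by(rule step[OF lt]) (use c less in \<open>auto intro: le_less_trans simp del: card_Diff_singleton\<close>)
  then show ?thesis using m by(simp add: insert_absorb)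
 qed (use assms in simp)
qed

definition negS :: "'n::finite osp set" where
 "negS = Ev ` low ` symm \<union> Od ` {b. \<forall>i. b $ Inl i = 0}"

lemma negS_low: "C \<in> symm ==> Ev (low C) \<in> negS"
 by(simp add: negS_def)

lemma negS_lowE: "lowE v \<in> negS"
 by(simp add: lowE_def negS_low)

lemma negS_qE: "Od (qE k) \<in> negS"
 by(simp add: negS_def qE_def axis_def)

lemma negS_alg: "X \<in> negS ==> X \<in> osp_alg"
 using skew_low by(auto simp: negS_def)

lemma tau_keys: "u \<in> keys (tau I) ==> u \<in> lists negS & (odd (length (filter is_odd u)) \<longleftrightarrow> odd (card I))"
proof (induction I arbitrary: u rule: finite_min_induct)
 case (insert k J)
 let ?A = "pre (Od (qE k)) (tau J)" and ?B = "\<lambda>j. pre (lowE (j, k)) (tau (J - {j}))"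
 have "keys (tau (insert k J)) <= keys ?A \<union> (\<Union>j\<in>J. keys (?B j))"
 proof -
  have "keys (\<Sum>j\<in>J. fscale (theta_sign j J) (?B j)) <= (\<Union>j\<in>J. keys (?B j))"
   using keys_sum[of "\<lambda>j. fscale (theta_sign j J) (?B j)" J] keys_fscale by fastforce
  moreover have "keys (fscale ((- 1) ^ card J) ?A) <= keys ?A" by(rule keys_fscale)
  ultimately show ?thesis
   unfolding tau_insert[OF insert(1)]
   using keys_diff[of "fscale ((- 1) ^ card J) ?A" "\<Sum>j\<in>J. fscale (theta_sign j J) (?B j)"] by blast
 qed
 then consider "u \<in> keys ?A" | j where "j \<in> J" "u \<in> keys (?B j)" using insert.prems by blast
 then show ?case
 proof cases
  case 1
  then obtain v where v: "v \<in> keys (tau J)" "u = Od (qE k) # v" using keys_pre by blast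
  have "k \<notin> J" using insert(1) by blast
  then show ?thesis using insert.IH[OF _ v(1)] v(2) negS_qE by simp
 next
  case (2 j)
  then obtain v where v: "v \<in> keys (tau (J - {j}))" "u = lowE (j, k) # v" using keys_pre by blast
  have "k \<notin> J" using insert(1) by blast
  moreover have "card J = Suc (card (J - {j}))" using 2 by(metis card.remove finite)
  moreover have "v \<in> lists negS & (odd (length (filter is_odd v)) \<longleftrightarrow> odd (card (J - {j})))"
   by(rule insert.IH[OF _ v(1)]) (simp add: card_mono)
  ultimately show ?thesis using v(2) negS_lowE by simp
 qed
qed simp

lemma super_simps [simp]: "alg super = osp_alg" "par super = osp_par" "body super = {}" "sact super = act_super"
 by(simp_all add: super_def)

context
 fixes R :: "('n::{finite,linorder}, 'w::ab_group_add) glmod" and U :: "'n mat set"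
 assumes R: "gl_module R" and U: "U \<in> osym" and 0: "0 \<in> U"
begin

lemma jet_word_super_local:
 "u \<in> lists osp_alg ==> w \<in> gspace R ==> (!!I S w. S \<in> U ==> w \<in> gspace R ==> f I S w = g I S w) ==>
  jet_word super R u f w = jet_word super R u g w"
proof (induction u arbitrary: f g)
 case Nil
 then show ?case using 0 by simp
next
 case (Cons X u)
 have "jet_word super R u (act_super R X f) w = jet_word super R u (act_super R X g) w"
  by(rule Cons.IH) (use Cons.prems act_super_local[OF R U Cons.prems(3)] in auto)
 then show ?case by simp
qed

lemma jet_pair_pre:
 assumes X: "X \<in> osp_alg" and t: "!!u. u \<in> keys t ==> u \<in> lists osp_alg & (odd (length (filter is_odd u)) \<longleftrightarrow> p)"
  and w: "w \<in> gspace R"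
 shows "jet_pair super R (tw (pre X t) w) f
  = - (if is_odd X & p then - 1 else 1) * jet_pair super R (tw t w) (restr R U (act_super R X f))"
proof -
 have "jet_pair super R (tw (pre X t) w) f = lin_ext (\<lambda>u. jet_word super R (X # u) f w) t"
  unfolding jet_pair_tw pre_def lin_ext_push by simp
 also have "... = lin_ext (\<lambda>u. - (if is_odd X & p then - 1 else 1) * jet_word super R u (restr R U (act_super R X f)) w) t"
 proof (rule lin_ext_cong)
  fix u assume "u \<in> keys t"
  note u = t[OF this]
  have "jet_word super R u (act_super R X f) w = jet_word super R u (restr R U (act_super R X f)) w"
   by(rule jet_word_super_local) (use u w in \<open>auto simp: restr_apply\<close>)
  then show "jet_word super R (X # u) f w = - (if is_odd X & p then - 1 else 1) * jet_word super R u (restr R U (act_super R X f)) w"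
   using u by simp
 qed
 finally show ?thesis
  unfolding jet_pair_tw by(simp add: lin_ext_def sum_distrib_left mult.left_commute)
qed

lemma tau_pair:
 assumes "f \<in> sections R U" "w \<in> gspace R"
 shows "jet_pair super R (tw (tau I) w) f = f I 0 w"
 using assms(1)
proof (induction I arbitrary: f rule: finite_min_induct)
 case empty
 show ?case by(simp add: tw_def fs.scale_one)
next
 case (insert k J)
 note f = insert.prems and w = assms(2)
 have tk: "u \<in> lists osp_alg & (odd (length (filter is_odd u)) \<longleftrightarrow> odd (card K))" if "u \<in> keys (tau K)" for K u
  using tau_keys[OF that] lists_mono[of negS osp_alg] negS_alg by blast
 have kJ: "k \<notin> J" using insert(1) by blast
 have ts: "theta_sign k J = 1"
 proof -
  have "{i \<in> J. i < k} = {}" using insert(1) by(auto dest: less_asym)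
  then show ?thesis unfolding theta_sign_def by(simp only: card.empty power_0)
 qed
 have qb: "qE k $ Inl i = 0" for i by(simp add: qE_def axis_def)
 have "act_super R (Od (qE k)) f J 0 w = - (SU l. qE k $ Inr l * DD l f J 0 w)"
  by(rule act_q_vector[OF R U qb sections_hol[OF f] 0 w])
 also have "(SU l. qE k $ Inr l * DD l f J 0 w) = (SU l. if l = k then DD l f J 0 w else 0)"
  by(rule sum.cong) (auto simp: qE_def axis_def)
 finally have q: "act_super R (Od (qE k)) f J 0 w = - DD k f J 0 w" by simp
 have 1: "jet_pair super R (tw (pre (Od (qE k)) (tau J)) w) f = (- 1) ^ card J * DD k f J 0 w"
 proof -
  have "jet_pair super R (tw (tau J) w) (restr R U (act_super R (Od (qE k)) f)) = restr R U (act_super R (Od (qE k)) f) J 0 w"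
   by(rule insert.IH[OF le_refl sections_act_super[OF R U f]]) simp
  also have "... = - DD k f J 0 w" unfolding restr_apply[OF 0 w] q ..
  finally show ?thesis
   by(subst jet_pair_pre[OF _ tk w]) auto
 qed
 have 2: "jet_pair super R (tw (pre (lowE (j, k)) (tau (J - {j}))) w) f = pd (Esym (j, k)) f (J - {j}) 0 w" for j
 proof -
  have a: "lowE (j, k) \<in> osp_alg" by(rule negS_alg[OF negS_lowE])
  have "jet_pair super R (tw (tau (J - {j})) w) (restr R U (act_super R (lowE (j, k)) f)) = restr R U (act_super R (lowE (j, k)) f) (J - {j}) 0 w"
   by(rule insert.IH[OF _ sections_act_super[OF R U f a]]) (simp add: card_mono)
  also have "... = - pd (Esym (j, k)) f (J - {j}) 0 w"
   unfolding restr_apply[OF 0 w] lowE_def by(rule act_super_low[OF R U f 0 w])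
  finally show ?thesis
   by(subst jet_pair_pre[OF a tk w]) auto
 qed
 have D: "DD k f J 0 w = f (insert k J) 0 w + (\<Sum>j\<in>J. theta_sign j J * pd (Esym (j, k)) f (J - {j}) 0 w)"
 proof -
  have "(SU j. th j (\<lambda>I. pd (Esym (j, k)) f I 0 w) J) = (\<Sum>j\<in>J. th j (\<lambda>I. pd (Esym (j, k)) f I 0 w) J)"
   by(rule sum.mono_neutral_right) (auto simp: th_def)
  then show ?thesis using kJ by(simp add: DD_def dt_def ts th_def)
 qed
 have "jet_pair super R (tw (tau (insert k J)) w) f = (- 1) ^ card J * ((- 1) ^ card J * DD k f J 0 w)
   - (\<Sum>j\<in>J. theta_sign j J * pd (Esym (j, k)) f (J - {j}) 0 w)"
  unfolding tau_insert[OF insert(1)] tw_diff tw_fscale tw_Sum jet_pair_diff jet_pair_fscale 1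
  by(simp add: jet_pair_lin_ext lin_ext_sum lin_ext_fscale 2[unfolded jet_pair_lin_ext])
 then show ?case unfolding D by(simp flip: power_add mult.assoc mult_2)
qed

end

section \<open>Spanning\<close>

lemma quad_q_low:
 assumes b: "!!i. b $ Inl i = 0" and y: "!!i. y $ Inl i = 0"
 shows "\<exists>C\<in>symm. quad b y = low C"
proof (rule bexI[of _ "qp_block (quad b y)"])
 show "quad b y = low (qp_block (quad b y))"
  unfolding vec_eq_iff
 proof (intro allI)
  fix a c :: "'a + 'a"
  show "quad b y $ a $ c = low (qp_block (quad b y)) $ a $ c"
   by(cases a; cases c) (simp_all add: low_def qp_block_def quad_def omega_pE omega_qE b y)
 qed
qed (rule qp_block_symm[OF skew_quad])

context
 fixes R :: "('n::{finite,linorder}, 'w::ab_group_add) glmod"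
 assumes R: "gl_module R"
begin

abbreviation "NN \<equiv> ind_null osp_alg osp_par R"
abbreviation "SS \<equiv> ind_space osp_alg R"

text \<open>The span of the \<open>tau K\<close> with \<open>K\<close> inside \<open>A\<close>;
  replacing the others by 0 keeps it an instance of \<open>tspan\<close>. Keeping track of
  \<open>A\<close> tells when an index lies below all those that occur, so that the recursion of
  \<open>tau\<close> applies.\<close>

definition tsp :: "'n set => ('n, 'w) tens set" where
 "tsp A = tspan osp_alg osp_par R (\<lambda>K. if K <= A then tau K else 0)"

lemma subspace_tsp: "fs.subspace (tsp A)"
 unfolding tsp_def by(rule subspace_tspan)

lemma NN_tsp: "NN <= tsp A"
 unfolding tsp_def using null_tspan by blast

lemma tsp_gen: "K <= A ==> w \<in> gspace R ==> lowp l (tw (tau K) w) \<in> tsp A"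
 unfolding tsp_def using tw_tspan[of w R l "\<lambda>K. if K <= A then tau K else 0" K] by simp

lemma tsp_tau: "K <= A ==> w \<in> gspace R ==> tw (tau K) w \<in> tsp A"
 using tsp_gen[of K A w "[]"] by simp

lemma tau_space: "w \<in> gspace R ==> tw (tau K) w \<in> SS"
 unfolding tw_def
proof (rule push_in_subspace[OF ind_space_subspace])
 fix u assume "u \<in> keys (tau K)" "w \<in> gspace R"
 then show "word u w \<in> SS" using tau_keys[of u K] lists_mono[of negS osp_alg] negS_alg by(blast intro: word_ind_space)
qed

lemma tsp_minimal:
 assumes V: "fs.subspace V" and N: "NN <= V"
  and g: "!!l K w. K <= A ==> w \<in> gspace R ==> lowp l (tw (tau K) w) \<in> V"
 shows "tsp A <= V"
 unfolding tsp_def tspan_def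
proof (rule fs.span_minimal[OF Un_least[OF N] V], rule subsetI)
 fix x assume "x \<in> {lowp l (tw (if K <= A then tau K else 0) w) |l K w. w \<in> gspace R}"
 then obtain l K w where "x = lowp l (tw (if K <= A then tau K else 0) w)" "w \<in> gspace R" by blast
 then show "x \<in> V" using g[of K w l] fs.subspace_0[OF V] by(cases "K <= A") (simp_all add: tw_def)
qed

lemma tsp_mono: "A <= B ==> tsp A <= tsp B"
 by(rule tsp_minimal[OF subspace_tsp NN_tsp]) (blast intro: tsp_gen)

lemma low_tsp:
 assumes "C \<in> symm" "x \<in> tsp A"
 shows "prep [Ev (low C)] x \<in> tsp A"
 unfolding tsp_def
proof (rule prep_low_tspan[OF R _ _ assms(1) assms(2)[unfolded tsp_def]])
 show "keys (if K <= A then tau K else 0) <= lists osp_alg" for K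
  using tau_keys[of _ K] lists_mono[of negS osp_alg] negS_alg by auto
qed (simp add: skew_low)

lemma lowE_tsp: "x \<in> tsp A ==> lowp l x \<in> tsp A"
proof (induction l)
 case (Cons v l)
 then have "prep [lowE v] (lowp l x) \<in> tsp A" unfolding lowE_def[of v] by(intro low_tsp) simp_all
 then show ?case by(simp add: prep_prep)
qed simp

lemma prep_bracket:
 assumes X: "X \<in> osp_alg" "Y \<in> osp_alg" and y: "y \<in> SS"
 shows "prep [X, Y] y - fscale (ksign X Y) (prep [Y, X] y) - prep [bracket X Y] y \<in> NN"
proof (rule lin_ind_space[OF subspace_null _ _ _ y])
 fix u :: "'n osp list" and w assume "u \<in> lists osp_alg" "w \<in> gspace R"
 then show "prep [X, Y] (word u w) - fscale (ksign X Y) (prep [Y, X] (word u w)) - prep [bracket X Y] (word u w) \<in> NN"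
  using rel_br[of "[]" osp_alg u X Y w R osp_par] X by simp
qed (simp_all add: prep_add prep_fscale fs.scale_right_distrib fs.scale_right_diff_distrib mult.commute)

lemma prep_Od_null:
 assumes y: "y \<in> SS"
 shows "prep [Od (a *s b + c *s d)] y - fscale a (prep [Od b] y) - fscale c (prep [Od d] y) \<in> NN"
proof (rule lin_ind_space[OF subspace_null _ _ _ y])
 fix u :: "'n osp list" and w assume "u \<in> lists osp_alg" "w \<in> gspace R"
 then show "prep [Od (a *s b + c *s d)] (word u w) - fscale a (prep [Od b] (word u w)) - fscale c (prep [Od d] (word u w)) \<in> NN"
  using rel_od[of "[]" osp_alg u b d w R a c osp_par] by simp
qed (simp_all add: prep_add prep_fscale fs.scale_right_distrib fs.scale_right_diff_distrib mult.commute)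

lemma prep_Od_0: "y \<in> SS ==> prep [Od 0] y \<in> NN"
 using prep_Od_null[of y 0 0 0 0] by simp

lemma lowE_osp: "lowE v \<in> osp_alg"
 by(rule negS_alg[OF negS_lowE])

text \<open>A lower block matrix kills \<open>q_k\<close>, so the bracket is \<open>Od 0\<close>,
  and a word starting with \<open>Od 0\<close> is null.\<close>

lemma q_lowE_commute:
 assumes y: "y \<in> SS"
 shows "prep [Od (qE k)] (lowp l y) - lowp l (prep [Od (qE k)] y) \<in> NN"
proof (induction l)
 case Nil
 then show ?case by(simp add: fs.subspace_0[OF subspace_null])
next
 case (Cons v l)
 let ?z = "lowp l y"
 have z: "?z \<in> SS" by(rule prep_ind_space[OF _ y]) (use lowE_osp in auto)
 have "low (Esym v) *v qE k = 0"
  by(simp add: vec_eq_iff split_sum_all low_mult_vec qE_def axis_def)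
 then have "bracket (Od (qE k)) (lowE v) = Od 0" by(simp add: lowE_def)
 then have "prep [Od (qE k), lowE v] ?z - prep [lowE v, Od (qE k)] ?z \<in> NN"
  using fs.subspace_add[OF subspace_null prep_bracket[OF _ lowE_osp z, of "Od (qE k)" v] prep_Od_0[OF z]]
  by(simp add: ksign_def fs.scale_one)
 moreover have "prep [lowE v] (prep [Od (qE k)] ?z - lowp l (prep [Od (qE k)] y)) \<in> NN"
  by(rule prep_null[OF _ Cons.IH]) (use lowE_osp in simp)
 ultimately show ?case
  using fs.subspace_add[OF subspace_null] by(fastforce simp: prep_diff prep_prep)
qed

lemma q_on_tsp:
 assumes q: "!!K w. K <= A ==> w \<in> gspace R ==> prep [Od (qE k)] (tw (tau K) w) \<in> tsp B" and x: "x \<in> tsp A"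
 shows "prep [Od (qE k)] x \<in> tsp B"
proof -
 have "tsp A <= {x. prep [Od (qE k)] x \<in> tsp B}"
 proof (rule tsp_minimal[OF prep_preimage_subspace[OF subspace_tsp]])
  show "NN <= {x. prep [Od (qE k)] x \<in> tsp B}"
  proof
   fix x assume "x \<in> NN"
   from prep_null[OF _ this, of "[Od (qE k)]"] show "x \<in> {x. prep [Od (qE k)] x \<in> tsp B}"
    using NN_tsp by auto
  qed
  fix l K w assume K: "K <= A" and w: "w \<in> gspace R"
  have "lowp l (prep [Od (qE k)] (tw (tau K) w)) \<in> tsp B"
   by(rule lowE_tsp[OF q[OF K w]])
  then show "lowp l (tw (tau K) w) \<in> {x. prep [Od (qE k)] x \<in> tsp B}"
   using null_subst[OF q_lowE_commute[OF tau_space[OF w]] subspace_tsp NN_tsp] by blast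
 qed
 then show ?thesis using x by blast
qed

text \<open>The recursion for \<open>tau (insert k I)\<close> is solved for its leading
  term.\<close>

lemma q_tau_less:
 assumes k: "\<forall>i\<in>I. k < i" and w: "w \<in> gspace R"
 shows "prep [Od (qE k)] (tw (tau I) w) \<in> tsp (insert k I)"
proof -
 let ?s = "(- 1) ^ card I :: complex"
 let ?S = "\<Sum>j\<in>I. fscale (theta_sign j I) (prep [lowE (j, k)] (tw (tau (I - {j})) w))"
 have "tw (tau (insert k I)) w = fscale ?s (prep [Od (qE k)] (tw (tau I) w)) - ?S"
  unfolding tau_insert[OF k] tw_diff tw_fscale tw_Sum tw_pre ..
 then have "fscale ?s (fscale ?s (prep [Od (qE k)] (tw (tau I) w))) = fscale ?s (tw (tau (insert k I)) w + ?S)" by simp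
 then have e: "prep [Od (qE k)] (tw (tau I) w) = fscale ?s (tw (tau (insert k I)) w + ?S)"
  by(simp add: fs.scale_one flip: power_add mult_2)
 have "lowp [(j, k)] (tw (tau (I - {j})) w) \<in> tsp (insert k I)" for j
  by(rule tsp_gen[OF _ w]) blast
 then have "?S \<in> tsp (insert k I)"
  by(intro fs.subspace_sum[OF subspace_tsp] fs.subspace_scale[OF subspace_tsp]) simp
 then show ?thesis
  unfolding e by(intro fs.subspace_scale[OF subspace_tsp] fs.subspace_add[OF subspace_tsp] tsp_tau[OF _ w]) auto
qed

text \<open>If \<open>k\<close> is not below the minimum \<open>m\<close>, the letter
  \<open>q_k\<close> is exchanged with the \<open>q_m\<close> inside \<open>tau\<close>, their
  anticommutator being a lower element. For \<open>k = m\<close> this determines the square up to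
  the factor 1/2. For \<open>k > m\<close> the inner \<open>q_k\<close> leads to sets with all
  indices above \<open>m\<close>, where \<open>q_m\<close> is handled by the recursion.\<close>

lemma q_tau: "w \<in> gspace R ==> prep [Od (qE k)] (tw (tau I) w) \<in> tsp (insert k I)"
proof (induction I arbitrary: k w rule: finite_min_induct)
 case empty
 then show ?case by(intro q_tau_less) simp_all
next
 case (insert m J)
 note w = insert.prems
 have qb: "qE i $ Inl a = 0" for i a by(simp add: qE_def axis_def)
 show ?case
 proof (cases "k < m")
  case True
  then show ?thesis using insert(1) by(intro q_tau_less w) (auto intro: less_trans)
 next
  case False
  let ?T = "tsp (insert k (insert m J))"
  let ?y = "tw (tau J) w"
  have y: "?y \<in> SS" by(rule tau_space[OF w])
  have IHJ: "prep [Od (qE k)] ?y \<in> tsp (insert k J)" by(rule insert.IH[OF le_refl w])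
  obtain C where C: "C \<in> symm" "quad (qE k) (qE m) = low C" using quad_q_low[OF qb qb] by blast
  have low: "prep [bracket (Od (qE k)) (Od (qE m))] ?y \<in> ?T"
   unfolding bracket.simps C(2) by(intro low_tsp C tsp_tau w) blast
  have br: "prep [Od (qE k), Od (qE m)] ?y + prep [Od (qE m), Od (qE k)] ?y - prep [bracket (Od (qE k)) (Od (qE m))] ?y \<in> NN"
   using prep_bracket[OF _ _ y, of "Od (qE k)" "Od (qE m)"] by(simp add: ksign_def del: bracket.simps)
  have sum: "prep [Od (qE k), Od (qE m)] ?y + prep [Od (qE m), Od (qE k)] ?y \<in> ?T"
   using null_subst[OF br subspace_tsp NN_tsp] low by blast
  have qq: "prep [Od (qE k)] (prep [Od (qE m)] ?y) \<in> ?T"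
  proof (cases "k = m")
   case True
   have "fscale (1/2) (prep [Od (qE k), Od (qE m)] ?y + prep [Od (qE m), Od (qE k)] ?y) \<in> ?T"
    by(rule fs.subspace_scale[OF subspace_tsp sum])
   moreover have "fscale (1/2) (z + z) = z" for z :: "('n, 'w) tens"
    by(simp add: fs.scale_right_distrib fs.scale_one flip: fs.scale_left_distrib)
   ultimately show ?thesis using True by(simp add: prep_prep)
  next
   case False
   with \<open>\<not> k < m\<close> have mk: "m < k" by auto
   have "prep [Od (qE m)] (prep [Od (qE k)] ?y) \<in> ?T"
   proof (rule q_on_tsp[OF _ IHJ])
    fix K w assume K: "K <= insert k J" and w: "w \<in> gspace R"
    have "prep [Od (qE m)] (tw (tau K) w) \<in> tsp (insert m K)"
     by(rule q_tau_less[OF _ w]) (use K mk insert(1) in auto)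
    then show "prep [Od (qE m)] (tw (tau K) w) \<in> ?T" using tsp_mono[of "insert m K" "insert k (insert m J)"] K by blast
   qed
   then have "prep [Od (qE m), Od (qE k)] ?y \<in> ?T" by(simp add: prep_prep)
   from fs.subspace_diff[OF subspace_tsp sum this] show ?thesis by(simp add: prep_prep)
  qed
  have Eq: "prep [Od (qE k)] (prep [lowE (j, m)] (tw (tau (J - {j})) w)) \<in> ?T" if "j \<in> J" for j
  proof -
   have "prep [Od (qE k)] (tw (tau (J - {j})) w) \<in> tsp (insert k (J - {j}))"
    by(rule insert.IH[OF _ w]) (simp add: card_mono)
   then have "lowp [(j, m)] (prep [Od (qE k)] (tw (tau (J - {j})) w)) \<in> ?T"
    using tsp_mono[of "insert k (J - {j})" "insert k (insert m J)"] by(intro lowE_tsp) blast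
   then show ?thesis
    using null_subst[OF q_lowE_commute[OF tau_space[OF w], of k "[(j, m)]" "J - {j}"] subspace_tsp NN_tsp] by simp
  qed
  show ?thesis
   unfolding tau_insert[OF insert(1)] tw_diff tw_fscale tw_Sum tw_pre prep_diff prep_fscale prep_sum
   by(intro fs.subspace_diff[OF subspace_tsp] fs.subspace_sum[OF subspace_tsp] fs.subspace_scale[OF subspace_tsp] qq Eq)
 qed
qed

lemma tsp_UNIV: "tsp UNIV = tspan osp_alg osp_par R tau"
 by(simp add: tsp_def)

text \<open>Even letters are lower matrices and odd ones are combinations of the \<open>q_k\<close>;
  both preserve the span.\<close>

lemma negS_tspan: "u \<in> lists negS ==> w \<in> gspace R ==> word u w \<in> tspan osp_alg osp_par R tau"
 unfolding tsp_UNIV[symmetric]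
proof (induction u)
 case Nil
 show ?case using tsp_tau[of "{}" UNIV w] Nil.prems by(simp add: tw_def fs.scale_one)
next
 case (Cons X u)
 then have x: "word u w \<in> tsp UNIV" and u: "u \<in> lists osp_alg" using lists_mono[of negS osp_alg] negS_alg by auto
 then have s: "word u w \<in> SS" using Cons.prems by(intro word_ind_space)
 have q: "prep [Od (qE k)] (word u w) \<in> tsp UNIV" for k
  by(rule q_on_tsp[OF _ x]) (use q_tau[of _ k] tsp_mono[of _ UNIV] in blast)
 from Cons.prems(1) have "X \<in> negS" by simp
 then consider C where "C \<in> symm" "X = Ev (low C)" | b where "!!i. b $ Inl i = 0" "X = Od b" by(auto simp: negS_def)
 then have "prep [X] (word u w) \<in> tsp UNIV"
 proof cases
  case (1 C)
  then show ?thesis using low_tsp[OF _ x] by simp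
 next
  case (2 b)
  have "prep [Od (\<Sum>k\<in>A. b $ Inr k *s qE k)] (word u w) \<in> tsp UNIV" for A :: "'n set"
  proof (induction A rule: infinite_finite_induct)
   case (insert k F)
   have "fscale (b $ Inr k) (prep [Od (qE k)] (word u w)) + fscale 1 (prep [Od (\<Sum>k\<in>F. b $ Inr k *s qE k)] (word u w)) \<in> tsp UNIV"
    using insert q by(intro fs.subspace_add[OF subspace_tsp] fs.subspace_scale[OF subspace_tsp])
   moreover have "prep [Od (b $ Inr k *s qE k + 1 *s (\<Sum>k\<in>F. b $ Inr k *s qE k))] (word u w)
    - (fscale (b $ Inr k) (prep [Od (qE k)] (word u w)) + fscale 1 (prep [Od (\<Sum>k\<in>F. b $ Inr k *s qE k)] (word u w))) \<in> NN"
    using prep_Od_null[OF s] by(simp only: diff_diff_eq)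
   ultimately have "prep [Od (b $ Inr k *s qE k + 1 *s (\<Sum>k\<in>F. b $ Inr k *s qE k))] (word u w) \<in> tsp UNIV"
    by(simp only: null_subst[OF _ subspace_tsp NN_tsp])
   then show ?case using insert by simp
  qed (use prep_Od_0[OF s] NN_tsp in \<open>auto simp del: prep_word\<close>)
  moreover have "(SU k. b $ Inr k *s qE k) = b" using symp_expand[of b] 2(1) by simp
  ultimately show ?thesis using 2(2) by metis
 qed
 then show ?case by simp
qed

end

lemma act_super_neg:
 fixes R :: "('n::{finite,linorder}, 'w::ab_group_add) glmod"
 assumes R: "gl_module R" and U: "U \<in> osym" and X: "X \<in> negS" and Y: "Y \<in> osp_alg"
  and f: "f \<in> sections R U" and S: "S \<in> U" and w: "w \<in> gspace R"
 shows "act_super R X (restr R U (act_super R Y f)) I S w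
  = ksign X Y * act_super R Y (restr R U (act_super R X f)) I S w + act_super R (bracket X Y) f I S w"
proof -
 from X consider C where "C \<in> symm" "X = Ev (low C)" | b where "!!i. b $ Inl i = 0" "X = Od b" by(auto simp: negS_def)
 then show ?thesis
 proof cases
  case (1 C)
  have "act_super R X (restr R U (act_super R Y f)) I S w = - pd C (act_super R Y f) I S w"
   unfolding 1(2) act_super_low[OF R U sections_act_super[OF R U f Y] S w] pd_restr[OF R U S w 1(1)] ..
  moreover have "restr R U (act_super R X f) = lc 0 f (- 1) (restr R U (pd C f))"
   unfolding 1(2) by(intro ext) (simp add: restr_def act_super_low[OF R U f] del: act_super.simps)
  then have "act_super R Y (restr R U (act_super R X f)) I S w = - act_super R Y (restr R U (pd C f)) I S w"
   using act_super_lin[OF R U Y f pd_sections[OF R U f 1(1)] S w, of 0 "- 1"] by(simp del: act_super.simps)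
  moreover have "pd C (act_super R Y f) I S w = act_super R Y (restr R U (pd C f)) I S w - act_super R (bracket X Y) f I S w"
   using low_act_Ev[OF R U 1(1) _ f S w] low_act_Od[OF R U 1(1) f S w] Y 1(2) by(cases Y) (simp_all del: act_super.simps)
  moreover have "ksign X Y = 1" by(simp add: 1(2) ksign_def)
  ultimately show ?thesis by(simp del: act_super.simps)
 next
  case (2 b)
  show ?thesis
  proof (cases Y)
   case (Ev M)
   then have M: "skew M" using Y by simp
   show ?thesis
    unfolding Ev 2(2) using q_act_Ev[OF R U 2(1) M f S w, of I] by(simp add: ksign_def del: act_super.simps)
  next
   case (Od y)
   show ?thesis
    unfolding Od 2(2) using q_act_Od[OF R U 2(1) f S w, of y I] by(simp add: ksign_def del: act_super.simps)
  qed
 qed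
qed

lemma dual_setting_super:
 "dual_setting (super :: ('n set, 'n::{finite,linorder}, 'w::ab_group_add) setting) negS tau"
proof
 let ?s = "super :: ('n set, 'n, 'w) setting"
 show "negS <= alg ?s" using negS_alg by auto
 show "par ?s <= alg ?s"
 proof
  fix X :: "'n osp" assume "X \<in> par ?s"
  then show "X \<in> alg ?s" by(cases X) (auto simp: Ev_osp_par)
 qed
 show "bracket X Y \<in> alg ?s"
  if "X \<in> alg ?s" "Y \<in> alg ?s" for X Y
  using that by(cases X; cases Y) (auto intro: skew_bracket skew_quad)
 show "oadd X Y \<in> alg ?s"
  if "X \<in> alg ?s" "Y \<in> alg ?s" for X Y
  using that ms.subspace_add[OF subspace_skew] by(cases X; cases Y) auto
 show "oscale c X \<in> alg ?s" if "X \<in> alg ?s" for X c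
  using that ms.subspace_scale[OF subspace_skew] by(cases X) auto
 show "Ev (low B) \<in> negS" if "B \<in> symm" for B :: "'n mat" by(rule negS_low[OF that])
 show "\<exists>Y\<in>negS. \<exists>Z\<in>par ?s. is_odd Y = is_odd Z & X = oadd Y Z"
  if X: "X \<in> alg ?s" for X
 proof -
  from X have "X \<in> osp_alg" by simp
  from osp_decomposition[OF this] show ?thesis
  proof (elim disjE exE conjE)
   fix C M assume "C \<in> symm" "Ev M \<in> osp_par" "X = oadd (Ev (low C)) (Ev M)"
   then show ?thesis by(intro bexI[of _ "Ev (low C)"] bexI[of _ "Ev M"]) (simp_all add: negS_low)
  next
   fix y z assume "\<forall>i. y $ Inl i = 0" "z \<in> Lp" "X = oadd (Od y) (Od z)"
   then show ?thesis by(intro bexI[of _ "Od y"] bexI[of _ "Od z"]) (simp_all add: negS_def Ev_osp_par)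
  qed
 qed
 show "bracket X (bracket Y Z) = oadd (bracket (bracket X Y) Z) (oscale (ksign X Y) (bracket Y (bracket X Z)))"
  if "X \<in> alg ?s" "Y \<in> alg ?s"
   "Z \<in> alg ?s" for X Y Z
  by(rule bracket_jacobi) (use that in auto)
 show "bracket X Y \<in> par ?s"
  if "X \<in> par ?s" "Y \<in> par ?s" for X Y
  using that osp_par_bracket by simp
 show "par_act R X w \<in> gspace R" if "gl_module R" "w \<in> gspace R" for R :: "('n, 'w) glmod" and X w
  by(rule osp_par_act_closed[OF that])
 show "par_act R (bracket X Y) w = par_act R X (par_act R Y w) - gscale R (ksign X Y) (par_act R Y (par_act R X w))"
  if "gl_module R" "X \<in> par ?s" "Y \<in> par ?s" "w \<in> gspace R"
  for R :: "('n, 'w) glmod" and X Y w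
  using osp_par_act_bracket[OF that(1) _ _ that(4), of X Y] that by simp
 show "keys (tau I) <= lists negS" for I :: "'n set" using tau_keys by blast
 show "word u w \<in> tspan (alg ?s) (par ?s) R tau"
  if "gl_module R" "u \<in> lists negS" "w \<in> gspace R" for R :: "('n, 'w) glmod" and u w
  unfolding super_simps by(rule negS_tspan[OF that])
 fix R :: "('n, 'w) glmod" and U :: "'n mat set" and f :: "('n set, 'n, 'w) sect"
 assume R: "gl_module R" and U: "U \<in> osym"
 show "sact super R X f i S w = sact super R X g i S w"
  if "X \<in> alg ?s" "!!i S w. S \<in> U ==> w \<in> gspace R ==> f i S w = g i S w" "S \<in> U" "w \<in> gspace R" for X i S w g
  unfolding super_simps by(rule act_super_local[OF R U that(2)]) (use that in simp_all)
 assume f: "f \<in> sections R U"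
 show "restr R U (sact super R X f) \<in> sections R U" if "X \<in> alg ?s" for X
  using sections_act_super[OF R U f, of X] that by simp
 show "sact super R X (lc a f b g) i S w = a * sact super R X f i S w + b * sact super R X g i S w"
  if "X \<in> alg ?s" "g \<in> sections R U" "S \<in> U" "w \<in> gspace R" for X i S w g a b
  unfolding super_simps by(rule act_super_lin[OF R U _ f that(2-4)]) (use that in simp)
 show "sact super R (oadd X Y) f i S w = sact super R X f i S w + sact super R Y f i S w"
  if "X \<in> alg ?s" "Y \<in> alg ?s" "is_odd X = is_odd Y" "S \<in> U" "w \<in> gspace R" for X Y i S w
  unfolding super_simps by(rule act_super_oadd[OF R U _ _ that(3) f that(4,5)]) (use that in simp_all)
 show "sact super R (oscale c X) f i S w = c * sact super R X f i S w"
  if "X \<in> alg ?s" "S \<in> U" "w \<in> gspace R" for X i S w c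
  unfolding super_simps by(rule act_super_oscale[OF R U _ f that(2,3)]) (use that in simp)
 show "sact super R (Ev (low B)) f i S w = - ddir B (sl f i w) S" if "S \<in> U" "w \<in> gspace R" for B i S w
  using act_super_low[OF R U f that] unfolding super_simps pd_def .
 show "sact super R X (restr R U (sact super R Y f)) i S w
    = ksign X Y * sact super R Y (restr R U (sact super R X f)) i S w + sact super R (bracket X Y) f i S w"
  if "X \<in> negS" "Y \<in> alg ?s" "S \<in> U" "w \<in> gspace R" for X Y i S w
  unfolding super_simps by(rule act_super_neg[OF R U that(1) _ f that(3,4)]) (use that in simp)
 assume 0: "0 \<in> U"
 show "sact super R X f (body super) 0 w = - f (body super) 0 (par_act R X w)"
  if "X \<in> par ?s" "w \<in> gspace R" for X w
  unfolding super_simps by(rule act_super_par[OF R U _ f 0 that(2)]) (use that in simp)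
 show "jet_pair super R (tw (tau i) w) f = f i 0 w" if "w \<in> gspace R" for i w
  by(rule tau_pair[OF R U 0 f that])
qed

section \<open>Index sets and weights\<close>

lemma half_integral_dominant_bgg_weight:
 assumes p: "p \<in> partitions_rows CARD('n)"
 shows "half_integral_dominant (bgg_weight p :: 'n::{finite,linorder} => real)"
 unfolding half_integral_dominant_def
proof (intro conjI allI impI)
 fix i :: 'n
 show "2 * bgg_weight p i \<in> \<int>" by(simp add: bgg_weight_def right_diff_distrib)
next
 fix i j :: 'n assume "i <= j"
 then have "card {k. k < i} <= card {k. k < j}" by(intro card_mono) auto
 then have "p (CARD('n) - Suc (card {k. k < i})) <= p (CARD('n) - Suc (card {k. k < j}))"
  using p by(auto simp: partitions_rows_def dest: antimonoD intro!: antimonoD[of p])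
 then have "bgg_weight p i - bgg_weight p j
   = real (p (CARD('n) - Suc (card {k. k < j})) - p (CARD('n) - Suc (card {k. k < i})))"
  by(simp add: bgg_weight_def of_nat_diff)
 then show "bgg_weight p i - bgg_weight p j \<in> \<nat>" by simp
qed

lemma finite_bounded_partitions: "finite {p \<in> partitions_rows n. \<forall>i. p i <= b}"
proof (rule finite_subset)
 show "finite {f. \<forall>x. (x \<in> {..<n} --> f x \<in> {..b}) & (x \<notin> {..<n} --> f x = (0::nat))}"
  by(rule finite_set_of_finite_funs) simp_all
qed (auto simp: partitions_rows_def)

text \<open>Equal arm and leg at the first diagonal cell make the first row as long as the first
  column, so the partition fits into an \<open>n\<close> by \<open>n\<close> square.\<close>

lemma finite_K_index: "finite (K_index n r m)"
proof (rule finite_subset[OF _ finite_bounded_partitions[of n n]], rule subsetI, rule CollectI, intro conjI allI)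
 fix p i assume "p \<in> K_index n r m"
 then have p: "p \<in> partitions_rows n" and ab: "!!i. i < diag_cells p ==> frob_a p i = frob_b p i" by(auto simp: K_index_def)
 show "p \<in> partitions_rows n" by(rule p)
 have mono: "p i <= p 0" for i using p by(auto simp: partitions_rows_def dest: antimonoD)
 have z: "p k = 0" if "k >= n" for k using p that by(simp add: partitions_rows_def)
 have "p 0 <= n"
 proof (cases "p 0 = 0")
  case False
  have "finite {i. i < p i}" by(rule finite_subset[of _ "{..<n}"]) (use z in \<open>force simp: not_less[symmetric]\<close>, simp)
  moreover have "0 \<in> {i. i < p i}" using False by simp
  ultimately have "diag_cells p > 0" unfolding diag_cells_def by(metis card_gt_0_iff empty_iff)
  from ab[OF this] have "p 0 - 1 = card {k. 0 < p k} - 1" by(simp add: frob_a_def frob_b_def)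
  moreover have "card {k. 0 < p k} <= card {..<n}"
   by(rule card_mono) (use z in \<open>force simp: not_less[symmetric]\<close>)+
  moreover have "n > 0" using z[of 0] False by(cases n) auto
  ultimately show ?thesis by simp
 qed simp
 then show "p i <= n" using mono[of i] by simp
qed

lemma finite_SK_index: "finite (SK_index n m)"
proof (rule finite_subset[OF _ finite_bounded_partitions[of n "2 * m"]], rule subsetI, rule CollectI, intro conjI allI)
 fix p i assume "p \<in> SK_index n m"
 then have p: "p \<in> partitions_rows n" and s: "psize p = 2 * m" by(auto simp: SK_index_def)
 show "p \<in> partitions_rows n" by(rule p)
 have "finite {i. p i \<noteq> 0}"
  by(rule finite_subset[of _ "{..<n}"]) (use p in \<open>force simp: partitions_rows_def not_less[symmetric]\<close>, simp)
 then show "p i <= 2 * m"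
  unfolding s[symmetric] psize_def by(cases "p i = 0") (auto intro: member_le_sum)
qed

lemma (in dual_setting) bgg_dual_exact:
 fixes I :: "nat => (nat => nat) set" and R :: "(nat => nat) => ('n, 'w) glmod"
 assumes fin: "!!m. finite (I m)" and gl: "!!m p. p \<in> I m ==> gl_module (R p)"
  and span: "!!m p. p \<in> I m ==> \<exists>B. finite B & gspace (R p) = module.span (gscale (R p)) B"
  and bgg: "bgg_resolution (alg st) (par st) I R T d \<epsilon>" and dual: "dual_differentials st I R d D"
 shows "dual_complex_exact X I R D"
proof (rule dual_complex_exact[OF fin gl span])
 note b = bgg[unfolded bgg_resolution_def]
 show "ind_hom (alg st) (par st) (R p) (R p') (d m p p')" if "p \<in> I (Suc m)" "p' \<in> I m" for m p p'
  by(rule b[THEN conjunct1, THEN spec, THEN bspec, THEN bspec, OF that])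
 show "(\<forall>p\<in>I m. chain_diff I d m c p \<in> nulls (R p)) \<longleftrightarrow>
    (\<exists>e\<in>chains (alg st) (I (Suc (Suc m))) R.
     \<forall>p\<in>I (Suc m). c p - chain_diff I d (Suc m) e p \<in> nulls (R p))"
  if "c \<in> chains (alg st) (I (Suc m)) R" for m c
  by(rule b[THEN conjunct2, THEN conjunct2, THEN conjunct2, THEN conjunct2, THEN spec, THEN bspec, OF that])
 show "dual_operator st (R p') (R p) (d m p p') (D m p' p)" if "p \<in> I (Suc m)" "p' \<in> I m" for m p p'
  by(rule dual[unfolded dual_differentials_def, THEN spec, THEN bspec, THEN bspec, OF that])
qed

theorem proposition4p3p6:
 fixes Sg :: "('n::{finite,linorder} \<Rightarrow> real) \<Rightarrow> ('n, 'w::ab_group_add) glmod"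
 assumes Sg: "\<And>\<beta>. half_integral_dominant \<beta> \<Longrightarrow> irreducible_hw (Sg \<beta>) \<beta>"
 defines "R \<equiv> (\<lambda>\<alpha>. Sg (bgg_weight \<alpha>))"
 shows
  "(\<forall>d \<epsilon> D.
    bgg_resolution sp_alg sp_par (K_index CARD('n) 0) R (poly_parity 0) d \<epsilon> \<and>
    dual_differentials classical (K_index CARD('n) 0) R d D
    \<longrightarrow> dual_complex_exact siegel_cell (K_index CARD('n) 0) R D) \<and>
  (\<forall>d \<epsilon> D.
    bgg_resolution sp_alg sp_par (K_index CARD('n) 1) R (poly_parity 1) d \<epsilon> \<and>
    dual_differentials classical (K_index CARD('n) 1) R d D
    \<longrightarrow> dual_complex_exact siegel_cell (K_index CARD('n) 1) R D) \<and>
  (\<forall>d \<epsilon> D.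
    bgg_resolution osp_alg osp_par (SK_index CARD('n)) R UNIV d \<epsilon> \<and>
    dual_differentials super (SK_index CARD('n)) R d D
    \<longrightarrow> dual_complex_exact siegel_cell (SK_index CARD('n)) R D)"
proof -
 have hw: "irreducible_hw (R p) (bgg_weight p)" if "p \<in> partitions_rows CARD('n)" for p
  unfolding R_def by(rule Sg[OF half_integral_dominant_bgg_weight[OF that]])
 have gl: "gl_module (R p)" and span: "\<exists>B. finite B & gspace (R p) = module.span (gscale (R p)) B"
  if "p \<in> partitions_rows CARD('n)" for p
  using hw[OF that] unfolding irreducible_hw_def by blast+
 have K: "p \<in> partitions_rows n" if "p \<in> K_index n r m" for p n r m using that by(simp add: K_index_def)
 have SK: "p \<in> partitions_rows n" if "p \<in> SK_index n m" for p n m using that by(simp add: SK_index_def)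
 \<comment> \<open>The two parities share all arguments, so a general \<open>r\<close> and a general
   target serve both.\<close>
 have cl: "dual_complex_exact siegel_cell (K_index CARD('n) r) R D"
  if "bgg_resolution sp_alg sp_par (K_index CARD('n) r) R T d \<epsilon>" "dual_differentials classical (K_index CARD('n) r) R d D"
  for r T d \<epsilon> D
  by(rule dual_setting.bgg_dual_exact[OF dual_setting_classical finite_K_index _ _ _ that(2)]) (use that gl[OF K] span[OF K] in simp_all)
 have "dual_complex_exact siegel_cell (SK_index CARD('n)) R D"
  if "bgg_resolution osp_alg osp_par (SK_index CARD('n)) R T d \<epsilon>" "dual_differentials super (SK_index CARD('n)) R d D"
  for T d \<epsilon> D
  by(rule dual_setting.bgg_dual_exact[OF dual_setting_super finite_SK_index _ _ _ that(2)]) (use that gl[OF SK] span[OF SK] in simp_all)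
 with cl show ?thesis by blast
qed

end
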